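(* Let $N_a\sim P_a$ and $N_b\sim P_b$ be two independent $B_4$-mixing point processes on $\mathbb{R}^d$, both observed in $W_n$, where $(W_n)$ is a convex averaging sequence. Let $R>0$ and $0<\alpha\le1/2$ with $c_n^\alpha/\varrho(W_n)\to0$. Assume that each of the two processes, denoted generically $N$ with intensity $\lambda>0$ and (reduced) moment and cumulant measures $\alpha^{(2)}_{red},\gamma^{(k)}_{red}$, satisfies: (a) $(N(W_n)-\lambda|W_n|)/\sqrt{|W_n|}\xrightarrow{d}\mathcal N(0,\sigma^2)$ as $n\to\infty$, where $\sigma^2=\lambda(1+\gamma^{(2)}_{red}(\mathbb{R}^d))$; (b) there is $a_0>0$ with $\alpha^{(2)}_{red}(A)\le a_0|A|$ for all bounded Borel $A\subset\mathbb{R}^d$; (c) either $\alpha>1/4$, or $\gamma^{(3)}_{red},\gamma^{(4)}_{red}$ have Lebesgue densities $\kappa^{(3)},\kappa^{(4)}$ with $|\kappa^{(3)}(x,y)|\le a_{01}$ for all $x,y\in\mathbb{R}^d$ and $\int_{\mathbb{R}^d}\int_{\mathbb{R}^d}\bigl(\int_{\mathbb{R}^d}|\kappa^{(4)}(x,y+z,z)|dz\bigr)^2dy\,dx\le a_{02}$ for some constants $a_{01},a_{02}$. Let the bandwidths $b_n>0$ satisfy $b_n\to0$, $c_nb_n\to\infty$, $c_nb_n^2\to0$ and $c_nb_n/\varrho(W_n)\to0$, and let $v\in D[0,R]$ be a càdlàg function on $[0,R]$. Then, under the null hypothesis $H_0^{a,b}:P_a=P_b$, as $n\to\infty$, $$\frac{\sqrt{|W_n|}\,\sup_{0\le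 r\le R}\bigl|\bigl((\widehat{\lambda_a^2K_a})_n(c_n^\alpha r)-(\widehat{\lambda_b^2K_b})_n(c_n^\alpha r)\bigr)v(r)\bigr|}{|W_n|^{\alpha}\sqrt{(\widehat{\lambda_a^2})_n(\widehat{\sigma_a^2})_n+(\widehat{\lambda_b^2})_n(\widehat{\sigma_b^2})_n}}+\frac{\sqrt{|W_n|}\,\bigl|(\widehat{\lambda_a})_n-(\widehat{\lambda_b})_n\bigr|}{\sqrt{(\widehat{\sigma_a^2})_n+(\widehat{\sigma_b^2})_n}}\ \xrightarrow{d}\ \Bigl(2|B|\sup_{0\le r\le R}|r^dv(r)|+1\Bigr)|\mathcal N(0,1)|.$$
   Context: $|\cdot|$ is Lebesgue measure on $\mathbb{R}^d$ (or absolute value), $\mathcal N(0,\tau^2)$ a centered Gaussian random variable with variance $\tau^2$, $\xrightarrow{d}$ convergence in distribution, $\sum^{\ne}$ a sum over tuples of pairwise distinct indices. Point processes. $N=\sum_{i\ge1}\delta_{X_i}$ is a simple point process on $\mathbb{R}^d$ with intensity $\lambda=\mathbf E N([0,1)^d)>0$. Its $k$-th factorial moment measure is $\alpha^{(k)}(A_1\times\dots\times A_k)=\mathbf E\sum^{\ne}_{i_1,\dots,i_k\ge1}\mathbf 1_{A_1}(X_{i_1})\cdots\mathbf 1_{A_k}(X_{i_k})$. $N$ is $k$-th order stationary if $\mathbf E N^k([0,1)^d)<\infty$ and, for $j=1,\dots,k$, $\alpha^{(j)}$ is invariant under diagonal shifts $A_1\times\dots\times A_j\mapsto(A_1+x)\times\dots\times(A_j+x)$.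 The $k$-th factorial cumulant measure is the (locally finite) signed measure $\gamma^{(k)}(A_1\times\dots\times A_k)=\sum_{j=1}^k(-1)^{j-1}(j-1)!\sum_{K_1\cup\dots\cup K_j=\{1,\dots,k\}}\prod_{i=1}^j\alpha^{(\#K_i)}(\times_{l\in K_i}A_l)$, the inner sum being over partitions into $j$ disjoint non-empty subsets. The reduced measures $\alpha^{(k)}_{red},\gamma^{(k)}_{red}$ on $\mathbb{R}^{d(k-1)}$ are defined by $\alpha^{(k)}(A_1\times\dots\times A_k)=\lambda\int_{A_k}\alpha^{(k)}_{red}((A_1-x)\times\dots\times(A_{k-1}-x))\,dx$ and likewise for $\gamma^{(k)}$; in particular $\gamma^{(2)}_{red}(\cdot)=\alpha^{(2)}_{red}(\cdot)-\lambda|\cdot|$. $\|\gamma^{(k)}_{red}\|_{var}$ is the total variation on $\mathbb{R}^{d(k-1)}$. $N$ is $B_4$-mixing if it is fourth-order stationary and $\|\gamma^{(j)}_{red}\|_{var}<\infty$ for $j=2,3,4$. Windows and $B$. A convex averaging sequence $(W_n)$ is an increasing sequence of convex compact sets $W_n\subset\mathbb{R}^d$ with $\varrho(W_n):=\sup\{r>0: x+rB_e\subseteq W_n\text{ for some }x\in W_n\}\to\infty$, where $B_e$ is the closed Euclidean unit ball. Put $c_n:=|W_n|^{1/d}$. $B\subset\mathbb{R}^d$ is a fixed compact convex set, symmetric about the origin, with the origin as an interior point. $D[0,R]$ is the Skorohod space of càdlàg functions on $[0,R]$. Estimators. For a point process $N=\sum_{i\ge1}\delta_{X_i}$ put $$(\widehat{\lambda^2K_B})_n(r):=\sum^{\ne}_{i,j\ge1}\frac{\mathbf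 1_{W_n}(X_i)\mathbf 1_{W_n}(X_j)\mathbf 1_{rB}(X_j-X_i)}{|(W_n-X_i)\cap(W_n-X_j)|},\quad \widehat\lambda_n:=\frac{N(W_n)}{|W_n|},\quad(\widehat{\lambda^2})_n:=\frac{(N(W_n)-1)N(W_n)}{|W_n|^2},$$ $$(\widehat{\sigma^2})_n:=\widehat\lambda_n+\sum^{\ne}_{i,j\ge1}\frac{\mathbf 1_{W_n}(X_i)\mathbf 1_{W_n}(X_j)}{|(W_n-X_i)\cap(W_n-X_j)|}\,w\Bigl(\frac{X_j-X_i}{b_nc_n}\Bigr)-(\widehat{\lambda^2})_n(b_nc_n)^d\int_{\mathbb{R}^d}w(x)\,dx,$$ where $w:\mathbb{R}^d\to[0,\infty)$ is a fixed Borel-measurable, bounded, symmetric function with bounded support and $\lim_{x\to0}w(x)=w(0)=1$. The quantities $(\widehat{\lambda_a^2K_a})_n$, $(\widehat{\lambda_a})_n$, $(\widehat{\lambda_a^2})_n$, $(\widehat{\sigma_a^2})_n$ are the estimators $(\widehat{\lambda^2K_B})_n$, $\widehat\lambda_n$, $(\widehat{\lambda^2})_n$, $(\widehat{\sigma^2})_n$ computed from $N_a$, and those with subscript $b$ are computed from $N_b$.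
   Formalization: The asymptotic variance σ² in (a) is additionally assumed to be positive for both processes; for σ² = 0 (e.g. planar Ginibre processes with v = 0 and a triangular kernel w) the statistic is of type 0/0 and the stated limit can fail. *)

theory Defs
  imports "HOL-Probability.Probability"
begin

text \<open>
  A simple point process on the Euclidean space \<open>'a\<close> is a random locally finite set of points
  \<open>N \<omega> = {X\<^sub>1 \<omega>, X\<^sub>2 \<omega>, \<dots>}\<close>; the number of points in \<open>A\<close> is \<open>card (N \<omega> \<inter> A)\<close>. The law of \<open>N\<close> is a
  measure on the space of configurations with the sigma-algebra generated by the counting maps.
\<close>

definition configs :: "'a::euclidean_space set set" where
  "configs = {\<phi>. \<forall>A. bounded A \<longrightarrow> finite (\<phi> \<inter> A)}"

definition config_space :: "'a::euclidean_space set measure" where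
  "config_space = sigma configs
     {{\<phi> \<in> configs. card (\<phi> \<inter> A) = n} | A n. A \<in> sets borel \<and> bounded A}"

definition point_process :: "'w measure \<Rightarrow> ('w \<Rightarrow> 'a::euclidean_space set) \<Rightarrow> bool" where
  "point_process M N \<longleftrightarrow> N \<in> M \<rightarrow>\<^sub>M config_space"

definition unit_cube :: "'a::euclidean_space set" where
  "unit_cube = {x. \<forall>e\<in>Basis. 0 \<le> x \<bullet> e \<and> x \<bullet> e < 1}"

definition intensity :: "'w measure \<Rightarrow> ('w \<Rightarrow> 'a::euclidean_space set) \<Rightarrow> real" where
  "intensity M N = (\<integral>\<omega>. real (card (N \<omega> \<inter> unit_cube)) \<partial>M)"

text \<open>
  The tuples are indexed by a finite set \<open>K\<close> of natural numbers, so that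
  \<open>fact_moment M N K A\<close> is the value of the factorial moment measure of order \<open>card K\<close> on the
  rectangle with sides \<open>A l\<close>, \<open>l \<in> K\<close>.
\<close>

definition fact_moment ::
    "'w measure \<Rightarrow> ('w \<Rightarrow> 'a::euclidean_space set) \<Rightarrow> nat set \<Rightarrow> (nat \<Rightarrow> 'a set) \<Rightarrow> ennreal" where
  "fact_moment M N K A =
     (\<integral>\<^sup>+\<omega>. emeasure (count_space UNIV) {t \<in> (\<Pi>\<^sub>E l\<in>K. N \<omega> \<inter> A l). inj_on t K} \<partial>M)"

definition stationary_of_order :: "nat \<Rightarrow> 'w measure \<Rightarrow> ('w \<Rightarrow> 'a::euclidean_space set) \<Rightarrow> bool" where
  "stationary_of_order k M N \<longleftrightarrow>
     (\<integral>\<^sup>+\<omega>. ennreal (real (card (N \<omega> \<inter> unit_cube)) ^ k) \<partial>M) < \<infinity> \<and>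
     (\<forall>j\<in>{1..k}. \<forall>A x. (\<forall>l\<in>{1..j}. A l \<in> sets borel) \<longrightarrow>
        fact_moment M N {1..j} (\<lambda>l. (\<lambda>y. y + x) ` A l) = fact_moment M N {1..j} A)"

definition fact_cumulant ::
    "'w measure \<Rightarrow> ('w \<Rightarrow> 'a::euclidean_space set) \<Rightarrow> nat \<Rightarrow> (nat \<Rightarrow> 'a set) \<Rightarrow> real" where
  "fact_cumulant M N k A =
     (\<Sum>j=1..k. (-1) ^ (j - 1) * fact (j - 1) *
        (\<Sum>P | partition_on {1..k} P \<and> card P = j. \<Prod>K\<in>P. enn2real (fact_moment M N K A)))"

text \<open>
  A measure on the \<open>m\<close>-fold product of \<open>'a\<close> lives on the product sigma-algebra with index set
  \<open>{1..m}\<close>.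
\<close>

definition locally_finite :: "nat set \<Rightarrow> (nat \<Rightarrow> 'a::euclidean_space) measure \<Rightarrow> bool" where
  "locally_finite J \<mu> \<longleftrightarrow> sets \<mu> = sets (\<Pi>\<^sub>M l\<in>J. (borel :: 'a measure)) \<and>
     (\<forall>A. (\<forall>l\<in>J. A l \<in> sets borel \<and> bounded (A l)) \<longrightarrow> emeasure \<mu> (\<Pi>\<^sub>E l\<in>J. A l) < \<infinity>)"

text \<open>
  A locally finite signed measure is given by its Jordan decomposition, i.e. by a pair of mutually
  singular locally finite measures, the positive and the negative part. Its value
  \<open>signed_value \<gamma> A\<close> is meaningful whenever both parts of \<open>A\<close> are finite.
\<close>

type_synonym 'b signed = "'b measure \<times> 'b measure"

definition signed_measure_on :: "nat set \<Rightarrow> (nat \<Rightarrow> 'a::euclidean_space) signed \<Rightarrow> bool" where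
  "signed_measure_on J \<gamma> \<longleftrightarrow> locally_finite J (fst \<gamma>) \<and> locally_finite J (snd \<gamma>) \<and>
     (\<exists>S\<in>sets (fst \<gamma>). emeasure (fst \<gamma>) S = 0 \<and> emeasure (snd \<gamma>) (space (snd \<gamma>) - S) = 0)"

definition signed_value :: "'b signed \<Rightarrow> 'b set \<Rightarrow> real" where
  "signed_value \<gamma> A = measure (fst \<gamma>) A - measure (snd \<gamma>) A"

definition total_variation :: "'b signed \<Rightarrow> ennreal" where
  "total_variation \<gamma> = emeasure (fst \<gamma>) (space (fst \<gamma>)) + emeasure (snd \<gamma>) (space (snd \<gamma>))"

definition reduced_moment ::
    "'w measure \<Rightarrow> ('w \<Rightarrow> 'a::euclidean_space set) \<Rightarrow> nat \<Rightarrow> (nat \<Rightarrow> 'a) measure \<Rightarrow> bool" where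
  "reduced_moment M N k \<mu> \<longleftrightarrow> locally_finite {1..<k} \<mu> \<and>
     (\<forall>A. (\<forall>l\<in>{1..k}. A l \<in> sets borel) \<longrightarrow>
        fact_moment M N {1..k} A =
          ennreal (intensity M N) *
          (\<integral>\<^sup>+x\<in>A k. emeasure \<mu> (\<Pi>\<^sub>E l\<in>{1..<k}. (\<lambda>y. y - x) ` A l) \<partial>lborel))"

definition reduced_cumulant ::
    "'w measure \<Rightarrow> ('w \<Rightarrow> 'a::euclidean_space set) \<Rightarrow> nat \<Rightarrow> (nat \<Rightarrow> 'a) signed \<Rightarrow> bool" where
  "reduced_cumulant M N k \<gamma> \<longleftrightarrow> signed_measure_on {1..<k} \<gamma> \<and>
     (\<forall>A. (\<forall>l\<in>{1..k}. A l \<in> sets borel \<and> bounded (A l)) \<longrightarrow>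
        fact_cumulant M N k A =
          intensity M N *
          (LINT x:A k|lborel. signed_value \<gamma> (\<Pi>\<^sub>E l\<in>{1..<k}. (\<lambda>y. y - x) ` A l)))"

text \<open>
  \<open>B4_mixing M N \<gamma>\<close>: the process \<open>N\<close> is \<open>B\<^sub>4\<close>-mixing and \<open>\<gamma> k\<close> is its reduced factorial cumulant
  measure of order \<open>k = 2, 3, 4\<close> (which is unique).
\<close>

definition B4_mixing ::
    "'w measure \<Rightarrow> ('w \<Rightarrow> 'a::euclidean_space set) \<Rightarrow> (nat \<Rightarrow> (nat \<Rightarrow> 'a) signed) \<Rightarrow> bool" where
  "B4_mixing M N \<gamma> \<longleftrightarrow> stationary_of_order 4 M N \<and>
     (\<forall>k\<in>{2,3,4}. reduced_cumulant M N k (\<gamma> k) \<and> total_variation (\<gamma> k) < \<infinity>)"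

definition asymp_variance ::
    "'w measure \<Rightarrow> ('w \<Rightarrow> 'a::euclidean_space set) \<Rightarrow> (nat \<Rightarrow> (nat \<Rightarrow> 'a) signed) \<Rightarrow> real" where
  "asymp_variance M N \<gamma> = intensity M N * (1 + signed_value (\<gamma> 2) (space (fst (\<gamma> 2))))"

definition signed_density :: "nat set \<Rightarrow> (nat \<Rightarrow> 'a::euclidean_space) signed \<Rightarrow> ((nat \<Rightarrow> 'a) \<Rightarrow> real) \<Rightarrow> bool"
  where
  "signed_density J \<gamma> f \<longleftrightarrow> integrable (\<Pi>\<^sub>M l\<in>J. lborel) f \<and>
     (\<forall>C\<in>sets (\<Pi>\<^sub>M l\<in>J. (borel :: 'a measure)).
        signed_value \<gamma> C = (LINT t:C|(\<Pi>\<^sub>M l\<in>J. lborel). f t))"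

definition inradius :: "'a::euclidean_space set \<Rightarrow> real" where
  "inradius W = Sup {r. 0 < r \<and> (\<exists>x\<in>W. cball x r \<subseteq> W)}"

definition convex_averaging :: "(nat \<Rightarrow> 'a::euclidean_space set) \<Rightarrow> bool" where
  "convex_averaging W \<longleftrightarrow> incseq W \<and> (\<forall>n. convex (W n) \<and> compact (W n)) \<and>
     filterlim (\<lambda>n. inradius (W n)) at_top sequentially"

definition wscale :: "'a::euclidean_space set \<Rightarrow> real" where
  "wscale W = measure lborel W powr (1 / real DIM('a))"

definition cadlag_on :: "real \<Rightarrow> (real \<Rightarrow> real) \<Rightarrow> bool" where
  "cadlag_on R v \<longleftrightarrow> (\<forall>t\<in>{0..<R}. (v \<longlongrightarrow> v t) (at t within {t<..R})) \<and>
     (\<forall>t\<in>{0<..R}. \<exists>l. (v \<longlongrightarrow> l) (at t within {0..<t}))"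

definition point_pairs :: "'a set \<Rightarrow> 'a set \<Rightarrow> ('a \<times> 'a) set" where
  "point_pairs W \<phi> = {(x, y). x \<in> \<phi> \<inter> W \<and> y \<in> \<phi> \<inter> W \<and> x \<noteq> y}"

definition overlap :: "'a::euclidean_space set \<Rightarrow> 'a \<Rightarrow> 'a \<Rightarrow> real" where
  "overlap W x y = measure lborel ((\<lambda>z. z - x) ` W \<inter> (\<lambda>z. z - y) ` W)"

definition K_hat :: "'a::euclidean_space set \<Rightarrow> 'a set \<Rightarrow> 'a set \<Rightarrow> real \<Rightarrow> real" where
  "K_hat B W \<phi> r =
     (\<Sum>(x, y)\<in>point_pairs W \<phi>. indicator ((\<lambda>z. r *\<^sub>R z) ` B) (y - x) / overlap W x y)"

definition lambda_hat :: "'a::euclidean_space set \<Rightarrow> 'a set \<Rightarrow> real" where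
  "lambda_hat W \<phi> = real (card (\<phi> \<inter> W)) / measure lborel W"

definition lambda2_hat :: "'a::euclidean_space set \<Rightarrow> 'a set \<Rightarrow> real" where
  "lambda2_hat W \<phi> =
     (real (card (\<phi> \<inter> W)) - 1) * real (card (\<phi> \<inter> W)) / (measure lborel W)\<^sup>2"

definition sigma2_hat ::
    "('a::euclidean_space \<Rightarrow> real) \<Rightarrow> real \<Rightarrow> 'a set \<Rightarrow> 'a set \<Rightarrow> real" where
  "sigma2_hat w b W \<phi> =
     lambda_hat W \<phi>
     + (\<Sum>(x, y)\<in>point_pairs W \<phi>. w ((y - x) /\<^sub>R (b * wscale W)) / overlap W x y)
     - lambda2_hat W \<phi> * (b * wscale W) ^ DIM('a) * (\<integral>x. w x \<partial>lborel)"

definition smoothing_kernel :: "('a::euclidean_space \<Rightarrow> real) \<Rightarrow> bool" where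
  "smoothing_kernel w \<longleftrightarrow> (\<forall>x. 0 \<le> w x) \<and> w \<in> borel_measurable borel \<and> bounded (range w) \<and>
     (\<forall>x. w (- x) = w x) \<and> bounded {x. w x \<noteq> 0} \<and> (w \<longlongrightarrow> 1) (at 0) \<and> w 0 = 1"

definition clt_condition ::
    "'w measure \<Rightarrow> (nat \<Rightarrow> 'a::euclidean_space set) \<Rightarrow> ('w \<Rightarrow> 'a set) \<Rightarrow> real \<Rightarrow> bool" where
  "clt_condition M W N s2 \<longleftrightarrow>
     weak_conv_m
       (\<lambda>n. distr M borel (\<lambda>\<omega>. (real (card (N \<omega> \<inter> W n)) - intensity M N * measure lborel (W n))
                               / sqrt (measure lborel (W n))))
       (density lborel (normal_density 0 (sqrt s2)))"

definition moment_bound :: "(nat \<Rightarrow> 'a::euclidean_space) measure \<Rightarrow> bool" where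
  "moment_bound \<mu> \<longleftrightarrow> (\<exists>a0>0. \<forall>A. A \<in> sets borel \<and> bounded A \<longrightarrow>
     emeasure \<mu> (\<Pi>\<^sub>E l\<in>{1..<2}. A) \<le> ennreal a0 * emeasure lborel A)"

definition density_condition :: "(nat \<Rightarrow> (nat \<Rightarrow> 'a::euclidean_space) signed) \<Rightarrow> bool" where
  "density_condition \<gamma> \<longleftrightarrow>
     (\<exists>(\<kappa>3 :: 'a \<Rightarrow> 'a \<Rightarrow> real) (\<kappa>4 :: 'a \<Rightarrow> 'a \<Rightarrow> 'a \<Rightarrow> real) a01 a02.
        signed_density {1..<3} (\<gamma> 3) (\<lambda>t. \<kappa>3 (t 1) (t 2)) \<and>
        signed_density {1..<4} (\<gamma> 4) (\<lambda>t. \<kappa>4 (t 1) (t 2) (t 3)) \<and>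
        (\<forall>x y. \<bar>\<kappa>3 x y\<bar> \<le> a01) \<and>
        (\<integral>\<^sup>+x. \<integral>\<^sup>+y. (\<integral>\<^sup>+z. ennreal \<bar>\<kappa>4 x (y + z) z\<bar> \<partial>lborel)\<^sup>2 \<partial>lborel \<partial>lborel) \<le> ennreal a02)"

text \<open>
  The Gaussian limit in \<open>clt_condition\<close> is non-degenerate: test statistics are normalised by
  an estimator of the asymptotic variance, and \<open>normal_density 0 0\<close> is the zero function. Hence the
  requirement that this variance be positive.
\<close>

definition process_conditions ::
    "'w measure \<Rightarrow> (nat \<Rightarrow> 'a::euclidean_space set) \<Rightarrow> real \<Rightarrow> ('w \<Rightarrow> 'a set) \<Rightarrow>
     (nat \<Rightarrow> 'a) measure \<Rightarrow> (nat \<Rightarrow> (nat \<Rightarrow> 'a) signed) \<Rightarrow> bool" where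
  "process_conditions M W \<alpha> N \<mu> \<gamma> \<longleftrightarrow>
     0 < asymp_variance M N \<gamma> \<and> clt_condition M W N (asymp_variance M N \<gamma>) \<and>
     moment_bound \<mu> \<and>
     (\<alpha> > 1/4 \<or> density_condition \<gamma>)"

end

theory Submission
  imports Defs
begin

text \<open>
  The centred pair sum \<open>\<Sum> 1\<^bsub>W\<^esub>(X\<^sub>i) 1\<^bsub>W\<^esub>(X\<^sub>j) h(X\<^sub>j - X\<^sub>i) / |W \<inter> (W - X\<^sub>j + X\<^sub>i)|\<close> is split into its linear part,
  which is essentially \<open>2 \<lambda> (\<integral>h) (\<lambda>\<^sub>n - \<lambda>)\<close> for the intensity estimator \<open>\<lambda>\<^sub>n\<close>, and a non-linear remainder.
  Expanding moments in cumulants, the terms of order \<open>|W|\<^sup>2\<close> cancel in the variance of the remainder,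
  and what is left is at most a constant times \<open>(\<parallel>\<gamma>\<^sub>3\<parallel> + \<parallel>\<gamma>\<^sub>4\<parallel> + \<parallel>\<gamma>\<^sub>2\<parallel> + \<integral>h) / |W|\<close> when \<open>0 \<le> h \<le> 1\<close>.

  The bound is moreover additive over disjoint supports, so a chaining over dyadic subdivisions of
  \<open>[0, R]\<close> costs only a factor \<open>log\<^sup>2 |W|\<close> and yields, uniformly in the radius,
  \<open>|W|\<^bsup>1/2-\<alpha>\<^esup> (K\<^sub>n(r) - E K\<^sub>n(r)) = 2 \<lambda> |B| r\<^sup>d |W|\<^bsup>1/2\<^esup> (\<lambda>\<^sub>n - \<lambda>) + o(1)\<close> in probability. With
  smoothing kernels instead of indicators the same variance bound makes the variance estimator
  consistent. Under the null hypothesis the expectations cancel in the difference of the two samples, hence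
  the statistic is asymptotically a multiple of \<open>|W|\<^bsup>1/2\<^esup>\<close> times the absolute difference of the two
  intensity estimators, whose limit is Gaussian by independence and the two central limit theorems.
\<close>

subsection \<open>Measurability of sums over the points of a configuration\<close>

text \<open>Moment and cumulant measures are prescribed on rectangles only, whereas the variance
  formula needs them for integrands such as \<open>f x y * f z u\<close>. Inside a bounded window
  they become linear functionals on bounded functions, continuous under bounded pointwise
  convergence. Such functionals are determined by rectangles, so every expansion reduces to a finite
  identity between partitions. Two more obstacles shape the proof. The linear part of a pair sum
  carries edge effects depending on the radius; they are written as integrals of one centred process
  over displacements, and its absolute integral over the largest displacement set controls all radii
  at once. The grid of radii is equidistant in volume with at least |W| cells, so that monotonicity
  of the estimator and the bound on the reduced second moment measure make the discretisation error
  negligible. The exponents balance: the chaining variance has order log^2 |W| times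
  |W|^(\<alpha>-1), the scaling contributes |W|^(1-2\<alpha>), and the product log^2 |W| times
  |W|^(-\<alpha>) vanishes.\<close>

lemma space_config_space [simp]: "space config_space = configs"
  unfolding config_space_def by (rule space_measure_of) auto

lemma measurable_card_config:
  assumes "A \<in> sets borel" "bounded A"
  shows "(\<lambda>\<phi>. real (card (\<phi> \<inter> A))) \<in> borel_measurable config_space"
proof -
  have "(\<lambda>\<phi>. card (\<phi> \<inter> A)) \<in> measurable config_space (count_space UNIV)"
  proof (rule measurable_count_space_eq2_countable[THEN iffD2])
    show "(\<lambda>\<phi>. card (\<phi> \<inter> A)) \<in> space config_space \<rightarrow> UNIV \<and>
        (\<forall>n\<in>UNIV. (\<lambda>\<phi>. card (\<phi> \<inter> A)) -` {n} \<inter> space config_space \<in> sets config_space)"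
    proof safe
      fix n
      have "(\<lambda>\<phi>. card (\<phi> \<inter> A)) -` {n} \<inter> space config_space = {\<phi> \<in> configs. card (\<phi> \<inter> A) = n}"
        by auto
      also have "\<dots> \<in> sets config_space"
        unfolding config_space_def using assms by (intro in_measure_of) auto
      finally show "(\<lambda>\<phi>. card (\<phi> \<inter> A)) -` {n} \<inter> space config_space \<in> sets config_space" .
    qed auto
  qed
  then show ?thesis by measurable
qed

lemma config_finite:
  assumes "N \<in> M \<rightarrow>\<^sub>M config_space" "\<omega> \<in> space M" "bounded W"
  shows "finite (N \<omega> \<inter> W)"
  using measurable_space[OF assms(1,2)] assms(3) by (auto simp: configs_def)

text \<open>Dynkin argument over measurable rectangles: on \<open>a \<times> b\<close> the sum is an
  indicator of \<open>a\<close> times the number of points in \<open>W \<inter> b\<close>, and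
  complements are taken relative to the finite total number of points in \<open>W\<close>. The set
  may depend on the sample point as well as on the location, which is what permits iterated
  sums.\<close>

lemma measurable_sum_config_indicator:
  fixes N :: "'w \<Rightarrow> 'a::euclidean_space set"
  assumes N: "N \<in> M \<rightarrow>\<^sub>M config_space" and W: "W \<in> sets borel" "bounded W"
    and A: "A \<in> sets (M \<Otimes>\<^sub>M (borel :: 'a measure))"
  shows "(\<lambda>\<omega>. \<Sum>x\<in>N \<omega> \<inter> W. indicator A (\<omega>, x) :: real) \<in> borel_measurable M"
proof -
  let ?s = "\<lambda>A \<omega>. \<Sum>x\<in>N \<omega> \<inter> W. indicator A (\<omega>, x) :: real"
  have fin: "finite (N \<omega> \<inter> W)" if "\<omega> \<in> space M" for \<omega>
    using config_finite[OF N that W(2)] .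
  have cnt: "(\<lambda>\<omega>. real (card (N \<omega> \<inter> (W \<inter> B)))) \<in> borel_measurable M"
    if "B \<in> sets borel" for B
    using measurable_compose[OF N measurable_card_config[of "W \<inter> B"]] that W
    by (auto intro: bounded_subset)
  let ?G = "{a \<times> b | a b. a \<in> sets M \<and> b \<in> sets (borel :: 'a measure)}"
  have "Int_stable ?G"
    by (rule Int_stable_pair_measure_generator)
  moreover have "?G \<subseteq> Pow (space M \<times> UNIV)"
    using sets.sets_into_space by fastforce
  moreover have "A \<in> sigma_sets (space M \<times> UNIV) ?G"
    using A by (simp add: sets_pair_measure)
  ultimately show ?thesis
  proof (induction rule: sigma_sets_induct_disjoint)
    case (basic A)
    then obtain a b where ab: "A = a \<times> b" "a \<in> sets M" "b \<in> sets (borel :: 'a measure)" by auto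
    have "(\<lambda>\<omega>. indicator a \<omega> * real (card (N \<omega> \<inter> (W \<inter> b)))) \<in> borel_measurable M"
      using cnt[OF ab(3)] ab by measurable
    also have "?this \<longleftrightarrow> ?case"
    proof (rule measurable_cong)
      fix \<omega> assume "\<omega> \<in> space M"
      have "?s A \<omega> = indicator a \<omega> * (\<Sum>x\<in>N \<omega> \<inter> W. indicator b x)"
        unfolding ab by (simp add: indicator_times sum_distrib_left)
      also have "(\<Sum>x\<in>N \<omega> \<inter> W. indicator b x) = real (card (N \<omega> \<inter> (W \<inter> b)))"
        using fin[OF \<open>\<omega> \<in> space M\<close>] sum_indicator_eq_card[of "N \<omega> \<inter> W" b]
        by (simp add: Int_assoc indicator_def of_nat_sum[symmetric] del: of_nat_sum)
      finally show "indicator a \<omega> * real (card (N \<omega> \<inter> (W \<inter> b))) = ?s A \<omega>" by simp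
    qed
    finally show ?case .
  next
    case empty
    show ?case by simp
  next
    case (compl A)
    have "(\<lambda>\<omega>. real (card (N \<omega> \<inter> (W \<inter> UNIV))) - ?s A \<omega>) \<in> borel_measurable M"
      using cnt[of UNIV] compl by (intro borel_measurable_diff) auto
    also have "?this \<longleftrightarrow> ?case"
    proof (rule measurable_cong)
      fix \<omega> assume w: "\<omega> \<in> space M"
      have "?s (space M \<times> UNIV - A) \<omega> = (\<Sum>x\<in>N \<omega> \<inter> W. 1 - indicator A (\<omega>, x))"
        using w by (intro sum.cong) (auto simp: indicator_def)
      then show "real (card (N \<omega> \<inter> (W \<inter> UNIV))) - ?s A \<omega> = ?s (space M \<times> UNIV - A) \<omega>"
        by (simp add: sum_subtractf)
    qed
    finally show ?case .
  next
    case (union A)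
    have "(\<lambda>\<omega>. \<Sum>i. ?s (A i) \<omega>) \<in> borel_measurable M"
      using union by (intro borel_measurable_suminf) auto
    also have "?this \<longleftrightarrow> ?case"
    proof (rule measurable_cong)
      fix \<omega> assume "\<omega> \<in> space M"
      have "(\<lambda>i. indicator (A i) (\<omega>, x) :: real) sums indicator (\<Union>i. A i) (\<omega>, x)" for x
        by (rule indicator_sums) (use union in \<open>auto simp: disjoint_family_on_def\<close>)
      then have "(\<lambda>i. ?s (A i) \<omega>) sums ?s (\<Union>i. A i) \<omega>"
        by (intro sums_sum) auto
      then show "(\<Sum>i. ?s (A i) \<omega>) = ?s (\<Union>i. A i) \<omega>" by (simp add: sums_iff)
    qed
    finally show ?case .
  qed
qed

lemma measurable_sum_config:
  fixes N :: "'w \<Rightarrow> 'a::euclidean_space set" and h :: "'w \<Rightarrow> 'a \<Rightarrow> real"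
  assumes N: "N \<in> M \<rightarrow>\<^sub>M config_space" and W: "W \<in> sets borel" "bounded W"
    and h: "(\<lambda>(\<omega>, x). h \<omega> x) \<in> borel_measurable (M \<Otimes>\<^sub>M borel)"
  shows "(\<lambda>\<omega>. \<Sum>x\<in>N \<omega> \<inter> W. h \<omega> x) \<in> borel_measurable M"
proof -
  have nonneg: "(\<lambda>\<omega>. \<Sum>x\<in>N \<omega> \<inter> W. u (\<omega>, x)) \<in> borel_measurable M"
    if "u \<in> borel_measurable (M \<Otimes>\<^sub>M borel)" "\<And>p. 0 \<le> u p" for u :: "'w \<times> 'a \<Rightarrow> real"
    using that
  proof (induction u rule: borel_measurable_induct_real)
    case (set A)
    then show ?case by (rule measurable_sum_config_indicator[OF N W])
  next
    case (mult u c)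
    then have "(\<lambda>\<omega>. c * (\<Sum>x\<in>N \<omega> \<inter> W. u (\<omega>, x))) \<in> borel_measurable M" by measurable
    then show ?case by (simp add: sum_distrib_left)
  next
    case (add u v)
    then have "(\<lambda>\<omega>. (\<Sum>x\<in>N \<omega> \<inter> W. v (\<omega>, x)) + (\<Sum>x\<in>N \<omega> \<inter> W. u (\<omega>, x))) \<in> borel_measurable M"
      by measurable
    then show ?case by (simp add: sum.distrib)
  next
    case (seq U)
    show ?case
    proof (rule borel_measurable_LIMSEQ_real)
      show "(\<lambda>i. \<Sum>x\<in>N \<omega> \<inter> W. U i (\<omega>, x)) \<longlonglongrightarrow> (\<Sum>x\<in>N \<omega> \<inter> W. u (\<omega>, x))" if "\<omega> \<in> space M" for \<omega>
        using seq that by (intro tendsto_sum) (auto simp: space_pair_measure)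
    qed (use seq in auto)
  qed
  let ?h = "\<lambda>(\<omega>, x). h \<omega> x"
  have "(\<lambda>\<omega>. (\<Sum>x\<in>N \<omega> \<inter> W. max 0 (?h (\<omega>, x))) - (\<Sum>x\<in>N \<omega> \<inter> W. max 0 (- ?h (\<omega>, x)))) \<in> borel_measurable M"
    using h by (intro borel_measurable_diff nonneg) (auto simp del: split_conv)
  also have "(\<lambda>\<omega>. (\<Sum>x\<in>N \<omega> \<inter> W. max 0 (?h (\<omega>, x))) - (\<Sum>x\<in>N \<omega> \<inter> W. max 0 (- ?h (\<omega>, x)))) =
      (\<lambda>\<omega>. \<Sum>x\<in>N \<omega> \<inter> W. h \<omega> x)"
    by (auto simp: fun_eq_iff sum_subtractf[symmetric] intro!: sum.cong)
  finally show ?thesis .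
qed

text \<open>The parameter \<open>k\<close> collects the sample point together with the points
  already summed over, so that sums over tuples can be treated one coordinate at a time.\<close>

lemma measurable_sum_config_compose:
  fixes N :: "'w \<Rightarrow> 'a::euclidean_space set" and h :: "'k \<Rightarrow> 'a \<Rightarrow> real"
  assumes N: "N \<in> M \<rightarrow>\<^sub>M config_space" and W: "W \<in> sets borel" "bounded W"
    and g: "g \<in> K \<rightarrow>\<^sub>M M"
    and h: "(\<lambda>p. h (fst p) (snd p)) \<in> borel_measurable (K \<Otimes>\<^sub>M borel)"
  shows "(\<lambda>k. \<Sum>x\<in>N (g k) \<inter> W. h k x) \<in> borel_measurable K"
  using measurable_sum_config[OF measurable_compose[OF g N] W, of h] h by (simp add: split_beta')

text \<open>Equality is vanishing distance, and the distance is a measurable real function. The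
  distinctness conditions in sums over tuples rely on it.\<close>

lemma pred_eq_borel [measurable (raw)]:
  fixes f g :: "'w \<Rightarrow> 'a::euclidean_space"
  assumes [measurable]: "f \<in> borel_measurable M" "g \<in> borel_measurable M"
  shows "Measurable.pred M (\<lambda>x. f x = g x)"
proof -
  have "Measurable.pred M (\<lambda>x. dist (f x) (g x) = 0)" by measurable
  then show ?thesis by simp
qed

section \<open>Sums over pairs, triples and quadruples of distinct points\<close>

definition point_triples :: "'a set \<Rightarrow> 'a set \<Rightarrow> ('a \<times> 'a \<times> 'a) set" where
  "point_triples W \<phi> = {(x, y, z). x \<in> \<phi> \<inter> W \<and> y \<in> \<phi> \<inter> W \<and> z \<in> \<phi> \<inter> W \<and> distinct [x, y, z]}"

definition point_quads :: "'a set \<Rightarrow> 'a set \<Rightarrow> ('a \<times> 'a \<times> 'a \<times> 'a) set" where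
  "point_quads W \<phi> = {(x, y, z, u). x \<in> \<phi> \<inter> W \<and> y \<in> \<phi> \<inter> W \<and> z \<in> \<phi> \<inter> W \<and> u \<in> \<phi> \<inter> W \<and>
     distinct [x, y, z, u]}"

lemma sum_point_pairs:
  fixes F :: "'a \<times> 'a \<Rightarrow> 'b::comm_monoid_add"
  assumes "finite (\<phi> \<inter> W)"
  shows "(\<Sum>t\<in>point_pairs W \<phi>. F t) =
    (\<Sum>x\<in>\<phi> \<inter> W. \<Sum>y\<in>\<phi> \<inter> W. if x \<noteq> y then F (x, y) else 0)"
proof -
  have "(\<Sum>t\<in>point_pairs W \<phi>. F t) =
      (\<Sum>t\<in>(\<phi> \<inter> W) \<times> (\<phi> \<inter> W). if fst t \<noteq> snd t then F t else 0)"
    by (rule sum.mono_neutral_cong_left) (use assms in \<open>auto simp: point_pairs_def\<close>)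
  also have "\<dots> = (\<Sum>x\<in>\<phi> \<inter> W. \<Sum>y\<in>\<phi> \<inter> W. if x \<noteq> y then F (x, y) else 0)"
    by (simp add: sum.cartesian_product split_beta cong: if_cong)
  finally show ?thesis .
qed

lemma sum_point_triples:
  fixes F :: "'a \<times> 'a \<times> 'a \<Rightarrow> 'b::comm_monoid_add"
  assumes "finite (\<phi> \<inter> W)"
  shows "(\<Sum>t\<in>point_triples W \<phi>. F t) =
    (\<Sum>x\<in>\<phi> \<inter> W. \<Sum>y\<in>\<phi> \<inter> W. \<Sum>z\<in>\<phi> \<inter> W. if distinct [x, y, z] then F (x, y, z) else 0)"
proof -
  have "(\<Sum>t\<in>point_triples W \<phi>. F t) =
      (\<Sum>t\<in>(\<phi> \<inter> W) \<times> (\<phi> \<inter> W) \<times> (\<phi> \<inter> W).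
         if distinct [fst t, fst (snd t), snd (snd t)] then F t else 0)"
    by (rule sum.mono_neutral_cong_left) (use assms in \<open>auto simp: point_triples_def\<close>)
  also have "\<dots> = (\<Sum>x\<in>\<phi> \<inter> W. \<Sum>y\<in>\<phi> \<inter> W. \<Sum>z\<in>\<phi> \<inter> W. if distinct [x, y, z] then F (x, y, z) else 0)"
    by (simp add: sum.cartesian_product split_beta cong: if_cong)
  finally show ?thesis .
qed

lemma sum_point_quads:
  fixes F :: "'a \<times> 'a \<times> 'a \<times> 'a \<Rightarrow> 'b::comm_monoid_add"
  assumes "finite (\<phi> \<inter> W)"
  shows "(\<Sum>t\<in>point_quads W \<phi>. F t) =
    (\<Sum>x\<in>\<phi> \<inter> W. \<Sum>y\<in>\<phi> \<inter> W. \<Sum>z\<in>\<phi> \<inter> W. \<Sum>u\<in>\<phi> \<inter> W.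
       if distinct [x, y, z, u] then F (x, y, z, u) else 0)"
proof -
  have "(\<Sum>t\<in>point_quads W \<phi>. F t) =
      (\<Sum>t\<in>(\<phi> \<inter> W) \<times> (\<phi> \<inter> W) \<times> (\<phi> \<inter> W) \<times> (\<phi> \<inter> W).
         if distinct [fst t, fst (snd t), fst (snd (snd t)), snd (snd (snd t))] then F t else 0)"
    by (rule sum.mono_neutral_cong_left) (use assms in \<open>auto simp: point_quads_def\<close>)
  also have "\<dots> = (\<Sum>x\<in>\<phi> \<inter> W. \<Sum>y\<in>\<phi> \<inter> W. \<Sum>z\<in>\<phi> \<inter> W. \<Sum>u\<in>\<phi> \<inter> W.
       if distinct [x, y, z, u] then F (x, y, z, u) else 0)"
    by (simp add: sum.cartesian_product split_beta cong: if_cong)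
  finally show ?thesis .
qed

lemma measurable_sum_point_pairs:
  fixes N :: "'w \<Rightarrow> 'a::euclidean_space set" and F :: "'w \<Rightarrow> 'a \<times> 'a \<Rightarrow> real"
  assumes N [measurable]: "N \<in> M \<rightarrow>\<^sub>M config_space" and W: "W \<in> sets borel" "bounded W"
    and F [measurable]: "(\<lambda>(\<omega>, t). F \<omega> t) \<in> borel_measurable (M \<Otimes>\<^sub>M (borel \<Otimes>\<^sub>M borel))"
  shows "(\<lambda>\<omega>. \<Sum>t\<in>point_pairs W (N \<omega>). F \<omega> t) \<in> borel_measurable M"
proof -
  have [measurable]: "(\<lambda>p. F (fst (fst p)) (snd (fst p), snd p)) \<in> borel_measurable ((M \<Otimes>\<^sub>M borel) \<Otimes>\<^sub>M borel)"
    using measurable_compose[OF _ F, of "\<lambda>p. (fst (fst p), (snd (fst p), snd p))"] by simp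
  have "(\<lambda>\<omega>. \<Sum>x\<in>N \<omega> \<inter> W. \<Sum>y\<in>N \<omega> \<inter> W. if x \<noteq> y then F \<omega> (x, y) else 0) \<in> borel_measurable M"
    by (rule measurable_sum_config_compose[OF N W], measurable)+
  then show ?thesis
    using N W by (subst measurable_cong[OF sum_point_pairs]) (auto intro: config_finite)
qed

lemma measurable_sum_point_triples:
  fixes N :: "'w \<Rightarrow> 'a::euclidean_space set" and F :: "'a \<times> 'a \<times> 'a \<Rightarrow> real"
  assumes N [measurable]: "N \<in> M \<rightarrow>\<^sub>M config_space" and W: "W \<in> sets borel" "bounded W"
    and F [measurable]: "F \<in> borel_measurable (borel \<Otimes>\<^sub>M borel \<Otimes>\<^sub>M borel)"
  shows "(\<lambda>\<omega>. \<Sum>t\<in>point_triples W (N \<omega>). F t) \<in> borel_measurable M"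
proof -
  have "(\<lambda>\<omega>. \<Sum>x\<in>N \<omega> \<inter> W. \<Sum>y\<in>N \<omega> \<inter> W. \<Sum>z\<in>N \<omega> \<inter> W.
      if distinct [x, y, z] then F (x, y, z) else 0) \<in> borel_measurable M"
    by ((rule measurable_sum_config_compose[OF N W], measurable)+, simp, measurable)
  then show ?thesis
    using N W by (subst measurable_cong[OF sum_point_triples]) (auto intro: config_finite)
qed

lemma measurable_sum_point_quads:
  fixes N :: "'w \<Rightarrow> 'a::euclidean_space set" and F :: "'a \<times> 'a \<times> 'a \<times> 'a \<Rightarrow> real"
  assumes N [measurable]: "N \<in> M \<rightarrow>\<^sub>M config_space" and W: "W \<in> sets borel" "bounded W"
    and F [measurable]: "F \<in> borel_measurable (borel \<Otimes>\<^sub>M borel \<Otimes>\<^sub>M borel \<Otimes>\<^sub>M borel)"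
  shows "(\<lambda>\<omega>. \<Sum>t\<in>point_quads W (N \<omega>). F t) \<in> borel_measurable M"
proof -
  have "(\<lambda>\<omega>. \<Sum>x\<in>N \<omega> \<inter> W. \<Sum>y\<in>N \<omega> \<inter> W. \<Sum>z\<in>N \<omega> \<inter> W. \<Sum>u\<in>N \<omega> \<inter> W.
      if distinct [x, y, z, u] then F (x, y, z, u) else 0) \<in> borel_measurable M"
    by ((rule measurable_sum_config_compose[OF N W], measurable)+, simp, measurable)
  then show ?thesis
    using N W by (subst measurable_cong[OF sum_point_quads]) (auto intro: config_finite)
qed

subsection \<open>Linear operators continuous under bounded pointwise convergence\<close>

text \<open>The bound is required at every point of the type, also outside \<open>space X\<close>,
  so that it can be used without a side condition on the point.\<close>

definition bm :: "'x measure \<Rightarrow> ('x \<Rightarrow> real) set" where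
  "bm X = {F. F \<in> borel_measurable X \<and> (\<exists>C. \<forall>x. \<bar>F x\<bar> \<le> C)}"

lemma bmI: "F \<in> borel_measurable X \<Longrightarrow> (\<And>x. \<bar>F x\<bar> \<le> C) \<Longrightarrow> F \<in> bm X"
  by (auto simp: bm_def)

lemma bm_measurable: "F \<in> bm X \<Longrightarrow> F \<in> borel_measurable X"
  by (auto simp: bm_def)

lemma bmE:
  assumes "F \<in> bm X"
  obtains C where "F \<in> borel_measurable X" "0 \<le> C" "\<And>x. \<bar>F x\<bar> \<le> C"
proof -
  obtain C where "F \<in> borel_measurable X" "\<And>x. \<bar>F x\<bar> \<le> C" using assms by (auto simp: bm_def)
  moreover from this(2)[of undefined] have "0 \<le> C" by linarith
  ultimately show ?thesis using that by blast
qed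

lemma bm_add: "F \<in> bm X \<Longrightarrow> G \<in> bm X \<Longrightarrow> (\<lambda>x. F x + G x) \<in> bm X"
proof -
  assume "F \<in> bm X" "G \<in> bm X"
  then obtain C D where "\<And>x. \<bar>F x\<bar> \<le> C" "\<And>x. \<bar>G x\<bar> \<le> D"
    and [measurable]: "F \<in> borel_measurable X" "G \<in> borel_measurable X" by (auto simp: bm_def)
  then show ?thesis
    by (intro bmI[of _ _ "C + D"]) (auto intro: order_trans[OF abs_triangle_ineq add_mono])
qed

lemma bm_mult: "F \<in> bm X \<Longrightarrow> G \<in> bm X \<Longrightarrow> (\<lambda>x. F x * G x) \<in> bm X"
proof -
  assume "F \<in> bm X" "G \<in> bm X"
  then obtain C D where "\<And>x. \<bar>F x\<bar> \<le> C" "\<And>x. \<bar>G x\<bar> \<le> D"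
    and [measurable]: "F \<in> borel_measurable X" "G \<in> borel_measurable X" by (auto simp: bm_def)
  then show ?thesis
    by (intro bmI[of _ _ "C * D"]) (auto simp: abs_mult intro!: mult_mono intro: order_trans[OF abs_ge_zero])
qed

lemma bm_const: "(\<lambda>x. c) \<in> bm X"
  by (rule bmI[of _ _ "\<bar>c\<bar>"]) auto

lemma bm_cmult: "F \<in> bm X \<Longrightarrow> (\<lambda>x. c * F x) \<in> bm X"
  by (rule bm_mult[OF bm_const])

lemma bm_sum: "(\<And>i. i \<in> I \<Longrightarrow> F i \<in> bm X) \<Longrightarrow> (\<lambda>x. \<Sum>i\<in>I. F i x) \<in> bm X"
  by (induction I rule: infinite_finite_induct) (auto intro: bm_add bm_const)

lemma bm_indicator: "A \<in> sets X \<Longrightarrow> indicator A \<in> bm X"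
  by (rule bmI[of _ _ 1]) (auto simp: indicator_def)

lemma bm_compose: "F \<in> bm X \<Longrightarrow> \<phi> \<in> Y \<rightarrow>\<^sub>M X \<Longrightarrow> (\<lambda>y. F (\<phi> y)) \<in> bm Y"
  by (auto simp: bm_def)

lemma bm_integrable:
  assumes "finite_measure \<nu>" "F \<in> bm \<nu>"
  shows "integrable \<nu> F"
proof -
  from assms(2) obtain C where "\<And>x. \<bar>F x\<bar> \<le> C" "F \<in> borel_measurable \<nu>" by (auto simp: bm_def)
  then show ?thesis by (intro finite_measure.integrable_const_bound[OF assms(1), of F C]) auto
qed

text \<open>A non-integrable function has integral 0 and the right side is non-negative, so
  estimates can be made before measurability is discussed.\<close>

lemma abs_integral_le_bound:
  assumes "finite_measure \<nu>" "\<And>x. \<bar>F x :: real\<bar> \<le> C"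
  shows "\<bar>\<integral>x. F x \<partial>\<nu>\<bar> \<le> measure \<nu> (space \<nu>) * C"
proof (cases "integrable \<nu> F")
  case True
  interpret finite_measure \<nu> by fact
  have "\<bar>\<integral>x. F x \<partial>\<nu>\<bar> \<le> (\<integral>x. \<bar>F x\<bar> \<partial>\<nu>)" by (rule integral_abs_bound)
  also have "\<dots> \<le> (\<integral>x. C \<partial>\<nu>)" using True assms by (intro integral_mono) auto
  finally show ?thesis by simp
next
  case False
  moreover have "0 \<le> C" using assms(2)[of undefined] by linarith
  ultimately show ?thesis by (simp add: not_integrable_integral_eq)
qed

text \<open>Bounded pointwise convergence is the mode in which dominated convergence works with a
  constant majorant. The class contains substitutions and is closed under sums, products with a
  fixed bounded function, composition and integration against finite measures; its members are
  determined by their values on rectangles. The identities are required on \<open>space Y\<close>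
  only, the norm bound everywhere.\<close>

definition bpc_op :: "'x measure \<Rightarrow> 'y measure \<Rightarrow> (('x \<Rightarrow> real) \<Rightarrow> 'y \<Rightarrow> real) \<Rightarrow> bool" where
  "bpc_op X Y T \<longleftrightarrow>
     (\<forall>F\<in>bm X. T F \<in> borel_measurable Y) \<and>
     (\<forall>F\<in>bm X. \<forall>G\<in>bm X. \<forall>y\<in>space Y. T (\<lambda>x. F x + G x) y = T F y + T G y) \<and>
     (\<forall>c. \<forall>F\<in>bm X. \<forall>y\<in>space Y. T (\<lambda>x. c * F x) y = c * T F y) \<and>
     (\<exists>K\<ge>0. \<forall>F\<in>bm X. \<forall>C. (\<forall>x. \<bar>F x\<bar> \<le> C) \<longrightarrow> (\<forall>y. \<bar>T F y\<bar> \<le> K * C)) \<and>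
     (\<forall>Fs F C. (\<forall>i. Fs i \<in> bm X) \<longrightarrow> F \<in> bm X \<longrightarrow> (\<forall>i x. \<bar>Fs i x\<bar> \<le> C) \<longrightarrow>
        (\<forall>x. (\<lambda>i. Fs i x) \<longlonglongrightarrow> F x) \<longrightarrow> (\<forall>y\<in>space Y. (\<lambda>i. T (Fs i) y) \<longlonglongrightarrow> T F y))"

lemma bpc_opI:
  assumes "\<And>F. F \<in> bm X \<Longrightarrow> T F \<in> borel_measurable Y"
    and "\<And>F G y. F \<in> bm X \<Longrightarrow> G \<in> bm X \<Longrightarrow> y \<in> space Y \<Longrightarrow> T (\<lambda>x. F x + G x) y = T F y + T G y"
    and "\<And>c F y. F \<in> bm X \<Longrightarrow> y \<in> space Y \<Longrightarrow> T (\<lambda>x. c * F x) y = c * T F y"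
    and "0 \<le> K" "\<And>F C y. F \<in> bm X \<Longrightarrow> (\<And>x. \<bar>F x\<bar> \<le> C) \<Longrightarrow> \<bar>T F y\<bar> \<le> K * C"
    and "\<And>Fs F C y. (\<And>i. Fs i \<in> bm X) \<Longrightarrow> F \<in> bm X \<Longrightarrow> (\<And>i x. \<bar>Fs i x\<bar> \<le> C) \<Longrightarrow>
        (\<And>x. (\<lambda>i. Fs i x) \<longlonglongrightarrow> F x) \<Longrightarrow> y \<in> space Y \<Longrightarrow> (\<lambda>i. T (Fs i) y) \<longlonglongrightarrow> T F y"
  shows "bpc_op X Y T"
  unfolding bpc_op_def using assms by blast

lemma bpc_op_measurable: "bpc_op X Y T \<Longrightarrow> F \<in> bm X \<Longrightarrow> T F \<in> borel_measurable Y"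
  and bpc_op_add: "bpc_op X Y T \<Longrightarrow> F \<in> bm X \<Longrightarrow> G \<in> bm X \<Longrightarrow> y \<in> space Y \<Longrightarrow>
        T (\<lambda>x. F x + G x) y = T F y + T G y"
  and bpc_op_cmult: "bpc_op X Y T \<Longrightarrow> F \<in> bm X \<Longrightarrow> y \<in> space Y \<Longrightarrow> T (\<lambda>x. c * F x) y = c * T F y"
  by (auto simp: bpc_op_def)

lemma bpc_op_bound:
  assumes "bpc_op X Y T"
  obtains K where "0 \<le> K" "\<And>F C y. F \<in> bm X \<Longrightarrow> (\<And>x. \<bar>F x\<bar> \<le> C) \<Longrightarrow> \<bar>T F y\<bar> \<le> K * C"
  using assms by (auto simp: bpc_op_def) 

lemma bpc_op_tendsto:
  assumes "bpc_op X Y T" "\<And>i. Fs i \<in> bm X" "F \<in> bm X" "\<And>i x. \<bar>Fs i x\<bar> \<le> C"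
    "\<And>x. (\<lambda>i. Fs i x) \<longlonglongrightarrow> F x" "y \<in> space Y"
  shows "(\<lambda>i. T (Fs i) y) \<longlonglongrightarrow> T F y"
  using assms unfolding bpc_op_def by blast

lemma bpc_op_bm: "bpc_op X Y T \<Longrightarrow> F \<in> bm X \<Longrightarrow> T F \<in> bm Y"
proof -
  assume T: "bpc_op X Y T" and F: "F \<in> bm X"
  obtain K where K: "\<And>F C y. F \<in> bm X \<Longrightarrow> (\<And>x. \<bar>F x\<bar> \<le> C) \<Longrightarrow> \<bar>T F y\<bar> \<le> K * C"
    using bpc_op_bound[OF T] by metis
  obtain C where "\<And>x. \<bar>F x\<bar> \<le> C" using F by (auto simp: bm_def)
  then show ?thesis using K[OF F] bpc_op_measurable[OF T F] by (auto intro: bmI)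
qed

lemma bpc_subst: "\<phi> \<in> Y \<rightarrow>\<^sub>M X \<Longrightarrow> bpc_op X Y (\<lambda>F y. F (\<phi> y))"
  by (rule bpc_opI[where K=1]) (auto dest: bm_measurable)

text \<open>The hypothesis \<open>space Y = UNIV\<close> turns the identities for \<open>T\<close>,
  which hold on \<open>space Y\<close>, into equalities of functions; \<open>S\<close> may depend on
  the values of its argument anywhere.\<close>

lemma bpc_comp:
  assumes S: "bpc_op Y Z S" and T: "bpc_op X Y T" and Y: "space Y = UNIV"
  shows "bpc_op X Z (\<lambda>F. S (T F))"
proof -
  obtain K where K: "0 \<le> K" "\<And>F C y. F \<in> bm X \<Longrightarrow> (\<And>x. \<bar>F x\<bar> \<le> C) \<Longrightarrow> \<bar>T F y\<bar> \<le> K * C"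
    using bpc_op_bound[OF T] by metis
  obtain L where L: "0 \<le> L" "\<And>F C y. F \<in> bm Y \<Longrightarrow> (\<And>x. \<bar>F x\<bar> \<le> C) \<Longrightarrow> \<bar>S F y\<bar> \<le> L * C"
    using bpc_op_bound[OF S] by metis
  have TF: "T F \<in> bm Y" if "F \<in> bm X" for F using bpc_op_bm[OF T that] .
  show ?thesis
  proof (rule bpc_opI[where K="L * K"])
    fix F G z assume FG: "F \<in> bm X" "G \<in> bm X" "z \<in> space Z"
    have "T (\<lambda>x. F x + G x) = (\<lambda>y. T F y + T G y)"
      using bpc_op_add[OF T FG(1,2)] Y by (auto simp: fun_eq_iff)
    then show "S (T (\<lambda>x. F x + G x)) z = S (T F) z + S (T G) z"
      using bpc_op_add[OF S TF TF FG(3)] FG by simp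
  next
    fix F c z assume FG: "F \<in> bm X" "z \<in> space Z"
    have "T (\<lambda>x. c * F x) = (\<lambda>y. c * T F y)"
      using bpc_op_cmult[OF T FG(1)] Y by (auto simp: fun_eq_iff)
    then show "S (T (\<lambda>x. c * F x)) z = c * S (T F) z"
      using bpc_op_cmult[OF S TF FG(2)] FG by simp
  next
    fix F C z assume FC: "F \<in> bm X" "\<And>x. \<bar>F x\<bar> \<le> C"
    show "\<bar>S (T F) z\<bar> \<le> L * K * C"
      using L(2)[OF TF K(2), OF FC(1) FC] by (simp add: mult.assoc)
  next
    fix Fs F C z assume *: "\<And>i. Fs i \<in> bm X" "F \<in> bm X" "\<And>i x. \<bar>Fs i x\<bar> \<le> C"
        "\<And>x. (\<lambda>i. Fs i x) \<longlonglongrightarrow> F x" "z \<in> space Z"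
    show "(\<lambda>i. S (T (Fs i)) z) \<longlonglongrightarrow> S (T F) z"
      by (rule bpc_op_tendsto[OF S TF TF K(2) bpc_op_tendsto[OF T]]) (use * Y in auto)
  qed (use K L bpc_op_measurable[OF S] TF in auto)
qed

text \<open>Dominated convergence with the constant \<open>K * C\<close>, which is integrable
  because \<nu> is finite. The operator is given through an integrand \<open>e F y z\<close>, a form
  that allows the rule to be applied again to its own result and so to iterated integrals.\<close>

lemma bpc_int:
  assumes \<nu>: "finite_measure \<nu>" and T: "bpc_op X (Y \<Otimes>\<^sub>M \<nu>) (\<lambda>F p. e F (fst p) (snd p))"
  shows "bpc_op X Y (\<lambda>F y. \<integral>z. e F y z \<partial>\<nu>)"
proof -
  interpret finite_measure \<nu> by fact
  obtain K where K: "0 \<le> K" "\<And>F C p. F \<in> bm X \<Longrightarrow> (\<And>x. \<bar>F x\<bar> \<le> C) \<Longrightarrow> \<bar>e F (fst p) (snd p)\<bar> \<le> K * C"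
    using bpc_op_bound[OF T] by metis
  have K': "\<bar>e F y z\<bar> \<le> K * C" if "F \<in> bm X" "\<And>x. \<bar>F x\<bar> \<le> C" for F C y z
    using K(2)[OF that, of "(y, z)"] by simp
  have sec: "(\<lambda>z. e F y z) \<in> bm \<nu>" if "F \<in> bm X" "y \<in> space Y" for F y
  proof -
    have "(\<lambda>p. e F (fst p) (snd p)) \<in> bm (Y \<Otimes>\<^sub>M \<nu>)" using bpc_op_bm[OF T that(1)] .
    from bm_compose[OF this measurable_Pair1'[OF that(2)]] show ?thesis by simp
  qed
  have int: "integrable \<nu> (\<lambda>z. e F y z)" if "F \<in> bm X" "y \<in> space Y" for F y
    using bm_integrable[OF \<nu> sec[OF that]] .
  show ?thesis
  proof (rule bpc_opI[where K="measure \<nu> (space \<nu>) * K"])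
    show "(\<lambda>y. \<integral>z. e F y z \<partial>\<nu>) \<in> borel_measurable Y" if "F \<in> bm X" for F
      using borel_measurable_lebesgue_integral[of "e F" Y] bpc_op_measurable[OF T that]
      by (simp add: split_beta')
  next
    fix F G y assume *: "F \<in> bm X" "G \<in> bm X" "y \<in> space Y"
    have "(\<integral>z. e (\<lambda>x. F x + G x) y z \<partial>\<nu>) = (\<integral>z. e F y z + e G y z \<partial>\<nu>)"
      using bpc_op_add[OF T *(1,2), of "(y, _)"] *
      by (intro Bochner_Integration.integral_cong) (auto simp: space_pair_measure)
    then show "(\<integral>z. e (\<lambda>x. F x + G x) y z \<partial>\<nu>) = (\<integral>z. e F y z \<partial>\<nu>) + (\<integral>z. e G y z \<partial>\<nu>)"
      using int * by simp
  next
    fix F c y assume *: "F \<in> bm X" "y \<in> space Y"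
    have "(\<integral>z. e (\<lambda>x. c * F x) y z \<partial>\<nu>) = (\<integral>z. c * e F y z \<partial>\<nu>)"
      using bpc_op_cmult[OF T *(1), of "(y, _)"] *
      by (intro Bochner_Integration.integral_cong) (auto simp: space_pair_measure)
    then show "(\<integral>z. e (\<lambda>x. c * F x) y z \<partial>\<nu>) = c * (\<integral>z. e F y z \<partial>\<nu>)" by simp
  next
    fix F C y assume *: "F \<in> bm X" "\<And>x. \<bar>F x\<bar> \<le> C"
    show "\<bar>\<integral>z. e F y z \<partial>\<nu>\<bar> \<le> measure \<nu> (space \<nu>) * K * C"
      using abs_integral_le_bound[OF \<nu> K'[OF *]] by (simp add: mult.assoc)
  next
    fix Fs F C y assume *: "\<And>i. Fs i \<in> bm X" "F \<in> bm X" "\<And>i x. \<bar>Fs i x\<bar> \<le> C"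
        "\<And>x. (\<lambda>i. Fs i x) \<longlonglongrightarrow> F x" "y \<in> space Y"
    show "(\<lambda>i. \<integral>z. e (Fs i) y z \<partial>\<nu>) \<longlonglongrightarrow> (\<integral>z. e F y z \<partial>\<nu>)"
    proof (rule integral_dominated_convergence[where w="\<lambda>_. K * C"])
      show "AE z in \<nu>. (\<lambda>i. e (Fs i) y z) \<longlonglongrightarrow> e F y z"
        using bpc_op_tendsto[OF T *(1-4), of "(y, _)"] *(5) by (intro AE_I2) (auto simp: space_pair_measure)
      show "AE z in \<nu>. norm (e (Fs i) y z) \<le> K * C" for i using K'[OF *(1) *(3)] by auto
    qed (use sec * in \<open>auto dest: bm_measurable\<close>)
  qed (use K in auto)
qed

lemma bpc_mult:
  assumes k: "k \<in> bm Y" and T: "bpc_op X Y T"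
  shows "bpc_op X Y (\<lambda>F y. k y * T F y)"
proof -
  obtain K where K: "0 \<le> K" "\<And>F C p. F \<in> bm X \<Longrightarrow> (\<And>x. \<bar>F x\<bar> \<le> C) \<Longrightarrow> \<bar>T F p\<bar> \<le> K * C"
    using bpc_op_bound[OF T] by metis
  obtain D where D: "\<And>y. \<bar>k y\<bar> \<le> D" using k by (auto simp: bm_def)
  have D0: "0 \<le> D" using D[of undefined] by linarith
  show ?thesis
  proof (rule bpc_opI[where K="D * K"])
    fix F C y assume *: "F \<in> bm X" "\<And>x. \<bar>F x\<bar> \<le> C"
    have "\<bar>k y * T F y\<bar> \<le> D * (K * C)"
      unfolding abs_mult using D K(2)[OF *] D0 by (intro mult_mono) auto
    then show "\<bar>k y * T F y\<bar> \<le> D * K * C" by (simp add: mult.assoc)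
  next
    fix Fs F C y assume *: "\<And>i. Fs i \<in> bm X" "F \<in> bm X" "\<And>i x. \<bar>Fs i x\<bar> \<le> C"
        "\<And>x. (\<lambda>i. Fs i x) \<longlonglongrightarrow> F x" "y \<in> space Y"
    show "(\<lambda>i. k y * T (Fs i) y) \<longlonglongrightarrow> k y * T F y"
      by (intro tendsto_mult tendsto_const bpc_op_tendsto[OF T *])
  qed (use K D0 bpc_op_measurable[OF T] bm_measurable[OF k] bpc_op_add[OF T] bpc_op_cmult[OF T] in
      \<open>auto simp: distrib_left\<close>)
qed

lemma bpc_add:
  assumes T: "bpc_op X Y T" and S: "bpc_op X Y S"
  shows "bpc_op X Y (\<lambda>F y. T F y + S F y)"
proof -
  obtain K where K: "0 \<le> K" "\<And>F C p. F \<in> bm X \<Longrightarrow> (\<And>x. \<bar>F x\<bar> \<le> C) \<Longrightarrow> \<bar>T F p\<bar> \<le> K * C"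
    using bpc_op_bound[OF T] by metis
  obtain L where L: "0 \<le> L" "\<And>F C p. F \<in> bm X \<Longrightarrow> (\<And>x. \<bar>F x\<bar> \<le> C) \<Longrightarrow> \<bar>S F p\<bar> \<le> L * C"
    using bpc_op_bound[OF S] by metis
  show ?thesis
  proof (rule bpc_opI[where K="K + L"])
    fix F C y assume *: "F \<in> bm X" "\<And>x. \<bar>F x\<bar> \<le> C"
    show "\<bar>T F y + S F y\<bar> \<le> (K + L) * C"
      using K(2)[OF *, of y] L(2)[OF *, of y] by (simp add: distrib_right)
  next
    fix Fs F C y assume *: "\<And>i. Fs i \<in> bm X" "F \<in> bm X" "\<And>i x. \<bar>Fs i x\<bar> \<le> C"
        "\<And>x. (\<lambda>i. Fs i x) \<longlonglongrightarrow> F x" "y \<in> space Y"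
    show "(\<lambda>i. T (Fs i) y + S (Fs i) y) \<longlonglongrightarrow> T F y + S F y"
      by (intro tendsto_add bpc_op_tendsto[OF T *] bpc_op_tendsto[OF S *])
  qed (use K L bpc_op_measurable[OF T] bpc_op_measurable[OF S] bpc_op_add[OF T] bpc_op_cmult[OF T]
      bpc_op_add[OF S] bpc_op_cmult[OF S] in \<open>auto simp: distrib_left\<close>)
qed

lemma bpc_diff: "bpc_op X Y T \<Longrightarrow> bpc_op X Y S \<Longrightarrow> bpc_op X Y (\<lambda>F y. T F y - S F y)"
  using bpc_add[of X Y T "\<lambda>F y. - 1 * S F y"] bpc_mult[OF bm_const, of X Y S "- 1"] by simp

text \<open>Functionals are operators into functions on a one-point space, so that one set of
  closure rules serves both.\<close>

abbreviation bpc_fun :: "'x measure \<Rightarrow> (('x \<Rightarrow> real) \<Rightarrow> real) \<Rightarrow> bool" where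
  "bpc_fun X \<Phi> \<equiv> bpc_op X (count_space (UNIV :: unit set)) (\<lambda>F _. \<Phi> F)"

lemma bpc_fun_comp:
  "bpc_fun Y \<Phi> \<Longrightarrow> space Y = UNIV \<Longrightarrow> bpc_op X Y T \<Longrightarrow> bpc_fun X (\<lambda>F. \<Phi> (\<lambda>y. T F y))"
  using bpc_comp[of Y "count_space (UNIV :: unit set)" "\<lambda>F _. \<Phi> F" X T] by simp

lemma bpc_fun_sum:
  assumes \<Phi>: "bpc_fun X \<Phi>" and I: "finite I" "\<And>i. i \<in> I \<Longrightarrow> F i \<in> bm X"
  shows "\<Phi> (\<lambda>x. \<Sum>i\<in>I. F i x) = (\<Sum>i\<in>I. \<Phi> (F i))"
  using I
proof (induction I rule: finite_induct)
  case empty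
  show ?case using bpc_op_cmult[OF \<Phi> bm_const[of 0 X], of "()" 0] by simp
next
  case (insert i I)
  then have "\<Phi> (\<lambda>x. F i x + (\<Sum>i\<in>I. F i x)) = \<Phi> (F i) + \<Phi> (\<lambda>x. \<Sum>i\<in>I. F i x)"
    by (intro bpc_op_add[OF \<Phi>] bm_sum) auto
  then show ?case using insert by simp
qed

text \<open>Agreement on indicators passes to simple functions by linearity and to \<open>F\<close>
  by bounded convergence. The approximating simple functions satisfy
  \<open>\<bar>s i x\<bar> \<le> 2 * \<bar>F x\<bar>\<close>, hence are bounded uniformly in
  \<open>i\<close>; no split into positive and negative parts is made.\<close>

lemma bpc_fun_eq_sets:
  assumes \<Phi>: "bpc_fun X \<Phi>" and \<Psi>: "bpc_fun X \<Psi>" and X: "space X = UNIV"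
    and ind: "\<And>A. A \<in> sets X \<Longrightarrow> \<Phi> (indicator A) = \<Psi> (indicator A)" and F: "F \<in> bm X"
  shows "\<Phi> F = \<Psi> F"
proof -
  obtain C where C: "\<And>x. \<bar>F x\<bar> \<le> C" and [measurable]: "F \<in> borel_measurable X"
    using F by (auto simp: bm_def)
  have "\<exists>s. (\<forall>i. simple_function X (s i)) \<and> (\<forall>x\<in>space X. (\<lambda>i. s i x) \<longlonglongrightarrow> F x) \<and>
      (\<forall>i. \<forall>x\<in>space X. dist (s i x) 0 \<le> 2 * dist (F x) 0)"
    by (rule borel_measurable_implies_sequence_metric) fact
  then obtain s where s0: "(\<forall>i. simple_function X (s i)) \<and> (\<forall>x\<in>space X. (\<lambda>i. s i x) \<longlonglongrightarrow> F x) \<and>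
      (\<forall>i. \<forall>x\<in>space X. dist (s i x) 0 \<le> 2 * dist (F x) 0)"
    by (rule exE)
  have s: "simple_function X (s i)" "(\<lambda>i. s i x) \<longlonglongrightarrow> F x" "\<bar>s i x\<bar> \<le> 2 * \<bar>F x\<bar>" for i x
    using s0 X by auto
  have sC: "\<bar>s i x\<bar> \<le> 2 * C" for i x using s(3)[of i x] C[of x] by linarith
  have sb: "s i \<in> bm X" for i
    using borel_measurable_simple_function[OF s(1)] sC by (intro bmI)
  have sr: "s i = (\<lambda>x. \<Sum>y\<in>range (s i). y * indicator (s i -` {y}) x)" for i
  proof
    fix x
    have "s i x = (\<Sum>y\<in>s i ` space X. indicator (s i -` {y} \<inter> space X) x *\<^sub>R y)"
      by (rule simple_function_indicator_representation_banach[OF s(1)]) (simp add: X)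
    also have "\<dots> = (\<Sum>y\<in>range (s i). y * indicator (s i -` {y}) x)"
      by (simp add: X mult.commute)
    finally show "s i x = (\<Sum>y\<in>range (s i). y * indicator (s i -` {y}) x)" .
  qed
  have A: "s i -` {y} \<in> sets X" for i y
    using simple_functionD(2)[OF s(1), of i "{y}"] X by simp
  have fin: "finite (range (s i))" for i
    using simple_functionD(1)[OF s(1), of i] X by simp
  have bmi: "(\<lambda>x. y * indicator (s i -` {y}) x) \<in> bm X" for i y
    by (intro bm_cmult bm_indicator A)
  have "\<Phi> (s i) = \<Psi> (s i)" for i
  proof -
    have "\<Phi> (s i) = (\<Sum>y\<in>range (s i). \<Phi> (\<lambda>x. y * indicator (s i -` {y}) x))"
      by (subst sr, rule bpc_fun_sum[OF \<Phi> fin bmi])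
    also have "\<dots> = (\<Sum>y\<in>range (s i). \<Psi> (\<lambda>x. y * indicator (s i -` {y}) x))"
      using bpc_op_cmult[OF \<Phi> bm_indicator[OF A]] bpc_op_cmult[OF \<Psi> bm_indicator[OF A]] ind[OF A]
      by (intro sum.cong) auto
    also have "\<dots> = \<Psi> (s i)"
      by (subst (3) sr, rule bpc_fun_sum[OF \<Psi> fin bmi, symmetric])
    finally show ?thesis .
  qed
  moreover have "(\<lambda>i. \<Phi> (s i)) \<longlonglongrightarrow> \<Phi> F" "(\<lambda>i. \<Psi> (s i)) \<longlonglongrightarrow> \<Psi> F"
    using bpc_op_tendsto[OF \<Phi> sb F sC s(2), of "()"] bpc_op_tendsto[OF \<Psi> sb F sC s(2), of "()"] by auto
  ultimately show ?thesis by (simp add: LIMSEQ_unique)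
qed

text \<open>Dynkin argument over rectangles. The functionals may be signed, so countable unions
  cannot be handled by monotonicity; disjointness bounds the partial sums of the indicators by 1,
  and bounded convergence applies instead.\<close>

lemma bpc_fun_eq_pair:
  fixes X :: "'x measure" and Y :: "'y measure"
  assumes \<Phi>: "bpc_fun (X \<Otimes>\<^sub>M Y) \<Phi>" and \<Psi>: "bpc_fun (X \<Otimes>\<^sub>M Y) \<Psi>"
    and XY: "space X = UNIV" "space Y = UNIV"
    and rect: "\<And>a b. a \<in> sets X \<Longrightarrow> b \<in> sets Y \<Longrightarrow> \<Phi> (indicator (a \<times> b)) = \<Psi> (indicator (a \<times> b))"
    and F: "F \<in> bm (X \<Otimes>\<^sub>M Y)"
  shows "\<Phi> F = \<Psi> F"
proof (rule bpc_fun_eq_sets[OF \<Phi> \<Psi> _ _ F])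
  fix A assume A: "A \<in> sets (X \<Otimes>\<^sub>M Y)"
  let ?G = "{a \<times> b | a b. a \<in> sets X \<and> b \<in> sets Y}"
  have "Int_stable ?G" by (rule Int_stable_pair_measure_generator)
  moreover have "?G \<subseteq> Pow UNIV" by simp
  moreover have "A \<in> sigma_sets UNIV ?G" using A XY by (simp add: sets_pair_measure)
  ultimately show "\<Phi> (indicator A) = \<Psi> (indicator A)"
  proof (induction rule: sigma_sets_induct_disjoint)
    case (basic A)
    then show ?case using rect by auto
  next
    case empty
    show ?case using rect[of "{}" "{}"] by (simp only: Sigma_empty1 sets.empty_sets)
  next
    case (compl A)
    have A: "A \<in> sets (X \<Otimes>\<^sub>M Y)" using compl XY by (simp add: sets_pair_measure)
    \<comment> \<open>The complement is written with a sum and a factor -1, the two operations with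
      which the functionals are known to commute.\<close>
    have eq: "indicator (UNIV - A) = (\<lambda>x. indicator (UNIV \<times> UNIV) x + - 1 * indicator A x :: real)"
      by (auto simp: indicator_def)
    have b: "indicator (UNIV \<times> UNIV) \<in> bm (X \<Otimes>\<^sub>M Y)" "(\<lambda>x. - 1 * indicator A x) \<in> bm (X \<Otimes>\<^sub>M Y)"
      using bm_const[of 1 "X \<Otimes>\<^sub>M Y"] bm_cmult[OF bm_indicator[OF A], of "- 1"] by (auto simp: indicator_def)
    have U: "\<Phi> (indicator (UNIV \<times> UNIV)) = \<Psi> (indicator (UNIV \<times> UNIV))"
      using XY by (intro rect) (metis sets.top)+
    have "\<Phi> (\<lambda>x. - 1 * indicator A x) = \<Psi> (\<lambda>x. - 1 * indicator A x)"
      using bpc_op_cmult[OF \<Phi> bm_indicator[OF A], of "()" "- 1"]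
        bpc_op_cmult[OF \<Psi> bm_indicator[OF A], of "()" "- 1"] compl by simp
    moreover have u: "() \<in> space (count_space UNIV)" by simp
    ultimately show ?case
      unfolding eq bpc_op_add[OF \<Phi> b u] bpc_op_add[OF \<Psi> b u] U by (simp only:)
  next
    case (union A)
    have A: "A i \<in> sets (X \<Otimes>\<^sub>M Y)" for i using union XY by (auto simp: sets_pair_measure)
    let ?F = "\<lambda>n x. \<Sum>i<n. indicator (A i) x :: real"
    have Fb: "?F n \<in> bm (X \<Otimes>\<^sub>M Y)" for n by (intro bm_sum bm_indicator A)
    have Ub: "indicator (\<Union>i. A i) \<in> bm (X \<Otimes>\<^sub>M Y)" using A by (intro bm_indicator) auto
    have lim: "(\<lambda>n. ?F n x) \<longlonglongrightarrow> indicator (\<Union>i. A i) x" for x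
      using indicator_sums[of A x] union by (auto simp: sums_def disjoint_family_on_def)
    have F1: "\<bar>?F n x\<bar> \<le> 1" for n x
    proof -
      have "?F n x \<le> indicator (\<Union>i. A i) x"
        by (rule LIMSEQ_le_const[OF lim]) (auto intro!: exI[of _ n] sum_mono2)
      then show ?thesis by (simp add: sum_nonneg order_trans[OF _ indicator_le_1])
    qed
    have "\<Phi> (?F n) = \<Psi> (?F n)" for n
      using union by (simp add: bpc_fun_sum[OF \<Phi>] bpc_fun_sum[OF \<Psi>] bm_indicator A)
    moreover have "(\<lambda>n. \<Phi> (?F n)) \<longlonglongrightarrow> \<Phi> (indicator (\<Union>i. A i))"
      using bpc_op_tendsto[OF \<Phi> Fb Ub F1 lim, of "()"] by simp
    moreover have "(\<lambda>n. \<Psi> (?F n)) \<longlonglongrightarrow> \<Psi> (indicator (\<Union>i. A i))"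
      using bpc_op_tendsto[OF \<Psi> Fb Ub F1 lim, of "()"] by simp
    ultimately show ?case by (simp add: LIMSEQ_unique)
  qed
qed (simp add: space_pair_measure XY)

lemma bpc_times_indicator:
  assumes a: "a \<in> sets X"
  shows "bpc_op Y (X \<Otimes>\<^sub>M Y) (\<lambda>G p. indicator a (fst p) * G (snd p))"
  by (intro bpc_mult bpc_subst bm_compose[OF bm_indicator[OF a]]) auto

text \<open>Freezing the first side \<open>a\<close> turns both functionals into functionals of the
  remaining coordinates, to which the two-factor statement applies; \<open>bpc_fun_eq_quad\<close>
  repeats the step once more.\<close>

lemma bpc_fun_eq_triple:
  fixes X :: "'x measure" and Y :: "'y measure" and Z :: "'z measure"
  assumes \<Phi>: "bpc_fun (X \<Otimes>\<^sub>M Y \<Otimes>\<^sub>M Z) \<Phi>" and \<Psi>: "bpc_fun (X \<Otimes>\<^sub>M Y \<Otimes>\<^sub>M Z) \<Psi>"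
    and XY: "space X = UNIV" "space Y = UNIV" "space Z = UNIV"
    and rect: "\<And>a b c. a \<in> sets X \<Longrightarrow> b \<in> sets Y \<Longrightarrow> c \<in> sets Z \<Longrightarrow>
      \<Phi> (indicator (a \<times> b \<times> c)) = \<Psi> (indicator (a \<times> b \<times> c))"
    and F: "F \<in> bm (X \<Otimes>\<^sub>M Y \<Otimes>\<^sub>M Z)"
  shows "\<Phi> F = \<Psi> F"
proof (rule bpc_fun_eq_pair[OF \<Phi> \<Psi> XY(1) _ _ F])
  show sp: "space (Y \<Otimes>\<^sub>M Z) = UNIV" by (simp add: space_pair_measure XY)
  fix a b assume a: "a \<in> sets X" and b: "b \<in> sets (Y \<Otimes>\<^sub>M Z)"
  have eq: "(\<lambda>p. indicator a (fst p) * indicator S (snd p) :: real) = indicator (a \<times> S)" for S :: "('y \<times> 'z) set"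
    by (auto simp: indicator_def)
  have sp': "space (X \<Otimes>\<^sub>M Y \<Otimes>\<^sub>M Z) = UNIV" by (simp add: space_pair_measure XY)
  have "\<Phi> (\<lambda>p. indicator a (fst p) * indicator b (snd p)) = \<Psi> (\<lambda>p. indicator a (fst p) * indicator b (snd p))"
  proof (rule bpc_fun_eq_pair[OF bpc_fun_comp[OF \<Phi> sp' bpc_times_indicator[OF a]]
        bpc_fun_comp[OF \<Psi> sp' bpc_times_indicator[OF a]] XY(2,3) _ bm_indicator[OF b]])
    fix b c assume "b \<in> sets Y" "c \<in> sets Z"
    then show "\<Phi> (\<lambda>p. indicator a (fst p) * indicator (b \<times> c) (snd p)) =
        \<Psi> (\<lambda>p. indicator a (fst p) * indicator (b \<times> c) (snd p))"
      unfolding eq using rect a by simp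
  qed
  then show "\<Phi> (indicator (a \<times> b)) = \<Psi> (indicator (a \<times> b))" by (simp only: eq)
qed

lemma bpc_fun_eq_quad:
  fixes X :: "'x measure" and Y :: "'y measure" and Z :: "'z measure" and U :: "'u measure"
  assumes \<Phi>: "bpc_fun (X \<Otimes>\<^sub>M Y \<Otimes>\<^sub>M Z \<Otimes>\<^sub>M U) \<Phi>" and \<Psi>: "bpc_fun (X \<Otimes>\<^sub>M Y \<Otimes>\<^sub>M Z \<Otimes>\<^sub>M U) \<Psi>"
    and XY: "space X = UNIV" "space Y = UNIV" "space Z = UNIV" "space U = UNIV"
    and rect: "\<And>a b c d. a \<in> sets X \<Longrightarrow> b \<in> sets Y \<Longrightarrow> c \<in> sets Z \<Longrightarrow> d \<in> sets U \<Longrightarrow>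
      \<Phi> (indicator (a \<times> b \<times> c \<times> d)) = \<Psi> (indicator (a \<times> b \<times> c \<times> d))"
    and F: "F \<in> bm (X \<Otimes>\<^sub>M Y \<Otimes>\<^sub>M Z \<Otimes>\<^sub>M U)"
  shows "\<Phi> F = \<Psi> F"
proof (rule bpc_fun_eq_pair[OF \<Phi> \<Psi> XY(1) _ _ F])
  show sp: "space (Y \<Otimes>\<^sub>M Z \<Otimes>\<^sub>M U) = UNIV" by (simp add: space_pair_measure XY)
  fix a b assume a: "a \<in> sets X" and b: "b \<in> sets (Y \<Otimes>\<^sub>M Z \<Otimes>\<^sub>M U)"
  have eq: "(\<lambda>p. indicator a (fst p) * indicator S (snd p) :: real) = indicator (a \<times> S)" for S :: "('y \<times> 'z \<times> 'u) set"
    by (auto simp: indicator_def)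
  have sp': "space (X \<Otimes>\<^sub>M Y \<Otimes>\<^sub>M Z \<Otimes>\<^sub>M U) = UNIV" by (simp add: space_pair_measure XY)
  have "\<Phi> (\<lambda>p. indicator a (fst p) * indicator b (snd p)) = \<Psi> (\<lambda>p. indicator a (fst p) * indicator b (snd p))"
  proof (rule bpc_fun_eq_triple[OF bpc_fun_comp[OF \<Phi> sp' bpc_times_indicator[OF a]]
        bpc_fun_comp[OF \<Psi> sp' bpc_times_indicator[OF a]] XY(2-4) _ bm_indicator[OF b]])
    fix b c d assume "b \<in> sets Y" "c \<in> sets Z" "d \<in> sets U"
    then show "\<Phi> (\<lambda>p. indicator a (fst p) * indicator (b \<times> c \<times> d) (snd p)) =
        \<Psi> (\<lambda>p. indicator a (fst p) * indicator (b \<times> c \<times> d) (snd p))"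
      unfolding eq using rect a by simp
  qed
  then show "\<Phi> (indicator (a \<times> b)) = \<Psi> (indicator (a \<times> b))" by (simp only: eq)
qed

text \<open>The random number of summands provides the majorant: a bound \<open>C\<close> on
  \<open>F\<close> bounds the sum by \<open>C * real (card (T \<omega>))\<close>, which is
  integrable.\<close>

lemma bpc_fun_expectation_sum:
  fixes T :: "'w \<Rightarrow> 'x set"
  assumes fin: "\<And>\<omega>. \<omega> \<in> space M \<Longrightarrow> finite (T \<omega>)"
    and int: "integrable M (\<lambda>\<omega>. real (card (T \<omega>)))"
    and meas: "\<And>F :: 'x \<Rightarrow> real. F \<in> borel_measurable X \<Longrightarrow> (\<lambda>\<omega>. \<Sum>t\<in>T \<omega>. F t) \<in> borel_measurable M"
  shows "bpc_fun X (\<lambda>F. \<integral>\<omega>. (\<Sum>t\<in>T \<omega>. F t) \<partial>M)"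
    and "F \<in> bm X \<Longrightarrow> integrable M (\<lambda>\<omega>. \<Sum>t\<in>T \<omega>. F t)"
proof -
  have bnd: "\<bar>\<Sum>t\<in>T \<omega>. F t\<bar> \<le> C * real (card (T \<omega>))" if "\<And>x. \<bar>F x\<bar> \<le> C" for F :: "'x \<Rightarrow> real" and C \<omega>
  proof -
    have "\<bar>\<Sum>t\<in>T \<omega>. F t\<bar> \<le> (\<Sum>t\<in>T \<omega>. C)" using that by (intro order_trans[OF sum_abs] sum_mono)
    then show ?thesis by (simp add: mult.commute)
  qed
  have integ: "integrable M (\<lambda>\<omega>. \<Sum>t\<in>T \<omega>. F t)" if "F \<in> bm X" for F
  proof -
    from bmE[OF that] obtain C where "\<And>x. \<bar>F x\<bar> \<le> C" by blast
    then have "norm (\<Sum>t\<in>T \<omega>. F t) \<le> norm (C * real (card (T \<omega>)))" for \<omega>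
      using bnd[of F C \<omega>] by simp
    then show ?thesis
      using meas[OF bm_measurable[OF that]]
      by (intro Bochner_Integration.integrable_bound[OF integrable_mult_right[OF int]]) auto
  qed
  then show "F \<in> bm X \<Longrightarrow> integrable M (\<lambda>\<omega>. \<Sum>t\<in>T \<omega>. F t)" .
  show "bpc_fun X (\<lambda>F. \<integral>\<omega>. (\<Sum>t\<in>T \<omega>. F t) \<partial>M)"
  proof (rule bpc_opI[where K="\<integral>\<omega>. real (card (T \<omega>)) \<partial>M"])
    fix F C assume *: "F \<in> bm X" "\<And>x. \<bar>F x\<bar> \<le> C"
    have "\<bar>\<integral>\<omega>. (\<Sum>t\<in>T \<omega>. F t) \<partial>M\<bar> \<le> (\<integral>\<omega>. \<bar>\<Sum>t\<in>T \<omega>. F t\<bar> \<partial>M)" by (rule integral_abs_bound)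
    also have "\<dots> \<le> (\<integral>\<omega>. C * real (card (T \<omega>)) \<partial>M)"
      using bnd[of F C] * by (intro integral_mono integrable_abs integ integrable_mult_right int) auto
    finally show "\<bar>\<integral>\<omega>. (\<Sum>t\<in>T \<omega>. F t) \<partial>M\<bar> \<le> (\<integral>\<omega>. real (card (T \<omega>)) \<partial>M) * C"
      by (simp add: mult.commute)
  next
    fix Fs F C assume *: "\<And>i. Fs i \<in> bm X" "F \<in> bm X" "\<And>i x. \<bar>Fs i x\<bar> \<le> C"
        "\<And>x. (\<lambda>i. Fs i x) \<longlonglongrightarrow> F x"
    show "(\<lambda>i. \<integral>\<omega>. (\<Sum>t\<in>T \<omega>. Fs i t) \<partial>M) \<longlonglongrightarrow> (\<integral>\<omega>. (\<Sum>t\<in>T \<omega>. F t) \<partial>M)"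
    proof (rule integral_dominated_convergence[where w="\<lambda>\<omega>. C * real (card (T \<omega>))"])
      show "AE \<omega> in M. (\<lambda>i. \<Sum>t\<in>T \<omega>. Fs i t) \<longlonglongrightarrow> (\<Sum>t\<in>T \<omega>. F t)"
        using *(4) by (intro AE_I2 tendsto_sum) auto
      show "AE \<omega> in M. norm (\<Sum>t\<in>T \<omega>. Fs i t) \<le> C * real (card (T \<omega>))" for i
        using bnd[OF *(3)] by auto
      show "(\<lambda>\<omega>. \<Sum>t\<in>T \<omega>. F t) \<in> borel_measurable M"
        "(\<lambda>\<omega>. \<Sum>t\<in>T \<omega>. Fs i t) \<in> borel_measurable M" for i
        by (intro meas bm_measurable *)+
    qed (intro integrable_mult_right int)
  next
    fix F G assume "F \<in> bm X" "G \<in> bm X"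
    then show "(\<integral>\<omega>. (\<Sum>t\<in>T \<omega>. F t + G t) \<partial>M) =
        (\<integral>\<omega>. (\<Sum>t\<in>T \<omega>. F t) \<partial>M) + (\<integral>\<omega>. (\<Sum>t\<in>T \<omega>. G t) \<partial>M)"
      unfolding sum.distrib by (intro Bochner_Integration.integral_add integ)
  qed (simp_all add: sum_distrib_left[symmetric])
qed

subsection \<open>Sums over partitions of small sets\<close>

text \<open>A partition of \<open>insert a A\<close> arises in exactly one way from a partition of
  \<open>A\<close>, by making \<open>a\<close> a block of its own or by joining it to a block
  \<open>K\<close>. Both cases are treated together by letting \<open>K\<close> range over
  \<open>insert {} P\<close>.\<close>

lemma sum_partition_on_insert:
  fixes \<Phi> :: "'b set set \<Rightarrow> 'c::comm_monoid_add"
  assumes A: "finite A" "a \<notin> A"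
  shows "(\<Sum>Q | partition_on (insert a A) Q. \<Phi> Q) =
    (\<Sum>P | partition_on A P. \<Phi> (insert {a} P) + (\<Sum>K\<in>P. \<Phi> (insert (insert a K) (P - {K}))))"
proof -
  have fin: "finite P" if "partition_on A P" for P
    by (rule finite_elements[OF A(1) that])
  have ne: "{} \<notin> P" if "partition_on A P" for P
    using that by (simp add: partition_on_def)
  have "(\<Sum>P | partition_on A P. \<Phi> (insert {a} P) + (\<Sum>K\<in>P. \<Phi> (insert (insert a K) (P - {K})))) =
      (\<Sum>P | partition_on A P. \<Sum>K\<in>insert {} P. \<Phi> (insert (insert a K) (P - {K})))"
    using ne fin by (intro sum.cong refl) simp
  also have "\<dots> = (\<Sum>(P, K)\<in>(SIGMA P:{P. partition_on A P}. insert {} P). \<Phi> (insert (insert a K) (P - {K})))"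
  proof -
    have 1: "finite {P. partition_on A P}" by (rule finitely_many_partition_on[OF A(1)])
    have 2: "\<forall>P\<in>{P. partition_on A P}. finite (insert {} P)" using fin by blast
    show ?thesis by (rule sum.Sigma[OF 1 2])
  qed
  also have "\<dots> = (\<Sum>Q | partition_on (insert a A) Q. \<Phi> Q)"
  \<comment> \<open>The inverse map deletes \<open>a\<close> from every block and drops an empty
    block that may result; what remains of the block of \<open>a\<close> is the second component,
    empty when \<open>{a}\<close> was a block.\<close>
  proof (rule sum.reindex_bij_witness[where
        i="\<lambda>Q. ((\<lambda>B. B - {a}) ` Q - {{}}, \<Union>{B \<in> Q. a \<in> B} - {a})" and
        j="\<lambda>(P, K). insert (insert a K) (P - {K})"])
    fix p assume p: "p \<in> (SIGMA P:{P. partition_on A P}. insert {} P)"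
    obtain P K where pk: "p = (P, K)" "partition_on A P" "K \<in> insert {} P"
      using p by auto
    have aP: "a \<notin> B" if "B \<in> P" for B
      using that pk(2) A by (auto simp: partition_on_def)
    have aK: "a \<notin> K" using pk(3) aP by auto
    have im: "(\<lambda>B. B - {a}) ` (P - {K}) = P - {K}"
    proof -
      have "B - {a} = B" if "B \<in> P - {K}" for B using aP that by auto
      then show ?thesis by simp
    qed
    have "(\<lambda>B. B - {a}) ` insert (insert a K) (P - {K}) - {{}} = P"
    proof -
      have "insert a K - {a} = K" using aK by auto
      then have "(\<lambda>B. B - {a}) ` insert (insert a K) (P - {K}) = insert K (P - {K})" by (simp only: image_insert im)
      then show ?thesis using ne[OF pk(2)] pk(3) by auto
    qed
    moreover have "{B \<in> insert (insert a K) (P - {K}). a \<in> B} = {insert a K}"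
      using aP by auto
    ultimately show "((\<lambda>B. B - {a}) ` (case p of (P, K) \<Rightarrow> insert (insert a K) (P - {K})) - {{}},
        \<Union>{B \<in> (case p of (P, K) \<Rightarrow> insert (insert a K) (P - {K})). a \<in> B} - {a}) = p"
      using pk aK by simp
    show "(case p of (P, K) \<Rightarrow> insert (insert a K) (P - {K})) \<in> {Q. partition_on (insert a A) Q}"
    proof -
      have "\<Union>(insert (insert a K) (P - {K})) = insert a A"
        using pk(2,3) by (auto simp: partition_on_def)
      moreover have "disjoint (insert (insert a K) (P - {K}))"
        using pk(2,3) aP by (auto simp: partition_on_def disjoint_def)
      moreover have "{} \<notin> insert (insert a K) (P - {K})" using ne[OF pk(2)] by auto
      ultimately show ?thesis using pk by (simp add: partition_on_def)
    qed
    show "\<Phi> (case p of (P, K) \<Rightarrow> insert (insert a K) (P - {K})) =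
        (case p of (P, K) \<Rightarrow> \<Phi> (insert (insert a K) (P - {K})))" by (simp add: pk)
  next
    fix Q assume "Q \<in> {Q. partition_on (insert a A) Q}"
    then have Q: "\<Union>Q = insert a A" "disjoint Q" "{} \<notin> Q" by (auto simp: partition_on_def)
    then obtain B where B: "B \<in> Q" "a \<in> B" by blast
    have uniq: "C = B" if "C \<in> Q" "a \<in> C" for C
      using that B Q(2) by (auto simp: disjoint_def)
    have QB: "{C \<in> Q. a \<in> C} = {B}" using B uniq by blast
    define K where "K = B - {a}"
    have iK: "insert a K = B" using B by (auto simp: K_def)
    have KQ: "K \<notin> Q - {B}"
    proof
      assume k: "K \<in> Q - {B}"
      then have "K \<inter> B = {}" using B Q(2) by (auto simp: disjoint_def)
      then have "K = {}" by (auto simp: K_def)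
      then show False using k Q(3) by auto
    qed
    have im: "(\<lambda>C. C - {a}) ` Q = insert K (Q - {B})"
    proof -
      have "C - {a} = C" if "C \<in> Q - {B}" for C using uniq that by blast
      then have "(\<lambda>C. C - {a}) ` (Q - {B}) = Q - {B}" by simp
      moreover have "(\<lambda>C. C - {a}) ` Q = (\<lambda>C. C - {a}) ` insert B (Q - {B})"
        using B by (simp add: insert_absorb)
      ultimately show ?thesis by (simp only: image_insert K_def)
    qed
    have P: "(\<lambda>C. C - {a}) ` Q - {{}} - {K} = Q - {B}" using im KQ Q(3) by auto
    show "(case ((\<lambda>B. B - {a}) ` Q - {{}}, \<Union>{B \<in> Q. a \<in> B} - {a}) of
        (P, K) \<Rightarrow> insert (insert a K) (P - {K})) = Q"
      using B by (simp add: QB K_def[symmetric] P iK insert_absorb)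
    have "partition_on A ((\<lambda>C. C - {a}) ` Q - {{}})"
    proof -
      have "\<Union>(S - {{}}) = \<Union>S" for S :: "'b set set" by auto
      then have "\<Union>((\<lambda>C. C - {a}) ` Q - {{}}) = \<Union>Q - {a}" by simp
      then have "\<Union>((\<lambda>C. C - {a}) ` Q - {{}}) = A" using Q(1) A by simp
      moreover have "disjoint ((\<lambda>C. C - {a}) ` Q - {{}})"
        using Q(2) by (auto simp: disjoint_def)
      ultimately show ?thesis by (auto simp: partition_on_def)
    qed
    moreover have "K \<in> insert {} ((\<lambda>C. C - {a}) ` Q - {{}})" using im by auto
    ultimately show "((\<lambda>B. B - {a}) ` Q - {{}}, \<Union>{B \<in> Q. a \<in> B} - {a}) \<in>
        (SIGMA P:{P. partition_on A P}. insert {} P)"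
      by (simp add: QB K_def[symmetric])
  qed
  finally show ?thesis by simp
qed

lemma sum_partition_on_empty:
  fixes \<Phi> :: "'b set set \<Rightarrow> 'c::comm_monoid_add"
  shows "(\<Sum>Q | partition_on {} Q. \<Phi> Q) = \<Phi> {}"
proof -
  have "{Q. partition_on {} Q} = {{} :: 'b set set}" by (auto simp: partition_on_def)
  then show ?thesis by simp
qed

text \<open>Undoes the grouping by the number of blocks, so that the recursion
  \<open>sum_partition_on_insert\<close> over all partitions applies.\<close>

lemma fact_cumulant_altdef:
  assumes "1 \<le> k"
  shows "fact_cumulant M N k A = (\<Sum>P | partition_on {1..k} P.
    (-1) ^ (card P - 1) * fact (card P - 1) * (\<Prod>K\<in>P. enn2real (fact_moment M N K A)))"
proof -
  have fin: "finite {P. partition_on {1..k} P}" by (rule finitely_many_partition_on) simp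
  have c: "card P \<in> {1..k}" if "partition_on {1..k} P" for P
  proof -
    have K: "finite K \<and> K \<noteq> {}" if "K \<in> P" for K
      using \<open>partition_on {1..k} P\<close> that finite_subset[of K "{1..k}"] by (auto simp: partition_on_def)
    then have "card {1..k} = (\<Sum>K\<in>P. card K)" using product_partition[OF that] by blast
    moreover have "(\<Sum>K\<in>P. 1) \<le> (\<Sum>K\<in>P. card K)"
      using K by (intro sum_mono) (simp add: Suc_le_eq card_gt_0_iff)
    ultimately have "card P \<le> k" by simp
    moreover have "P \<noteq> {}" using that assms by (auto simp: partition_on_def)
    moreover have "finite P" using that finite_elements[of "{1..k}" P] by simp
    ultimately show ?thesis by (auto simp: Suc_le_eq card_gt_0_iff)
  qed
  have "fact_cumulant M N k A = (\<Sum>j=1..k. \<Sum>P | partition_on {1..k} P \<and> card P = j.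
    (-1) ^ (card P - 1) * fact (card P - 1) * (\<Prod>K\<in>P. enn2real (fact_moment M N K A)))"
    unfolding fact_cumulant_def sum_distrib_left by (intro sum.cong) auto
  also have "\<dots> = (\<Sum>P | partition_on {1..k} P.
    (-1) ^ (card P - 1) * fact (card P - 1) * (\<Prod>K\<in>P. enn2real (fact_moment M N K A)))"
    by (subst sum.group[OF fin, of "{1..k}" card, symmetric]) (use c in \<open>auto simp: conj_commute\<close>)
  finally show ?thesis .
qed

text \<open>Lets the simplifier decide whether two explicitly listed blocks coincide.\<close>

lemma insert_eq_insert_iff:
  "insert a A = insert b B \<longleftrightarrow> insert a A \<subseteq> insert b B \<and> insert b B \<subseteq> insert a A"
  by auto

lemma atLeastAtMost_eqs:
  "{1..2::nat} = {1, 2}" "{1..3::nat} = {1, 2, 3}" "{1..4::nat} = {1, 2, 3, 4}"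
  by auto

lemma sum_partition_on_2:
  fixes \<Phi> :: "nat set set \<Rightarrow> real"
  shows "(\<Sum>P | partition_on {2, 3} P. \<Phi> P) = \<Phi> {{2}, {3}} + \<Phi> {{2, 3}}"
  by (simp add: sum_partition_on_insert sum_partition_on_empty)

lemma sum_partition_on_3:
  fixes \<Phi> :: "nat set set \<Rightarrow> real"
  shows "(\<Sum>P | partition_on {2, 3, 4} P. \<Phi> P) =
      \<Phi> {{2}, {3}, {4}} + \<Phi> {{2}, {3, 4}} + (\<Phi> {{2, 3}, {4}} + \<Phi> {{2, 4}, {3}}) + \<Phi> {{2, 3, 4}}"
  by (simp add: sum_partition_on_insert sum_partition_on_empty insert_Diff_if insert_eq_insert_iff)

context
  fixes M :: "'w measure" and N :: "'w \<Rightarrow> 'a::euclidean_space set" and A :: "nat \<Rightarrow> 'a set"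
    and m :: "nat set \<Rightarrow> real"
  assumes m: "m = (\<lambda>K. enn2real (fact_moment M N K A))"
begin

lemma fact_cumulant_2: "fact_cumulant M N 2 A = m {1, 2} - m {1} * m {2}"
  by (simp add: fact_cumulant_altdef atLeastAtMost_eqs[unfolded One_nat_def] m sum_partition_on_insert
      sum_partition_on_empty insert_Diff_if insert_eq_insert_iff)

lemma fact_cumulant_3: "fact_cumulant M N 3 A =
    m {1, 2, 3} - (m {1, 2} * m {3} + m {1, 3} * m {2} + m {2, 3} * m {1}) + 2 * m {1} * m {2} * m {3}"
proof -
  have 1: "{1..3} = insert 1 {2, 3::nat}" by auto
  have "fact_cumulant M N 3 A = (\<Sum>P | partition_on (insert 1 {2, 3}) P.
      (-1) ^ (card P - 1) * fact (card P - 1) * (\<Prod>K\<in>P. m K))"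
    unfolding 1[symmetric] m by (rule fact_cumulant_altdef) simp
  then show ?thesis
    by (simp add: sum_partition_on_insert[of "{2, 3}"] sum_partition_on_2 insert_Diff_if insert_eq_insert_iff)
qed

text \<open>The 15 partitions of four indices: one with a single block, 4 + 3 with two blocks, six
  with three and one with four, weighted by 1, -1, 2 and -6.\<close>

lemma fact_cumulant_4: "fact_cumulant M N 4 A =
    m {1, 2, 3, 4} - (m {1, 2, 3} * m {4} + m {1, 2, 4} * m {3} + m {1, 3, 4} * m {2} + m {2, 3, 4} * m {1})
    - (m {1, 2} * m {3, 4} + m {1, 3} * m {2, 4} + m {1, 4} * m {2, 3})
    + 2 * (m {1, 2} * m {3} * m {4} + m {1, 3} * m {2} * m {4} + m {1, 4} * m {2} * m {3}
         + m {2, 3} * m {1} * m {4} + m {2, 4} * m {1} * m {3} + m {3, 4} * m {1} * m {2})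
    - 6 * m {1} * m {2} * m {3} * m {4}"
proof -
  have 1: "{1..4} = insert 1 {2, 3, 4::nat}" by auto
  have "fact_cumulant M N 4 A = (\<Sum>P | partition_on (insert 1 {2, 3, 4}) P.
      (-1) ^ (card P - 1) * fact (card P - 1) * (\<Prod>K\<in>P. m K))"
    unfolding 1[symmetric] m by (rule fact_cumulant_altdef) simp
  then show ?thesis
    by (simp add: sum_partition_on_insert[of "{2, 3, 4}"] sum_partition_on_3 insert_Diff_if
        insert_eq_insert_iff fact_numeral)
qed

end

subsection \<open>Factorial moments of rectangles\<close>

definition inj_card :: "nat set \<Rightarrow> (nat \<Rightarrow> 'a set) \<Rightarrow> nat" where
  "inj_card K B = card {t \<in> Pi\<^sub>E K B. inj_on t K}"

lemma inj_card_empty: "inj_card {} B = 1"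
  by (simp add: inj_card_def)

text \<open>Choosing the value \<open>x\<close> at \<open>i\<close> first leaves the injective
  tuples over \<open>K\<close> that avoid \<open>x\<close>. The sides of the remaining box shrink to
  \<open>B l - {x}\<close>, which is why they are allowed to differ from index to index.\<close>

lemma inj_card_insert:
  assumes K: "finite K" "i \<notin> K" and B: "\<And>l. finite (B l)"
  shows "inj_card (insert i K) B = (\<Sum>x\<in>B i. inj_card K (\<lambda>l. B l - {x}))"
proof -
  let ?S = "SIGMA x:B i. {t \<in> Pi\<^sub>E K (\<lambda>l. B l - {x}). inj_on t K}"
  have "bij_betw (\<lambda>(x, t). t(i := x)) ?S {t \<in> Pi\<^sub>E (insert i K) B. inj_on t (insert i K)}"
  proof (rule bij_betw_byWitness[where f'="\<lambda>t. (t i, t(i := undefined))"])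
    show "\<forall>a\<in>?S. ((case a of (x, t) \<Rightarrow> t(i := x)) i, (case a of (x, t) \<Rightarrow> t(i := x))(i := undefined)) = a"
      using K by (auto simp: PiE_def extensional_def fun_eq_iff)
    show "\<forall>a'\<in>{t \<in> Pi\<^sub>E (insert i K) B. inj_on t (insert i K)}.
       (case (a' i, a'(i := undefined)) of (x, t) \<Rightarrow> t(i := x)) = a'"
      by auto
    show "(\<lambda>(x, t). t(i := x)) ` ?S \<subseteq> {t \<in> Pi\<^sub>E (insert i K) B. inj_on t (insert i K)}"
    proof clarify
      fix x t assume *: "x \<in> B i" "t \<in> Pi\<^sub>E K (\<lambda>l. B l - {x})" "inj_on t K"
      then have "t(i := x) \<in> Pi\<^sub>E (insert i K) B" using K by (auto simp: PiE_def extensional_def)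
      moreover have "inj_on (t(i := x)) (insert i K)"
        using * K by (auto simp: inj_on_def PiE_def Pi_def)
      ultimately show "t(i := x) \<in> Pi\<^sub>E (insert i K) B \<and> inj_on (t(i := x)) (insert i K)" ..
    qed
    show "(\<lambda>t. (t i, t(i := undefined))) ` {t \<in> Pi\<^sub>E (insert i K) B. inj_on t (insert i K)} \<subseteq> ?S"
    proof (rule image_subsetI)
      fix t assume "t \<in> {t \<in> Pi\<^sub>E (insert i K) B. inj_on t (insert i K)}"
      then have *: "t \<in> Pi\<^sub>E (insert i K) B" "inj_on t (insert i K)" by auto
      have "t l \<noteq> t i" if "l \<in> K" for l using *(2) K(2) that unfolding inj_on_def by auto
      then have "t(i := undefined) \<in> Pi\<^sub>E K (\<lambda>l. B l - {t i})"
        using * K by (auto simp: PiE_def extensional_def Pi_def)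
      moreover have "inj_on (t(i := undefined)) K"
        using *(2) K(2) by (auto simp: inj_on_def)
      ultimately show "(t i, t(i := undefined)) \<in> ?S"
        using * by auto
    qed
  qed
  then have "card {t \<in> Pi\<^sub>E (insert i K) B. inj_on t (insert i K)} = card ?S"
    by (rule bij_betw_same_card[symmetric])
  also have "\<dots> = (\<Sum>x\<in>B i. card {t \<in> Pi\<^sub>E K (\<lambda>l. B l - {x}). inj_on t K})"
  proof (rule card_SigmaI[OF B], rule ballI)
    fix x
    have "finite (Pi\<^sub>E K (\<lambda>l. B l - {x}))" using K B by (intro finite_PiE) auto
    then show "finite {t \<in> Pi\<^sub>E K (\<lambda>l. B l - {x}). inj_on t K}" by simp
  qed
  finally show ?thesis by (simp add: inj_card_def)
qed

lemma Diff_Diff_Un: "A - B - C = A - (B \<union> C)"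
  by auto

lemma sum_Int_Diff_real:
  fixes g :: "'a \<Rightarrow> real"
  assumes "finite S"
  shows "(\<Sum>x\<in>S \<inter> B. g x) = (\<Sum>x\<in>S. indicator B x * g x)"
    and "(\<Sum>x\<in>S \<inter> B - C. g x) = (\<Sum>x\<in>S. indicator B x * indicator (- C) x * g x)"
  using sum.inter_restrict[OF assms, of g B] sum.inter_restrict[OF assms, of g "B - C"]
  by (auto simp: Int_Diff indicator_def intro!: sum.cong)

lemma inj_card_2:
  assumes S: "finite S" and ij: "distinct [i, j]"
  shows "real (inj_card {i, j} (\<lambda>l. S \<inter> A l)) =
    (\<Sum>x\<in>S. \<Sum>y\<in>S. if x \<noteq> y then indicator (A i \<times> A j) (x, y) else 0)"
proof -
  have "real (inj_card {i, j} (\<lambda>l. S \<inter> A l)) =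
      (\<Sum>x\<in>S \<inter> A i. \<Sum>y\<in>S \<inter> A j - {x}. 1)"
    using S ij by (simp add: inj_card_insert inj_card_empty del: sum_constant)
  then show ?thesis
    by (simp only: sum_Int_Diff_real[OF S] sum_distrib_left)
       (intro sum.cong refl, auto simp: indicator_def)
qed

lemma inj_card_3:
  assumes S: "finite S" and ij: "distinct [i, j, k]"
  shows "real (inj_card {i, j, k} (\<lambda>l. S \<inter> A l)) =
    (\<Sum>x\<in>S. \<Sum>y\<in>S. \<Sum>z\<in>S. if distinct [x, y, z] then indicator (A i \<times> A j \<times> A k) (x, y, z) else 0)"
proof -
  have "real (inj_card {i, j, k} (\<lambda>l. S \<inter> A l)) =
      (\<Sum>x\<in>S \<inter> A i. \<Sum>y\<in>S \<inter> A j - {x}. \<Sum>z\<in>S \<inter> A k - ({x} \<union> {y}). 1)"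
    using S ij by (simp add: inj_card_insert inj_card_empty Diff_Diff_Un insert_commute del: sum_constant)
  then show ?thesis
    by (simp only: sum_Int_Diff_real[OF S] sum_distrib_left)
       (intro sum.cong refl, auto simp: indicator_def)
qed

lemma inj_card_4:
  assumes S: "finite S" and ij: "distinct [i, j, k, l]"
  shows "real (inj_card {i, j, k, l} (\<lambda>l. S \<inter> A l)) =
    (\<Sum>x\<in>S. \<Sum>y\<in>S. \<Sum>z\<in>S. \<Sum>u\<in>S. if distinct [x, y, z, u]
       then indicator (A i \<times> A j \<times> A k \<times> A l) (x, y, z, u) else 0)"
proof -
  have "real (inj_card {i, j, k, l} (\<lambda>l. S \<inter> A l)) =
      (\<Sum>x\<in>S \<inter> A i. \<Sum>y\<in>S \<inter> A j - {x}. \<Sum>z\<in>S \<inter> A k - ({x} \<union> {y}). \<Sum>u\<in>S \<inter> A l - ({x} \<union> {y} \<union> {z}). 1)"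
    using S ij by (simp add: inj_card_insert inj_card_empty Diff_Diff_Un insert_commute del: sum_constant)
  then show ?thesis
    by (simp only: sum_Int_Diff_real[OF S] sum_distrib_left)
       (intro sum.cong refl, auto simp: indicator_def)
qed

subsection \<open>Moments and intensity\<close>

lemma sets_unit_cube [measurable]: "(unit_cube :: 'a::euclidean_space set) \<in> sets borel"
proof -
  have "(unit_cube :: 'a set) = (\<Inter>e\<in>Basis. {x. 0 \<le> x \<bullet> e} \<inter> {x. x \<bullet> e < 1})"
    by (auto simp: unit_cube_def)
  also have "\<dots> \<in> sets borel"
    by (intro sets.finite_INT sets.Int borel_closed borel_open closed_Collect_le open_Collect_less)
       (auto intro: continuous_intros)
  finally show ?thesis .
qed

lemma box_subset_unit_cube: "box 0 One \<subseteq> (unit_cube :: 'a::euclidean_space set)"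
  and unit_cube_subset_cbox: "(unit_cube :: 'a::euclidean_space set) \<subseteq> cbox 0 One"
  by (auto simp: unit_cube_def box_def cbox_def inner_sum_left inner_Basis if_distrib cong: if_cong
      intro: less_imp_le)

lemma bounded_unit_cube: "bounded (unit_cube :: 'a::euclidean_space set)"
  using unit_cube_subset_cbox bounded_cbox bounded_subset by blast

lemma measure_unit_cube: "emeasure lborel (unit_cube :: 'a::euclidean_space set) = 1"
proof (rule antisym)
  have "emeasure lborel (unit_cube :: 'a set) \<le> emeasure lborel (cbox 0 One :: 'a set)"
    by (rule emeasure_mono[OF unit_cube_subset_cbox]) simp
  then show "emeasure lborel (unit_cube :: 'a set) \<le> 1" by (simp add: emeasure_lborel_cbox_eq)
  have "emeasure lborel (box 0 One :: 'a set) \<le> emeasure lborel (unit_cube :: 'a set)"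
    by (rule emeasure_mono[OF box_subset_unit_cube]) simp
  then show "1 \<le> emeasure lborel (unit_cube :: 'a set)" by (simp add: emeasure_lborel_box_eq)
qed

text \<open>Stationarity controls the counts in translates of the unit cube; through a finite cover
  this control reaches every bounded set. Compactness is applied with open boxes, which are then
  enlarged to the half-open cubes.\<close>

lemma cover_unit_cubes:
  fixes A :: "'a::euclidean_space set"
  assumes "bounded A"
  obtains F where "finite F" "A \<subseteq> (\<Union>x\<in>F. (\<lambda>y. y + x) ` unit_cube)"
proof -
  have "compact (closure A)" using assms by simp
  moreover have "open ((\<lambda>y. y + x) ` box (0::'a) One)" for x
    using open_translation[OF open_box, of x 0 One] by (simp add: add.commute[of _ x])
  moreover have "closure A \<subseteq> (\<Union>x\<in>UNIV. (\<lambda>y. y + x) ` box (0::'a) One)"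
  proof
    fix a :: 'a
    \<comment> \<open>The centre of the box; shifting the box by
      \<open>a - (1/2) *\<^sub>R One\<close> moves its centre to \<open>a\<close>.\<close>
    have "(1/2) *\<^sub>R One \<in> box (0::'a) One" by (simp add: box_def inner_sum_left inner_Basis if_distrib cong: if_cong)
    then show "a \<in> (\<Union>x\<in>UNIV. (\<lambda>y. y + x) ` box (0::'a) One)"
      by (intro UN_I[of "a - (1/2) *\<^sub>R One"] image_eqI[of _ _ "(1/2) *\<^sub>R One"]) auto
  qed
  ultimately obtain F where F: "finite F" "closure A \<subseteq> (\<Union>x\<in>F. (\<lambda>y. y + x) ` box (0::'a) One)"
    by (rule compactE_image[of "closure A" UNIV "\<lambda>x. (\<lambda>y. y + x) ` box (0::'a) One"]) auto
  have "(\<Union>x\<in>F. (\<lambda>y. y + x) ` box (0::'a) One) \<subseteq> (\<Union>x\<in>F. (\<lambda>y. y + x) ` unit_cube)"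
    using box_subset_unit_cube by (intro UN_mono image_mono) auto
  then have "A \<subseteq> (\<Union>x\<in>F. (\<lambda>y. y + x) ` unit_cube)"
    by (rule order_trans[OF order_trans[OF closure_subset F(2)]])
  then show ?thesis by (rule that[OF F(1)])
qed

lemma borel_translate: "A \<in> sets borel \<Longrightarrow> (\<lambda>y. y + x) ` A \<in> sets (borel :: 'a::euclidean_space measure)"
proof -
  assume A: "A \<in> sets borel"
  have "(\<lambda>y. y + x) ` A = (\<lambda>y. y - x) -` A \<inter> space borel"
    by (auto simp: image_iff intro!: bexI[of _ "_ - x"])
  also have "\<dots> \<in> sets borel" by (rule measurable_sets[OF _ A]) measurable
  finally show ?thesis .
qed

lemma bounded_translate: "bounded A \<Longrightarrow> bounded ((\<lambda>y. y + x) ` (A :: 'a::euclidean_space set))"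
  using bounded_translation[of A x] by (simp add: add.commute)

text \<open>Finiteness is assumed for the ordinary fourth moment, stationarity for factorial
  moments; this inequality leads from the latter back to the former. For \<open>c \<ge> 4\<close>
  the smallest factor \<open>c - 3\<close> is at least a quarter of \<open>c\<close>, for smaller
  \<open>c\<close> the constant 256 dominates.\<close>

lemma pow4_le_falling:
  fixes c :: nat
  shows "c ^ 4 \<le> 64 * (c * (c - 1) * (c - 2) * (c - 3)) + 256"
proof (cases "c \<ge> 4")
  case True
  then obtain k where k: "c = k + 4" by (metis le_add_diff_inverse2)
  show ?thesis unfolding k by (simp add: power4_eq_xxxx algebra_simps)
next
  case False
  then have "c \<in> {0, 1, 2, 3}" by auto
  then show ?thesis by auto
qed

text \<open>The truncated differences do no harm: with fewer than four points one of the factors is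
  0, and so is the number of injective quadruples.\<close>

lemma inj_card_falling:
  assumes "finite B"
  shows "inj_card {1..4} (\<lambda>_. B) = card B * (card B - 1) * (card B - 2) * (card B - 3)"
proof -
  have "inj_card {1..4} (\<lambda>_. B) = (\<Sum>x\<in>B. \<Sum>y\<in>B - {x}. \<Sum>z\<in>B - {x} - {y}. card (B - {x} - {y} - {z}))"
    using assms unfolding atLeastAtMost_eqs by (simp add: inj_card_insert inj_card_empty)
  also have "\<dots> = (\<Sum>x\<in>B. \<Sum>y\<in>B - {x}. \<Sum>z\<in>B - {x} - {y}. card B - 3)"
    using assms by (intro sum.cong refl) (auto simp: card_Diff_singleton)
  also have "\<dots> = (\<Sum>x\<in>B. \<Sum>y\<in>B - {x}. (card B - 2) * (card B - 3))"
    using assms by (intro sum.cong refl) (auto simp: card_Diff_singleton)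
  also have "\<dots> = (\<Sum>x\<in>B. (card B - 1) * ((card B - 2) * (card B - 3)))"
    using assms by (intro sum.cong refl) (auto simp: card_Diff_singleton)
  finally show ?thesis by simp
qed

lemma emeasure_inj_PiE:
  assumes "finite K" "\<And>l. finite (B l)"
  shows "emeasure (count_space UNIV) {t \<in> Pi\<^sub>E K B. inj_on t K} = ennreal (real (inj_card K B))"
proof -
  have "finite {t \<in> Pi\<^sub>E K B. inj_on t K}" using assms by (simp add: finite_PiE)
  then show ?thesis by (simp add: inj_card_def emeasure_count_space ennreal_of_nat_eq_real_of_nat)
qed

section \<open>Fourth moments of counts and the intensity measure\<close>

locale b4_process = prob_space M for M :: "'w measure" +
  fixes N :: "'w \<Rightarrow> 'a::euclidean_space set" and \<gamma> :: "nat \<Rightarrow> (nat \<Rightarrow> 'a) signed"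
  assumes pp: "point_process M N" and B4: "B4_mixing M N \<gamma>"
begin

abbreviation "lam \<equiv> intensity M N"

lemma N_measurable [measurable]: "N \<in> M \<rightarrow>\<^sub>M config_space"
  using pp by (simp add: point_process_def)

lemma finite_N: "\<omega> \<in> space M \<Longrightarrow> bounded A \<Longrightarrow> finite (N \<omega> \<inter> A)"
  by (rule config_finite[OF N_measurable])

lemma card_measurable: "A \<in> sets borel \<Longrightarrow> bounded A \<Longrightarrow> (\<lambda>\<omega>. real (card (N \<omega> \<inter> A))) \<in> borel_measurable M"
  by (rule measurable_compose[OF N_measurable measurable_card_config])

lemma fact_moment_inj_card:
  assumes "finite K" "\<And>l. bounded (A l)"
  shows "fact_moment M N K A = (\<integral>\<^sup>+\<omega>. ennreal (real (inj_card K (\<lambda>l. N \<omega> \<inter> A l))) \<partial>M)"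
  unfolding fact_moment_def
  by (intro nn_integral_cong emeasure_inj_PiE assms finite_N)

lemma stationary:
  assumes "j \<in> {1..4}" "\<And>l. A l \<in> sets borel"
  shows "fact_moment M N {1..j} (\<lambda>l. (\<lambda>y. y + x) ` A l) = fact_moment M N {1..j} A"
  using B4 assms by (simp add: B4_mixing_def stationary_of_order_def)

text \<open>Translation invariance is available for factorial moments only. The fourth moment at the
  unit cube bounds the factorial one there, which is carried over to the translate and converted
  back by \<open>pow4_le_falling\<close>.\<close>

lemma integrable_pow4_cube:
  "integrable M (\<lambda>\<omega>. real (card (N \<omega> \<inter> (\<lambda>y. y + x) ` unit_cube)) ^ 4)"
proof (rule integrableI_nonneg)
  let ?Q = "unit_cube :: 'a set" and ?T = "(\<lambda>y. y + x) ` unit_cube :: 'a set"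
  have T: "?T \<in> sets borel" "bounded ?T"
    by (auto intro: borel_translate bounded_translate bounded_unit_cube)
  show "(\<lambda>\<omega>. real (card (N \<omega> \<inter> ?T)) ^ 4) \<in> borel_measurable M"
    using card_measurable[OF T] by measurable
  have "fact_moment M N {1..4} (\<lambda>l. ?T) = fact_moment M N {1..4} (\<lambda>l. ?Q)"
    by (rule stationary) auto
  also have "\<dots> = (\<integral>\<^sup>+\<omega>. ennreal (real (inj_card {1..4} (\<lambda>l. N \<omega> \<inter> ?Q))) \<partial>M)"
    by (rule fact_moment_inj_card) (auto intro: bounded_unit_cube)
  also have "\<dots> \<le> (\<integral>\<^sup>+\<omega>. ennreal (real (card (N \<omega> \<inter> ?Q)) ^ 4) \<partial>M)"
  proof (rule nn_integral_mono)
    fix \<omega> assume "\<omega> \<in> space M"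
    then have "inj_card {1..4} (\<lambda>l. N \<omega> \<inter> ?Q) = card (N \<omega> \<inter> ?Q) * (card (N \<omega> \<inter> ?Q) - 1) * (card (N \<omega> \<inter> ?Q) - 2) * (card (N \<omega> \<inter> ?Q) - 3)"
      by (intro inj_card_falling finite_N bounded_unit_cube)
    also have "\<dots> \<le> card (N \<omega> \<inter> ?Q) ^ 4"
      unfolding power4_eq_xxxx by (intro mult_mono) auto
    finally show "ennreal (real (inj_card {1..4} (\<lambda>l. N \<omega> \<inter> ?Q))) \<le> ennreal (real (card (N \<omega> \<inter> ?Q)) ^ 4)"
      unfolding of_nat_power[symmetric] by (intro ennreal_leI) (simp only: of_nat_le_iff)
  qed
  also have "\<dots> < \<infinity>"
    using B4 by (simp add: B4_mixing_def stationary_of_order_def)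
  finally have fin: "fact_moment M N {1..4} (\<lambda>l. ?T) < \<infinity>" .
  have "(\<integral>\<^sup>+\<omega>. ennreal (real (card (N \<omega> \<inter> ?T)) ^ 4) \<partial>M) \<le>
      (\<integral>\<^sup>+\<omega>. 64 * ennreal (real (inj_card {1..4} (\<lambda>l. N \<omega> \<inter> ?T))) + 256 \<partial>M)"
  proof (rule nn_integral_mono)
    fix \<omega> assume "\<omega> \<in> space M"
    then have "inj_card {1..4} (\<lambda>l. N \<omega> \<inter> ?T) = card (N \<omega> \<inter> ?T) * (card (N \<omega> \<inter> ?T) - 1) * (card (N \<omega> \<inter> ?T) - 2) * (card (N \<omega> \<inter> ?T) - 3)"
      by (intro inj_card_falling finite_N T)
    then have "card (N \<omega> \<inter> ?T) ^ 4 \<le> 64 * inj_card {1..4} (\<lambda>l. N \<omega> \<inter> ?T) + 256"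
      using pow4_le_falling[of "card (N \<omega> \<inter> ?T)"] by (simp only:)
    then have "real (card (N \<omega> \<inter> ?T)) ^ 4 \<le> 64 * real (inj_card {1..4} (\<lambda>l. N \<omega> \<inter> ?T)) + 256"
      unfolding of_nat_le_iff[symmetric, where ?'a=real] by simp
    then have "ennreal (real (card (N \<omega> \<inter> ?T)) ^ 4) \<le> ennreal (64 * real (inj_card {1..4} (\<lambda>l. N \<omega> \<inter> ?T)) + 256)"
      by (rule ennreal_leI)
    also have "\<dots> = 64 * ennreal (real (inj_card {1..4} (\<lambda>l. N \<omega> \<inter> ?T))) + 256"
      by (simp add: ennreal_plus ennreal_mult)
    finally show "ennreal (real (card (N \<omega> \<inter> ?T)) ^ 4) \<le> 64 * ennreal (real (inj_card {1..4} (\<lambda>l. N \<omega> \<inter> ?T))) + 256" .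
  qed
  also have "\<dots> = 64 * fact_moment M N {1..4} (\<lambda>l. ?T) + 256"
  proof -
    have m: "(\<lambda>\<omega>. ennreal (real (inj_card {1..4} (\<lambda>l. N \<omega> \<inter> ?T)))) \<in> borel_measurable M"
    proof -
      have "(\<lambda>\<omega>. real (nat \<lfloor>real (card (N \<omega> \<inter> ?T))\<rfloor> * (nat \<lfloor>real (card (N \<omega> \<inter> ?T))\<rfloor> - 1) *
          (nat \<lfloor>real (card (N \<omega> \<inter> ?T))\<rfloor> - 2) * (nat \<lfloor>real (card (N \<omega> \<inter> ?T))\<rfloor> - 3))) \<in> borel_measurable M"
        by (rule measurable_compose[OF card_measurable[OF T]]) measurable
      also have "?this \<longleftrightarrow> (\<lambda>\<omega>. real (inj_card {1..4} (\<lambda>l. N \<omega> \<inter> ?T))) \<in> borel_measurable M"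
        by (intro measurable_cong) (subst inj_card_falling, auto intro!: finite_N T)
      finally show ?thesis by measurable
    qed
    show ?thesis
      by (subst nn_integral_add) (use m in \<open>auto simp: nn_integral_cmult fact_moment_inj_card T emeasure_space_1\<close>)
  qed
  also have "\<dots> < \<infinity>" using fin by (simp add: ennreal_mult_less_top less_top)
  finally show "(\<integral>\<^sup>+\<omega>. ennreal (real (card (N \<omega> \<inter> ?T)) ^ 4) \<partial>M) < \<infinity>" .
qed auto

lemma integrable_card_pow4:
  assumes A: "A \<in> sets borel" "bounded A"
  shows "integrable M (\<lambda>\<omega>. real (card (N \<omega> \<inter> A)) ^ 4)"
proof -
  obtain F where F: "finite F" "A \<subseteq> (\<Union>x\<in>F. (\<lambda>y. y + x) ` unit_cube)"
    using cover_unit_cubes[OF A(2)] by metis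
  let ?T = "\<lambda>x. (\<lambda>y. y + x) ` unit_cube :: 'a set"
  have T: "bounded (?T x)" for x by (intro bounded_translate bounded_unit_cube)
  have "integrable M (\<lambda>\<omega>. real (card F) ^ 4 * (\<Sum>x\<in>F. real (card (N \<omega> \<inter> ?T x)) ^ 4))"
    by (intro integrable_mult_right Bochner_Integration.integrable_sum integrable_pow4_cube)
  then show ?thesis
  proof (rule Bochner_Integration.integrable_bound)
    show "(\<lambda>\<omega>. real (card (N \<omega> \<inter> A)) ^ 4) \<in> borel_measurable M"
      using card_measurable[OF A] by measurable
    show "AE \<omega> in M. norm (real (card (N \<omega> \<inter> A)) ^ 4) \<le> norm (real (card F) ^ 4 * (\<Sum>x\<in>F. real (card (N \<omega> \<inter> ?T x)) ^ 4))"
    proof (rule AE_I2)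
      fix \<omega> assume w: "\<omega> \<in> space M"
      define S where "S = (\<Sum>x\<in>F. real (card (N \<omega> \<inter> ?T x)) ^ 4)"
      have S0: "0 \<le> S" unfolding S_def by (intro sum_nonneg) auto
      have fin: "finite (N \<omega> \<inter> ?T x)" for x by (rule finite_N[OF w T])
      have "card (N \<omega> \<inter> A) \<le> card (\<Union>x\<in>F. N \<omega> \<inter> ?T x)"
      proof (rule card_mono)
        show "finite (\<Union>x\<in>F. N \<omega> \<inter> ?T x)" using F(1) fin by blast
        show "N \<omega> \<inter> A \<subseteq> (\<Union>x\<in>F. N \<omega> \<inter> ?T x)" using F(2) by blast
      qed
      also have "\<dots> \<le> (\<Sum>x\<in>F. card (N \<omega> \<inter> ?T x))" by (rule card_UN_le[OF F(1)])
      finally have "real (card (N \<omega> \<inter> A)) \<le> (\<Sum>x\<in>F. real (card (N \<omega> \<inter> ?T x)))"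
        unfolding of_nat_le_iff[symmetric, where ?'a=real] by simp
      \<comment> \<open>Each count is at most the fourth root of the sum \<open>S\<close> of all
        fourth powers. This gives the power inequality for a sum of \<open>card F\<close> terms with
        constant \<open>card F ^ 4\<close>.\<close>
      also have "\<dots> \<le> (\<Sum>x\<in>F. root 4 S)"
      proof (rule sum_mono)
        fix x assume "x \<in> F"
        then have "real (card (N \<omega> \<inter> ?T x)) ^ 4 \<le> S"
          unfolding S_def using F(1) by (intro member_le_sum) auto
        then have "root 4 (real (card (N \<omega> \<inter> ?T x)) ^ 4) \<le> root 4 S" by simp
        then show "real (card (N \<omega> \<inter> ?T x)) \<le> root 4 S" by (simp add: real_root_power_cancel)
      qed
      finally have "real (card (N \<omega> \<inter> A)) ^ 4 \<le> (real (card F) * root 4 S) ^ 4"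
        by (intro power_mono) auto
      also have "\<dots> = real (card F) ^ 4 * S" using S0 by (simp add: power_mult_distrib)
      finally show "norm (real (card (N \<omega> \<inter> A)) ^ 4) \<le> norm (real (card F) ^ 4 * (\<Sum>x\<in>F. real (card (N \<omega> \<inter> ?T x)) ^ 4))"
        using S0 by (simp add: S_def)
    qed
  qed
qed

lemma integrable_card_pow:
  assumes A: "A \<in> sets borel" "bounded A" and k: "k \<le> 4"
  shows "integrable M (\<lambda>\<omega>. real (card (N \<omega> \<inter> A)) ^ k)"
proof (rule Bochner_Integration.integrable_bound)
  show "integrable M (\<lambda>\<omega>. 1 + real (card (N \<omega> \<inter> A)) ^ 4)"
    using integrable_card_pow4[OF A] by simp
  show "(\<lambda>\<omega>. real (card (N \<omega> \<inter> A)) ^ k) \<in> borel_measurable M"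
    using card_measurable[OF A] by measurable
  have "real c ^ k \<le> 1 + real c ^ 4" for c :: nat
  proof (cases "c = 0")
    case False
    then have "real c ^ k \<le> real c ^ 4" using k by (intro power_increasing) auto
    then show ?thesis by simp
  qed (simp add: power_0_left)
  then show "AE \<omega> in M. norm (real (card (N \<omega> \<inter> A)) ^ k) \<le> norm (1 + real (card (N \<omega> \<inter> A)) ^ 4)"
    by (intro AE_I2) simp
qed

lemma integrable_card:
  "A \<in> sets borel \<Longrightarrow> bounded A \<Longrightarrow> integrable M (\<lambda>\<omega>. real (card (N \<omega> \<inter> A)))"
  using integrable_card_pow[of A 1] by simp

lemma nn_card_translate:
  assumes A: "A \<in> sets borel" "bounded A"
  shows "(\<integral>\<^sup>+\<omega>. ennreal (real (card (N \<omega> \<inter> (\<lambda>y. y + x) ` A))) \<partial>M) = (\<integral>\<^sup>+\<omega>. ennreal (real (card (N \<omega> \<inter> A))) \<partial>M)"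
proof -
  have 1: "fact_moment M N {1..1} (\<lambda>l. B) = (\<integral>\<^sup>+\<omega>. ennreal (real (card (N \<omega> \<inter> B))) \<partial>M)" if "bounded B" for B
    unfolding fact_moment_inj_card[OF finite_atLeastAtMost that]
    by (intro nn_integral_cong) (simp add: inj_card_insert[where i="Suc 0"] inj_card_empty finite_N that)
  show ?thesis
    using stationary[of 1 "\<lambda>_. A" x] A unfolding 1[OF A(2)] 1[OF bounded_translate[OF A(2)]] by simp
qed

text \<open>The mean count is proportional to Lebesgue measure by a double averaging: the mean count
  of \<open>B\<close> equals that of each translate of \<open>B\<close>; averaging over shifts
  \<open>y\<close> in the unit cube, exchanging integrals and substituting \<open>z = x + y\<close>
  leaves the volume of \<open>B\<close> times the mean count of a reflected cube.\<close>

lemma nn_card: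
  assumes A: "A \<in> sets borel" "bounded A"
  shows "(\<integral>\<^sup>+\<omega>. ennreal (real (card (N \<omega> \<inter> A))) \<partial>M) = ennreal lam * emeasure lborel A"
proof -
  let ?Q = "unit_cube :: 'a set"
  let ?n = "\<lambda>A. \<integral>\<^sup>+\<omega>. ennreal (real (card (N \<omega> \<inter> A))) \<partial>M"
  \<comment> \<open>The reflected cube enters because the substitution turns
    \<open>y \<in> ?Q\<close> into \<open>z - x \<in> ?Q\<close>, that is, \<open>x\<close> lies in
    \<open>z\<close> minus the cube.\<close>
  have bQ: "bounded (uminus ` ?Q)" using bounded_unit_cube by simp
  have mQ: "uminus ` ?Q \<in> sets borel"
  proof -
    have "uminus ` ?Q = uminus -` ?Q \<inter> space borel" by (auto simp: image_iff) (metis minus_minus)+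
    also have "\<dots> \<in> sets borel" by (rule measurable_sets[where A=borel]) auto
    finally show ?thesis .
  qed
  have key: "?n B = ?n (uminus ` ?Q) * emeasure lborel B" if B: "B \<in> sets borel" "bounded B" for B
  proof -
    note B(1) [measurable]
    obtain r1 r2 where r: "\<And>x. x \<in> B \<Longrightarrow> norm x \<le> r1" "\<And>x. x \<in> ?Q \<Longrightarrow> norm x \<le> r2"
      using B(2) bounded_unit_cube unfolding bounded_iff by metis
    \<comment> \<open>A ball containing every point \<open>x\<close> that can contribute to
      \<open>B\<close> after a shift from the unit cube; it keeps the sums finite.\<close>
    define W where "W = cball (0::'a) (r1 + r2)"
    have W: "W \<in> sets borel" "bounded W" by (auto simp: W_def)
    have inW: "x \<in> W" if "x + y \<in> B" "y \<in> ?Q" for x y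
    proof -
      have "norm x \<le> norm (x + y) + norm y" using norm_triangle_ineq4[of "x + y" y] by simp
      then show ?thesis using r(1)[OF that(1)] r(2)[OF that(2)] by (simp add: W_def)
    qed
    let ?f = "\<lambda>\<omega> y. \<Sum>x\<in>N \<omega> \<inter> W. indicator B (x + y) * indicator ?Q y :: real"
    have fm: "(\<lambda>(\<omega>, y). ?f \<omega> y) \<in> borel_measurable (M \<Otimes>\<^sub>M lborel)"
      unfolding split_beta'
      by (rule measurable_sum_config_compose[OF N_measurable W])
         (use B in measurable)
    interpret L: pair_sigma_finite M lborel by unfold_locales
    have "?n B = (\<integral>\<^sup>+y. ?n B * indicator ?Q y \<partial>lborel)"
      by (simp add: nn_integral_cmult measure_unit_cube)
    also have "\<dots> = (\<integral>\<^sup>+y. (\<integral>\<^sup>+\<omega>. ennreal (?f \<omega> y) \<partial>M) \<partial>lborel)"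
    proof (rule nn_integral_cong)
      fix y :: 'a
      have "?n B = ?n ((\<lambda>z. z + - y) ` B)" by (rule nn_card_translate[OF B, symmetric])
      then have "?n B * indicator ?Q y = (\<integral>\<^sup>+\<omega>. ennreal (real (card (N \<omega> \<inter> (\<lambda>z. z + - y) ` B))) * indicator ?Q y \<partial>M)"
        by (cases "y \<in> ?Q") auto
      also have "\<dots> = (\<integral>\<^sup>+\<omega>. ennreal (?f \<omega> y) \<partial>M)"
      proof (rule nn_integral_cong)
        fix \<omega> assume w: "\<omega> \<in> space M"
        show "ennreal (real (card (N \<omega> \<inter> (\<lambda>z. z + - y) ` B))) * indicator ?Q y = ennreal (?f \<omega> y)"
        proof (cases "y \<in> ?Q")
          case True
          have "?f \<omega> y = (\<Sum>x\<in>N \<omega> \<inter> W. if x \<in> {x. x + y \<in> B} then 1 else 0)"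
            using True by (intro sum.cong) (auto simp: indicator_def)
          also have "\<dots> = (\<Sum>x\<in>N \<omega> \<inter> W \<inter> {x. x + y \<in> B}. 1)"
            by (rule sum.inter_restrict[symmetric]) (rule finite_N[OF w W(2)])
          also have "N \<omega> \<inter> W \<inter> {x. x + y \<in> B} = N \<omega> \<inter> (\<lambda>z. z + - y) ` B"
            using inW[OF _ True] by (auto simp: image_iff) (metis diff_add_cancel add_diff_cancel)+
          finally show ?thesis using True by simp
        qed simp
      qed
      finally show "?n B * indicator ?Q y = (\<integral>\<^sup>+\<omega>. ennreal (?f \<omega> y) \<partial>M)" .
    qed
    also have "\<dots> = (\<integral>\<^sup>+\<omega>. (\<integral>\<^sup>+y. ennreal (?f \<omega> y) \<partial>lborel) \<partial>M)"
    proof (rule L.Fubini')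
      show "(\<lambda>(\<omega>, y). ennreal (?f \<omega> y)) \<in> borel_measurable (M \<Otimes>\<^sub>M lborel)"
        using measurable_compose[OF fm measurable_ennreal] by (simp add: split_beta')
    qed
    also have "\<dots> = (\<integral>\<^sup>+\<omega>. (\<integral>\<^sup>+z. ennreal (\<Sum>x\<in>N \<omega> \<inter> W. indicator B z * indicator ?Q (z - x)) \<partial>lborel) \<partial>M)"
    proof (rule nn_integral_cong)
      fix \<omega> assume w: "\<omega> \<in> space M"
      have "(\<integral>\<^sup>+y. ennreal (?f \<omega> y) \<partial>lborel) = (\<integral>\<^sup>+y. (\<Sum>x\<in>N \<omega> \<inter> W. ennreal (indicator B (x + y) * indicator ?Q y)) \<partial>lborel)"
        by (intro nn_integral_cong sum_ennreal[symmetric]) auto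
      also have "\<dots> = (\<Sum>x\<in>N \<omega> \<inter> W. \<integral>\<^sup>+y. ennreal (indicator B (x + y) * indicator ?Q y) \<partial>lborel)"
        by (intro nn_integral_sum) measurable
      also have "\<dots> = (\<Sum>x\<in>N \<omega> \<inter> W. \<integral>\<^sup>+z. ennreal (indicator B z * indicator ?Q (z - x)) \<partial>lborel)"
      proof (rule sum.cong[OF refl])
        fix x
        have "(\<integral>\<^sup>+z. ennreal (indicator B z * indicator ?Q (z - x)) \<partial>lborel) =
            (\<integral>\<^sup>+z. ennreal (indicator B z * indicator ?Q (z - x)) \<partial>distr lborel borel ((+) x))"
          by (simp add: lborel_distr_plus)
        also have "\<dots> = (\<integral>\<^sup>+y. ennreal (indicator B (x + y) * indicator ?Q y) \<partial>lborel)"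
          using B by (subst nn_integral_distr) (auto simp del: ennreal_indicator)
        finally show "(\<integral>\<^sup>+y. ennreal (indicator B (x + y) * indicator ?Q y) \<partial>lborel) =
            (\<integral>\<^sup>+z. ennreal (indicator B z * indicator ?Q (z - x)) \<partial>lborel)" by simp
      qed
      also have "\<dots> = (\<integral>\<^sup>+z. (\<Sum>x\<in>N \<omega> \<inter> W. ennreal (indicator B z * indicator ?Q (z - x))) \<partial>lborel)"
        by (intro nn_integral_sum[symmetric]) measurable
      also have "\<dots> = (\<integral>\<^sup>+z. ennreal (\<Sum>x\<in>N \<omega> \<inter> W. indicator B z * indicator ?Q (z - x)) \<partial>lborel)"
        by (intro nn_integral_cong sum_ennreal) auto
      finally show "(\<integral>\<^sup>+y. ennreal (?f \<omega> y) \<partial>lborel) = (\<integral>\<^sup>+z. ennreal (\<Sum>x\<in>N \<omega> \<inter> W. indicator B z * indicator ?Q (z - x)) \<partial>lborel)" .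
    qed
    also have "\<dots> = (\<integral>\<^sup>+z. (\<integral>\<^sup>+\<omega>. ennreal (\<Sum>x\<in>N \<omega> \<inter> W. indicator B z * indicator ?Q (z - x)) \<partial>M) \<partial>lborel)"
    proof (rule L.Fubini'[symmetric])
      have "(\<lambda>p. \<Sum>x\<in>N (fst p) \<inter> W. indicator B (snd p) * indicator ?Q (snd p - x) :: real) \<in> borel_measurable (M \<Otimes>\<^sub>M lborel)"
        by (rule measurable_sum_config_compose[OF N_measurable W]) (use B in measurable)
      then show "(\<lambda>(\<omega>, z). ennreal (\<Sum>x\<in>N \<omega> \<inter> W. indicator B z * indicator ?Q (z - x))) \<in> borel_measurable (M \<Otimes>\<^sub>M lborel)"
        unfolding split_beta' by measurable
    qed
    also have "\<dots> = (\<integral>\<^sup>+z. ?n (uminus ` ?Q) * indicator B z \<partial>lborel)"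
    proof (rule nn_integral_cong)
      fix z :: 'a
      have "?n (uminus ` ?Q) = ?n ((\<lambda>y. y + z) ` uminus ` ?Q)" by (rule nn_card_translate[OF mQ bQ, symmetric])
      then have "?n (uminus ` ?Q) * indicator B z = (\<integral>\<^sup>+\<omega>. ennreal (real (card (N \<omega> \<inter> (\<lambda>y. y + z) ` uminus ` ?Q))) * indicator B z \<partial>M)"
        by (cases "z \<in> B") auto
      also have "\<dots> = (\<integral>\<^sup>+\<omega>. ennreal (\<Sum>x\<in>N \<omega> \<inter> W. indicator B z * indicator ?Q (z - x)) \<partial>M)"
      proof (rule nn_integral_cong)
        fix \<omega> assume w: "\<omega> \<in> space M"
        show "ennreal (real (card (N \<omega> \<inter> (\<lambda>y. y + z) ` uminus ` ?Q))) * indicator B z =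
            ennreal (\<Sum>x\<in>N \<omega> \<inter> W. indicator B z * indicator ?Q (z - x))"
        proof (cases "z \<in> B")
          case True
          have "(\<Sum>x\<in>N \<omega> \<inter> W. indicator B z * indicator ?Q (z - x) :: real) = (\<Sum>x\<in>N \<omega> \<inter> W. if x \<in> {x. z - x \<in> ?Q} then 1 else 0)"
            using True by (intro sum.cong) (auto simp: indicator_def)
          also have "\<dots> = (\<Sum>x\<in>N \<omega> \<inter> W \<inter> {x. z - x \<in> ?Q}. 1)"
            by (rule sum.inter_restrict[symmetric]) (rule finite_N[OF w W(2)])
          also have "N \<omega> \<inter> W \<inter> {x. z - x \<in> ?Q} = N \<omega> \<inter> (\<lambda>y. y + z) ` uminus ` ?Q"
          proof -
            have "x \<in> W" if "z - x \<in> ?Q" for x using inW[of x "z - x"] that True by simp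
            moreover have "x \<in> (\<lambda>y. y + z) ` uminus ` ?Q \<longleftrightarrow> z - x \<in> ?Q" for x
              by (auto simp: image_iff intro!: bexI[of _ "z - x"])
            ultimately show ?thesis by blast
          qed
          finally show ?thesis using True by simp
        qed simp
      qed
      finally show "(\<integral>\<^sup>+\<omega>. ennreal (\<Sum>x\<in>N \<omega> \<inter> W. indicator B z * indicator ?Q (z - x)) \<partial>M) = ?n (uminus ` ?Q) * indicator B z" by simp
    qed
    also have "\<dots> = ?n (uminus ` ?Q) * emeasure lborel B"
      using B by (simp add: nn_integral_cmult)
    finally show ?thesis .
  qed
  have "?n ?Q = ennreal lam"
    unfolding intensity_def
    by (rule nn_integral_eq_integral) (auto intro: integrable_card bounded_unit_cube)
  \<comment> \<open>Applying the proportionality to the unit cube, which has volume 1, identifies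
    the constant with the intensity.\<close>
  moreover have "?n ?Q = ?n (uminus ` ?Q)"
    using key[OF sets_unit_cube bounded_unit_cube] by (simp add: measure_unit_cube)
  ultimately show ?thesis using key[OF A] by simp
qed

lemma lam_nonneg: "0 \<le> lam"
  unfolding intensity_def by simp

lemma expectation_card:
  assumes A: "A \<in> sets borel" "bounded A"
  shows "(\<integral>\<omega>. real (card (N \<omega> \<inter> A)) \<partial>M) = lam * measure lborel A"
proof -
  have "ennreal (\<integral>\<omega>. real (card (N \<omega> \<inter> A)) \<partial>M) = ennreal lam * emeasure lborel A"
    unfolding nn_card[OF A, symmetric]
    by (rule nn_integral_eq_integral[symmetric]) (auto intro: integrable_card A)
  also have "emeasure lborel A = ennreal (measure lborel A)"
    using emeasure_bounded_finite[OF A(2)] by (simp add: emeasure_eq_ennreal_measure)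
  finally have "ennreal (\<integral>\<omega>. real (card (N \<omega> \<inter> A)) \<partial>M) = ennreal (lam * measure lborel A)"
    using lam_nonneg by (simp add: ennreal_mult)
  then show ?thesis
    by (subst (asm) ennreal_inj) (auto intro!: mult_nonneg_nonneg lam_nonneg)
qed

end

subsection \<open>Moment functionals in a window\<close>

definition sint :: "'b signed \<Rightarrow> ('b \<Rightarrow> real) \<Rightarrow> real" where
  "sint \<gamma> F = (\<integral>t. F t \<partial>fst \<gamma>) - (\<integral>t. F t \<partial>snd \<gamma>)"

lemma sint_cmult: "sint \<gamma> (\<lambda>t. c * F t) = c * sint \<gamma> F"
  by (simp add: sint_def right_diff_distrib)

lemma sint_indicator:
  assumes "S \<in> sets (fst \<gamma>)" "S \<in> sets (snd \<gamma>)"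
    and "\<And>t. t \<in> space (fst \<gamma>) \<Longrightarrow> F t = indicator S t" "\<And>t. t \<in> space (snd \<gamma>) \<Longrightarrow> F t = indicator S t"
  shows "sint \<gamma> F = signed_value \<gamma> S"
proof -
  have "(\<integral>t. F t \<partial>fst \<gamma>) = measure (fst \<gamma>) S"
    using assms sets.sets_into_space[OF assms(1)]
    by (simp add: Int_absorb2 cong: Bochner_Integration.integral_cong)
  moreover have "(\<integral>t. F t \<partial>snd \<gamma>) = measure (snd \<gamma>) S"
    using assms sets.sets_into_space[OF assms(2)]
    by (simp add: Int_absorb2 cong: Bochner_Integration.integral_cong)
  ultimately show ?thesis by (simp add: sint_def signed_value_def)
qed

text \<open>Lebesgue measure on \<open>W\<close>, taken as a density and not on a restricted space:
  the space stays \<open>UNIV\<close> and the sigma-algebra that of \<open>borel\<close>, so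
  integrands need no restriction.\<close>

definition window_measure :: "'a::euclidean_space set \<Rightarrow> 'a measure" where
  "window_measure W = density lborel (indicator W)"

lemma sets_window_measure [simp, measurable_cong]: "sets (window_measure W) = sets borel"
  by (simp add: window_measure_def)

lemma space_window_measure [simp]: "space (window_measure W) = UNIV"
  by (simp add: window_measure_def)

lemma integral_window_measure:
  fixes F :: "'a::euclidean_space \<Rightarrow> real"
  assumes [measurable]: "W \<in> sets borel" "F \<in> borel_measurable borel"
  shows "(\<integral>x. F x \<partial>window_measure W) = (\<integral>x. indicator W x * F x \<partial>lborel)"
proof -
  have "window_measure W = density lborel (\<lambda>x. ennreal (indicator W x))"
    by (simp add: window_measure_def del: ennreal_indicator) (simp add: ennreal_indicator[abs_def])
  then show ?thesis by (simp add: integral_density del: ennreal_indicator)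
qed

lemma bpc_precomp:
  assumes "bpc_op X Y T" "\<phi> \<in> Z \<rightarrow>\<^sub>M Y"
  shows "bpc_op X Z (\<lambda>F z. T F (\<phi> z))"
proof -
  obtain K where K: "0 \<le> K" "\<And>F C y. F \<in> bm X \<Longrightarrow> (\<And>x. \<bar>F x\<bar> \<le> C) \<Longrightarrow> \<bar>T F y\<bar> \<le> K * C"
    using bpc_op_bound[OF assms(1)] by metis
  note sp = measurable_space[OF assms(2)]
  show ?thesis
  proof (rule bpc_opI[where K=K])
    show "(\<lambda>z. T F (\<phi> z)) \<in> borel_measurable Z" if "F \<in> bm X" for F
      by (rule measurable_compose[OF assms(2) bpc_op_measurable[OF assms(1) that]])
    show "(\<lambda>i. T (Fs i) (\<phi> z)) \<longlonglongrightarrow> T F (\<phi> z)"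
      if "\<And>i. Fs i \<in> bm X" "F \<in> bm X" "\<And>i x. \<bar>Fs i x\<bar> \<le> C" "\<And>x. (\<lambda>i. Fs i x) \<longlonglongrightarrow> F x" "z \<in> space Z"
      for Fs F C z by (rule bpc_op_tendsto[OF assms(1) that(1-4) sp[OF that(5)]])
  qed (use K bpc_op_add[OF assms(1)] bpc_op_cmult[OF assms(1)] sp in simp_all)
qed

lemma translate_mem_PiE_iff:
  fixes t :: "nat \<Rightarrow> 'a::euclidean_space"
  assumes "t \<in> Pi\<^sub>E J (\<lambda>_. UNIV)"
  shows "t \<in> (\<Pi>\<^sub>E l\<in>J. (\<lambda>y. y - x) ` A l) \<longleftrightarrow> (\<forall>l\<in>J. t l + x \<in> A l)"
proof -
  have "t l \<in> (\<lambda>y. y - x) ` A l \<longleftrightarrow> t l + x \<in> A l" for l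
    by (auto simp: image_iff intro!: bexI[of _ "t l + x"])
  then show ?thesis using assms by (auto simp: PiE_iff)
qed

lemma borel_translate_minus: "A \<in> sets borel \<Longrightarrow> (\<lambda>y. y - x) ` A \<in> sets (borel :: 'a::euclidean_space measure)"
  using borel_translate[of A "- x"] by simp

locale b4_window = b4_process M N \<gamma>
  for M :: "'w measure" and N :: "'w \<Rightarrow> 'a::euclidean_space set" and \<gamma> :: "nat \<Rightarrow> (nat \<Rightarrow> 'a) signed" +
  fixes W :: "'a set"
  assumes W_borel [measurable]: "W \<in> sets borel" and W_bounded: "bounded W"
begin

abbreviation "LW \<equiv> window_measure W"

lemma finite_LW: "finite_measure LW"
proof
  have "emeasure LW (space LW) = emeasure lborel W"
    by (simp add: window_measure_def emeasure_density)
  then show "emeasure LW (space LW) \<noteq> \<infinity>"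
    using emeasure_bounded_finite[OF W_bounded] by simp
qed

lemma measure_LW: "measure LW UNIV = measure lborel W"
  by (simp add: window_measure_def measure_def emeasure_density)

lemma gam_sets:
  assumes "k \<in> {2, 3, 4}"
  shows "sets (fst (\<gamma> k)) = sets (\<Pi>\<^sub>M l\<in>{1..<k}. (borel :: 'a measure))"
    "sets (snd (\<gamma> k)) = sets (\<Pi>\<^sub>M l\<in>{1..<k}. (borel :: 'a measure))"
  using B4 assms by (auto simp: B4_mixing_def reduced_cumulant_def signed_measure_on_def locally_finite_def)

lemma gam_finite:
  assumes "k \<in> {2, 3, 4}"
  shows "finite_measure (fst (\<gamma> k))" "finite_measure (snd (\<gamma> k))"
  using B4 assms by (auto simp: B4_mixing_def total_variation_def intro!: finite_measureI)

lemma gam_space: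
  assumes "k \<in> {2, 3, 4}"
  shows "space (fst (\<gamma> k)) = Pi\<^sub>E {1..<k} (\<lambda>_. UNIV)" "space (snd (\<gamma> k)) = Pi\<^sub>E {1..<k} (\<lambda>_. UNIV)"
  using sets_eq_imp_space_eq[OF gam_sets(1)[OF assms]] sets_eq_imp_space_eq[OF gam_sets(2)[OF assms]]
  by (simp_all add: space_PiM)

lemma gam_component:
  assumes "k \<in> {2, 3, 4}" "l \<in> {1..<k}"
  shows "(\<lambda>t. t l) \<in> borel_measurable (fst (\<gamma> k))" "(\<lambda>t. t l) \<in> borel_measurable (snd (\<gamma> k))"
  using measurable_component_singleton[OF assms(2), of "\<lambda>_. borel :: 'a measure"]
  by (simp_all add: measurable_cong_sets[OF gam_sets(1)[OF assms(1)] refl] measurable_cong_sets[OF gam_sets(2)[OF assms(1)] refl])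

lemma gam_component_snd:
  assumes "k \<in> {2, 3, 4}" "l \<in> {1..<k}"
  shows "(\<lambda>q. snd q l) \<in> borel_measurable (Y \<Otimes>\<^sub>M fst (\<gamma> k))" "(\<lambda>q. snd q l) \<in> borel_measurable (Y \<Otimes>\<^sub>M snd (\<gamma> k))"
  by (rule measurable_compose[OF measurable_snd gam_component(1)[OF assms]])
     (rule measurable_compose[OF measurable_snd gam_component(2)[OF assms]])

lemma gam_components [measurable (raw)]:
  "(\<lambda>q. snd q 1) \<in> borel_measurable (Y \<Otimes>\<^sub>M fst (\<gamma> 2))" "(\<lambda>q. snd q 1) \<in> borel_measurable (Y \<Otimes>\<^sub>M snd (\<gamma> 2))"
  "(\<lambda>q. snd q 1) \<in> borel_measurable (Y \<Otimes>\<^sub>M fst (\<gamma> 3))" "(\<lambda>q. snd q 1) \<in> borel_measurable (Y \<Otimes>\<^sub>M snd (\<gamma> 3))"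
  "(\<lambda>q. snd q 2) \<in> borel_measurable (Y \<Otimes>\<^sub>M fst (\<gamma> 3))" "(\<lambda>q. snd q 2) \<in> borel_measurable (Y \<Otimes>\<^sub>M snd (\<gamma> 3))"
  "(\<lambda>q. snd q 1) \<in> borel_measurable (Y \<Otimes>\<^sub>M fst (\<gamma> 4))" "(\<lambda>q. snd q 1) \<in> borel_measurable (Y \<Otimes>\<^sub>M snd (\<gamma> 4))"
  "(\<lambda>q. snd q 2) \<in> borel_measurable (Y \<Otimes>\<^sub>M fst (\<gamma> 4))" "(\<lambda>q. snd q 2) \<in> borel_measurable (Y \<Otimes>\<^sub>M snd (\<gamma> 4))"
  "(\<lambda>q. snd q 3) \<in> borel_measurable (Y \<Otimes>\<^sub>M fst (\<gamma> 4))" "(\<lambda>q. snd q 3) \<in> borel_measurable (Y \<Otimes>\<^sub>M snd (\<gamma> 4))"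
  by (rule gam_component_snd; simp)+

text \<open>\<open>L1\<close> to \<open>L4\<close> integrate with respect to the factorial moment
  measures of orders 1 to 4 restricted to the window. The integrands take their points as separate
  arguments so that single points can be integrated out.\<close>

definition L1 :: "('a \<Rightarrow> real) \<Rightarrow> real" where
  "L1 f = (\<integral>\<omega>. (\<Sum>x\<in>N \<omega> \<inter> W. f x) \<partial>M)"

definition L2 :: "('a \<Rightarrow> 'a \<Rightarrow> real) \<Rightarrow> real" where
  "L2 f = (\<integral>\<omega>. (\<Sum>t\<in>point_pairs W (N \<omega>). f (fst t) (snd t)) \<partial>M)"

definition L3 :: "('a \<Rightarrow> 'a \<Rightarrow> 'a \<Rightarrow> real) \<Rightarrow> real" where
  "L3 f = (\<integral>\<omega>. (\<Sum>t\<in>point_triples W (N \<omega>). f (fst t) (fst (snd t)) (snd (snd t))) \<partial>M)"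

definition L4 :: "('a \<Rightarrow> 'a \<Rightarrow> 'a \<Rightarrow> 'a \<Rightarrow> real) \<Rightarrow> real" where
  "L4 f = (\<integral>\<omega>. (\<Sum>t\<in>point_quads W (N \<omega>). f (fst t) (fst (snd t)) (fst (snd (snd t))) (snd (snd (snd t)))) \<partial>M)"

abbreviation I :: "('a \<Rightarrow> real) \<Rightarrow> real" where
  "I f \<equiv> \<integral>x. f x \<partial>LW"

text \<open>\<open>G2\<close> to \<open>G4\<close> integrate with respect to the factorial cumulant
  measures in the window, written through the reduced measures: the last argument \<open>u\<close>
  is the reference point and the others are \<open>t l + u\<close>. The measure \<open>LW\<close>
  confines \<open>u\<close> to the window, the indicators confine the others.\<close>

definition G2 :: "('a \<Rightarrow> 'a \<Rightarrow> real) \<Rightarrow> real" where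
  "G2 f = lam * I (\<lambda>u. sint (\<gamma> 2) (\<lambda>t. indicator W (t 1 + u) * f (t 1 + u) u))"

definition G3 :: "('a \<Rightarrow> 'a \<Rightarrow> 'a \<Rightarrow> real) \<Rightarrow> real" where
  "G3 f = lam * I (\<lambda>u. sint (\<gamma> 3) (\<lambda>t. indicator W (t 1 + u) * (indicator W (t 2 + u) *
     f (t 1 + u) (t 2 + u) u)))"

definition G4 :: "('a \<Rightarrow> 'a \<Rightarrow> 'a \<Rightarrow> 'a \<Rightarrow> real) \<Rightarrow> real" where
  "G4 f = lam * I (\<lambda>u. sint (\<gamma> 4) (\<lambda>t. indicator W (t 1 + u) * (indicator W (t 2 + u) * (indicator W (t 3 + u) *
     f (t 1 + u) (t 2 + u) (t 3 + u) u))))"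

lemma L2_cmult: "L2 (\<lambda>x y. c * f x y) = c * L2 f"
  by (simp add: L2_def sum_distrib_left[symmetric])

lemma L3_cmult: "L3 (\<lambda>x y z. c * f x y z) = c * L3 f"
  by (simp add: L3_def sum_distrib_left[symmetric])

lemma G2_cmult: "G2 (\<lambda>x y. c * f x y) = c * G2 f"
  unfolding G2_def by (simp add: mult.left_commute[of _ c] sint_cmult)

lemma finite_tuples:
  assumes "\<omega> \<in> space M"
  shows "finite (N \<omega> \<inter> W)" "finite (point_pairs W (N \<omega>))" "finite (point_triples W (N \<omega>))" "finite (point_quads W (N \<omega>))"
    "card (point_pairs W (N \<omega>)) \<le> card (N \<omega> \<inter> W) ^ 2" "card (point_triples W (N \<omega>)) \<le> card (N \<omega> \<inter> W) ^ 3"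
    "card (point_quads W (N \<omega>)) \<le> card (N \<omega> \<inter> W) ^ 4"
proof -
  let ?S = "N \<omega> \<inter> W"
  show fin: "finite ?S" by (rule finite_N[OF assms W_bounded])
  have s: "point_pairs W (N \<omega>) \<subseteq> ?S \<times> ?S" "point_triples W (N \<omega>) \<subseteq> ?S \<times> ?S \<times> ?S"
    "point_quads W (N \<omega>) \<subseteq> ?S \<times> ?S \<times> ?S \<times> ?S"
    by (auto simp: point_pairs_def point_triples_def point_quads_def)
  show "finite (point_pairs W (N \<omega>))" "finite (point_triples W (N \<omega>))" "finite (point_quads W (N \<omega>))"
    using s fin by (auto intro: finite_subset)
  show "card (point_pairs W (N \<omega>)) \<le> card ?S ^ 2" "card (point_triples W (N \<omega>)) \<le> card ?S ^ 3"
    "card (point_quads W (N \<omega>)) \<le> card ?S ^ 4"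
    using card_mono[OF _ s(1)] card_mono[OF _ s(2)] card_mono[OF _ s(3)] fin
    by (simp_all add: card_cartesian_product power2_eq_square power3_eq_cube power4_eq_xxxx)
qed

lemma measurable_point_sums:
  fixes F1 :: "'a \<Rightarrow> real" and F2 :: "'a \<times> 'a \<Rightarrow> real"
  shows "F1 \<in> borel_measurable borel \<Longrightarrow> (\<lambda>\<omega>. \<Sum>x\<in>N \<omega> \<inter> W. F1 x) \<in> borel_measurable M"
    and "F2 \<in> borel_measurable (borel \<Otimes>\<^sub>M borel) \<Longrightarrow> (\<lambda>\<omega>. \<Sum>t\<in>point_pairs W (N \<omega>). F2 t) \<in> borel_measurable M"
proof -
  assume [measurable]: "F1 \<in> borel_measurable borel"
  show "(\<lambda>\<omega>. \<Sum>x\<in>N \<omega> \<inter> W. F1 x) \<in> borel_measurable M"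
    by (rule measurable_sum_config[OF N_measurable W_borel W_bounded]) measurable
next
  assume [measurable]: "F2 \<in> borel_measurable (borel \<Otimes>\<^sub>M borel)"
  show "(\<lambda>\<omega>. \<Sum>t\<in>point_pairs W (N \<omega>). F2 t) \<in> borel_measurable M"
    by (rule measurable_sum_point_pairs[OF N_measurable W_borel W_bounded]) measurable
qed

text \<open>The number of tuples of order k is at most the k-th power of the count in the window,
  which is integrable for k up to 4.\<close>

lemma bpc_base:
  shows "bpc_fun borel L1"
    and "bpc_fun (borel \<Otimes>\<^sub>M borel) (\<lambda>F. L2 (\<lambda>x y. F (x, y)))"
    and "bpc_fun (borel \<Otimes>\<^sub>M borel \<Otimes>\<^sub>M borel) (\<lambda>F. L3 (\<lambda>x y z. F (x, y, z)))"
    and "bpc_fun (borel \<Otimes>\<^sub>M borel \<Otimes>\<^sub>M borel \<Otimes>\<^sub>M borel) (\<lambda>F. L4 (\<lambda>x y z u. F (x, y, z, u)))"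
    and integrable_L1: "f \<in> bm borel \<Longrightarrow> integrable M (\<lambda>\<omega>. \<Sum>x\<in>N \<omega> \<inter> W. f x)"
    and integrable_L2: "f2 \<in> bm (borel \<Otimes>\<^sub>M borel) \<Longrightarrow> integrable M (\<lambda>\<omega>. \<Sum>t\<in>point_pairs W (N \<omega>). f2 t)"
    and integrable_L3: "f3 \<in> bm (borel \<Otimes>\<^sub>M borel \<Otimes>\<^sub>M borel) \<Longrightarrow> integrable M (\<lambda>\<omega>. \<Sum>t\<in>point_triples W (N \<omega>). f3 t)"
    and integrable_L4: "f4 \<in> bm (borel \<Otimes>\<^sub>M borel \<Otimes>\<^sub>M borel \<Otimes>\<^sub>M borel) \<Longrightarrow> integrable M (\<lambda>\<omega>. \<Sum>t\<in>point_quads W (N \<omega>). f4 t)"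
proof -
  have m1: "(\<lambda>\<omega>. \<Sum>t\<in>N \<omega> \<inter> W. F t) \<in> borel_measurable M" if "F \<in> borel_measurable borel" for F :: "'a \<Rightarrow> real"
    by (rule measurable_point_sums(1)[OF that])
  have m2: "(\<lambda>\<omega>. \<Sum>t\<in>point_pairs W (N \<omega>). F t) \<in> borel_measurable M" if "F \<in> borel_measurable (borel \<Otimes>\<^sub>M borel)" for F :: "'a \<times> 'a \<Rightarrow> real"
    by (rule measurable_point_sums(2)[OF that])
  note m3 = measurable_sum_point_triples[OF N_measurable W_borel W_bounded]
  note m4 = measurable_sum_point_quads[OF N_measurable W_borel W_bounded]
  have i: "integrable M (\<lambda>\<omega>. real (card (T \<omega>)))"
    if "\<And>\<omega>. \<omega> \<in> space M \<Longrightarrow> card (T \<omega>) \<le> card (N \<omega> \<inter> W) ^ k" "k \<le> 4"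
      "(\<lambda>\<omega>. \<Sum>t\<in>T \<omega>. 1 :: real) \<in> borel_measurable M" for T :: "'w \<Rightarrow> 'z set" and k
  proof (rule Bochner_Integration.integrable_bound[OF integrable_card_pow[OF W_borel W_bounded that(2)]])
    show "(\<lambda>\<omega>. real (card (T \<omega>))) \<in> borel_measurable M" using that(3) by simp
    show "AE \<omega> in M. norm (real (card (T \<omega>))) \<le> norm (real (card (N \<omega> \<inter> W)) ^ k)"
      using that(1) unfolding of_nat_power[symmetric] by (intro AE_I2) (simp del: of_nat_power)
  qed
  have i1: "integrable M (\<lambda>\<omega>. real (card (N \<omega> \<inter> W)))" by (rule integrable_card[OF W_borel W_bounded])
  have i2: "integrable M (\<lambda>\<omega>. real (card (point_pairs W (N \<omega>))))"
    by (rule i[OF finite_tuples(5) _ m2]) auto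
  have i3: "integrable M (\<lambda>\<omega>. real (card (point_triples W (N \<omega>))))"
    by (rule i[OF finite_tuples(6) _ m3]) auto
  have i4: "integrable M (\<lambda>\<omega>. real (card (point_quads W (N \<omega>))))"
    by (rule i[OF finite_tuples(7) _ m4]) auto
  note b1 = bpc_fun_expectation_sum[OF finite_tuples(1) i1 m1]
  note b2 = bpc_fun_expectation_sum[OF finite_tuples(2) i2 m2]
  note b3 = bpc_fun_expectation_sum[OF finite_tuples(3) i3 m3]
  note b4 = bpc_fun_expectation_sum[OF finite_tuples(4) i4 m4]
  show "bpc_fun borel L1"
    unfolding L1_def[abs_def] by (rule b1(1))
  show "bpc_fun (borel \<Otimes>\<^sub>M borel) (\<lambda>F. L2 (\<lambda>x y. F (x, y)))"
    unfolding L2_def prod.collapse by (rule b2(1))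
  show "bpc_fun (borel \<Otimes>\<^sub>M borel \<Otimes>\<^sub>M borel) (\<lambda>F. L3 (\<lambda>x y z. F (x, y, z)))"
    unfolding L3_def prod.collapse by (rule b3(1))
  show "bpc_fun (borel \<Otimes>\<^sub>M borel \<Otimes>\<^sub>M borel \<Otimes>\<^sub>M borel) (\<lambda>F. L4 (\<lambda>x y z u. F (x, y, z, u)))"
    unfolding L4_def prod.collapse by (rule b4(1))
  show "f \<in> bm borel \<Longrightarrow> integrable M (\<lambda>\<omega>. \<Sum>x\<in>N \<omega> \<inter> W. f x)" by (rule b1(2))
  show "f2 \<in> bm (borel \<Otimes>\<^sub>M borel) \<Longrightarrow> integrable M (\<lambda>\<omega>. \<Sum>t\<in>point_pairs W (N \<omega>). f2 t)" by (rule b2(2))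
  show "f3 \<in> bm (borel \<Otimes>\<^sub>M borel \<Otimes>\<^sub>M borel) \<Longrightarrow> integrable M (\<lambda>\<omega>. \<Sum>t\<in>point_triples W (N \<omega>). f3 t)" by (rule b3(2))
  show "f4 \<in> bm (borel \<Otimes>\<^sub>M borel \<Otimes>\<^sub>M borel \<Otimes>\<^sub>M borel) \<Longrightarrow> integrable M (\<lambda>\<omega>. \<Sum>t\<in>point_quads W (N \<omega>). f4 t)" by (rule b4(2))
qed

lemma bpc_L2: "bpc_op X (borel \<Otimes>\<^sub>M borel) (\<lambda>F p. e F (fst p) (snd p)) \<Longrightarrow> bpc_fun X (\<lambda>F. L2 (\<lambda>x y. e F x y))"
  using bpc_fun_comp[OF bpc_base(2), of X "\<lambda>F p. e F (fst p) (snd p)"]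
  by (simp add: space_pair_measure)

lemma bpc_L3: "bpc_op X (borel \<Otimes>\<^sub>M borel \<Otimes>\<^sub>M borel) (\<lambda>F p. e F (fst p) (fst (snd p)) (snd (snd p))) \<Longrightarrow>
    bpc_fun X (\<lambda>F. L3 (\<lambda>x y z. e F x y z))"
  using bpc_fun_comp[OF bpc_base(3), of X "\<lambda>F p. e F (fst p) (fst (snd p)) (snd (snd p))"]
  by (simp add: space_pair_measure)

lemma bpc_sint:
  assumes k: "k \<in> {2, 3, 4}"
    and "bpc_op X (Y \<Otimes>\<^sub>M fst (\<gamma> k)) (\<lambda>F p. e F (fst p) (snd p))"
    and "bpc_op X (Y \<Otimes>\<^sub>M snd (\<gamma> k)) (\<lambda>F p. e F (fst p) (snd p))"
  shows "bpc_op X Y (\<lambda>F y. sint (\<gamma> k) (\<lambda>t. e F y t))"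
  unfolding sint_def by (intro bpc_diff bpc_int gam_finite k assms)

lemma bm_indicator_compose: "\<phi> \<in> Y \<rightarrow>\<^sub>M borel \<Longrightarrow> (\<lambda>y. indicator W (\<phi> y)) \<in> bm Y"
  by (rule bm_compose[OF bm_indicator]) auto

text \<open>Stated with a parameter \<open>y\<close>, as an operator, because the fourth-order
  expansion contains \<open>G2\<close> inside \<open>G2\<close>: the product of two second
  cumulants, with the arguments of one depending on those of the other.\<close>

lemma bpc_G2:
  assumes T: "bpc_op X (Y \<Otimes>\<^sub>M borel \<Otimes>\<^sub>M borel) (\<lambda>F p. e F (fst p) (fst (snd p)) (snd (snd p)))"
  shows "bpc_op X Y (\<lambda>F y. G2 (\<lambda>x z. e F y x z))"
proof -
  have 1: "bpc_op X ((Y \<Otimes>\<^sub>M LW) \<Otimes>\<^sub>M \<nu>) (\<lambda>F q. indicator W (snd q 1 + snd (fst q)) * e F (fst (fst q)) (snd q 1 + snd (fst q)) (snd (fst q)))"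
    if "(\<lambda>t. t 1) \<in> borel_measurable \<nu>" for \<nu> :: "(nat \<Rightarrow> 'a) measure"
  proof (rule bpc_mult)
    have p: "(\<lambda>q. snd q 1) \<in> borel_measurable ((Y \<Otimes>\<^sub>M LW) \<Otimes>\<^sub>M \<nu>)"
      by (rule measurable_compose[OF measurable_snd that])
    have u: "(\<lambda>q. snd (fst q)) \<in> borel_measurable ((Y \<Otimes>\<^sub>M LW) \<Otimes>\<^sub>M \<nu>)"
      by measurable
    show "(\<lambda>q. indicator W (snd q 1 + snd (fst q))) \<in> bm ((Y \<Otimes>\<^sub>M LW) \<Otimes>\<^sub>M \<nu>)"
      by (intro bm_indicator_compose borel_measurable_add p u)
    have "(\<lambda>q. (fst (fst q), snd q 1 + snd (fst q), snd (fst q))) \<in> (Y \<Otimes>\<^sub>M LW) \<Otimes>\<^sub>M \<nu> \<rightarrow>\<^sub>M Y \<Otimes>\<^sub>M borel \<Otimes>\<^sub>M borel"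
      by (intro measurable_Pair borel_measurable_add p u measurable_compose[OF measurable_fst measurable_fst])
    from bpc_precomp[OF T this]
    show "bpc_op X ((Y \<Otimes>\<^sub>M LW) \<Otimes>\<^sub>M \<nu>) (\<lambda>F q. e F (fst (fst q)) (snd q 1 + snd (fst q)) (snd (fst q)))"
      by (simp only: fst_conv snd_conv)
  qed
  show ?thesis
    unfolding G2_def
    by (intro bpc_mult[OF bm_const] bpc_int[OF finite_LW] bpc_sint 1 gam_component) auto
qed

lemma bpc_G3: "bpc_fun (borel \<Otimes>\<^sub>M borel \<Otimes>\<^sub>M borel) (\<lambda>F. G3 (\<lambda>x y z. F (x, y, z)))"
  unfolding G3_def
  by (intro bpc_mult[OF bm_const] bpc_int[OF finite_LW] bpc_sint bpc_mult[OF bm_indicator_compose] bpc_subst) measurable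

lemma bpc_G4: "bpc_fun (borel \<Otimes>\<^sub>M borel \<Otimes>\<^sub>M borel \<Otimes>\<^sub>M borel) (\<lambda>F. G4 (\<lambda>x y z u. F (x, y, z, u)))"
  unfolding G4_def
  by (intro bpc_mult[OF bm_const] bpc_int[OF finite_LW] bpc_sint bpc_mult[OF bm_indicator_compose] bpc_subst) measurable

subsection \<open>Evaluation on rectangles\<close>

lemma moment_1: 
  assumes [measurable]: "\<And>l. A l \<in> sets borel"
  shows "enn2real (fact_moment M N {i} (\<lambda>l. A l \<inter> W)) = lam * I (indicator (A i))"
proof -
  have "fact_moment M N {i} (\<lambda>l. A l \<inter> W) = (\<integral>\<^sup>+\<omega>. ennreal (real (card (N \<omega> \<inter> (A i \<inter> W)))) \<partial>M)"
    by (subst fact_moment_inj_card)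
       (auto intro!: nn_integral_cong simp: inj_card_insert inj_card_empty finite_N bounded_Int W_bounded)
  also have "\<dots> = ennreal (lam * measure lborel (A i \<inter> W))"
    using expectation_card[of "A i \<inter> W"] integrable_card[of "A i \<inter> W"]
    by (subst nn_integral_eq_integral) (auto simp: bounded_Int W_bounded)
  finally have "enn2real (fact_moment M N {i} (\<lambda>l. A l \<inter> W)) = lam * measure lborel (A i \<inter> W)"
    by (simp add: lam_nonneg)
  also have "measure lborel (A i \<inter> W) = I (indicator (A i))"
    by (subst integral_window_measure) (simp_all add: indicator_inter_arith[symmetric] Int_commute)
  finally show ?thesis .
qed

lemma enn2real_moment:
  assumes "finite K" "\<And>\<omega>. \<omega> \<in> space M \<Longrightarrow> real (inj_card K (\<lambda>l. N \<omega> \<inter> W \<inter> A l)) = g \<omega>"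
    "integrable M g"
  shows "enn2real (fact_moment M N K (\<lambda>l. A l \<inter> W)) = (\<integral>\<omega>. g \<omega> \<partial>M)"
proof -
  have eq: "N \<omega> \<inter> (A l \<inter> W) = N \<omega> \<inter> W \<inter> A l" for \<omega> l by auto
  have "fact_moment M N K (\<lambda>l. A l \<inter> W) = (\<integral>\<^sup>+\<omega>. ennreal (g \<omega>) \<partial>M)"
    using assms(1,2) by (subst fact_moment_inj_card) (auto intro!: nn_integral_cong simp: eq bounded_Int W_bounded)
  moreover have "0 \<le> g \<omega>" if "\<omega> \<in> space M" for \<omega> using assms(2)[OF that] by (metis of_nat_0_le_iff)
  ultimately show ?thesis
    using assms(3) by (simp add: nn_integral_eq_integral integral_nonneg_AE)
qed

lemma moment_2:
  assumes A [measurable]: "\<And>l. A l \<in> sets borel" and ij: "distinct [i, j]"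
  shows "enn2real (fact_moment M N {i, j} (\<lambda>l. A l \<inter> W)) = L2 (\<lambda>x y. indicator (A i) x * indicator (A j) y)"
  unfolding L2_def
proof (rule enn2real_moment)
  fix \<omega> assume "\<omega> \<in> space M"
  note fin = finite_tuples(1)[OF this]
  show "real (inj_card {i, j} (\<lambda>l. N \<omega> \<inter> W \<inter> A l)) =
      (\<Sum>t\<in>point_pairs W (N \<omega>). indicator (A i) (fst t) * indicator (A j) (snd t))"
    unfolding inj_card_2[OF fin ij] sum_point_pairs[OF fin] by (intro sum.cong refl) (simp add: indicator_times)
qed (auto intro!: integrable_L2 bm_mult bm_compose[OF bm_indicator[OF A]])

lemma moment_3:
  assumes A [measurable]: "\<And>l. A l \<in> sets borel" and ij: "distinct [i, j, k]"
  shows "enn2real (fact_moment M N {i, j, k} (\<lambda>l. A l \<inter> W)) =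
    L3 (\<lambda>x y z. indicator (A i) x * (indicator (A j) y * indicator (A k) z))"
  unfolding L3_def
proof (rule enn2real_moment)
  fix \<omega> assume "\<omega> \<in> space M"
  note fin = finite_tuples(1)[OF this]
  show "real (inj_card {i, j, k} (\<lambda>l. N \<omega> \<inter> W \<inter> A l)) =
      (\<Sum>t\<in>point_triples W (N \<omega>). indicator (A i) (fst t) * (indicator (A j) (fst (snd t)) * indicator (A k) (snd (snd t))))"
    unfolding inj_card_3[OF fin ij] sum_point_triples[OF fin] by (intro sum.cong refl) (simp add: indicator_times)
qed (auto intro!: integrable_L3 bm_mult bm_compose[OF bm_indicator[OF A]])

lemma moment_4:
  assumes A [measurable]: "\<And>l. A l \<in> sets borel" and ij: "distinct [i, j, k, l]"
  shows "enn2real (fact_moment M N {i, j, k, l} (\<lambda>l. A l \<inter> W)) =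
    L4 (\<lambda>x y z u. indicator (A i) x * (indicator (A j) y * (indicator (A k) z * indicator (A l) u)))"
  unfolding L4_def
proof (rule enn2real_moment)
  fix \<omega> assume "\<omega> \<in> space M"
  note fin = finite_tuples(1)[OF this]
  show "real (inj_card {i, j, k, l} (\<lambda>l. N \<omega> \<inter> W \<inter> A l)) =
      (\<Sum>t\<in>point_quads W (N \<omega>). indicator (A i) (fst t) * (indicator (A j) (fst (snd t)) * (indicator (A k) (fst (snd (snd t))) * indicator (A l) (snd (snd (snd t))))))"
    unfolding inj_card_4[OF fin ij] sum_point_quads[OF fin] by (intro sum.cong refl) (simp add: indicator_times)
qed (auto intro!: integrable_L4 bm_mult bm_compose[OF bm_indicator[OF A]])

text \<open>Connects the defining relation for rectangles, in terms of \<open>signed_value\<close>,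
  with the integrals in \<open>G2\<close>, \<open>G3\<close> and \<open>G4\<close>: membership in a
  rectangle translated by \<open>- u\<close> is a condition on the points
  \<open>t l + u\<close>.\<close>

lemma cumulant_integral:
  assumes k: "k \<in> {2, 3, 4}" and A [measurable]: "\<And>l. A l \<in> sets borel"
    and F: "\<And>t u. t \<in> Pi\<^sub>E {1..<k} (\<lambda>_. UNIV) \<Longrightarrow> F u t * indicator (A k) u = indicator (A k) u * of_bool (\<forall>l\<in>{1..<k}. t l + u \<in> A l \<inter> W)"
    and m: "(\<lambda>u. indicator (A k) u * sint (\<gamma> k) (F u)) \<in> borel_measurable borel"
  shows "fact_cumulant M N k (\<lambda>l. A l \<inter> W) = lam * I (\<lambda>u. indicator (A k) u * sint (\<gamma> k) (F u))"
proof -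
  have "reduced_cumulant M N k (\<gamma> k)" using B4 k by (auto simp: B4_mixing_def)
  then have "fact_cumulant M N k (\<lambda>l. A l \<inter> W) =
      lam * (LINT u:A k \<inter> W|lborel. signed_value (\<gamma> k) (\<Pi>\<^sub>E l\<in>{1..<k}. (\<lambda>y. y - u) ` (A l \<inter> W)))"
    by (simp add: reduced_cumulant_def bounded_Int W_bounded)
  also have "(LINT u:A k \<inter> W|lborel. signed_value (\<gamma> k) (\<Pi>\<^sub>E l\<in>{1..<k}. (\<lambda>y. y - u) ` (A l \<inter> W))) =
      (\<integral>u. indicator W u * (indicator (A k) u * sint (\<gamma> k) (F u)) \<partial>lborel)"
    unfolding set_lebesgue_integral_def
  proof (rule Bochner_Integration.integral_cong[OF refl])
    fix u :: 'a
    show "indicator (A k \<inter> W) u *\<^sub>R signed_value (\<gamma> k) (\<Pi>\<^sub>E l\<in>{1..<k}. (\<lambda>y. y - u) ` (A l \<inter> W)) =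
        indicator W u * (indicator (A k) u * sint (\<gamma> k) (F u))"
    proof (cases "u \<in> A k")
      case True
      have S: "(\<Pi>\<^sub>E l\<in>{1..<k}. (\<lambda>y. y - u) ` (A l \<inter> W)) \<in> sets (\<Pi>\<^sub>M l\<in>{1..<k}. (borel :: 'a measure))"
        by (intro sets_PiM_I_finite borel_translate_minus) auto
      have "sint (\<gamma> k) (F u) = signed_value (\<gamma> k) (\<Pi>\<^sub>E l\<in>{1..<k}. (\<lambda>y. y - u) ` (A l \<inter> W))"
        using F[of _ u] True S gam_sets[OF k]
        by (intro sint_indicator) (auto simp: gam_space[OF k] translate_mem_PiE_iff indicator_def)
      then show ?thesis using True by (simp add: indicator_def)
    qed (simp add: indicator_def)
  qed
  also have "\<dots> = I (\<lambda>u. indicator (A k) u * sint (\<gamma> k) (F u))"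
    by (rule integral_window_measure[symmetric]) (use m in auto)
  finally show ?thesis .
qed

end

subsection \<open>Expansion of the moment functionals in cumulants\<close>

context b4_window
begin

abbreviation "bor2 \<equiv> borel \<Otimes>\<^sub>M (borel :: 'a measure)"
abbreviation "bor3 \<equiv> borel \<Otimes>\<^sub>M borel \<Otimes>\<^sub>M (borel :: 'a measure)"
abbreviation "bor4 \<equiv> borel \<Otimes>\<^sub>M borel \<Otimes>\<^sub>M borel \<Otimes>\<^sub>M (borel :: 'a measure)"

lemma sint_measurable:
  assumes k: "k \<in> {2, 3, 4}"
    and "(\<lambda>p. F (fst p) (snd p)) \<in> borel_measurable (Y \<Otimes>\<^sub>M fst (\<gamma> k))"
    and "(\<lambda>p. F (fst p) (snd p)) \<in> borel_measurable (Y \<Otimes>\<^sub>M snd (\<gamma> k))"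
  shows "(\<lambda>y. sint (\<gamma> k) (F y)) \<in> borel_measurable Y"
proof -
  interpret p: finite_measure "fst (\<gamma> k)" by (rule gam_finite[OF k])
  interpret n: finite_measure "snd (\<gamma> k)" by (rule gam_finite[OF k])
  show ?thesis
    unfolding sint_def using assms
    by (intro borel_measurable_diff p.borel_measurable_lebesgue_integral n.borel_measurable_lebesgue_integral)
       (simp_all add: split_beta')
qed

lemma cumulant_2:
  assumes A [measurable]: "\<And>l. A l \<in> sets borel"
  shows "fact_cumulant M N 2 (\<lambda>l. A l \<inter> W) = G2 (\<lambda>x y. indicator (A 1) x * indicator (A 2) y)"
proof -
  let ?F = "\<lambda>u t. indicator W (t 1 + u) * indicator (A 1) (t 1 + u) :: real"
  have "fact_cumulant M N 2 (\<lambda>l. A l \<inter> W) = lam * I (\<lambda>u. indicator (A 2) u * sint (\<gamma> 2) (?F u))"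
  proof (rule cumulant_integral)
    have "{1..<2::nat} = {1}" by auto
    then show "?F u t * indicator (A 2) u = indicator (A 2) u * of_bool (\<forall>l\<in>{1..<2}. t l + u \<in> A l \<inter> W)" for t u
      by (auto simp: indicator_def)
    show "(\<lambda>u. indicator (A 2) u * sint (\<gamma> 2) (?F u)) \<in> borel_measurable borel"
      by (intro borel_measurable_times sint_measurable) (auto simp del: One_nat_def)
  qed (use A in auto)
  then show ?thesis unfolding G2_def sint_cmult[symmetric] by (simp only: mult_ac)
qed

lemma cumulant_3:
  assumes A [measurable]: "\<And>l. A l \<in> sets borel"
  shows "fact_cumulant M N 3 (\<lambda>l. A l \<inter> W) =
    G3 (\<lambda>x y z. indicator (A 1) x * (indicator (A 2) y * indicator (A 3) z))"
proof -
  let ?F = "\<lambda>u t. indicator W (t 1 + u) * indicator (A 1) (t 1 + u) *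
    (indicator W (t 2 + u) * indicator (A 2) (t 2 + u)) :: real"
  have "fact_cumulant M N 3 (\<lambda>l. A l \<inter> W) = lam * I (\<lambda>u. indicator (A 3) u * sint (\<gamma> 3) (?F u))"
  proof (rule cumulant_integral)
    have "{1..<3::nat} = {1, 2}" by auto
    then show "?F u t * indicator (A 3) u = indicator (A 3) u * of_bool (\<forall>l\<in>{1..<3}. t l + u \<in> A l \<inter> W)" for t u
      by (auto simp: indicator_def)
    show "(\<lambda>u. indicator (A 3) u * sint (\<gamma> 3) (?F u)) \<in> borel_measurable borel"
      by (intro borel_measurable_times sint_measurable) (auto simp del: One_nat_def)
  qed (use A in auto)
  then show ?thesis unfolding G3_def sint_cmult[symmetric] by (simp only: mult_ac)
qed

lemma cumulant_4:
  assumes A [measurable]: "\<And>l. A l \<in> sets borel"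
  shows "fact_cumulant M N 4 (\<lambda>l. A l \<inter> W) =
    G4 (\<lambda>x y z u. indicator (A 1) x * (indicator (A 2) y * (indicator (A 3) z * indicator (A 4) u)))"
proof -
  let ?F = "\<lambda>u t. indicator W (t 1 + u) * indicator (A 1) (t 1 + u) *
    (indicator W (t 2 + u) * indicator (A 2) (t 2 + u) * (indicator W (t 3 + u) * indicator (A 3) (t 3 + u))) :: real"
  have "fact_cumulant M N 4 (\<lambda>l. A l \<inter> W) = lam * I (\<lambda>u. indicator (A 4) u * sint (\<gamma> 4) (?F u))"
  proof (rule cumulant_integral)
    have "{1..<4::nat} = {1, 2, 3}" by auto
    then show "?F u t * indicator (A 4) u = indicator (A 4) u * of_bool (\<forall>l\<in>{1..<4}. t l + u \<in> A l \<inter> W)" for t u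
      by (auto simp: indicator_def)
    show "(\<lambda>u. indicator (A 4) u * sint (\<gamma> 4) (?F u)) \<in> borel_measurable borel"
      by (intro borel_measurable_times sint_measurable) (auto simp del: One_nat_def)
  qed (use A in auto)
  then show ?thesis unfolding G4_def sint_cmult[symmetric] by (simp only: mult_ac)
qed

lemma L1_eq:
  assumes "f \<in> bm borel"
  shows "L1 f = lam * I f"
proof (rule bpc_fun_eq_sets[OF bpc_base(1) _ _ _ assms])
  show "bpc_fun borel (\<lambda>f. lam * I f)"
    by (intro bpc_mult[OF bm_const] bpc_int[OF finite_LW] bpc_subst) measurable
  fix A :: "'a set" assume A [measurable]: "A \<in> sets borel"
  have "L1 (indicator A) = (\<integral>\<omega>. real (card (N \<omega> \<inter> (W \<inter> A))) \<partial>M)"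
    unfolding L1_def
  proof (rule Bochner_Integration.integral_cong[OF refl])
    fix \<omega> assume w: "\<omega> \<in> space M"
    show "(\<Sum>x\<in>N \<omega> \<inter> W. indicator A x) = real (card (N \<omega> \<inter> (W \<inter> A)))"
      using arg_cong[OF sum_indicator_eq_card[OF finite_tuples(1)[OF w], of A], of real]
      by (simp add: Int_assoc indicator_def)
  qed
  also have "\<dots> = lam * measure lborel (W \<inter> A)"
    by (rule expectation_card) (auto intro: bounded_Int W_bounded)
  also have "measure lborel (W \<inter> A) = I (indicator A)"
    by (subst integral_window_measure) (simp_all add: indicator_inter_arith[symmetric])
  finally show "L1 (indicator A) = lam * I (indicator A)" .
qed simp

lemma distinct_indices:
  "distinct [1, 2::nat]" "distinct [1, 3::nat]" "distinct [2, 3::nat]" "distinct [1, 4::nat]"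
  "distinct [2, 4::nat]" "distinct [3, 4::nat]" "distinct [1, 2, 3::nat]" "distinct [1, 2, 4::nat]"
  "distinct [1, 3, 4::nat]" "distinct [2, 3, 4::nat]" "distinct [1, 2, 3, 4::nat]"
  by simp_all

lemma L2_rect:
  assumes [measurable]: "a \<in> sets borel" "b \<in> sets borel"
  shows "L2 (\<lambda>x y. indicator a x * indicator b y) =
    G2 (\<lambda>x y. indicator a x * indicator b y) + (lam * I (indicator a)) * (lam * I (indicator b))"
proof -
  define A where "A = (\<lambda>l::nat. if l = 1 then a else b)"
  have A: "A l \<in> sets borel" for l by (simp add: A_def)
  note c = fact_cumulant_2[OF refl, of M N "\<lambda>l. A l \<inter> W", unfolded cumulant_2[OF A] moment_1[OF A]]
  note c' = c[unfolded moment_2[of A 1 2, OF A distinct_indices(1)]]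
  show ?thesis using c' by (simp add: A_def)
qed

text \<open>Both sides are functionals continuous under bounded convergence, so the relation between
  moments and cumulants extends from rectangles to all bounded measurable \<open>f\<close>. The
  expansions of orders three and four follow the same pattern.\<close>

lemma L2_eq:
  assumes "(\<lambda>p. f (fst p) (snd p)) \<in> bm bor2"
  shows "L2 f = G2 f + lam * (lam * I (\<lambda>x. I (\<lambda>y. f x y)))"
proof -
  have "L2 (\<lambda>x y. F (x, y)) = G2 (\<lambda>x y. F (x, y)) + lam * (lam * I (\<lambda>x. I (\<lambda>y. F (x, y))))"
    if F: "F \<in> bm bor2" for F
  proof (rule bpc_fun_eq_pair[OF bpc_base(2) _ _ _ _ F])
    show "bpc_fun bor2 (\<lambda>F. G2 (\<lambda>x y. F (x, y)) + lam * (lam * I (\<lambda>x. I (\<lambda>y. F (x, y)))))"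
      by (intro bpc_add bpc_mult[OF bm_const] bpc_G2 bpc_int[OF finite_LW] bpc_subst) measurable
    fix a b :: "'a set" assume "a \<in> sets borel" "b \<in> sets borel"
    then show "L2 (\<lambda>x y. indicator (a \<times> b) (x, y)) = G2 (\<lambda>x y. indicator (a \<times> b) (x, y)) +
        lam * (lam * I (\<lambda>x. I (\<lambda>y. indicator (a \<times> b) (x, y))))"
      using L2_rect by (simp add: indicator_times)
  qed simp_all
  from this[OF assms] show ?thesis by simp
qed

text \<open>The pairs (1,2) and (2,3) keep their moment functional, while the pair (1,3) is replaced
  by its cumulant. This absorbs one of the two subtracted products of intensities and leaves
  \<open>lam ^ 3\<close> with coefficient -1. The form suits integrands
  \<open>f x y * f y z\<close>, where the neighbouring pairs are the ones that cancel later.\<close>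

lemma L3_eq:
  assumes "(\<lambda>p. f (fst p) (fst (snd p)) (snd (snd p))) \<in> bm bor3"
  shows "L3 f = G3 f + lam * L2 (\<lambda>x y. I (\<lambda>z. f x y z)) + lam * L2 (\<lambda>y z. I (\<lambda>x. f x y z))
    + lam * G2 (\<lambda>x z. I (\<lambda>y. f x y z)) - lam ^ 3 * I (\<lambda>y. I (\<lambda>x. I (\<lambda>z. f x y z)))"
proof -
  have "L3 (\<lambda>x y z. F (x, y, z)) = G3 (\<lambda>x y z. F (x, y, z)) + lam * L2 (\<lambda>x y. I (\<lambda>z. F (x, y, z)))
    + lam * L2 (\<lambda>y z. I (\<lambda>x. F (x, y, z))) + lam * G2 (\<lambda>x z. I (\<lambda>y. F (x, y, z)))
    - lam ^ 3 * I (\<lambda>y. I (\<lambda>x. I (\<lambda>z. F (x, y, z))))"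
    if F: "F \<in> bm bor3" for F
  proof (rule bpc_fun_eq_triple[OF bpc_base(3) _ _ _ _ _ F])
    show "bpc_fun bor3 (\<lambda>F. G3 (\<lambda>x y z. F (x, y, z)) + lam * L2 (\<lambda>x y. I (\<lambda>z. F (x, y, z)))
    + lam * L2 (\<lambda>y z. I (\<lambda>x. F (x, y, z))) + lam * G2 (\<lambda>x z. I (\<lambda>y. F (x, y, z)))
    - lam ^ 3 * I (\<lambda>y. I (\<lambda>x. I (\<lambda>z. F (x, y, z)))))"
      by (intro bpc_add bpc_diff bpc_mult[OF bm_const] bpc_G3 bpc_L2 bpc_G2 bpc_int[OF finite_LW] bpc_subst) measurable
    fix a b c :: "'a set" assume abc [measurable]: "a \<in> sets borel" "b \<in> sets borel" "c \<in> sets borel"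
    define A where "A = (\<lambda>l::nat. if l = 1 then a else if l = 2 then b else c)"
    have A: "A l \<in> sets borel" for l by (simp add: A_def)
    note c = fact_cumulant_3[OF refl, of M N "\<lambda>l. A l \<inter> W", unfolded cumulant_3[OF A] moment_1[OF A]]
    note c' = c[unfolded moment_2[of A 1 2, OF A distinct_indices(1)] moment_2[of A 1 3, OF A distinct_indices(2)]
        moment_2[of A 2 3, OF A distinct_indices(3)] moment_3[of A 1 2 3, OF A distinct_indices(7)]]
    have 2: "L2 (\<lambda>x y. indicator a x * (indicator b y * k)) = k * L2 (\<lambda>x y. indicator a x * indicator b y)" for a b k
      unfolding L2_cmult[symmetric] by (simp only: mult_ac)
    have 3: "L2 (\<lambda>x y. k * (indicator a x * indicator b y)) = k * L2 (\<lambda>x y. indicator a x * indicator b y)" for a b k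
      by (rule L2_cmult)
    have 4: "G2 (\<lambda>x y. indicator a x * (k * indicator b y)) = k * G2 (\<lambda>x y. indicator a x * indicator b y)" for a b k
      unfolding G2_cmult[symmetric] by (simp only: mult_ac)
    show "L3 (\<lambda>x y z. indicator (a \<times> b \<times> c) (x, y, z)) = G3 (\<lambda>x y z. indicator (a \<times> b \<times> c) (x, y, z)) +
        lam * L2 (\<lambda>x y. I (\<lambda>z. indicator (a \<times> b \<times> c) (x, y, z)))
        + lam * L2 (\<lambda>y z. I (\<lambda>x. indicator (a \<times> b \<times> c) (x, y, z))) + lam * G2 (\<lambda>x z. I (\<lambda>y. indicator (a \<times> b \<times> c) (x, y, z)))
        - lam ^ 3 * I (\<lambda>y. I (\<lambda>x. I (\<lambda>z. indicator (a \<times> b \<times> c) (x, y, z))))"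
      unfolding indicator_times fst_conv snd_conv Bochner_Integration.integral_mult_right_zero Bochner_Integration.integral_mult_left_zero 2 3 4
      using c' L2_rect[OF abc(1,3)] by (simp add: A_def algebra_simps power3_eq_cube)
  qed simp_all
  from this[OF assms] show ?thesis by simp
qed

text \<open>Products of two pair moments are expanded by \<open>L2_rect\<close>. Each of the six
  single pair cumulants then has coefficient 1 - 2 = -1, and the product of four intensities has 3 -
  12 + 6 = -3. Third-order moments are left unexpanded because they cancel as a whole in the
  variance.\<close>

lemma L4_eq:
  assumes "(\<lambda>p. f (fst p) (fst (snd p)) (fst (snd (snd p))) (snd (snd (snd p)))) \<in> bm bor4"
  shows "L4 f = G4 f
    + lam * L3 (\<lambda>x y z. I (\<lambda>u. f x y z u)) + lam * L3 (\<lambda>x y u. I (\<lambda>z. f x y z u))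
    + lam * L3 (\<lambda>x z u. I (\<lambda>y. f x y z u)) + lam * L3 (\<lambda>y z u. I (\<lambda>x. f x y z u))
    + G2 (\<lambda>x y. G2 (\<lambda>z u. f x y z u)) + G2 (\<lambda>x z. G2 (\<lambda>y u. f x y z u)) + G2 (\<lambda>x u. G2 (\<lambda>y z. f x y z u))
    - lam\<^sup>2 * G2 (\<lambda>x y. I (\<lambda>z. I (\<lambda>u. f x y z u))) - lam\<^sup>2 * G2 (\<lambda>z u. I (\<lambda>x. I (\<lambda>y. f x y z u)))
    - lam\<^sup>2 * G2 (\<lambda>x z. I (\<lambda>y. I (\<lambda>u. f x y z u))) - lam\<^sup>2 * G2 (\<lambda>y u. I (\<lambda>x. I (\<lambda>z. f x y z u)))
    - lam\<^sup>2 * G2 (\<lambda>x u. I (\<lambda>y. I (\<lambda>z. f x y z u))) - lam\<^sup>2 * G2 (\<lambda>y z. I (\<lambda>x. I (\<lambda>u. f x y z u)))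
    - 3 * lam ^ 4 * I (\<lambda>x. I (\<lambda>y. I (\<lambda>z. I (\<lambda>u. f x y z u))))"
proof -
  let ?R = "\<lambda>f. G4 f
    + lam * L3 (\<lambda>x y z. I (\<lambda>u. f x y z u)) + lam * L3 (\<lambda>x y u. I (\<lambda>z. f x y z u))
    + lam * L3 (\<lambda>x z u. I (\<lambda>y. f x y z u)) + lam * L3 (\<lambda>y z u. I (\<lambda>x. f x y z u))
    + G2 (\<lambda>x y. G2 (\<lambda>z u. f x y z u)) + G2 (\<lambda>x z. G2 (\<lambda>y u. f x y z u)) + G2 (\<lambda>x u. G2 (\<lambda>y z. f x y z u))
    - lam\<^sup>2 * G2 (\<lambda>x y. I (\<lambda>z. I (\<lambda>u. f x y z u))) - lam\<^sup>2 * G2 (\<lambda>z u. I (\<lambda>x. I (\<lambda>y. f x y z u)))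
    - lam\<^sup>2 * G2 (\<lambda>x z. I (\<lambda>y. I (\<lambda>u. f x y z u))) - lam\<^sup>2 * G2 (\<lambda>y u. I (\<lambda>x. I (\<lambda>z. f x y z u)))
    - lam\<^sup>2 * G2 (\<lambda>x u. I (\<lambda>y. I (\<lambda>z. f x y z u))) - lam\<^sup>2 * G2 (\<lambda>y z. I (\<lambda>x. I (\<lambda>u. f x y z u)))
    - 3 * lam ^ 4 * I (\<lambda>x. I (\<lambda>y. I (\<lambda>z. I (\<lambda>u. f x y z u))))"
  have "L4 (\<lambda>x y z u. F (x, y, z, u)) = ?R (\<lambda>x y z u. F (x, y, z, u))"
    if F: "F \<in> bm bor4" for F
  proof (rule bpc_fun_eq_quad[OF bpc_base(4) _ _ _ _ _ _ F])
    show "bpc_fun bor4 (\<lambda>F. ?R (\<lambda>x y z u. F (x, y, z, u)))"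
      by (intro bpc_add bpc_diff bpc_mult[OF bm_const] bpc_G4 bpc_L3 bpc_G2 bpc_int[OF finite_LW] bpc_subst) measurable
    fix a b c d :: "'a set"
    assume abc [measurable]: "a \<in> sets borel" "b \<in> sets borel" "c \<in> sets borel" "d \<in> sets borel"
    define A where "A = (\<lambda>l::nat. if l = 1 then a else if l = 2 then b else if l = 3 then c else d)"
    have A: "A l \<in> sets borel" for l by (simp add: A_def)
    note c = fact_cumulant_4[OF refl, of M N "\<lambda>l. A l \<inter> W", unfolded cumulant_4[OF A] moment_1[OF A]]
    note c' = c[unfolded moment_2[of A 1 2, OF A distinct_indices(1)] moment_2[of A 1 3, OF A distinct_indices(2)]
        moment_2[of A 1 4, OF A distinct_indices(4)] moment_2[of A 2 4, OF A distinct_indices(5)] moment_2[of A 3 4, OF A distinct_indices(6)]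
        moment_2[of A 2 3, OF A distinct_indices(3)] moment_3[of A 1 2 3, OF A distinct_indices(7)]
        moment_3[of A 1 2 4, OF A distinct_indices(8)] moment_3[of A 1 3 4, OF A distinct_indices(9)]
        moment_3[of A 2 3 4, OF A distinct_indices(10)] moment_4[of A 1 2 3 4, OF A distinct_indices(11)]]
    have L: "L3 (\<lambda>x y z. indicator a x * (indicator b y * (indicator c z * k))) = k * L3 (\<lambda>x y z. indicator a x * (indicator b y * indicator c z))"
      "L3 (\<lambda>x y z. indicator a x * (indicator b y * (k * indicator c z))) = k * L3 (\<lambda>x y z. indicator a x * (indicator b y * indicator c z))"
      "L3 (\<lambda>x y z. indicator a x * (k * (indicator b y * indicator c z))) = k * L3 (\<lambda>x y z. indicator a x * (indicator b y * indicator c z))"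
      "L3 (\<lambda>x y z. k * (indicator a x * (indicator b y * indicator c z))) = k * L3 (\<lambda>x y z. indicator a x * (indicator b y * indicator c z))" for a b c k
      unfolding L3_cmult[symmetric] by (simp_all only: mult_ac)
    have G: "G2 (\<lambda>x y. k1 * (k2 * (indicator a x * indicator b y))) = k1 * k2 * G2 (\<lambda>x y. indicator a x * indicator b y)"
      "G2 (\<lambda>x y. k1 * (indicator a x * (k2 * indicator b y))) = k1 * k2 * G2 (\<lambda>x y. indicator a x * indicator b y)"
      "G2 (\<lambda>x y. k1 * (indicator a x * (indicator b y * k2))) = k1 * k2 * G2 (\<lambda>x y. indicator a x * indicator b y)"
      "G2 (\<lambda>x y. indicator a x * (k1 * (k2 * indicator b y))) = k1 * k2 * G2 (\<lambda>x y. indicator a x * indicator b y)"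
      "G2 (\<lambda>x y. indicator a x * (k1 * (indicator b y * k2))) = k1 * k2 * G2 (\<lambda>x y. indicator a x * indicator b y)"
      "G2 (\<lambda>x y. indicator a x * (indicator b y * (k1 * k2))) = k1 * k2 * G2 (\<lambda>x y. indicator a x * indicator b y)"
      "G2 (\<lambda>x y. indicator a x * (indicator b y * k2)) = k2 * G2 (\<lambda>x y. indicator a x * indicator b y)"
      "G2 (\<lambda>x y. k1 * (indicator a x * indicator b y)) = k1 * G2 (\<lambda>x y. indicator a x * indicator b y)" for a b k1 k2
      unfolding G2_cmult[symmetric] by (simp_all only: mult_ac)
    have g1: "G2 (\<lambda>x y. G2 (\<lambda>z u. indicator a x * (indicator b y * (indicator c z * indicator d u)))) =
        G2 (\<lambda>x y. indicator a x * indicator b y) * G2 (\<lambda>z u. indicator c z * indicator d u)"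
      unfolding G2_cmult unfolding G(7) by simp
    have g2: "G2 (\<lambda>x z. G2 (\<lambda>y u. indicator a x * (indicator b y * (indicator c z * indicator d u)))) =
        G2 (\<lambda>x z. indicator a x * indicator c z) * G2 (\<lambda>y u. indicator b y * indicator d u)"
    proof -
      have "G2 (\<lambda>y u. indicator a x * (indicator b y * (indicator c z * indicator d u))) =
          G2 (\<lambda>y u. indicator b y * indicator d u) * (indicator a x * indicator c z)" for x z
        unfolding mult.commute[of "G2 _"] G2_cmult[symmetric] by (simp only: mult_ac)
      note e = this
      show ?thesis unfolding e G2_cmult by (rule mult.commute)
    qed
    have g3: "G2 (\<lambda>x u. G2 (\<lambda>y z. indicator a x * (indicator b y * (indicator c z * indicator d u)))) =
        G2 (\<lambda>x u. indicator a x * indicator d u) * G2 (\<lambda>y z. indicator b y * indicator c z)"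
    proof -
      have "G2 (\<lambda>y z. indicator a x * (indicator b y * (indicator c z * indicator d u))) =
          G2 (\<lambda>y z. indicator b y * indicator c z) * (indicator a x * indicator d u)" for x u
        unfolding mult.commute[of "G2 _"] G2_cmult[symmetric] by (simp only: mult_ac)
      note e = this
      show ?thesis unfolding e G2_cmult by (rule mult.commute)
    qed
    show "L4 (\<lambda>x y z u. indicator (a \<times> b \<times> c \<times> d) (x, y, z, u)) = ?R (\<lambda>x y z u. indicator (a \<times> b \<times> c \<times> d) (x, y, z, u))"
      unfolding indicator_times fst_conv snd_conv g1 g2 g3 unfolding Bochner_Integration.integral_mult_right_zero Bochner_Integration.integral_mult_left_zero L G
      using c' L2_rect[OF abc(1,2)] L2_rect[OF abc(1,3)] L2_rect[OF abc(1,4)] L2_rect[OF abc(2,3)] L2_rect[OF abc(2,4)] L2_rect[OF abc(3,4)]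
      by (simp add: A_def algebra_simps power2_eq_square power4_eq_xxxx)
  qed simp_all
  from this[OF assms] show ?thesis by simp
qed

end

subsection \<open>The variance of the non-linear part of a pair sum\<close>

context
  fixes S :: "'b set" and f :: "'b \<Rightarrow> 'b \<Rightarrow> real"
  assumes S: "finite S" and sym: "\<And>x y. f x y = f y x"
begin

lemma sum_sum_delta:
  assumes "x \<in> S"
  shows "(\<Sum>z\<in>S. \<Sum>u\<in>S. if z = x then g u else 0) = (\<Sum>u\<in>S. g u :: real)"
    and "(\<Sum>z\<in>S. \<Sum>u\<in>S. if u = x then g z else 0) = (\<Sum>u\<in>S. g u :: real)"
proof -
  show "(\<Sum>z\<in>S. \<Sum>u\<in>S. if u = x then g z else 0) = (\<Sum>u\<in>S. g u :: real)"
    using assms S by simp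
  then show "(\<Sum>z\<in>S. \<Sum>u\<in>S. if z = x then g u else 0) = (\<Sum>u\<in>S. g u :: real)"
    by (subst sum.swap)
qed

text \<open>The factor 2 counts the two points of the pair with which \<open>z\<close> may coincide;
  by symmetry of \<open>f\<close> both coincidences give the same sum.\<close>

lemma pair_sum_times_sum:
  "(\<Sum>x\<in>S. \<Sum>y\<in>S. if x \<noteq> y then f x y else 0) * (\<Sum>z\<in>S. F z) =
    (\<Sum>x\<in>S. \<Sum>y\<in>S. \<Sum>z\<in>S. if distinct [x, y, z] then f x y * F z else 0)
    + 2 * (\<Sum>x\<in>S. \<Sum>y\<in>S. if x \<noteq> y then f x y * F y else 0)"
proof -
  let ?e = "\<lambda>x y. if x \<noteq> y then f x y else 0"
  have "(\<Sum>x\<in>S. \<Sum>y\<in>S. ?e x y) * (\<Sum>z\<in>S. F z) = (\<Sum>x\<in>S. \<Sum>y\<in>S. \<Sum>z\<in>S. ?e x y * F z)"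
    by (simp only: sum_distrib_right) (simp only: sum_distrib_left)
  also have "\<dots> = (\<Sum>x\<in>S. \<Sum>y\<in>S. \<Sum>z\<in>S. (if distinct [x, y, z] then f x y * F z else 0)
      + ((if z = x then ?e x y * F x else 0) + (if z = y then ?e x y * F y else 0)))"
    by (intro sum.cong refl) auto
  also have "\<dots> = (\<Sum>x\<in>S. \<Sum>y\<in>S. \<Sum>z\<in>S. if distinct [x, y, z] then f x y * F z else 0)
      + ((\<Sum>x\<in>S. \<Sum>y\<in>S. ?e x y * F x) + (\<Sum>x\<in>S. \<Sum>y\<in>S. ?e x y * F y))"
    unfolding sum.distrib using S by (simp only: sum.delta) simp
  also have "(\<Sum>x\<in>S. \<Sum>y\<in>S. ?e x y * F x) = (\<Sum>x\<in>S. \<Sum>y\<in>S. ?e x y * F y)"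
    by (subst sum.swap) (intro sum.cong refl, use sym in auto)
  also have "(\<Sum>x\<in>S. \<Sum>y\<in>S. ?e x y * F y) = (\<Sum>x\<in>S. \<Sum>y\<in>S. if x \<noteq> y then f x y * F y else 0)"
    by (intro sum.cong refl) auto
  finally show ?thesis by simp
qed

text \<open>Two ordered pairs can share exactly one point in four ways and both points in two ways,
  whence the coefficients 4 and 2.\<close>

lemma pair_sum_square:
  "(\<Sum>x\<in>S. \<Sum>y\<in>S. if x \<noteq> y then f x y else 0)\<^sup>2 =
    (\<Sum>x\<in>S. \<Sum>y\<in>S. \<Sum>z\<in>S. \<Sum>u\<in>S. if distinct [x, y, z, u] then f x y * f z u else 0)
    + 4 * (\<Sum>x\<in>S. \<Sum>y\<in>S. \<Sum>z\<in>S. if distinct [x, y, z] then f x y * f y z else 0)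
    + 2 * (\<Sum>x\<in>S. \<Sum>y\<in>S. if x \<noteq> y then (f x y)\<^sup>2 else 0)"
proof -
  let ?e = "\<lambda>x y. if x \<noteq> y then f x y else 0"
  let ?d = "\<lambda>x y z (c::real). if distinct [x, y, z] then c else 0"
  have "(\<Sum>x\<in>S. \<Sum>y\<in>S. ?e x y)\<^sup>2 = (\<Sum>x\<in>S. \<Sum>y\<in>S. \<Sum>z\<in>S. \<Sum>u\<in>S. ?e x y * ?e z u)"
    unfolding power2_eq_square by (simp only: sum_distrib_right) (simp only: sum_distrib_left)
  also have "\<dots> = (\<Sum>x\<in>S. \<Sum>y\<in>S. \<Sum>z\<in>S. \<Sum>u\<in>S. (if distinct [x, y, z, u] then f x y * f z u else 0)
      + ((if z = x then ?d x y u (f x y * f x u) else 0) + ((if z = y then ?d x y u (f x y * f y u) else 0)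
      + ((if u = x then ?d x y z (f x y * f z x) else 0) + ((if u = y then ?d x y z (f x y * f z y) else 0)
      + ((if z = x then if u = y then (?e x y)\<^sup>2 else 0 else 0) + (if z = y then if u = x then (?e x y)\<^sup>2 else 0 else 0)))))))"
    by (intro sum.cong refl) (use sym in \<open>auto simp: power2_eq_square\<close>)
  also have "\<dots> = (\<Sum>x\<in>S. \<Sum>y\<in>S. \<Sum>z\<in>S. \<Sum>u\<in>S. if distinct [x, y, z, u] then f x y * f z u else 0)
      + ((\<Sum>x\<in>S. \<Sum>y\<in>S. \<Sum>z\<in>S. ?d x y z (f x y * f x z)) + ((\<Sum>x\<in>S. \<Sum>y\<in>S. \<Sum>z\<in>S. ?d x y z (f x y * f y z))
      + ((\<Sum>x\<in>S. \<Sum>y\<in>S. \<Sum>z\<in>S. ?d x y z (f x y * f z x)) + ((\<Sum>x\<in>S. \<Sum>y\<in>S. \<Sum>z\<in>S. ?d x y z (f x y * f z y))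
      + ((\<Sum>x\<in>S. \<Sum>y\<in>S. (?e x y)\<^sup>2) + (\<Sum>x\<in>S. \<Sum>y\<in>S. (?e x y)\<^sup>2))))))"
    unfolding sum.distrib by (simp only: sum_sum_delta cong: sum.cong) (simp add: S)
  also have "(\<Sum>x\<in>S. \<Sum>y\<in>S. \<Sum>z\<in>S. ?d x y z (f x y * f x z)) = (\<Sum>x\<in>S. \<Sum>y\<in>S. \<Sum>z\<in>S. ?d x y z (f x y * f y z))"
    by (subst sum.swap) (intro sum.cong refl, use sym in auto)
  also have "(\<Sum>x\<in>S. \<Sum>y\<in>S. \<Sum>z\<in>S. ?d x y z (f x y * f z x)) = (\<Sum>x\<in>S. \<Sum>y\<in>S. \<Sum>z\<in>S. ?d x y z (f x y * f y z))"
    by (subst sum.swap) (intro sum.cong refl, use sym in auto)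
  also have "(\<Sum>x\<in>S. \<Sum>y\<in>S. \<Sum>z\<in>S. ?d x y z (f x y * f z y)) = (\<Sum>x\<in>S. \<Sum>y\<in>S. \<Sum>z\<in>S. ?d x y z (f x y * f y z))"
    by (intro sum.cong refl, use sym in auto)
  also have "(\<Sum>x\<in>S. \<Sum>y\<in>S. (?e x y)\<^sup>2) = (\<Sum>x\<in>S. \<Sum>y\<in>S. if x \<noteq> y then (f x y)\<^sup>2 else 0)"
    by (intro sum.cong refl) auto
  finally show ?thesis by simp
qed

end

lemma sum_square:
  assumes S: "finite S"
  shows "(\<Sum>x\<in>S. F x)\<^sup>2 = (\<Sum>x\<in>S. \<Sum>y\<in>S. if x \<noteq> y then F x * F y else 0) + (\<Sum>x\<in>S. (F x)\<^sup>2 :: real)"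
proof -
  have "(\<Sum>x\<in>S. F x)\<^sup>2 = (\<Sum>x\<in>S. \<Sum>y\<in>S. (if x \<noteq> y then F x * F y else 0) + (if y = x then (F x)\<^sup>2 else 0))"
    unfolding power2_eq_square sum_product by (intro sum.cong refl) auto
  also have "\<dots> = (\<Sum>x\<in>S. \<Sum>y\<in>S. if x \<noteq> y then F x * F y else 0) + (\<Sum>x\<in>S. (F x)\<^sup>2)"
    unfolding sum.distrib using S by simp
  finally show ?thesis .
qed

context b4_window
begin

lemma bm_I:
  assumes "(\<lambda>p. e (fst p) (snd p)) \<in> bm (Y \<Otimes>\<^sub>M borel)"
  shows "(\<lambda>y. I (\<lambda>z. e y z)) \<in> bm Y"
proof -
  obtain C where C: "0 \<le> C" "\<And>y z. \<bar>e y z\<bar> \<le> C"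
    using bmE[OF assms] by (metis fst_conv snd_conv)
  interpret finite_measure LW by (rule finite_LW)
  have eq: "sets (Y \<Otimes>\<^sub>M LW) = sets (Y \<Otimes>\<^sub>M borel)" by (intro sets_pair_measure_cong) auto
  have "(\<lambda>(y, z). e y z) \<in> borel_measurable (Y \<Otimes>\<^sub>M LW)"
    using bm_measurable[OF assms] by (simp add: split_beta' measurable_cong_sets[OF eq refl])
  then have "(\<lambda>y. I (\<lambda>z. e y z)) \<in> borel_measurable Y"
    by (rule borel_measurable_lebesgue_integral)
  then show ?thesis using abs_integral_le_bound[OF finite_LW C(2)] by (rule bmI)
qed

lemma bm_integrable_LW: "f \<in> bm borel \<Longrightarrow> integrable LW f"
  by (rule bm_integrable[OF finite_LW]) (simp add: bm_def cong: measurable_cong_sets)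

abbreviation S1 :: "('a \<Rightarrow> real) \<Rightarrow> 'w \<Rightarrow> real" where
  "S1 F \<omega> \<equiv> \<Sum>x\<in>N \<omega> \<inter> W. F x"

abbreviation S2 :: "('a \<Rightarrow> 'a \<Rightarrow> real) \<Rightarrow> 'w \<Rightarrow> real" where
  "S2 f \<omega> \<equiv> \<Sum>t\<in>point_pairs W (N \<omega>). f (fst t) (snd t)"

abbreviation S3 :: "('a \<Rightarrow> 'a \<Rightarrow> 'a \<Rightarrow> real) \<Rightarrow> 'w \<Rightarrow> real" where
  "S3 f \<omega> \<equiv> \<Sum>t\<in>point_triples W (N \<omega>). f (fst t) (fst (snd t)) (snd (snd t))"

abbreviation S4 :: "('a \<Rightarrow> 'a \<Rightarrow> 'a \<Rightarrow> 'a \<Rightarrow> real) \<Rightarrow> 'w \<Rightarrow> real" where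
  "S4 f \<omega> \<equiv> \<Sum>t\<in>point_quads W (N \<omega>). f (fst t) (fst (snd t)) (fst (snd (snd t))) (snd (snd (snd t)))"

lemma G2_multc: "G2 (\<lambda>x y. f x y * c) = c * G2 f"
  unfolding G2_cmult[symmetric] by (simp only: mult.commute)

lemma variance_linear:
  assumes F: "F \<in> bm borel"
  shows "integrable M (\<lambda>\<omega>. (S1 F \<omega> - lam * I F)\<^sup>2)"
    and "(\<integral>\<omega>. (S1 F \<omega> - lam * I F)\<^sup>2 \<partial>M) = lam * I (\<lambda>x. (F x)\<^sup>2) + G2 (\<lambda>x y. F x * F y)"
proof -
  have F2: "(\<lambda>p. F (fst p) * F (snd p)) \<in> bm bor2"
    by (intro bm_mult bm_compose[OF F]) auto
  have Fs: "(\<lambda>x. (F x)\<^sup>2) \<in> bm borel"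
    unfolding power2_eq_square by (intro bm_mult F)
  have eq: "(S1 F \<omega> - lam * I F)\<^sup>2 = S2 (\<lambda>x y. F x * F y) \<omega> + S1 (\<lambda>x. (F x)\<^sup>2) \<omega> - 2 * (lam * I F) * S1 F \<omega> + (lam * I F)\<^sup>2"
    if "\<omega> \<in> space M" for \<omega>
    using finite_tuples(1)[OF that] by (simp add: power2_diff sum_square sum_point_pairs cong: if_cong)
  note i = integrable_L1[OF F] integrable_L1[OF Fs] integrable_L2[OF F2]
  have "integrable M (\<lambda>\<omega>. S2 (\<lambda>x y. F x * F y) \<omega> + S1 (\<lambda>x. (F x)\<^sup>2) \<omega> - 2 * (lam * I F) * S1 F \<omega> + (lam * I F)\<^sup>2)"
    by (intro Bochner_Integration.integrable_add Bochner_Integration.integrable_diff integrable_mult_right i integrable_const)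
  then show "integrable M (\<lambda>\<omega>. (S1 F \<omega> - lam * I F)\<^sup>2)"
    by (rule Bochner_Integration.integrable_cong[THEN iffD1, rotated 2]) (use eq in auto)
  have "(\<integral>\<omega>. (S1 F \<omega> - lam * I F)\<^sup>2 \<partial>M) =
      (\<integral>\<omega>. S2 (\<lambda>x y. F x * F y) \<omega> + S1 (\<lambda>x. (F x)\<^sup>2) \<omega> - 2 * (lam * I F) * S1 F \<omega> + (lam * I F)\<^sup>2 \<partial>M)"
    using eq by (intro Bochner_Integration.integral_cong) auto
  also have "\<dots> = L2 (\<lambda>x y. F x * F y) + L1 (\<lambda>x. (F x)\<^sup>2) - 2 * (lam * I F) * L1 F + (lam * I F)\<^sup>2"
    using i by (simp add: L1_def L2_def prob_space)
  also have "\<dots> = lam * I (\<lambda>x. (F x)\<^sup>2) + G2 (\<lambda>x y. F x * F y)"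
    unfolding L2_eq[OF F2] L1_eq[OF F] L1_eq[OF Fs] by (simp add: power2_eq_square algebra_simps)
  finally show "(\<integral>\<omega>. (S1 F \<omega> - lam * I F)\<^sup>2 \<partial>M) = lam * I (\<lambda>x. (F x)\<^sup>2) + G2 (\<lambda>x y. F x * F y)" .
qed

text \<open>The subtracted term \<open>2 * lam * (S1 F \<omega> - lam * I F)\<close> is the
  first-order projection of the pair sum, each pair contributing through either of its points. After
  squaring and expanding, all terms in which the pairs interact only through \<open>F\<close>
  cancel. In what survives, the two pairs are tied together by a cumulant, by two second cumulants
  or by a common point.\<close>

lemma variance_pairs:
  fixes f :: "'a \<Rightarrow> 'a \<Rightarrow> real"
  assumes f: "(\<lambda>p. f (fst p) (snd p)) \<in> bm bor2" and sym: "\<And>x y. f x y = f y x"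
  defines "F \<equiv> \<lambda>x. I (\<lambda>y. f x y)"
  defines "D \<equiv> \<lambda>\<omega>. S2 f \<omega> - L2 f - 2 * lam * (S1 F \<omega> - lam * I F)"
  shows "integrable M (\<lambda>\<omega>. (D \<omega>)\<^sup>2)"
    and "(\<integral>\<omega>. (D \<omega>)\<^sup>2 \<partial>M) = G4 (\<lambda>x y z u. f x y * f z u) + 2 * G2 (\<lambda>x z. G2 (\<lambda>y u. f x y * f z u))
      + 4 * G3 (\<lambda>x y z. f x y * f y z) + 4 * lam * G2 (\<lambda>x z. I (\<lambda>y. f x y * f y z)) + 2 * L2 (\<lambda>x y. (f x y)\<^sup>2)"
proof -
  have fc: "(\<lambda>q. f (a q) (b q)) \<in> bm Z" if "a \<in> borel_measurable Z" "b \<in> borel_measurable Z" for a b and Z :: "'z measure"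
    using bm_compose[OF f measurable_Pair[OF that]] by simp
  have F: "F \<in> bm borel" unfolding F_def by (rule bm_I[OF f])
  have Fc: "(\<lambda>q. F (a q)) \<in> bm Z" if "a \<in> borel_measurable Z" for a and Z :: "'z measure"
    using bm_compose[OF F that] .
  have b4: "(\<lambda>p. f (fst p) (fst (snd p)) * f (fst (snd (snd p))) (snd (snd (snd p)))) \<in> bm bor4"
    by (intro bm_mult fc) measurable
  have b3: "(\<lambda>p. f (fst p) (fst (snd p)) * f (fst (snd p)) (snd (snd p))) \<in> bm bor3"
    by (intro bm_mult fc) measurable
  have b3': "(\<lambda>p. f (fst p) (fst (snd p)) * F (snd (snd p))) \<in> bm bor3"
    by (intro bm_mult fc Fc) measurable
  have b2: "(\<lambda>p. (f (fst p) (snd p))\<^sup>2) \<in> bm bor2"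
    unfolding power2_eq_square by (intro bm_mult f)
  have b2': "(\<lambda>p. f (fst p) (snd p) * F (snd p)) \<in> bm bor2"
    by (intro bm_mult f Fc) measurable
  have b2'': "(\<lambda>p. F (fst p) * F (snd p)) \<in> bm bor2"
    by (intro bm_mult Fc) measurable
  have b1: "(\<lambda>x. (F x)\<^sup>2) \<in> bm borel"
    unfolding power2_eq_square by (intro bm_mult F)
  \<comment> \<open>The constants of \<open>D\<close> collected: \<open>- L2 f\<close> contributes
    one negative copy of the squared intensity term, the centring of \<open>S1 F\<close> two
    positive ones.\<close>
  let ?c = "lam * (lam * I F) - G2 f"
  have L2f: "L2 f = G2 f + lam * (lam * I F)"
    using L2_eq[OF f] by (simp add: F_def)
  have Deq: "D \<omega> = S2 f \<omega> - 2 * lam * S1 F \<omega> + ?c" for \<omega>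
    unfolding D_def L2f by (simp add: algebra_simps)
  let ?R = "\<lambda>\<omega>. S4 (\<lambda>x y z u. f x y * f z u) \<omega> + 4 * S3 (\<lambda>x y z. f x y * f y z) \<omega> + 2 * S2 (\<lambda>x y. (f x y)\<^sup>2) \<omega>
      + 4 * lam\<^sup>2 * S2 (\<lambda>x y. F x * F y) \<omega> + 4 * lam\<^sup>2 * S1 (\<lambda>x. (F x)\<^sup>2) \<omega> + ?c\<^sup>2
      - 4 * lam * S3 (\<lambda>x y z. f x y * F z) \<omega> - 8 * lam * S2 (\<lambda>x y. f x y * F y) \<omega> + 2 * ?c * S2 f \<omega> - 4 * lam * ?c * S1 F \<omega>"
  have eq: "(D \<omega>)\<^sup>2 = ?R \<omega>" if w: "\<omega> \<in> space M" for \<omega>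
  proof -
    note fin = finite_tuples(1)[OF w]
    have "(D \<omega>)\<^sup>2 = (S2 f \<omega>)\<^sup>2 + 4 * lam\<^sup>2 * (S1 F \<omega>)\<^sup>2 + ?c\<^sup>2 - 4 * lam * (S2 f \<omega> * S1 F \<omega>)
        + 2 * ?c * S2 f \<omega> - 4 * lam * ?c * S1 F \<omega>"
      unfolding Deq by (simp add: power2_eq_square algebra_simps)
    also have "(S2 f \<omega>)\<^sup>2 = S4 (\<lambda>x y z u. f x y * f z u) \<omega> + 4 * S3 (\<lambda>x y z. f x y * f y z) \<omega> + 2 * S2 (\<lambda>x y. (f x y)\<^sup>2) \<omega>"
      unfolding sum_point_pairs[OF fin] sum_point_triples[OF fin] sum_point_quads[OF fin] fst_conv snd_conv
      by (rule pair_sum_square[OF fin, of f]) (rule sym)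
    also have "(S1 F \<omega>)\<^sup>2 = S2 (\<lambda>x y. F x * F y) \<omega> + S1 (\<lambda>x. (F x)\<^sup>2) \<omega>"
      unfolding sum_point_pairs[OF fin] fst_conv snd_conv by (rule sum_square[OF fin])
    also have "S2 f \<omega> * S1 F \<omega> = S3 (\<lambda>x y z. f x y * F z) \<omega> + 2 * S2 (\<lambda>x y. f x y * F y) \<omega>"
      unfolding sum_point_pairs[OF fin] sum_point_triples[OF fin] fst_conv snd_conv
      by (rule pair_sum_times_sum[OF fin, of f]) (rule sym)
    finally show ?thesis by (simp add: algebra_simps)
  qed
  note i = integrable_L4[OF b4] integrable_L3[OF b3] integrable_L3[OF b3'] integrable_L2[OF b2] integrable_L2[OF b2']
    integrable_L2[OF b2''] integrable_L2[OF f] integrable_L1[OF b1] integrable_L1[OF F]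
  have "integrable M ?R"
    by (intro Bochner_Integration.integrable_add Bochner_Integration.integrable_diff integrable_mult_right i integrable_const)
  then show "integrable M (\<lambda>\<omega>. (D \<omega>)\<^sup>2)"
    by (rule Bochner_Integration.integrable_cong[THEN iffD1, rotated 2]) (use eq in auto)
  have "(\<integral>\<omega>. (D \<omega>)\<^sup>2 \<partial>M) = (\<integral>\<omega>. ?R \<omega> \<partial>M)"
    using eq by (intro Bochner_Integration.integral_cong) auto
  also have "\<dots> = L4 (\<lambda>x y z u. f x y * f z u) + 4 * L3 (\<lambda>x y z. f x y * f y z) + 2 * L2 (\<lambda>x y. (f x y)\<^sup>2)
      + 4 * lam\<^sup>2 * L2 (\<lambda>x y. F x * F y) + 4 * lam\<^sup>2 * L1 (\<lambda>x. (F x)\<^sup>2) + ?c\<^sup>2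
      - 4 * lam * L3 (\<lambda>x y z. f x y * F z) - 8 * lam * L2 (\<lambda>x y. f x y * F y) + 2 * ?c * L2 f - 4 * lam * ?c * L1 F"
    using i by (simp add: L1_def L2_def L3_def L4_def prob_space)
  also have "\<dots> = G4 (\<lambda>x y z u. f x y * f z u) + 2 * G2 (\<lambda>x z. G2 (\<lambda>y u. f x y * f z u))
      + 4 * G3 (\<lambda>x y z. f x y * f y z) + 4 * lam * G2 (\<lambda>x z. I (\<lambda>y. f x y * f y z)) + 2 * L2 (\<lambda>x y. (f x y)\<^sup>2)"
  proof -
    have If: "I (\<lambda>x. f x y) = F y" for y unfolding F_def using sym[of _ y] by simp
    have IF: "I (\<lambda>y. f x y) = F x" for x by (simp add: F_def)
    have L3sym: "L3 (\<lambda>x y z. g x * f y z) = L3 (\<lambda>x y z. f x y * g z)" for g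
      unfolding L3_def
    proof (rule Bochner_Integration.integral_cong[OF refl])
      fix \<omega> assume "\<omega> \<in> space M"
      show "S3 (\<lambda>x y z. g x * f y z) \<omega> = S3 (\<lambda>x y z. f x y * g z) \<omega>"
        by (rule sum.reindex_bij_witness[where i="\<lambda>(x, y, z). (z, y, x)" and j="\<lambda>(x, y, z). (z, y, x)"])
           (auto simp: point_triples_def sym)
    qed
    have L2sym: "L2 (\<lambda>y z. F y * f y z) = L2 (\<lambda>x y. f x y * F y)"
      unfolding L2_def
    proof (rule Bochner_Integration.integral_cong[OF refl])
      fix \<omega> assume "\<omega> \<in> space M"
      show "S2 (\<lambda>x y. F x * f x y) \<omega> = S2 (\<lambda>x y. f x y * F y) \<omega>"
        by (rule sum.reindex_bij_witness[where i="\<lambda>(x, y). (y, x)" and j="\<lambda>(x, y). (y, x)"])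
           (auto simp: point_pairs_def sym)
    qed
    \<comment> \<open>By symmetry of \<open>f\<close> the four third-order terms are equal. Their
      sum \<open>4 * lam * L3 (\<lambda>x y z. f x y * F z)\<close> is exactly what the cross term
      of the square removes.\<close>
    have L4': "L4 (\<lambda>x y z u. f x y * f z u) = G4 (\<lambda>x y z u. f x y * f z u)
      + 4 * lam * L3 (\<lambda>x y z. f x y * F z) + (G2 f)\<^sup>2 + 2 * G2 (\<lambda>x z. G2 (\<lambda>y u. f x y * f z u))
      - 2 * lam\<^sup>2 * (I F * G2 f) - 4 * lam\<^sup>2 * G2 (\<lambda>x y. F x * F y) - 3 * lam ^ 4 * (I F)\<^sup>2"
    proof -
      have g1: "G2 (\<lambda>x y. G2 (\<lambda>z u. f x y * f z u)) = (G2 f)\<^sup>2"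
      proof -
        have "G2 (\<lambda>x y. G2 (\<lambda>z u. f x y * f z u)) = G2 (\<lambda>x y. f x y * G2 f)" by (simp only: G2_cmult)
        also have "\<dots> = G2 f * G2 f" by (rule G2_multc)
        finally show ?thesis by (simp only: power2_eq_square)
      qed
      have g2: "G2 (\<lambda>x u. G2 (\<lambda>y z. f x y * f z u)) = G2 (\<lambda>x z. G2 (\<lambda>y u. f x y * f z u))"
      proof -
        have "(\<lambda>x u. G2 (\<lambda>y z. f x y * f z u)) = (\<lambda>x u. G2 (\<lambda>y z. f x y * f u z))"
        proof (intro ext arg_cong[where f=G2])
          fix x u y z
          show "f x y * f z u = f x y * f u z" using sym[of z u] by simp
        qed
        then show ?thesis by (rule arg_cong)
      qed
      have g3: "G2 (\<lambda>x y. f x y * I F) = I F * G2 f"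
        by (rule G2_multc)
      show ?thesis
        unfolding L4_eq[OF b4] g1 g2 Bochner_Integration.integral_mult_right_zero Bochner_Integration.integral_mult_left_zero
          IF If L3sym g3 G2_cmult G2_multc
        by (simp add: power2_eq_square)
    qed
    \<comment> \<open>Taken four times, the pair term
      \<open>2 * lam * L2 (\<lambda>x y. f x y * F y)\<close> cancels the coincidence part of the
      cross term, and the last term cancels the diagonal of the squared linear sum.\<close>
    have L3': "L3 (\<lambda>x y z. f x y * f y z) = G3 (\<lambda>x y z. f x y * f y z) + 2 * lam * L2 (\<lambda>x y. f x y * F y)
        + lam * G2 (\<lambda>x z. I (\<lambda>y. f x y * f y z)) - lam ^ 3 * I (\<lambda>x. (F x)\<^sup>2)"
      unfolding L3_eq[OF b3] Bochner_Integration.integral_mult_right_zero Bochner_Integration.integral_mult_left_zero IF If L2sym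
      by (simp add: power2_eq_square)
    have L2': "L2 (\<lambda>x y. F x * F y) = G2 (\<lambda>x y. F x * F y) + lam\<^sup>2 * (I F)\<^sup>2"
      unfolding L2_eq[OF b2''] by (simp add: power2_eq_square)
    show ?thesis
      unfolding L4' L3' L2' L2f L1_eq[OF F] L1_eq[OF b1]
      by (simp add: power2_eq_square power3_eq_cube power4_eq_xxxx algebra_simps)
  qed
  finally show "(\<integral>\<omega>. (D \<omega>)\<^sup>2 \<partial>M) = G4 (\<lambda>x y z u. f x y * f z u) + 2 * G2 (\<lambda>x z. G2 (\<lambda>y u. f x y * f z u))
      + 4 * G3 (\<lambda>x y z. f x y * f y z) + 4 * lam * G2 (\<lambda>x z. I (\<lambda>y. f x y * f y z)) + 2 * L2 (\<lambda>x y. (f x y)\<^sup>2)" .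
qed

end

subsection \<open>Variance bounds in terms of the total variations\<close>

text \<open>Integration against the variation measure, the sum of the two Jordan parts.
  \<open>aint \<gamma> (\<lambda>_. 1)\<close> is the total variation as a real number when both
  parts are finite.\<close>

definition aint :: "'b signed \<Rightarrow> ('b \<Rightarrow> real) \<Rightarrow> real" where
  "aint \<gamma> F = (\<integral>t. F t \<partial>fst \<gamma>) + (\<integral>t. F t \<partial>snd \<gamma>)"

lemma abs_integral_le:
  fixes F G :: "'b \<Rightarrow> real"
  assumes G: "integrable \<nu> G" and le: "\<And>t. t \<in> space \<nu> \<Longrightarrow> \<bar>F t\<bar> \<le> G t"
  shows "\<bar>\<integral>t. F t \<partial>\<nu>\<bar> \<le> (\<integral>t. G t \<partial>\<nu>)"
proof (cases "integrable \<nu> F")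
  case True
  have "\<bar>\<integral>t. F t \<partial>\<nu>\<bar> \<le> (\<integral>t. \<bar>F t\<bar> \<partial>\<nu>)" by (rule integral_abs_bound)
  also have "\<dots> \<le> (\<integral>t. G t \<partial>\<nu>)" using True G le by (intro integral_mono) auto
  finally show ?thesis .
next
  case False
  have "0 \<le> (\<integral>t. G t \<partial>\<nu>)"
    by (rule integral_nonneg_AE) (use le in \<open>auto intro: order_trans[OF abs_ge_zero]\<close>)
  then show ?thesis using False by (simp add: not_integrable_integral_eq)
qed

lemma integral_translate:
  fixes h :: "'a::euclidean_space \<Rightarrow> real"
  assumes [measurable]: "h \<in> borel_measurable borel"
  shows "(\<integral>y. h (y - x) \<partial>lborel) = (\<integral>y. h y \<partial>lborel)"
    and "integrable lborel h \<Longrightarrow> integrable lborel (\<lambda>y. h (y - x))"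
proof -
  have d: "lborel = distr lborel borel (\<lambda>y. y - x)"
  proof -
    have "(+) (- x) = (\<lambda>y. y - x)" by auto
    then show ?thesis using lborel_distr_plus[of "- x"] by simp
  qed
  have "(\<integral>y. h y \<partial>distr lborel borel (\<lambda>y. y - x)) = (\<integral>y. h (y - x) \<partial>lborel)"
    by (subst integral_distr) auto
  then show "(\<integral>y. h (y - x) \<partial>lborel) = (\<integral>y. h y \<partial>lborel)" by (simp add: d[symmetric])
  have "integrable (distr lborel borel (\<lambda>y. y - x)) h \<longleftrightarrow> integrable lborel (\<lambda>y. h (y - x))"
    by (subst integrable_distr_eq) auto
  then show "integrable lborel h \<Longrightarrow> integrable lborel (\<lambda>y. h (y - x))" by (simp add: d[symmetric])
qed

context b4_window
begin

definition tv :: real where "tv = aint (\<gamma> 2) (\<lambda>_. 1)"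

lemma gam_bm:
  assumes "k \<in> {2, 3, 4}" "F \<in> bm (\<Pi>\<^sub>M l\<in>{1..<k}. (borel :: 'a measure))"
  shows "F \<in> bm (fst (\<gamma> k))" "F \<in> bm (snd (\<gamma> k))"
  using assms(2) by (auto simp: bm_def measurable_cong_sets[OF gam_sets(1)[OF assms(1)] refl] measurable_cong_sets[OF gam_sets(2)[OF assms(1)] refl])

lemma sint_le_aint:
  assumes k: "k \<in> {2, 3, 4}" and G: "G \<in> bm (\<Pi>\<^sub>M l\<in>{1..<k}. (borel :: 'a measure))"
    and le: "\<And>t. \<bar>F t\<bar> \<le> G t"
  shows "\<bar>sint (\<gamma> k) F\<bar> \<le> aint (\<gamma> k) G"
  using abs_integral_le[OF bm_integrable[OF gam_finite(1)[OF k] gam_bm(1)[OF k G]], of F]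
    abs_integral_le[OF bm_integrable[OF gam_finite(2)[OF k] gam_bm(2)[OF k G]], of F] le
  by (simp add: sint_def aint_def)

lemma aint_mono:
  assumes k: "k \<in> {2, 3, 4}" and F: "F \<in> bm (\<Pi>\<^sub>M l\<in>{1..<k}. (borel :: 'a measure))"
    and G: "G \<in> bm (\<Pi>\<^sub>M l\<in>{1..<k}. (borel :: 'a measure))" and le: "\<And>t. F t \<le> G t"
  shows "aint (\<gamma> k) F \<le> aint (\<gamma> k) G"
  unfolding aint_def
  by (intro add_mono integral_mono bm_integrable gam_finite gam_bm k F G le)

lemma aint_cmult: "aint (\<gamma> k) (\<lambda>t. c * F t) = c * aint (\<gamma> k) F"
  by (simp add: aint_def distrib_left)

lemma aint_nonneg: "(\<And>t. 0 \<le> F t) \<Longrightarrow> 0 \<le> aint (\<gamma> k) F"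
  unfolding aint_def by (intro add_nonneg_nonneg integral_nonneg_AE) auto

lemma tv_nonneg: "0 \<le> tv"
  unfolding tv_def by (rule aint_nonneg) simp

lemma comp_PiM: "(l :: nat) \<in> {1..<k} \<Longrightarrow> (\<lambda>t. t l) \<in> (\<Pi>\<^sub>M l\<in>{1..<k}. (borel :: 'a measure)) \<rightarrow>\<^sub>M borel"
  by (rule measurable_component_singleton)

lemma abs_I_le:
  assumes "\<And>u. \<bar>e u\<bar> \<le> c"
  shows "\<bar>I e\<bar> \<le> measure lborel W * c"
  using abs_integral_le_bound[OF finite_LW assms] by (simp add: measure_LW)

lemma abs_G2_le:
  assumes "\<And>x y. \<bar>e x y\<bar> \<le> c"
  shows "\<bar>G2 e\<bar> \<le> lam * (measure lborel W * (c * tv))"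
proof -
  have c: "0 \<le> c" using assms[of undefined undefined] by linarith
  have "\<bar>sint (\<gamma> 2) (\<lambda>t. indicator W (t 1 + u) * e (t 1 + u) u)\<bar> \<le> aint (\<gamma> 2) (\<lambda>t. c * 1)" for u
    by (rule sint_le_aint) (use assms c in \<open>auto simp: abs_mult indicator_def intro: bm_const\<close>)
  then have "\<bar>I (\<lambda>u. sint (\<gamma> 2) (\<lambda>t. indicator W (t 1 + u) * e (t 1 + u) u))\<bar> \<le> measure lborel W * (c * tv)"
    unfolding aint_cmult tv_def[symmetric] by (rule abs_I_le)
  then show ?thesis
    unfolding G2_def abs_mult using lam_nonneg by (simp add: mult_left_mono)
qed

text \<open>The covariance term is treated as in Schur's test: the product of the two values of
  \<open>F\<close> is at most half the sum of their squares, and after a shift each square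
  contributes at most \<open>tv\<close> times the integral of \<open>(F x)\<^sup>2\<close> over the
  window.\<close>

lemma variance_linear_le:
  assumes F: "F \<in> bm borel"
  shows "(\<integral>\<omega>. (S1 F \<omega> - lam * I F)\<^sup>2 \<partial>M) \<le> lam * (1 + tv) * I (\<lambda>x. (F x)\<^sup>2)"
proof -
  have Fs: "(\<lambda>x. (F x)\<^sup>2) \<in> bm borel"
    unfolding power2_eq_square by (intro bm_mult F)
  have Fsi [simp]: "integrable LW (\<lambda>x. (F x)\<^sup>2)" by (rule bm_integrable_LW[OF Fs])
  have [measurable]: "F \<in> borel_measurable borel" by (rule bm_measurable[OF F])
  let ?g = "\<lambda>u t. indicator W (t 1 + u) * (F (t 1 + u))\<^sup>2 :: real"
  have part: "(\<integral>u. (\<integral>t. ?g u t \<partial>\<nu>) \<partial>LW) \<le> measure \<nu> (space \<nu>) * I (\<lambda>x. (F x)\<^sup>2)"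
    and int: "integrable LW (\<lambda>u. \<integral>t. ?g u t \<partial>\<nu>)"
    if fin: "finite_measure \<nu>" and m: "(\<lambda>t. t 1) \<in> borel_measurable \<nu>" for \<nu> :: "(nat \<Rightarrow> 'a) measure"
  proof -
    interpret nu: finite_measure \<nu> by fact
    interpret LW: finite_measure LW by (rule finite_LW)
    interpret P: pair_sigma_finite LW \<nu> by unfold_locales
    have p: "(\<lambda>q. snd q 1) \<in> borel_measurable (LW \<Otimes>\<^sub>M \<nu>)" by (rule measurable_compose[OF measurable_snd m])
    have q: "(\<lambda>q. snd q 1 + fst q) \<in> borel_measurable (LW \<Otimes>\<^sub>M \<nu>)"
      by (intro borel_measurable_add p) measurable
    have "(\<lambda>x. indicator W x * (F x)\<^sup>2) \<in> bm borel"
      by (intro bm_mult bm_indicator Fs) simp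
    from bm_compose[OF this q] have b: "(\<lambda>q. ?g (fst q) (snd q)) \<in> bm (LW \<Otimes>\<^sub>M \<nu>)" by simp
    have "integrable (LW \<Otimes>\<^sub>M \<nu>) (\<lambda>q. ?g (fst q) (snd q))"
      by (rule bm_integrable[OF _ b]) (intro finite_measure_pair_measure finite_LW fin)
    then have i: "integrable (LW \<Otimes>\<^sub>M \<nu>) (\<lambda>(u, t). ?g u t)" by (simp add: split_beta')
    show "integrable LW (\<lambda>u. \<integral>t. ?g u t \<partial>\<nu>)"
      by (rule P.integrable_fst[OF i])
    have "(\<integral>u. (\<integral>t. ?g u t \<partial>\<nu>) \<partial>LW) = (\<integral>t. (\<integral>u. ?g u t \<partial>LW) \<partial>\<nu>)"
      by (rule P.Fubini_integral[OF i, symmetric])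
    also have "\<dots> \<le> \<bar>\<integral>t. (\<integral>u. ?g u t \<partial>LW) \<partial>\<nu>\<bar>" by simp
    also have "\<dots> \<le> measure \<nu> (space \<nu>) * I (\<lambda>x. (F x)\<^sup>2)"
    proof (rule abs_integral_le_bound[OF fin])
      fix t :: "nat \<Rightarrow> 'a"
      have iW: "integrable lborel (\<lambda>x. indicator W x * (F x)\<^sup>2)"
      proof -
        obtain C where C: "\<And>x. \<bar>(F x)\<^sup>2\<bar> \<le> C" using bmE[OF Fs] by metis
        show ?thesis
        proof (rule Bochner_Integration.integrable_bound)
          show "integrable lborel (\<lambda>x. indicator W x * C)"
            using emeasure_bounded_finite[OF W_bounded] by (intro integrable_mult_left integrable_real_indicator) auto
          show "AE x in lborel. norm (indicator W x * (F x)\<^sup>2) \<le> norm (indicator W x * C)"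
            using C by (intro AE_I2) (auto simp: indicator_def intro: order_trans[OF _ abs_ge_self])
        qed measurable
      qed
      have "\<bar>\<integral>u. ?g u t \<partial>LW\<bar> = (\<integral>u. indicator W u * ?g u t \<partial>lborel)"
        by (subst integral_window_measure) (auto intro!: abs_of_nonneg integral_nonneg_AE)
      \<comment> \<open>Without the condition that \<open>u\<close> lies in the window, the
        integrand is a translate of a function supported in the window, so its integral no longer
        depends on \<open>t\<close>. The double minus matches the form of
        \<open>integral_translate\<close>.\<close>
      also have "\<dots> \<le> (\<integral>u. indicator W (u - (- t 1)) * (F (u - (- t 1)))\<^sup>2 \<partial>lborel)"
        using integral_translate(2)[of "\<lambda>x. indicator W x * (F x)\<^sup>2" "- t 1"] iW
        by (intro integral_mono_AE' AE_I2) (auto simp: indicator_def add.commute)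
      also have "\<dots> = (\<integral>u. indicator W u * (F u)\<^sup>2 \<partial>lborel)"
        by (rule integral_translate(1)) measurable
      also have "\<dots> = I (\<lambda>x. (F x)\<^sup>2)" by (subst integral_window_measure) auto
      finally show "\<bar>\<integral>u. ?g u t \<partial>LW\<bar> \<le> I (\<lambda>x. (F x)\<^sup>2)" .
    qed
    finally show "(\<integral>u. (\<integral>t. ?g u t \<partial>\<nu>) \<partial>LW) \<le> measure \<nu> (space \<nu>) * I (\<lambda>x. (F x)\<^sup>2)" .
  qed
  have k2: "(2::nat) \<in> {2, 3, 4}" by simp
  have c1: "(\<lambda>t. t 1) \<in> borel_measurable (fst (\<gamma> 2))" "(\<lambda>t. t 1) \<in> borel_measurable (snd (\<gamma> 2))"
    by (rule gam_component[OF k2]; simp)+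
  have G2le: "G2 (\<lambda>x y. F x * F y) \<le> lam * (tv * I (\<lambda>x. (F x)\<^sup>2))"
  proof -
    have bF: "(\<lambda>t. indicator W (t 1 + u) * (F (t 1 + u))\<^sup>2) \<in> bm (\<Pi>\<^sub>M l\<in>{1..<2::nat}. (borel :: 'a measure))" for u
    proof -
      have "(\<lambda>x. indicator W x * (F x)\<^sup>2) \<in> bm borel" by (intro bm_mult bm_indicator Fs) simp
      moreover have "(\<lambda>t. t 1 + u) \<in> borel_measurable (\<Pi>\<^sub>M l\<in>{1..<2::nat}. (borel :: 'a measure))"
        by (intro borel_measurable_add comp_PiM) auto
      ultimately show ?thesis by (rule bm_compose)
    qed
    have s: "\<bar>sint (\<gamma> 2) (\<lambda>t. indicator W (t 1 + u) * (F (t 1 + u) * F u))\<bar> \<le> aint (\<gamma> 2) (\<lambda>t. (1/2) * ?g u t + (1/2) * (F u)\<^sup>2)" for u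
    proof (rule sint_le_aint[OF k2])
      show "(\<lambda>t. (1/2) * ?g u t + (1/2) * (F u)\<^sup>2) \<in> bm (\<Pi>\<^sub>M l\<in>{1..<2::nat}. (borel :: 'a measure))"
        by (intro bm_add bm_cmult bF bm_const)
      have "\<bar>a * b\<bar> \<le> (1/2) * a\<^sup>2 + (1/2) * b\<^sup>2" for a b :: real
        using sum_squares_bound[of "\<bar>a\<bar>" "\<bar>b\<bar>"] by (simp add: abs_mult)
      then show "\<bar>indicator W (t 1 + u) * (F (t 1 + u) * F u)\<bar> \<le> (1/2) * ?g u t + (1/2) * (F u)\<^sup>2" for t
        by (cases "t 1 + u \<in> W") simp_all
    qed
    have e: "aint (\<gamma> 2) (\<lambda>t. (1/2) * ?g u t + (1/2) * (F u)\<^sup>2) =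
        (1/2) * ((\<integral>t. ?g u t \<partial>fst (\<gamma> 2)) + (\<integral>t. ?g u t \<partial>snd (\<gamma> 2))) + (1/2) * (tv * (F u)\<^sup>2)" for u
    proof -
      note b = bm_cmult[OF bF, of "1/2" u]
      have s: "(\<integral>t. (1/2) * ?g u t + (1/2) * (F u)\<^sup>2 \<partial>\<nu>) = (1/2) * (\<integral>t. ?g u t \<partial>\<nu>) + (1/2) * (measure \<nu> (space \<nu>) * (F u)\<^sup>2)"
        if "integrable \<nu> (\<lambda>t. (1/2) * ?g u t)" "finite_measure \<nu>" for \<nu> :: "(nat \<Rightarrow> 'a) measure"
        using that by (subst Bochner_Integration.integral_add) (auto simp: finite_measure.integrable_const simp del: One_nat_def)
      show ?thesis
        unfolding aint_def tv_def
          s[OF bm_integrable[OF gam_finite(1)[OF k2] gam_bm(1)[OF k2 b]] gam_finite(1)[OF k2]]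
          s[OF bm_integrable[OF gam_finite(2)[OF k2] gam_bm(2)[OF k2 b]] gam_finite(2)[OF k2]]
        by (simp add: algebra_simps del: One_nat_def)
    qed
    have i: "integrable LW (\<lambda>u. aint (\<gamma> 2) (\<lambda>t. (1/2) * ?g u t + (1/2) * (F u)\<^sup>2))"
      unfolding e by (intro Bochner_Integration.integrable_add integrable_mult_right int gam_finite k2 c1 Fsi)
    have "I (\<lambda>u. sint (\<gamma> 2) (\<lambda>t. indicator W (t 1 + u) * (F (t 1 + u) * F u))) \<le>
        I (\<lambda>u. aint (\<gamma> 2) (\<lambda>t. (1/2) * ?g u t + (1/2) * (F u)\<^sup>2))"
      using abs_integral_le[OF i s] by linarith
    also have "\<dots> = (1/2) * ((\<integral>u. (\<integral>t. ?g u t \<partial>fst (\<gamma> 2)) \<partial>LW) + (\<integral>u. (\<integral>t. ?g u t \<partial>snd (\<gamma> 2)) \<partial>LW)) + (1/2) * (tv * I (\<lambda>x. (F x)\<^sup>2))"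
      unfolding e using int[OF gam_finite(1)[OF k2] c1(1)] int[OF gam_finite(2)[OF k2] c1(2)] by (simp del: One_nat_def)
    also have "\<dots> \<le> (1/2) * (tv * I (\<lambda>x. (F x)\<^sup>2)) + (1/2) * (tv * I (\<lambda>x. (F x)\<^sup>2))"
    proof -
      have "tv * I (\<lambda>x. (F x)\<^sup>2) = measure (fst (\<gamma> 2)) (space (fst (\<gamma> 2))) * I (\<lambda>x. (F x)\<^sup>2) +
          measure (snd (\<gamma> 2)) (space (snd (\<gamma> 2))) * I (\<lambda>x. (F x)\<^sup>2)"
        by (simp add: tv_def aint_def distrib_right)
      moreover have "1 / 2 * (a + b) + 1 / 2 * T \<le> 1 / 2 * T + 1 / 2 * T" if "T = p + q" "a \<le> p" "b \<le> q"
        for a b p q T :: real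
        by (intro add_mono mult_left_mono) (use that in \<open>auto intro: add_mono\<close>)
      ultimately show ?thesis
        using part[OF gam_finite(1)[OF k2] c1(1)] part[OF gam_finite(2)[OF k2] c1(2)] by blast
    qed
    finally show ?thesis unfolding G2_def using lam_nonneg by (intro mult_left_mono) auto
  qed
  then show ?thesis unfolding variance_linear(2)[OF F] by (simp add: algebra_simps)
qed

end

text \<open>\<open>h\<close> plays the role of the smoothing function or indicator and \<kappa> that
  of its edge-corrected version. The constant \<open>K\<close> will be twice the reciprocal of the
  window volume; it is kept apart from \<open>h\<close> because the variance scales with its
  square.\<close>

locale b4_kernel = b4_window M N \<gamma> W
  for M :: "'w measure" and N :: "'w \<Rightarrow> 'a::euclidean_space set" and \<gamma> :: "nat \<Rightarrow> (nat \<Rightarrow> 'a) signed" and W +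
  fixes h \<kappa> :: "'a \<Rightarrow> real" and H K :: real
  assumes h_measurable [measurable]: "h \<in> borel_measurable borel" and \<kappa>_measurable [measurable]: "\<kappa> \<in> borel_measurable borel"
    and h_sym: "\<And>z. h (- z) = h z" and \<kappa>_sym: "\<And>z. \<kappa> (- z) = \<kappa> z"
    and h_nonneg: "\<And>z. 0 \<le> h z" and h_le: "\<And>z. h z \<le> H" and h_int: "integrable lborel h"
    and \<kappa>_nonneg: "\<And>z. 0 \<le> \<kappa> z" and \<kappa>_le: "\<And>z. \<kappa> z \<le> K * h z" and K_nonneg: "0 \<le> K"
begin

definition ff :: "'a \<Rightarrow> 'a \<Rightarrow> real" where
  "ff x y = indicator W x * (indicator W y * \<kappa> (y - x))"

lemma H_nonneg: "0 \<le> H"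
  using h_nonneg[of 0] h_le[of 0] by linarith

lemma h_bm: "h \<in> bm borel"
  using h_nonneg h_le by (intro bmI[of _ _ H]) auto

lemma \<kappa>_le_KH: "\<kappa> z \<le> K * H"
  using \<kappa>_le[of z] mult_left_mono[OF h_le K_nonneg, of z] by linarith

lemma \<kappa>_bm: "\<kappa> \<in> bm borel"
  using \<kappa>_nonneg \<kappa>_le_KH by (intro bmI[of _ _ "K * H"]) auto

lemma ff_nonneg: "0 \<le> ff x y"
  using \<kappa>_nonneg by (simp add: ff_def)

lemma ff_sym: "ff x y = ff y x"
  using \<kappa>_sym[of "y - x"] by (simp add: ff_def mult.left_commute)

lemma ff_le: "ff x y \<le> K * h (y - x)"
  using \<kappa>_le[of "y - x"] h_nonneg[of "y - x"] K_nonneg by (simp add: ff_def indicator_def)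

lemma ff_le': "ff x y \<le> K * h (x - y)"
  using ff_le[of y x] ff_sym[of x y] by simp

lemma ff_le_KH: "ff x y \<le> K * H"
  using ff_le[of x y] mult_left_mono[OF h_le K_nonneg, of "y - x"] by linarith

lemma ff_bm: "(\<lambda>p. ff (fst p) (snd p)) \<in> bm bor2"
  unfolding ff_def by (intro bm_mult bm_compose[OF \<kappa>_bm] bm_indicator_compose) measurable

lemma I_ff_le: "\<bar>I (\<lambda>y. ff x y)\<bar> \<le> K * (\<integral>z. h z \<partial>lborel)"
proof -
  have m: "(\<lambda>y. ff x y) \<in> borel_measurable borel" unfolding ff_def by measurable
  have "I (\<lambda>y. ff x y) = (\<integral>y. indicator W y * ff x y \<partial>lborel)"
    by (rule integral_window_measure) (use m in auto)
  also have "\<bar>\<dots>\<bar> \<le> (\<integral>y. K * h (y - x) \<partial>lborel)"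
    by (rule abs_integral_le) (use integral_translate(2)[OF h_measurable h_int] ff_le ff_nonneg h_nonneg K_nonneg
        in \<open>auto simp: indicator_def\<close>)
  also have "\<dots> = K * (\<integral>z. h z \<partial>lborel)" by (simp add: integral_translate(1))
  finally show ?thesis .
qed

text \<open>After translation by the reference point the kernels depend on the reduced variables
  alone: \<open>t 2 - t 1\<close> and \<open>t 3\<close> for two disjoint pairs,
  \<open>t 2 - t 1\<close> and \<open>t 2\<close> for two pairs sharing a point, \<open>t 1\<close>
  for a single pair.\<close>

definition A2 where "A2 = aint (\<gamma> 2) (\<lambda>t. h (t 1))"
definition A3 where "A3 = aint (\<gamma> 3) (\<lambda>t. h (t 2 - t 1) * h (t 2))"
definition A4 where "A4 = aint (\<gamma> 4) (\<lambda>t. h (t 2 - t 1) * h (t 3))"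

lemma h_int_nonneg: "0 \<le> (\<integral>z. h z \<partial>lborel)"
  using h_nonneg by (intro integral_nonneg_AE) auto

lemma G4_le: "\<bar>G4 (\<lambda>x y z u. ff x y * ff z u)\<bar> \<le> lam * (measure lborel W * (K\<^sup>2 * A4))"
proof -
  have "\<bar>sint (\<gamma> 4) (\<lambda>t. indicator W (t 1 + u) * (indicator W (t 2 + u) * (indicator W (t 3 + u) *
      (ff (t 1 + u) (t 2 + u) * ff (t 3 + u) u))))\<bar> \<le> aint (\<gamma> 4) (\<lambda>t. K\<^sup>2 * (h (t 2 - t 1) * h (t 3)))" for u
  proof (rule sint_le_aint)
    show "(\<lambda>t. K\<^sup>2 * (h (t 2 - t 1) * h (t 3))) \<in> bm (\<Pi>\<^sub>M l\<in>{1..<4::nat}. (borel :: 'a measure))"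
      by (intro bm_cmult bm_mult bm_compose[OF h_bm] borel_measurable_diff comp_PiM) auto
    fix t :: "nat \<Rightarrow> 'a"
    have "ff (t 1 + u) (t 2 + u) * ff (t 3 + u) u \<le> (K * h (t 2 - t 1)) * (K * h (t 3))"
      using ff_le[of "t 1 + u" "t 2 + u"] ff_le'[of "t 3 + u" u] ff_nonneg K_nonneg h_nonneg
      by (intro mult_mono) auto
    then show "\<bar>indicator W (t 1 + u) * (indicator W (t 2 + u) * (indicator W (t 3 + u) *
      (ff (t 1 + u) (t 2 + u) * ff (t 3 + u) u)))\<bar> \<le> K\<^sup>2 * (h (t 2 - t 1) * h (t 3))"
      using ff_nonneg h_nonneg K_nonneg by (auto simp: indicator_def power2_eq_square abs_mult algebra_simps)
  qed simp
  then show ?thesis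
    unfolding G4_def abs_mult A4_def aint_cmult
    using lam_nonneg by (auto intro!: mult_left_mono abs_I_le)
qed

lemma G3_le: "\<bar>G3 (\<lambda>x y z. ff x y * ff y z)\<bar> \<le> lam * (measure lborel W * (K\<^sup>2 * A3))"
proof -
  have "\<bar>sint (\<gamma> 3) (\<lambda>t. indicator W (t 1 + u) * (indicator W (t 2 + u) *
      (ff (t 1 + u) (t 2 + u) * ff (t 2 + u) u)))\<bar> \<le> aint (\<gamma> 3) (\<lambda>t. K\<^sup>2 * (h (t 2 - t 1) * h (t 2)))" for u
  proof (rule sint_le_aint)
    show "(\<lambda>t. K\<^sup>2 * (h (t 2 - t 1) * h (t 2))) \<in> bm (\<Pi>\<^sub>M l\<in>{1..<3::nat}. (borel :: 'a measure))"
      by (intro bm_cmult bm_mult bm_compose[OF h_bm] borel_measurable_diff comp_PiM) auto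
    fix t :: "nat \<Rightarrow> 'a"
    have "ff (t 1 + u) (t 2 + u) * ff (t 2 + u) u \<le> (K * h (t 2 - t 1)) * (K * h (t 2))"
      using ff_le[of "t 1 + u" "t 2 + u"] ff_le'[of "t 2 + u" u] ff_nonneg K_nonneg h_nonneg
      by (intro mult_mono) auto
    then show "\<bar>indicator W (t 1 + u) * (indicator W (t 2 + u) *
      (ff (t 1 + u) (t 2 + u) * ff (t 2 + u) u))\<bar> \<le> K\<^sup>2 * (h (t 2 - t 1) * h (t 2))"
      using ff_nonneg h_nonneg K_nonneg by (auto simp: indicator_def power2_eq_square abs_mult algebra_simps)
  qed simp
  then show ?thesis
    unfolding G3_def abs_mult A3_def aint_cmult
    using lam_nonneg by (auto intro!: mult_left_mono abs_I_le)
qed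

text \<open>One kernel is bounded by its supremum \<open>K * H\<close>, the other is integrated over
  \<open>u\<close>. The bound is thus linear in the integral of \<open>h\<close>, and each of the
  two cumulants costs only a total variation.\<close>

lemma G2G2_le: "\<bar>G2 (\<lambda>x z. G2 (\<lambda>y u. ff x y * ff z u))\<bar> \<le>
    lam * (measure lborel W * (lam * (K * H * tv) * (K * (\<integral>z. h z \<partial>lborel)) * tv))"
proof (rule abs_G2_le)
  fix x z
  have i: "integrable LW (\<lambda>u. (K * H * tv) * ff z u)"
    by (rule bm_integrable_LW) (unfold ff_def, intro bm_cmult bm_mult bm_const bm_compose[OF \<kappa>_bm] bm_indicator_compose; measurable)
  have "\<bar>sint (\<gamma> 2) (\<lambda>t. indicator W (t 1 + u) * (ff x (t 1 + u) * ff z u))\<bar> \<le> (K * H * tv) * ff z u" for u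
  proof -
    have "\<bar>sint (\<gamma> 2) (\<lambda>t. indicator W (t 1 + u) * (ff x (t 1 + u) * ff z u))\<bar> \<le> aint (\<gamma> 2) (\<lambda>t. (K * H * ff z u) * 1)"
    proof (rule sint_le_aint)
      fix t :: "nat \<Rightarrow> 'a"
      have "ff x (t 1 + u) * ff z u \<le> K * H * ff z u"
        using ff_le_KH ff_nonneg by (intro mult_right_mono)
      then show "\<bar>indicator W (t 1 + u) * (ff x (t 1 + u) * ff z u)\<bar> \<le> K * H * ff z u * 1"
        using ff_nonneg[of x "t 1 + u"] ff_nonneg[of z u] K_nonneg H_nonneg by (auto simp: indicator_def)
    qed (auto intro: bm_const)
    then show ?thesis unfolding aint_cmult tv_def[symmetric] by (simp add: mult_ac)
  qed
  from abs_integral_le[OF i this]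
  have "\<bar>I (\<lambda>u. sint (\<gamma> 2) (\<lambda>t. indicator W (t 1 + u) * (ff x (t 1 + u) * ff z u)))\<bar> \<le> (K * H * tv) * I (\<lambda>u. ff z u)"
    by simp
  also have "\<dots> \<le> (K * H * tv) * (K * (\<integral>z. h z \<partial>lborel))"
    using I_ff_le[of z] K_nonneg H_nonneg tv_nonneg by (intro mult_left_mono) auto
  finally show "\<bar>G2 (\<lambda>y u. ff x y * ff z u)\<bar> \<le> lam * (K * H * tv) * (K * (\<integral>z. h z \<partial>lborel))"
    unfolding G2_def abs_mult using lam_nonneg by (simp add: mult.assoc mult_left_mono)
qed

lemma I_ff_ff_le: "\<bar>I (\<lambda>y. ff x y * ff y z)\<bar> \<le> K * H * (K * (\<integral>z. h z \<partial>lborel))"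
proof -
  have i: "integrable LW (\<lambda>y. (K * H) * ff x y)"
    by (rule bm_integrable_LW) (unfold ff_def, intro bm_cmult bm_mult bm_const bm_compose[OF \<kappa>_bm] bm_indicator_compose; measurable)
  have "\<bar>I (\<lambda>y. ff x y * ff y z)\<bar> \<le> I (\<lambda>y. (K * H) * ff x y)"
  proof (rule abs_integral_le[OF i])
    fix y
    show "\<bar>ff x y * ff y z\<bar> \<le> (K * H) * ff x y"
      using mult_right_mono[OF ff_le_KH[of y z] ff_nonneg[of x y]] ff_nonneg[of x y] ff_nonneg[of y z]
      by (simp add: abs_mult mult.commute)
  qed
  also have "\<dots> \<le> K * H * (K * (\<integral>z. h z \<partial>lborel))"
    using I_ff_le[of x] K_nonneg H_nonneg by (simp add: mult_left_mono)
  finally show ?thesis .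
qed

lemma L2_sq_le: "L2 (\<lambda>x y. (ff x y)\<^sup>2) \<le>
    lam * (measure lborel W * (K * H * (K * A2))) + lam * (lam * (measure lborel W * (K * H * (K * (\<integral>z. h z \<partial>lborel)))))"
proof -
  have b: "(\<lambda>p. (ff (fst p) (snd p))\<^sup>2) \<in> bm bor2"
    unfolding power2_eq_square by (intro bm_mult ff_bm)
  have "\<bar>sint (\<gamma> 2) (\<lambda>t. indicator W (t 1 + u) * (ff (t 1 + u) u)\<^sup>2)\<bar> \<le> aint (\<gamma> 2) (\<lambda>t. K * H * K * h (t 1))" for u
  proof (rule sint_le_aint)
    show "(\<lambda>t. K * H * K * h (t 1)) \<in> bm (\<Pi>\<^sub>M l\<in>{1..<2::nat}. (borel :: 'a measure))"
      by (intro bm_cmult bm_compose[OF h_bm] comp_PiM) auto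
    fix t :: "nat \<Rightarrow> 'a"
    have "ff (t 1 + u) u * ff (t 1 + u) u \<le> (K * H) * (K * h (t 1))"
      using ff_le_KH[of "t 1 + u" u] ff_le'[of "t 1 + u" u] ff_nonneg K_nonneg H_nonneg by (intro mult_mono) auto
    then show "\<bar>indicator W (t 1 + u) * (ff (t 1 + u) u)\<^sup>2\<bar> \<le> K * H * K * h (t 1)"
      using h_nonneg K_nonneg H_nonneg by (auto simp: indicator_def power2_eq_square mult_ac)
  qed simp
  then have "\<bar>G2 (\<lambda>x y. (ff x y)\<^sup>2)\<bar> \<le> lam * (measure lborel W * (K * H * K * A2))"
    unfolding G2_def abs_mult A2_def aint_cmult
    using lam_nonneg by (auto intro!: mult_left_mono abs_I_le)
  moreover have "\<bar>I (\<lambda>x. I (\<lambda>y. (ff x y)\<^sup>2))\<bar> \<le> measure lborel W * (K * H * (K * (\<integral>z. h z \<partial>lborel)))"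
    by (rule abs_I_le) (use I_ff_ff_le[of x x for x] ff_sym in \<open>simp add: power2_eq_square\<close>)
  ultimately show ?thesis
    unfolding L2_eq[OF b] using lam_nonneg by (intro add_mono mult_left_mono) (auto simp: mult.assoc)
qed

definition nonlinear_part :: "'w \<Rightarrow> real" where
  "nonlinear_part \<omega> = S2 ff \<omega> - L2 ff - 2 * lam * (S1 (\<lambda>x. I (\<lambda>y. ff x y)) \<omega> - lam * I (\<lambda>x. I (\<lambda>y. ff x y)))"

text \<open>The terms with the integral of \<open>h\<close> have the coefficients
  \<open>2 * lam\<^sup>2 * tv\<^sup>2\<close> from the double cumulant,
  \<open>4 * lam\<^sup>2 * tv\<close> from the pairs sharing a point and
  \<open>2 * lam\<^sup>2\<close> from the diagonal; together they form the square in the constant.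
  The other coefficients are at most \<open>4 * lam\<close>.\<close>

lemma nonlinear_part_variance:
  shows "integrable M (\<lambda>\<omega>. (nonlinear_part \<omega>)\<^sup>2)"
    and "(\<integral>\<omega>. (nonlinear_part \<omega>)\<^sup>2 \<partial>M) \<le>
      K\<^sup>2 * measure lborel W * (4 * lam + 2 * lam\<^sup>2 * (tv + 1)\<^sup>2) * (A4 + A3 + H * (A2 + (\<integral>z. h z \<partial>lborel)))"
proof -
  note v = variance_pairs[OF ff_bm ff_sym, folded nonlinear_part_def]
  show "integrable M (\<lambda>\<omega>. (nonlinear_part \<omega>)\<^sup>2)" by (rule v(1))
  let ?w = "measure lborel W" and ?h = "\<integral>z. h z \<partial>lborel"
  have Pa: "\<bar>G2 (\<lambda>x z. I (\<lambda>y. ff x y * ff y z))\<bar> \<le> lam * (?w * (K * H * (K * ?h) * tv))"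
    by (rule abs_G2_le[OF I_ff_ff_le])
  have A0: "0 \<le> A4" "0 \<le> A3" "0 \<le> A2"
    unfolding A4_def A3_def A2_def using h_nonneg by (auto intro!: aint_nonneg)
  have "(\<integral>\<omega>. (nonlinear_part \<omega>)\<^sup>2 \<partial>M) \<le> lam * (?w * (K\<^sup>2 * A4)) +
      2 * (lam * (?w * (lam * (K * H * tv) * (K * ?h) * tv))) + 4 * (lam * (?w * (K\<^sup>2 * A3)))
      + 4 * lam * (lam * (?w * (K * H * (K * ?h) * tv)))
      + 2 * (lam * (?w * (K * H * (K * A2))) + lam * (lam * (?w * (K * H * (K * ?h)))))"
    unfolding v(2)
    using G4_le G3_le G2G2_le mult_left_mono[OF abs_le_D1[OF Pa], of "4 * lam"] lam_nonneg L2_sq_le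
    by (intro add_mono) (auto simp: abs_le_iff)
  also have "\<dots> = K\<^sup>2 * ?w * (lam * A4 + 4 * lam * A3 + H * (2 * lam * A2 + 2 * lam\<^sup>2 * (tv + 1)\<^sup>2 * ?h))"
    by (simp add: power2_eq_square algebra_simps)
  also have "\<dots> \<le> K\<^sup>2 * ?w * ((4 * lam + 2 * lam\<^sup>2 * (tv + 1)\<^sup>2) * (A4 + A3 + H * (A2 + ?h)))"
  proof (rule mult_left_mono)
    let ?c = "4 * lam + 2 * lam\<^sup>2 * (tv + 1)\<^sup>2"
    have c: "lam \<le> ?c" "4 * lam \<le> ?c" "2 * lam \<le> ?c" "2 * lam\<^sup>2 * (tv + 1)\<^sup>2 \<le> ?c"
      using lam_nonneg by (simp_all add: add_increasing2)
    have "lam * A4 + 4 * lam * A3 + H * (2 * lam * A2 + 2 * lam\<^sup>2 * (tv + 1)\<^sup>2 * ?h) \<le>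
        ?c * A4 + ?c * A3 + H * (?c * A2 + ?c * ?h)"
      using A0 h_int_nonneg H_nonneg c by (intro add_mono mult_right_mono mult_left_mono) auto
    then show "lam * A4 + 4 * lam * A3 + H * (2 * lam * A2 + 2 * lam\<^sup>2 * (tv + 1)\<^sup>2 * ?h) \<le>
        ?c * (A4 + A3 + H * (A2 + ?h))" by (simp add: algebra_simps)
  qed simp
  finally show "(\<integral>\<omega>. (nonlinear_part \<omega>)\<^sup>2 \<partial>M) \<le>
      K\<^sup>2 * ?w * (4 * lam + 2 * lam\<^sup>2 * (tv + 1)\<^sup>2) * (A4 + A3 + H * (A2 + ?h))" by (simp add: mult.assoc)
qed

end

subsection \<open>Set covariance of a convex window\<close>

definition setcov :: "'a::euclidean_space set \<Rightarrow> 'a \<Rightarrow> real" where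
  "setcov W z = measure lborel {y. y \<in> W \<and> y + z \<in> W}"

context
  fixes W :: "'a::euclidean_space set"
  assumes W [measurable]: "W \<in> sets borel" and bW: "bounded W"
begin

lemma setcov_sets [measurable]: "{y. y \<in> W \<and> y + z \<in> W} \<in> sets borel"
  by measurable

lemma setcov_altdef: "setcov W z = (\<integral>y. indicator W y * indicator W (y + z) \<partial>lborel)"
proof -
  have "(\<integral>y. indicator W y * indicator W (y + z) \<partial>lborel) = (\<integral>y. indicator {y. y \<in> W \<and> y + z \<in> W} y \<partial>lborel :: real)"
    by (intro Bochner_Integration.integral_cong) (auto simp: indicator_def)
  then show ?thesis by (simp add: setcov_def)
qed

lemma overlap_eq_setcov: "overlap W x y = setcov W (y - x)"
proof -
  have "(\<lambda>z. z - x) ` W \<inter> (\<lambda>z. z - y) ` W = {p. p + x \<in> W \<and> p + y \<in> W}"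
  proof -
    have "p \<in> (\<lambda>z. z - a) ` W \<longleftrightarrow> p + a \<in> W" for p a
      by (auto simp: image_iff intro!: bexI[of _ "p + a"])
    then show ?thesis by blast
  qed
  then have "overlap W x y = measure lborel {p. p + x \<in> W \<and> p + y \<in> W}" by (simp add: overlap_def)
  also have "\<dots> = (\<integral>p. indicator W (p - (- x)) * indicator W (p - (- x) + (y - x)) \<partial>lborel)"
  proof -
    have "(\<integral>p. indicator W (p - (- x)) * indicator W (p - (- x) + (y - x)) \<partial>lborel) =
        (\<integral>p. indicator {p. p + x \<in> W \<and> p + y \<in> W} p \<partial>lborel :: real)"
      by (intro Bochner_Integration.integral_cong) (auto simp: indicator_def)
    then show ?thesis by simp
  qed
  also have "\<dots> = setcov W (y - x)"
    unfolding setcov_altdef by (rule integral_translate(1)[of "\<lambda>q. indicator W q * indicator W (q + (y - x))"]) measurable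
  finally show ?thesis .
qed

lemma setcov_measurable [measurable]: "setcov W \<in> borel_measurable borel"
proof -
  have "(\<lambda>z. \<integral>y. indicator W y * indicator W (y + z) \<partial>lborel :: real) \<in> borel_measurable borel"
    by (rule lborel.borel_measurable_lebesgue_integral) (simp add: split_beta')
  then show ?thesis by (simp add: setcov_altdef[abs_def])
qed

lemma setcov_nonneg: "0 \<le> setcov W z"
  by (simp add: setcov_def)

lemma setcov_sym: "setcov W (- z) = setcov W z"
proof -
  have "setcov W (- z) = overlap W z 0" by (simp add: overlap_eq_setcov)
  also have "\<dots> = overlap W 0 z" by (simp add: overlap_def Int_commute)
  finally show ?thesis by (simp add: overlap_eq_setcov)
qed

text \<open>With t = |z| / r, shrink \<open>W\<close> towards \<open>x0\<close> by the factor 1 - t.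
  The shrunken copy stays in \<open>W\<close> when shifted by \<open>z\<close>, because the shifted
  point is a convex combination of a point of \<open>W\<close> and \<open>x0 + z / t\<close>, which
  lies in the given ball. Bernoulli's inequality bounds its relative volume (1 - t)^d from
  below.\<close>

lemma setcov_ge:
  assumes "convex W" "compact W" "x0 \<in> W" "cball x0 r \<subseteq> W" "0 < r" "norm z \<le> r"
  shows "(1 - real DIM('a) * (norm z / r)) * measure lborel W \<le> setcov W z"
proof -
  define t where "t = norm z / r"
  have t: "0 \<le> t" "t \<le> 1" using assms by (auto simp: t_def)
  let ?S = "(\<lambda>w. (1 - t) *\<^sub>R w + t *\<^sub>R x0) ` W"
  have "?S \<subseteq> {y. y \<in> W \<and> y + z \<in> W}"
  proof safe
    fix w assume w: "w \<in> W"
    show "(1 - t) *\<^sub>R w + t *\<^sub>R x0 \<in> W"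
      using t convexD_alt[OF assms(1) w assms(3)] by simp
    show "(1 - t) *\<^sub>R w + t *\<^sub>R x0 + z \<in> W"
    proof (cases "z = 0")
      case True
      then show ?thesis using t convexD_alt[OF assms(1) w assms(3)] by simp
    next
      case False
      then have t0: "0 < t" using assms(5) by (simp add: t_def)
      have "norm ((1 / t) *\<^sub>R z) \<le> r" using False assms(5) by (simp add: t_def)
      then have "x0 + (1 / t) *\<^sub>R z \<in> W" using assms(4) by (auto simp: dist_norm)
      then have "(1 - t) *\<^sub>R w + t *\<^sub>R (x0 + (1 / t) *\<^sub>R z) \<in> W"
        using t by (intro convexD_alt[OF assms(1) w]) auto
      then show ?thesis using t0 by (simp add: scaleR_add_right add.assoc)
    qed
  qed
  moreover have S: "?S \<in> sets borel"
    using assms(2) by (intro borel_compact compact_continuous_image continuous_intros)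
  ultimately have "measure lborel ?S \<le> setcov W z"
    unfolding setcov_def using emeasure_bounded_finite[of "{y. y \<in> W \<and> y + z \<in> W}"] bW
    by (intro measure_mono_fmeasurable) (auto simp: fmeasurable_def intro: bounded_subset)
  moreover have "measure lborel ?S = (1 - t) ^ DIM('a) * measure lborel W"
  proof -
    have "measure lebesgue ?S = \<bar>1 - t\<bar> ^ DIM('a) * measure lebesgue W"
      using measure_lebesgue_affine[of "1 - t" "t *\<^sub>R x0" W] by (simp add: add.commute)
    then show ?thesis using S t by (simp add: measure_completion)
  qed
  moreover have "1 - real DIM('a) * t \<le> (1 - t) ^ DIM('a)"
    using Bernoulli_inequality[of "- t" "DIM('a)"] t by simp
  ultimately show ?thesis
    using mult_right_mono[of "1 - real DIM('a) * t" "(1 - t) ^ DIM('a)" "measure lborel W"] by (simp add: t_def)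
qed

end

subsection \<open>Pair sums with edge correction\<close>

context b4_window
begin

definition fk :: "('a \<Rightarrow> real) \<Rightarrow> 'a \<Rightarrow> 'a \<Rightarrow> real" where
  "fk h x y = indicator W x * (indicator W y * (h (y - x) / setcov W (y - x)))"

definition NP :: "('a \<Rightarrow> 'a \<Rightarrow> real) \<Rightarrow> 'w \<Rightarrow> real" where
  "NP f \<omega> = S2 f \<omega> - L2 f - 2 * lam * (S1 (\<lambda>x. I (\<lambda>y. f x y)) \<omega> - lam * I (\<lambda>x. I (\<lambda>y. f x y)))"

text \<open>Half of the window volume as a lower bound for the set covariance limits the edge
  weights to twice the reciprocal volume. It is asked only on the support of \<open>h\<close>;
  elsewhere \<open>h z / setcov W z\<close> is 0, also when the denominator vanishes.\<close>

definition kernel_ok :: "('a \<Rightarrow> real) \<Rightarrow> bool" where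
  "kernel_ok h \<longleftrightarrow> h \<in> borel_measurable borel \<and> (\<forall>z. h (- z) = h z) \<and> (\<forall>z. 0 \<le> h z) \<and> (\<exists>H. \<forall>z. h z \<le> H) \<and>
     integrable lborel h \<and> (\<forall>z. h z \<noteq> 0 \<longrightarrow> measure lborel W / 2 \<le> setcov W z) \<and> 0 < measure lborel W"

lemma kernel_ok_interp:
  assumes "kernel_ok h" "\<And>z. h z \<le> H"
  shows "b4_kernel M N \<gamma> W h (\<lambda>z. h z / setcov W z) H (2 / measure lborel W)"
proof (unfold_locales)
  note a = assms(1)[unfolded kernel_ok_def]
  show m: "h \<in> borel_measurable borel" using a by blast
  show "(\<lambda>z. h z / setcov W z) \<in> borel_measurable borel"
    using m setcov_measurable[OF W_borel W_bounded] by measurable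
  show "h (- z) = h z" for z using a by blast
  then show "h (- z) / setcov W (- z) = h z / setcov W z" for z
    by (simp add: setcov_sym[OF W_borel W_bounded])
  show h0: "0 \<le> h z" for z using a by blast
  then show "0 \<le> h z / setcov W z" for z by (simp add: setcov_nonneg[OF W_borel W_bounded])
  show "integrable lborel h" using a by blast
  have w: "0 < measure lborel W" using a by blast
  then show "0 \<le> 2 / measure lborel W" by simp
  show "h z / setcov W z \<le> 2 / measure lborel W * h z" for z
  proof (cases "h z = 0")
    case False
    then have "measure lborel W / 2 \<le> setcov W z" using a by blast
    then have "h z / setcov W z \<le> h z / (measure lborel W / 2)"
      using w h0[of z] by (intro divide_left_mono) auto
    then show ?thesis by (simp add: mult.commute)
  qed simp
qed (rule assms(2))

lemma fk_bm:
  assumes "kernel_ok h"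
  shows "(\<lambda>p. fk h (fst p) (snd p)) \<in> bm bor2"
proof -
  obtain H where H: "\<And>z. h z \<le> H" using assms by (auto simp: kernel_ok_def)
  interpret k: b4_kernel M N \<gamma> W h "\<lambda>z. h z / setcov W z" H "2 / measure lborel W" by (rule kernel_ok_interp[OF assms H])
  show ?thesis using k.ff_bm by (simp add: k.ff_def fk_def)
qed

definition varsum :: "('a \<Rightarrow> real) \<Rightarrow> real \<Rightarrow> real" where
  "varsum h H = aint (\<gamma> 4) (\<lambda>t. h (t 2 - t 1) * h (t 3)) + aint (\<gamma> 3) (\<lambda>t. h (t 2 - t 1) * h (t 2))
     + H * (aint (\<gamma> 2) (\<lambda>t. h (t 1)) + (\<integral>z. h z \<partial>lborel))"

text \<open>The constant of \<open>nonlinear_part_variance\<close>; the factor 4 comes from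
  \<open>K\<^sup>2\<close> with \<open>K\<close> equal to twice the reciprocal window
  volume.\<close>

definition vconst :: real where "vconst = 4 * (4 * lam + 2 * lam\<^sup>2 * (tv + 1)\<^sup>2)"

lemma vconst_nonneg: "0 \<le> vconst"
  using lam_nonneg by (simp add: vconst_def)

lemma NP_variance:
  assumes "kernel_ok h" "\<And>z. h z \<le> H"
  shows "integrable M (\<lambda>\<omega>. (NP (fk h) \<omega>)\<^sup>2)"
    and "(\<integral>\<omega>. (NP (fk h) \<omega>)\<^sup>2 \<partial>M) \<le> vconst / measure lborel W * varsum h H"
proof -
  interpret k: b4_kernel M N \<gamma> W h "\<lambda>z. h z / setcov W z" H "2 / measure lborel W" by (rule kernel_ok_interp[OF assms])
  have eq: "k.nonlinear_part = NP (fk h)"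
    unfolding k.nonlinear_part_def[abs_def] NP_def[abs_def] by (simp add: k.ff_def[abs_def] fk_def[abs_def])
  show "integrable M (\<lambda>\<omega>. (NP (fk h) \<omega>)\<^sup>2)"
    using k.nonlinear_part_variance(1) by (simp add: eq)
  have w: "measure lborel W \<noteq> 0" using assms by (auto simp: kernel_ok_def)
  then show "(\<integral>\<omega>. (NP (fk h) \<omega>)\<^sup>2 \<partial>M) \<le> vconst / measure lborel W * varsum h H"
    using k.nonlinear_part_variance(2)
    by (simp add: eq k.A4_def k.A3_def k.A2_def varsum_def vconst_def power2_eq_square)
qed

text \<open>On the support of \<open>h\<close> the set covariance is positive; off the support both
  sides are 0, whatever the denominator.\<close>

lemma fk_times_setcov:
  assumes "kernel_ok h"
  shows "h z / setcov W z * setcov W z = h z"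
  using assms by (cases "h z = 0") (auto simp: kernel_ok_def)

text \<open>Integrating over the position \<open>u\<close> of a pair with fixed displacement
  produces the set covariance, which the edge correction cancels exactly. The mean of the
  edge-corrected sum therefore does not depend on the window; \<open>I_I_fk\<close> is the same
  computation for Lebesgue measure.\<close>

lemma G2_fk:
  assumes h: "kernel_ok h"
  shows "G2 (fk h) = lam * sint (\<gamma> 2) (\<lambda>t. h (t 1))"
proof -
  let ?\<kappa> = "\<lambda>z. h z / setcov W z"
  obtain H where H: "\<And>z. h z \<le> H" using h by (auto simp: kernel_ok_def)
  interpret k: b4_kernel M N \<gamma> W h ?\<kappa> H "2 / measure lborel W" by (rule kernel_ok_interp[OF h H])
  have k2: "(2::nat) \<in> {2, 3, 4}" by simp
  let ?g = "\<lambda>u t. indicator W (t 1 + u) * fk h (t 1 + u) u"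
  have part: "(\<integral>u. (\<integral>t. ?g u t \<partial>\<nu>) \<partial>LW) = (\<integral>t. h (t 1) \<partial>\<nu>)"
    and int: "integrable LW (\<lambda>u. \<integral>t. ?g u t \<partial>\<nu>)"
    if fin: "finite_measure \<nu>" and m: "(\<lambda>t. t 1) \<in> borel_measurable \<nu>" for \<nu> :: "(nat \<Rightarrow> 'a) measure"
  proof -
    interpret nu: finite_measure \<nu> by fact
    interpret LW: finite_measure LW by (rule finite_LW)
    interpret P: pair_sigma_finite LW \<nu> by unfold_locales
    have p: "(\<lambda>q. snd q 1) \<in> borel_measurable (LW \<Otimes>\<^sub>M \<nu>)" by (rule measurable_compose[OF measurable_snd m])
    have u: "fst \<in> LW \<Otimes>\<^sub>M \<nu> \<rightarrow>\<^sub>M borel" by measurable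
    have "(\<lambda>q. indicator W (snd q 1 + fst q) * fk h (snd q 1 + fst q) (fst q)) \<in> bm (LW \<Otimes>\<^sub>M \<nu>)"
      using bm_compose[OF fk_bm[OF h] measurable_Pair[OF borel_measurable_add[OF p u] u]]
      by (intro bm_mult bm_indicator_compose borel_measurable_add p u) simp
    then have "integrable (LW \<Otimes>\<^sub>M \<nu>) (\<lambda>q. ?g (fst q) (snd q))"
      by (rule bm_integrable[rotated]) (intro finite_measure_pair_measure finite_LW fin)
    then have i: "integrable (LW \<Otimes>\<^sub>M \<nu>) (\<lambda>(u, t). ?g u t)" by (simp add: split_beta')
    show "integrable LW (\<lambda>u. \<integral>t. ?g u t \<partial>\<nu>)" by (rule P.integrable_fst[OF i])
    have "(\<integral>u. (\<integral>t. ?g u t \<partial>\<nu>) \<partial>LW) = (\<integral>t. (\<integral>u. ?g u t \<partial>LW) \<partial>\<nu>)"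
      by (rule P.Fubini_integral[OF i, symmetric])
    also have "\<dots> = (\<integral>t. h (t 1) \<partial>\<nu>)"
    proof (rule Bochner_Integration.integral_cong[OF refl])
      fix t :: "nat \<Rightarrow> 'a"
      have "(\<integral>u. ?g u t \<partial>LW) = (\<integral>u. ?\<kappa> (t 1) * (indicator W u * indicator W (u + t 1)) \<partial>LW)"
        using k.\<kappa>_sym[of "t 1"] by (intro Bochner_Integration.integral_cong) (auto simp: fk_def indicator_def add.commute)
      also have "\<dots> = ?\<kappa> (t 1) * (\<integral>u. indicator W u * (indicator W u * indicator W (u + t 1)) \<partial>lborel)"
        by (simp add: integral_window_measure[OF W_borel])
      also have "(\<integral>u. indicator W u * (indicator W u * indicator W (u + t 1)) \<partial>lborel :: real) = setcov W (t 1)"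
        unfolding setcov_altdef[OF W_borel W_bounded] by (intro Bochner_Integration.integral_cong) (auto simp: indicator_def)
      finally show "(\<integral>u. ?g u t \<partial>LW) = h (t 1)" by (simp only: fk_times_setcov[OF h])
    qed
    finally show "(\<integral>u. (\<integral>t. ?g u t \<partial>\<nu>) \<partial>LW) = (\<integral>t. h (t 1) \<partial>\<nu>)" .
  qed
  have c1: "(\<lambda>t. t 1) \<in> borel_measurable (fst (\<gamma> 2))" "(\<lambda>t. t 1) \<in> borel_measurable (snd (\<gamma> 2))"
    by (rule gam_component[OF k2]; simp)+
  show ?thesis
    unfolding G2_def sint_def
    using int[OF gam_finite(1)[OF k2] c1(1)] int[OF gam_finite(2)[OF k2] c1(2)]
      part[OF gam_finite(1)[OF k2] c1(1)] part[OF gam_finite(2)[OF k2] c1(2)] by (simp del: One_nat_def)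
qed

lemma I_fk:
  assumes h: "kernel_ok h"
  shows "I (\<lambda>y. fk h x y) = indicator W x * (\<integral>z. indicator W (x + z) * (h z / setcov W z) \<partial>lborel)"
proof -
  obtain H where H: "\<And>z. h z \<le> H" using h by (auto simp: kernel_ok_def)
  interpret k: b4_kernel M N \<gamma> W h "\<lambda>z. h z / setcov W z" H "2 / measure lborel W" by (rule kernel_ok_interp[OF h H])
  have [measurable]: "(\<lambda>z. h z / setcov W z) \<in> borel_measurable borel" by (rule k.\<kappa>_measurable)
  have "I (\<lambda>y. fk h x y) = indicator W x * (\<integral>y. indicator W y * (h (y - x) / setcov W (y - x)) \<partial>LW)"
    unfolding fk_def by (rule Bochner_Integration.integral_mult_right_zero)
  also have "(\<integral>y. indicator W y * (h (y - x) / setcov W (y - x)) \<partial>LW) = (\<integral>y. indicator W y * (indicator W y * (h (y - x) / setcov W (y - x))) \<partial>lborel)"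
    using measurable_compose[OF _ k.\<kappa>_measurable, of "\<lambda>y. y - x" borel]
    by (intro integral_window_measure[OF W_borel] borel_measurable_times) auto
  also have "\<dots> = (\<integral>y. indicator W (x + (y - x)) * (h (y - x) / setcov W (y - x)) \<partial>lborel)"
    by (intro Bochner_Integration.integral_cong) (auto simp: indicator_def)
  also have "\<dots> = (\<integral>z. indicator W (x + z) * (h z / setcov W z) \<partial>lborel)"
    by (rule integral_translate(1)[of "\<lambda>z. indicator W (x + z) * (h z / setcov W z)"]) measurable
  finally show ?thesis .
qed

lemma I_I_fk:
  assumes h: "kernel_ok h"
  shows "I (\<lambda>x. I (\<lambda>y. fk h x y)) = (\<integral>z. h z \<partial>lborel)"
proof -
  obtain H where H: "\<And>z. h z \<le> H" using h by (auto simp: kernel_ok_def)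
  interpret k: b4_kernel M N \<gamma> W h "\<lambda>z. h z / setcov W z" H "2 / measure lborel W" by (rule kernel_ok_interp[OF h H])
  let ?\<kappa> = "\<lambda>z. h z / setcov W z"
  have [measurable]: "?\<kappa> \<in> borel_measurable borel" by (rule k.\<kappa>_measurable)
  have ki: "integrable lborel ?\<kappa>"
  proof (rule Bochner_Integration.integrable_bound[OF integrable_mult_right[OF k.h_int, of "2 / measure lborel W"]])
    show "AE z in lborel. norm (?\<kappa> z) \<le> norm (2 / measure lborel W * h z)"
      unfolding real_norm_def abs_of_nonneg[OF k.\<kappa>_nonneg]
      by (intro AE_I2 order_trans[OF k.\<kappa>_le abs_ge_self])
  qed simp
  interpret LW: finite_measure LW by (rule finite_LW)
  interpret P: pair_sigma_finite LW lborel by unfold_locales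
  let ?g = "\<lambda>x z. indicator W x * (indicator W (x + z) * ?\<kappa> z)"
  have inz: "integrable lborel (?g x)" for x
  proof (rule Bochner_Integration.integrable_bound[OF ki])
    show "?g x \<in> borel_measurable lborel" by measurable
  qed (auto simp: indicator_def)
  have gm: "(\<lambda>(x, z). ?g x z) \<in> borel_measurable (LW \<Otimes>\<^sub>M lborel)"
    unfolding split_beta' by measurable
  have i: "integrable (LW \<Otimes>\<^sub>M lborel) (\<lambda>(x, z). ?g x z)"
  proof (rule P.Fubini_integrable[OF gm])
    have "integrable LW (\<lambda>x. \<integral>z. norm (?g x z) \<partial>lborel)"
    proof (rule LW.integrable_const_bound[where B="\<integral>z. ?\<kappa> z \<partial>lborel"])
      show "AE x in LW. norm (\<integral>z. norm (?g x z) \<partial>lborel) \<le> (\<integral>z. ?\<kappa> z \<partial>lborel)"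
      proof (rule AE_I2)
        fix x
        have "\<bar>\<bar>indicator W x * (indicator W (x + z) * r)\<bar>\<bar> \<le> r" if "0 \<le> r" for r :: real and z
          using that by (simp add: indicator_def)
        from this[OF k.\<kappa>_nonneg] have "\<bar>\<bar>?g x z\<bar>\<bar> \<le> ?\<kappa> z" for z .
        then show "norm (\<integral>z. norm (?g x z) \<partial>lborel) \<le> (\<integral>z. ?\<kappa> z \<partial>lborel)"
          unfolding real_norm_def by (intro abs_integral_le[OF ki])
      qed
      show "(\<lambda>x. \<integral>z. norm (?g x z) \<partial>lborel) \<in> borel_measurable LW"
        by (rule lborel.borel_measurable_lebesgue_integral)
           (use measurable_compose[OF gm borel_measurable_norm] in \<open>simp only: split_beta'\<close>)
    qed
    then show "integrable LW (\<lambda>x. \<integral>z. norm (case (x, z) of (x, z) \<Rightarrow> ?g x z) \<partial>lborel)" by simp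
  qed (use inz in auto)
  have "I (\<lambda>x. I (\<lambda>y. fk h x y)) = (\<integral>x. (\<integral>z. ?g x z \<partial>lborel) \<partial>LW)"
    by (simp only: I_fk[OF h] Bochner_Integration.integral_mult_right_zero)
  also have "\<dots> = (\<integral>z. (\<integral>x. ?g x z \<partial>LW) \<partial>lborel)"
    by (rule P.Fubini_integral[OF i, symmetric])
  also have "\<dots> = (\<integral>z. h z \<partial>lborel)"
  proof (rule Bochner_Integration.integral_cong[OF refl])
    fix z
    have "(\<integral>x. ?g x z \<partial>LW) = ?\<kappa> z * (\<integral>x. indicator W x * indicator W (x + z) \<partial>LW)"
      unfolding Bochner_Integration.integral_mult_right_zero[symmetric] by (simp only: mult_ac)
    also have "(\<integral>x. indicator W x * indicator W (x + z) \<partial>LW :: real) = setcov W z"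
      unfolding setcov_altdef[OF W_borel W_bounded]
      by (subst integral_window_measure[OF W_borel]) (auto intro!: Bochner_Integration.integral_cong simp: indicator_def)
    finally show "(\<integral>x. ?g x z \<partial>LW) = h z" by (simp only: fk_times_setcov[OF h])
  qed
  finally show ?thesis .
qed

lemma L2_fk:
  assumes h: "kernel_ok h"
  shows "L2 (fk h) = lam * sint (\<gamma> 2) (\<lambda>t. h (t 1)) + lam\<^sup>2 * (\<integral>z. h z \<partial>lborel)"
  using L2_eq[OF fk_bm[OF h]] by (simp add: G2_fk[OF h] I_I_fk[OF h] power2_eq_square)

lemma integral_I_fk_sq_le:
  assumes h: "kernel_ok h"
  shows "(\<lambda>x. I (\<lambda>y. fk h x y)) \<in> bm borel"
    and "I (\<lambda>x. (I (\<lambda>y. fk h x y))\<^sup>2) \<le> 4 / measure lborel W * (\<integral>z. h z \<partial>lborel)\<^sup>2"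
proof -
  obtain H where H: "\<And>z. h z \<le> H" using h by (auto simp: kernel_ok_def)
  interpret k: b4_kernel M N \<gamma> W h "\<lambda>z. h z / setcov W z" H "2 / measure lborel W" by (rule kernel_ok_interp[OF h H])
  show "(\<lambda>x. I (\<lambda>y. fk h x y)) \<in> bm borel" by (rule bm_I[OF fk_bm[OF h]])
  have w: "measure lborel W \<noteq> 0" using h by (auto simp: kernel_ok_def)
  have "\<bar>I (\<lambda>y. fk h x y)\<bar>\<^sup>2 \<le> (2 / measure lborel W * (\<integral>z. h z \<partial>lborel))\<^sup>2" for x
    using k.I_ff_le[of x] by (intro power_mono) (auto simp: k.ff_def fk_def)
  then have "\<bar>I (\<lambda>x. (I (\<lambda>y. fk h x y))\<^sup>2)\<bar> \<le> measure lborel W * (2 / measure lborel W * (\<integral>z. h z \<partial>lborel))\<^sup>2"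
    by (intro abs_I_le) simp
  then show "I (\<lambda>x. (I (\<lambda>y. fk h x y))\<^sup>2) \<le> 4 / measure lborel W * (\<integral>z. h z \<partial>lborel)\<^sup>2"
    using w by (simp add: power2_eq_square)
qed

end

subsection \<open>Dyadic chaining\<close>

text \<open>Induction on the depth: even indices form a chain of smaller depth, and an odd index is
  one finest increment away from its predecessor. Each level thus uses a single increment, which is
  bounded by the Euclidean norm of all increments of that level; unlike a maximum, that norm has a
  square whose expectation is a sum of variances.\<close>

lemma dyadic_chaining:
  fixes X :: "nat \<Rightarrow> real"
  assumes "X 0 = 0" "j \<le> 2 ^ p"
  shows "\<bar>X j\<bar> \<le> (\<Sum>k\<le>p. sqrt (\<Sum>i<2 ^ k. (X ((i + 1) * 2 ^ (p - k)) - X (i * 2 ^ (p - k)))\<^sup>2))"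
  using assms
proof (induction p arbitrary: X j)
  case 0
  then have "j = 0 \<or> j = 1" by auto
  then show ?case using 0 by auto
next
  case (Suc p)
  let ?inc = "\<lambda>X p k. sqrt (\<Sum>i<2 ^ k. (X ((i + 1) * 2 ^ (p - k)) - X (i * 2 ^ (p - k)))\<^sup>2)"
  have split: "(\<Sum>k\<le>Suc p. ?inc X (Suc p) k) = (\<Sum>k\<le>p. ?inc (\<lambda>i. X (2 * i)) p k) + ?inc X (Suc p) (Suc p)"
  proof -
    have "?inc X (Suc p) k = ?inc (\<lambda>i. X (2 * i)) p k" if "k \<le> p" for k
    proof -
      have "Suc p - k = Suc (p - k)" using that by simp
      then show ?thesis by (simp add: mult.left_commute mult.assoc algebra_simps)
    qed
    then show ?thesis by simp
  qed
  have even: "\<bar>X (2 * i)\<bar> \<le> (\<Sum>k\<le>p. ?inc (\<lambda>i. X (2 * i)) p k)" if "i \<le> 2 ^ p" for i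
    using Suc.IH[of "\<lambda>i. X (2 * i)" i] Suc.prems(1) that by simp
  define i where "i = j div 2"
  have i: "i \<le> 2 ^ p" using Suc.prems(2) by (auto simp: i_def)
  show ?case
  proof (cases "even j")
    case True
    then have "X j = X (2 * i)" by (simp add: i_def)
    then have "\<bar>X j\<bar> \<le> (\<Sum>k\<le>p. ?inc (\<lambda>i. X (2 * i)) p k)" using even[OF i] by simp
    moreover have "0 \<le> ?inc X (Suc p) (Suc p)" by (intro real_sqrt_ge_zero sum_nonneg) auto
    ultimately show ?thesis unfolding split by linarith
  next
    case False
    then have j: "j = 2 * i + 1" by (simp add: i_def)
    have "2 * i < 2 ^ Suc p" using Suc.prems(2) j by simp
    then have "(X ((2 * i + 1) * 2 ^ (Suc p - Suc p)) - X ((2 * i) * 2 ^ (Suc p - Suc p)))\<^sup>2 \<le>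
        (\<Sum>i<2 ^ Suc p. (X ((i + 1) * 2 ^ (Suc p - Suc p)) - X (i * 2 ^ (Suc p - Suc p)))\<^sup>2)"
      by (intro member_le_sum[of "2 * i"]) auto
    then have "sqrt ((X j - X (2 * i))\<^sup>2) \<le> ?inc X (Suc p) (Suc p)"
      unfolding j by (intro real_sqrt_le_mono) simp
    then have "\<bar>X j - X (2 * i)\<bar> \<le> ?inc X (Suc p) (Suc p)" by simp
    then show ?thesis unfolding split using even[OF i] by linarith
  qed
qed

text \<open>Cauchy-Schwarz over the \<open>p + 1\<close> levels, since only second moments of the
  increments are controlled.\<close>

lemma dyadic_chaining_square:
  fixes X :: "nat \<Rightarrow> real"
  assumes "X 0 = 0" "j \<le> 2 ^ p"
  shows "(X j)\<^sup>2 \<le> real (p + 1) * (\<Sum>k\<le>p. \<Sum>i<2 ^ k. (X ((i + 1) * 2 ^ (p - k)) - X (i * 2 ^ (p - k)))\<^sup>2)"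
proof -
  let ?s = "\<lambda>k. \<Sum>i<2 ^ k. (X ((i + 1) * 2 ^ (p - k)) - X (i * 2 ^ (p - k)))\<^sup>2"
  have s: "0 \<le> ?s k" for k by (intro sum_nonneg) auto
  have "(X j)\<^sup>2 = \<bar>X j\<bar>\<^sup>2" by simp
  also have "\<dots> \<le> (\<Sum>k\<le>p. 1 * sqrt (?s k))\<^sup>2"
    using dyadic_chaining[of X, OF assms] by (intro power_mono) auto
  also have "\<dots> \<le> (\<Sum>k\<le>p. 1\<^sup>2) * (\<Sum>k\<le>p. (sqrt (?s k))\<^sup>2)"
    by (rule Cauchy_Schwarz_ineq_sum)
  also have "\<dots> = real (p + 1) * (\<Sum>k\<le>p. ?s k)"
    using s by simp
  finally show ?thesis .
qed

context b4_window
begin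

text \<open>\<open>NP\<close> is linear in the kernel, so increments in the radius are again of the
  form \<open>NP\<close>, with the indicator of a ring as kernel.\<close>

lemma NP_diff:
  assumes h: "kernel_ok h1" "kernel_ok h2" "kernel_ok (\<lambda>z. h1 z - h2 z)"
  shows "NP (fk h1) \<omega> - NP (fk h2) \<omega> = NP (fk (\<lambda>z. h1 z - h2 z)) \<omega>"
proof -
  let ?h = "\<lambda>z. h1 z - h2 z"
  have fk: "fk ?h x y = fk h1 x y - fk h2 x y" for x y
    by (simp add: fk_def diff_divide_distrib right_diff_distrib)
  have 1: "S2 (fk ?h) \<omega> = S2 (fk h1) \<omega> - S2 (fk h2) \<omega>"
    by (simp add: fk sum_subtractf)
  have 2: "L2 (fk ?h) = L2 (fk h1) - L2 (fk h2)"
    using integrable_L2[OF fk_bm[OF h(1)]] integrable_L2[OF fk_bm[OF h(2)]]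
    by (simp add: L2_def fk sum_subtractf)
  have b: "(\<lambda>y. fk h' x y) \<in> bm borel" if "kernel_ok h'" for x h'
    using bm_compose[OF fk_bm[OF that], of "\<lambda>y. (x, y)" borel] by simp
  have I: "I (\<lambda>y. fk ?h x y) = I (\<lambda>y. fk h1 x y) - I (\<lambda>y. fk h2 x y)" for x
    using bm_integrable_LW[OF b[OF h(1)]] bm_integrable_LW[OF b[OF h(2)]] by (simp add: fk)
  have 3: "S1 (\<lambda>x. I (\<lambda>y. fk ?h x y)) \<omega> = S1 (\<lambda>x. I (\<lambda>y. fk h1 x y)) \<omega> - S1 (\<lambda>x. I (\<lambda>y. fk h2 x y)) \<omega>"
    by (simp add: I sum_subtractf)
  have 4: "I (\<lambda>x. I (\<lambda>y. fk ?h x y)) = I (\<lambda>x. I (\<lambda>y. fk h1 x y)) - I (\<lambda>x. I (\<lambda>y. fk h2 x y))"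
    using bm_integrable_LW[OF integral_I_fk_sq_le(1)[OF h(1)]] bm_integrable_LW[OF integral_I_fk_sq_le(1)[OF h(2)]]
    by (simp add: I)
  show ?thesis unfolding NP_def 1 2 3 4 by (simp add: algebra_simps)
qed

text \<open>The higher cumulant terms of a family of disjoint kernels add up to at most the total
  variations; this superadditivity is what makes chaining work without densities of the cumulant
  measures.\<close>

lemma sum_varsum_le:
  assumes "finite J" "disjoint_family_on C J" "\<And>j. j \<in> J \<Longrightarrow> C j \<in> sets borel" "\<And>j. j \<in> J \<Longrightarrow> C j \<subseteq> D"
    "D \<in> sets borel" "bounded D"
  shows "(\<Sum>j\<in>J. varsum (indicator (C j)) 1) \<le>
    aint (\<gamma> 4) (\<lambda>_. 1) + aint (\<gamma> 3) (\<lambda>_. 1) + tv + measure lborel D"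
proof -
  let ?h = "\<lambda>j. indicator (C j) :: 'a \<Rightarrow> real"
  have s1: "(\<Sum>j\<in>J. ?h j z) \<le> 1" for z
  proof -
    have "(\<Sum>j\<in>J. ?h j z) = indicator (\<Union>j\<in>J. C j) z"
      by (rule indicator_UN_disjoint[OF assms(1,2), symmetric])
    then show ?thesis by (simp add: indicator_le_1)
  qed
  have s2: "(\<Sum>j\<in>J. ?h j z * ?h j z') \<le> 1" for z z'
    by (rule order_trans[OF sum_mono s1[of z]]) (auto simp: indicator_def)
  have hb: "?h j \<in> bm borel" if "j \<in> J" for j by (intro bm_indicator assms that)
  have sum_aint: "(\<Sum>j\<in>J. aint (\<gamma> k) (F j)) = aint (\<gamma> k) (\<lambda>t. \<Sum>j\<in>J. F j t)"
    if k: "k \<in> {2, 3, 4}" and F: "\<And>j. j \<in> J \<Longrightarrow> F j \<in> bm (\<Pi>\<^sub>M l\<in>{1..<k}. (borel :: 'a measure))" for k F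
  proof -
    have "integrable (fst (\<gamma> k)) (F j)" "integrable (snd (\<gamma> k)) (F j)" if "j \<in> J" for j
      using gam_bm[OF k F[OF that]] by (auto intro: bm_integrable gam_finite[OF k])
    then show ?thesis by (simp add: aint_def sum.distrib)
  qed
  have le1: "(\<Sum>j\<in>J. aint (\<gamma> k) (F j)) \<le> aint (\<gamma> k) (\<lambda>_. 1)"
    if k: "k \<in> {2, 3, 4}" and F: "\<And>j. j \<in> J \<Longrightarrow> F j \<in> bm (\<Pi>\<^sub>M l\<in>{1..<k}. (borel :: 'a measure))"
      and F1: "\<And>t. (\<Sum>j\<in>J. F j t) \<le> 1" for k F
  proof -
    have "(\<Sum>j\<in>J. aint (\<gamma> k) (F j)) = aint (\<gamma> k) (\<lambda>t. \<Sum>j\<in>J. F j t)"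
      by (rule sum_aint[OF k]) (rule F)
    also have "\<dots> \<le> aint (\<gamma> k) (\<lambda>_. 1)"
      by (rule aint_mono[OF k bm_sum[OF F] bm_const F1])
    finally show ?thesis .
  qed
  have 4: "(\<Sum>j\<in>J. aint (\<gamma> 4) (\<lambda>t. ?h j (t 2 - t 1) * ?h j (t 3))) \<le> aint (\<gamma> 4) (\<lambda>_. 1)"
    by (intro le1 s2 bm_mult bm_compose[OF hb] borel_measurable_diff comp_PiM) auto
  have 3: "(\<Sum>j\<in>J. aint (\<gamma> 3) (\<lambda>t. ?h j (t 2 - t 1) * ?h j (t 2))) \<le> aint (\<gamma> 3) (\<lambda>_. 1)"
    by (intro le1 s2 bm_mult bm_compose[OF hb] borel_measurable_diff comp_PiM) auto
  have 2: "(\<Sum>j\<in>J. aint (\<gamma> 2) (\<lambda>t. ?h j (t 1))) \<le> tv"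
    unfolding tv_def by (intro le1 s1 bm_compose[OF hb] comp_PiM) auto
  have "(\<Sum>j\<in>J. \<integral>z. ?h j z \<partial>lborel) = (\<Sum>j\<in>J. measure lborel (C j))"
    using assms by simp
  also have "\<dots> = measure lborel (\<Union>j\<in>J. C j)"
    using assms emeasure_bounded_finite[OF bounded_subset[OF assms(6,4)]]
    by (intro measure_finite_Union[symmetric]) (auto simp: less_top)
  also have "\<dots> \<le> measure lborel D"
    using assms emeasure_bounded_finite[OF assms(6)]
    by (intro measure_mono_fmeasurable) (auto simp: fmeasurable_def)
  finally have 1: "(\<Sum>j\<in>J. \<integral>z. ?h j z \<partial>lborel) \<le> measure lborel D" .
  show ?thesis
    unfolding varsum_def sum.distrib mult_1 using 1 2 3 4 by linarith
qed

text \<open>Between neighbouring grid radii the mean of the estimator may grow at most like the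
  volume of the ring; this is where the bound on the reduced second moment measure enters. Its
  defining relation, known on rectangles, is extended to the kernel \<open>fk\<close> by
  \<open>bpc_fun_eq_pair\<close>. The factor 2 is the bound on the edge weights.\<close>

lemma moment_bound_fk:
  assumes mu: "reduced_moment M N 2 \<mu>" and a0: "0 < a0"
    "\<And>A. A \<in> sets borel \<Longrightarrow> bounded A \<Longrightarrow> emeasure \<mu> (\<Pi>\<^sub>E l\<in>{1..<2::nat}. A) \<le> ennreal a0 * emeasure lborel A"
    and C: "C \<in> sets borel" "bounded C" and ok: "kernel_ok (indicator C)"
  shows "L2 (fk (indicator C)) \<le> 2 * lam * a0 * measure lborel C"
proof -
  obtain \<rho> where \<rho>: "\<And>x. x \<in> W \<Longrightarrow> norm x \<le> \<rho>" using W_bounded by (auto simp: bounded_iff)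
  have e12: "{1..2} = {1, 2::nat}" "{1..<2} = {1::nat}" by auto
  \<comment> \<open>\<mu> is only locally finite. Differences of points of \<open>W\<close> have
    norm at most \<open>2 * \<rho>\<close>, so restricting \<mu> to \<open>Q\<close> loses nothing
    and makes it finite, as \<open>bpc_int\<close> requires.\<close>
  define Q where "Q = (\<Pi>\<^sub>E l\<in>{1..<2::nat}. cball (0::'a) (2 * \<rho>))"
  have \<mu>s: "sets \<mu> = sets (\<Pi>\<^sub>M l\<in>{1..<2::nat}. (borel :: 'a measure))"
    and \<mu>f: "\<And>A. (\<And>l. A l \<in> sets borel \<and> bounded (A l)) \<Longrightarrow> emeasure \<mu> (\<Pi>\<^sub>E l\<in>{1..<2::nat}. A l) < \<infinity>"
    using mu by (auto simp: reduced_moment_def locally_finite_def)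
  have \<mu>sp: "space \<mu> = Pi\<^sub>E {1..<2} (\<lambda>_. UNIV)"
    using sets_eq_imp_space_eq[OF \<mu>s] by (simp add: space_PiM)
  have rectS: "(\<Pi>\<^sub>E l\<in>{1..<2::nat}. A l) \<in> sets \<mu>" if "\<And>l. A l \<in> sets borel" for A :: "nat \<Rightarrow> 'a set"
    unfolding \<mu>s by (intro sets_PiM_I_finite) (use that in auto)
  have Q: "Q \<in> sets \<mu>" unfolding Q_def by (rule rectS) auto
  define \<nu> where "\<nu> = density \<mu> (indicator Q)"
  have \<nu>s: "sets \<nu> = sets \<mu>" by (simp add: \<nu>_def)
  have \<nu>sp: "space \<nu> = space \<mu>" by (simp add: \<nu>_def)
  have \<nu>e: "emeasure \<nu> S = emeasure \<mu> (Q \<inter> S)" if "S \<in> sets \<mu>" for S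
    unfolding \<nu>_def using Q that by (subst emeasure_density) (auto simp: indicator_inter_arith[symmetric])
  have fin: "finite_measure \<nu>"
  proof
    have "emeasure \<mu> Q < \<infinity>" unfolding Q_def by (rule \<mu>f) auto
    then show "emeasure \<nu> (space \<nu>) \<noteq> \<infinity>"
      using \<nu>e[OF sets.top] sets.sets_into_space[OF Q] by (simp add: \<nu>sp Int_absorb2)
  qed
  have comp: "(\<lambda>t. t 1) \<in> borel_measurable \<nu>"
    using comp_PiM[of 1 2] by (simp add: measurable_cong_sets[OF trans[OF \<nu>s \<mu>s] refl])
  have snd_comp: "(\<lambda>q. snd q 1) \<in> borel_measurable (Y \<Otimes>\<^sub>M \<nu>)" for Y :: "'y measure"
    by (rule measurable_compose[OF measurable_snd comp])
  let ?\<Psi> = "\<lambda>F. lam * I (\<lambda>u. \<integral>t. indicator W (t 1 + u) * F (t 1 + u, u) \<partial>\<nu>)"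
  have "L2 (\<lambda>x y. F (x, y)) = ?\<Psi> F" if F: "F \<in> bm bor2" for F
  proof (rule bpc_fun_eq_pair[OF bpc_base(2) _ _ _ _ F])
    have u: "(\<lambda>q. snd (fst q)) \<in> borel_measurable ((count_space (UNIV :: unit set) \<Otimes>\<^sub>M LW) \<Otimes>\<^sub>M \<nu>)" by measurable
    show "bpc_fun bor2 ?\<Psi>"
      by (intro bpc_mult[OF bm_const] bpc_int[OF finite_LW] bpc_int[OF fin] bpc_mult[OF bm_indicator_compose] bpc_subst
          measurable_Pair borel_measurable_add snd_comp u)
    fix a b :: "'a set" assume ab [measurable]: "a \<in> sets borel" "b \<in> sets borel"
    define A where "A = (\<lambda>l::nat. if l = 1 then a else b)"
    have A: "A l \<in> sets borel" for l by (simp add: A_def)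
    define e :: "'a \<Rightarrow> real" where "e = (\<lambda>x. indicator b x * (\<integral>t. indicator W (t 1 + x) * indicator a (t 1 + x) \<partial>\<nu>))"
    have eI: "(\<integral>t. indicator W (t 1 + u) * (indicator a (t 1 + u) * indicator b u) \<partial>\<nu>) = e u" for u
      unfolding e_def Bochner_Integration.integral_mult_right_zero[symmetric] by (simp only: mult_ac)
    have e_nonneg: "0 \<le> e x" for x unfolding e_def by (intro mult_nonneg_nonneg integral_nonneg_AE) auto
    have e_bm: "e \<in> bm borel"
    proof -
      have u': "(\<lambda>q. fst q) \<in> borel_measurable ((borel :: 'a measure) \<Otimes>\<^sub>M \<nu>)" by measurable
      have "bpc_op bor2 borel (\<lambda>F u. \<integral>t. indicator W (t 1 + u) * F (t 1 + u, u) \<partial>\<nu>)"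
        by (intro bpc_int[OF fin] bpc_mult[OF bm_indicator_compose] bpc_subst
            measurable_Pair borel_measurable_add snd_comp u')
      from bpc_op_bm[OF this bm_indicator[of "a \<times> b"]] show ?thesis
        by (simp add: indicator_times eI del: One_nat_def)
    qed
    have AW: "A l \<inter> W \<in> sets borel" for l using A by auto
    have "fact_moment M N {1, 2} (\<lambda>l. A l \<inter> W) = ennreal lam *
        (\<integral>\<^sup>+x\<in>A 2 \<inter> W. emeasure \<mu> (\<Pi>\<^sub>E l\<in>{1..<2}. (\<lambda>y. y - x) ` (A l \<inter> W)) \<partial>lborel)"
      using mp[OF spec[OF conjunct2[OF mu[unfolded reduced_moment_def]], of "\<lambda>l. A l \<inter> W"]] AW
      unfolding e12(1) by simp
    also have "(\<integral>\<^sup>+x\<in>A 2 \<inter> W. emeasure \<mu> (\<Pi>\<^sub>E l\<in>{1..<2}. (\<lambda>y. y - x) ` (A l \<inter> W)) \<partial>lborel) =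
        (\<integral>\<^sup>+x. ennreal (indicator W x * (indicator b x * (\<integral>t. indicator W (t 1 + x) * indicator a (t 1 + x) \<partial>\<nu>))) \<partial>lborel)"
    proof (rule nn_integral_cong)
      fix x :: 'a
      let ?S = "\<Pi>\<^sub>E l\<in>{1..<2::nat}. (\<lambda>y. y - x) ` (A l \<inter> W)"
      show "emeasure \<mu> ?S * indicator (A 2 \<inter> W) x =
          ennreal (indicator W x * (indicator b x * (\<integral>t. indicator W (t 1 + x) * indicator a (t 1 + x) \<partial>\<nu>)))"
      proof (cases "x \<in> b \<and> x \<in> W")
        case True
        have S: "?S \<in> sets \<mu>" by (rule rectS) (intro borel_translate_minus AW)
        have SQ: "?S \<subseteq> Q"
        proof
          fix t assume t: "t \<in> ?S"
          then have t': "t \<in> Pi\<^sub>E {1..<2} (\<lambda>_. UNIV)" by (auto simp: PiE_iff)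
          have "t 1 + x \<in> W" using t translate_mem_PiE_iff[OF t', of x "\<lambda>l. A l \<inter> W"] by (simp only: e12(2)) simp
          then have "norm (t 1) \<le> 2 * \<rho>"
            using norm_triangle_ineq4[of "t 1 + x" x] \<rho>[of "t 1 + x"] \<rho>[of x] True by simp
          then show "t \<in> Q"
            using t' unfolding Q_def e12(2) by (auto simp: PiE_iff)
        qed
        have "(\<integral>t. indicator W (t 1 + x) * indicator a (t 1 + x) \<partial>\<nu>) = (\<integral>t. indicator ?S t \<partial>\<nu> :: real)"
        proof (rule Bochner_Integration.integral_cong[OF refl])
          fix t assume "t \<in> space \<nu>"
          then have t': "t \<in> Pi\<^sub>E {1..<2} (\<lambda>_. UNIV)" by (simp add: \<nu>sp \<mu>sp)
          have "t \<in> ?S \<longleftrightarrow> t 1 + x \<in> a \<inter> W"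
            using translate_mem_PiE_iff[OF t', of x "\<lambda>l. A l \<inter> W"] by (simp only: e12(2)) (simp add: A_def)
          then show "indicator W (t 1 + x) * indicator a (t 1 + x) = (indicator ?S t :: real)"
            by (simp only: indicator_def) auto
        qed
        also have "\<dots> = measure \<nu> ?S"
          using S sets.sets_into_space[OF S] by (simp add: \<nu>s \<nu>sp Int_absorb2)
        finally have "ennreal (\<integral>t. indicator W (t 1 + x) * indicator a (t 1 + x) \<partial>\<nu>) = emeasure \<mu> (Q \<inter> ?S)"
          using finite_measure.emeasure_eq_measure[OF fin] \<nu>e[OF S] by simp
        also have "Q \<inter> ?S = ?S" using SQ by auto
        finally show ?thesis using True by (simp add: A_def)
      qed (auto simp: A_def indicator_def)
    qed
    also have "\<dots> = ennreal (I e)"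
    proof -
      obtain K where K: "0 \<le> K" "\<And>x. \<bar>e x\<bar> \<le> K" using bmE[OF e_bm] by metis
      have [measurable]: "e \<in> borel_measurable borel" by (rule bm_measurable[OF e_bm])
      have "integrable lborel (\<lambda>x. indicator W x * e x)"
      proof (rule Bochner_Integration.integrable_bound)
        show "integrable lborel (\<lambda>x. indicator W x * K)"
          using emeasure_bounded_finite[OF W_bounded] by (intro integrable_mult_left integrable_real_indicator) auto
        show "AE x in lborel. norm (indicator W x * e x) \<le> norm (indicator W x * K)"
          using K by (intro AE_I2) (simp add: indicator_def)
      qed measurable
      then have "(\<integral>\<^sup>+x. ennreal (indicator W x * e x) \<partial>lborel) = ennreal (\<integral>x. indicator W x * e x \<partial>lborel)"
        by (rule nn_integral_eq_integral) (use e_nonneg in auto)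
      also have "(\<integral>x. indicator W x * e x \<partial>lborel) = I e"
        by (rule integral_window_measure[OF W_borel, symmetric]) measurable
      finally show ?thesis by (simp add: e_def)
    qed
    finally have fm: "fact_moment M N {1, 2} (\<lambda>l. A l \<inter> W) = ennreal lam * ennreal (I e)" .
    have "0 \<le> I e" by (rule integral_nonneg_AE) (use e_nonneg in auto)
    then have "enn2real (fact_moment M N {1, 2} (\<lambda>l. A l \<inter> W)) = lam * I e"
      unfolding fm using lam_nonneg by (simp add: enn2real_mult)
    moreover have "distinct [1, 2::nat]" by simp
    ultimately have "L2 (\<lambda>x y. indicator a x * indicator b y) = lam * I e"
      using moment_2[of A 1 2, OF A] by (simp add: A_def)
    then show "L2 (\<lambda>x y. indicator (a \<times> b) (x, y)) = ?\<Psi> (indicator (a \<times> b))"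
      by (simp add: indicator_times eI del: One_nat_def)
  qed simp_all
  from this[OF fk_bm[OF ok]]
  have L2: "L2 (fk (indicator C)) = lam * I (\<lambda>u. \<integral>t. indicator W (t 1 + u) * fk (indicator C) (t 1 + u) u \<partial>\<nu>)" by simp
  have w: "0 < measure lborel W" using ok by (simp add: kernel_ok_def)
  let ?S = "\<Pi>\<^sub>E l\<in>{1..<2::nat}. C"
  have S: "?S \<in> sets \<mu>" by (rule rectS) (rule C)
  have "measure \<nu> ?S \<le> a0 * measure lborel C"
  proof -
    have "emeasure \<nu> ?S \<le> emeasure \<mu> ?S"
      unfolding \<nu>e[OF S] using Q S by (intro emeasure_mono) auto
    also have "\<dots> \<le> ennreal a0 * emeasure lborel C" by (rule a0(2)[OF C])
    also have "\<dots> = ennreal (a0 * measure lborel C)"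
      using a0(1) emeasure_bounded_finite[OF C(2)] by (simp add: ennreal_mult emeasure_eq_ennreal_measure less_top)
    finally have "ennreal (measure \<nu> ?S) \<le> ennreal (a0 * measure lborel C)"
      by (simp add: finite_measure.emeasure_eq_measure[OF fin])
    then show ?thesis using a0(1) by (subst (asm) ennreal_le_iff) auto
  qed
  then have \<nu>S: "(\<integral>t. (2 / measure lborel W) * indicator ?S t \<partial>\<nu>) \<le> (2 / measure lborel W) * (a0 * measure lborel C)"
    using S sets.sets_into_space[OF S] w by (simp add: \<nu>s \<nu>sp Int_absorb2 divide_right_mono)
  have "\<bar>I (\<lambda>u. \<integral>t. indicator W (t 1 + u) * fk (indicator C) (t 1 + u) u \<partial>\<nu>)\<bar> \<le>
      measure lborel W * ((2 / measure lborel W) * (a0 * measure lborel C))"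
  proof (rule abs_I_le)
    fix u
    have "\<bar>\<integral>t. indicator W (t 1 + u) * fk (indicator C) (t 1 + u) u \<partial>\<nu>\<bar> \<le> (\<integral>t. (2 / measure lborel W) * indicator ?S t \<partial>\<nu>)"
    proof (rule abs_integral_le)
      show "integrable \<nu> (\<lambda>t. (2 / measure lborel W) * indicator ?S t)"
        using S finite_measure.emeasure_finite[OF fin] by (intro integrable_mult_right integrable_real_indicator) (auto simp: \<nu>s less_top)
      fix t assume "t \<in> space \<nu>"
      then have t': "t \<in> Pi\<^sub>E {1..<2} (\<lambda>_. UNIV)" by (simp add: \<nu>sp \<mu>sp)
      interpret k: b4_kernel M N \<gamma> W "indicator C" "\<lambda>z. indicator C z / setcov W z" 1 "2 / measure lborel W"
        by (rule kernel_ok_interp[OF ok indicator_le_1])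
      have "fk (indicator C) (t 1 + u) u \<le> 2 / measure lborel W * indicator C (t 1)"
        using k.ff_le'[of "t 1 + u" u] by (simp add: k.ff_def fk_def)
      moreover have "t \<in> ?S \<longleftrightarrow> t 1 \<in> C"
        using t' by (simp only: e12(2)) (auto simp: PiE_iff)
      then have "indicator C (t 1) = (indicator ?S t :: real)"
        by (simp only: indicator_def)
      moreover have "0 \<le> fk (indicator C) (t 1 + u) u" using k.ff_nonneg[of "t 1 + u" u] by (simp add: k.ff_def fk_def)
      ultimately show "\<bar>indicator W (t 1 + u) * fk (indicator C) (t 1 + u) u\<bar> \<le> (2 / measure lborel W) * indicator ?S t"
        using w by (simp add: indicator_def)
    qed
    also note \<nu>S
    finally show "\<bar>\<integral>t. indicator W (t 1 + u) * fk (indicator C) (t 1 + u) u \<partial>\<nu>\<bar> \<le> (2 / measure lborel W) * (a0 * measure lborel C)" .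
  qed
  then have "L2 (fk (indicator C)) \<le> lam * (measure lborel W * ((2 / measure lborel W) * (a0 * measure lborel C)))"
    unfolding L2 using lam_nonneg by (intro mult_left_mono) auto
  then show ?thesis using w by (simp add: mult_ac)
qed

end

subsection \<open>Uniform linearisation of the pair statistic in a fixed window\<close>

text \<open>\<open>s\<close> is the factor by which radii in \<open>[0, R]\<close> are blown up
  along the window sequence. The covariance bound at the largest radius covers all smaller ones,
  since the scaled copies of \<open>B\<close> are nested.\<close>

locale k_window = b4_window M N \<gamma> W
  for M :: "'w measure" and N :: "'w \<Rightarrow> 'a::euclidean_space set" and \<gamma> :: "nat \<Rightarrow> (nat \<Rightarrow> 'a) signed" and W +
  fixes \<mu> :: "(nat \<Rightarrow> 'a) measure" and a0 s R :: real and B :: "'a set"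
  assumes mu: "reduced_moment M N 2 \<mu>" and a0: "0 < a0"
    and mu_le: "\<And>A. A \<in> sets borel \<Longrightarrow> bounded A \<Longrightarrow> emeasure \<mu> (\<Pi>\<^sub>E l\<in>{1..<2::nat}. A) \<le> ennreal a0 * emeasure lborel A"
    and B: "compact B" "convex B" "\<And>x. x \<in> B \<Longrightarrow> - x \<in> B" "0 \<in> B"
    and s: "0 < s" and R: "0 < R" and W_pos: "0 < measure lborel W"
    and cov: "\<And>z. z \<in> (\<lambda>z. (s * R) *\<^sub>R z) ` B \<Longrightarrow> measure lborel W / 2 \<le> setcov W z"
begin

text \<open>The origin is removed because the points of a pair are distinct and their difference is
  never 0. This makes \<open>C 0\<close> empty, so the chain of radii starts at the value 0.\<close>

definition C :: "real \<Rightarrow> 'a set" where "C r = (\<lambda>z. (s * r) *\<^sub>R z) ` B - {0}"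

lemma C_borel: "C r \<in> sets borel" and C_bounded: "bounded (C r)"
proof -
  have "compact ((\<lambda>z. (s * r) *\<^sub>R z) ` B)" using B(1) by (rule compact_scaling)
  then show "C r \<in> sets borel" "bounded (C r)"
    unfolding C_def by (auto intro: borel_compact compact_imp_bounded bounded_subset)
qed

lemma C_0: "C 0 = {}"
  by (auto simp: C_def)

lemma C_sym: "- z \<in> C r \<longleftrightarrow> z \<in> C r"
proof -
  have "- z \<in> C r" if "z \<in> C r" for z
    using that B(3) unfolding C_def by (auto intro!: image_eqI[of _ _ "- _"])
  from this[of z] this[of "- z"] show ?thesis by auto
qed

lemma C_mono:
  assumes "0 \<le> r" "r \<le> r'"
  shows "C r \<subseteq> C r'"
proof (cases "r' = 0")
  case False
  then have r': "0 < r'" using assms by simp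
  have "(s * r) *\<^sub>R b \<in> (\<lambda>z. (s * r') *\<^sub>R z) ` B" if "b \<in> B" for b
  proof (rule image_eqI[of _ _ "(r / r') *\<^sub>R b"])
    have "(r / r') *\<^sub>R b = (1 - r / r') *\<^sub>R 0 + (r / r') *\<^sub>R b" by simp
    also have "\<dots> \<in> B" using assms r' by (intro convexD_alt[OF B(2) B(4) that]) auto
    finally show "(r / r') *\<^sub>R b \<in> B" .
  qed (use r' in simp)
  then show ?thesis by (auto simp: C_def)
qed (use assms in auto)

lemma measure_C:
  assumes "0 \<le> r"
  shows "measure lborel (C r) = (s * r) ^ DIM('a) * measure lborel B"
proof -
  have cp: "compact ((\<lambda>z. (s * r) *\<^sub>R z) ` B)" using B(1) by (rule compact_scaling)
  have S: "(\<lambda>z. (s * r) *\<^sub>R z) ` B \<in> sets borel" "B \<in> sets borel"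
    using cp B(1) by (auto intro: borel_compact)
  have "measure lborel (C r) = measure lborel ((\<lambda>z. (s * r) *\<^sub>R z) ` B)"
  proof -
    have "emeasure lborel ((\<lambda>z. (s * r) *\<^sub>R z) ` B - {0}) = emeasure lborel ((\<lambda>z. (s * r) *\<^sub>R z) ` B)"
      by (rule emeasure_Diff_null_set) (use S in \<open>auto simp: null_sets_def\<close>)
    then show ?thesis by (simp add: C_def measure_def)
  qed
  also have "\<dots> = (s * r) ^ DIM('a) * measure lborel B"
    using measure_lebesgue_affine[of "s * r" 0 B] s assms S by (simp add: measure_completion)
  finally show ?thesis .
qed

lemma kernel_ok_indicator:
  assumes "D \<in> sets borel" "D \<subseteq> C R" "\<And>z. - z \<in> D \<longleftrightarrow> z \<in> D"
  shows "kernel_ok (indicator D)"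
  unfolding kernel_ok_def
proof (intro conjI allI impI)
  show "integrable lborel (indicator D :: 'a \<Rightarrow> real)"
    using emeasure_bounded_finite[OF bounded_subset[OF C_bounded assms(2)]] assms(1)
    by (intro integrable_real_indicator) auto
  show "\<exists>H. \<forall>z. indicator D z \<le> (H::real)" by (rule exI[of _ 1]) (simp add: indicator_def)
  show "indicator D z \<noteq> (0::real) \<Longrightarrow> measure lborel W / 2 \<le> setcov W z" for z
    using assms(2) cov[of z] by (auto simp: indicator_def C_def split: if_splits)
qed (use assms W_pos in \<open>auto simp: indicator_def\<close>)

lemma kernel_ok_C: "0 \<le> r \<Longrightarrow> r \<le> R \<Longrightarrow> kernel_ok (indicator (C r))"
  by (intro kernel_ok_indicator C_borel C_mono C_sym) auto

lemma kernel_ok_ring: "0 \<le> r \<Longrightarrow> r \<le> r' \<Longrightarrow> r' \<le> R \<Longrightarrow> kernel_ok (indicator (C r' - C r))"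
  using C_mono[of r' R] by (intro kernel_ok_indicator) (auto simp: C_borel C_sym)

abbreviation "fC r \<equiv> fk (indicator (C r))"

lemma fC_nonneg: "0 \<le> fk (indicator D) x y"
  by (simp add: fk_def setcov_nonneg[OF W_borel W_bounded])

lemma K_hat_eq: "K_hat B W (N \<omega>) (s * r) = S2 (fC r) \<omega>"
  unfolding K_hat_def
  by (rule sum.cong) (auto simp: point_pairs_def fk_def C_def indicator_def overlap_eq_setcov[OF W_borel W_bounded])

lemma fk_ring:
  assumes "0 \<le> r" "r \<le> r'"
  shows "(\<lambda>z. indicator (C r') z - indicator (C r) z) = (indicator (C r' - C r) :: 'a \<Rightarrow> real)"
  using C_mono[OF assms] by (intro ext) (auto simp: indicator_def)

lemma NP_ring:
  assumes "0 \<le> r" "r \<le> r'" "r' \<le> R"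
  shows "NP (fC r') \<omega> - NP (fC r) \<omega> = NP (fk (indicator (C r' - C r))) \<omega>"
  using NP_diff[of "indicator (C r')" "indicator (C r)" \<omega>] kernel_ok_C[of r'] kernel_ok_C[of r] kernel_ok_ring[OF assms] assms
  by (simp add: fk_ring)

lemma L2_ring:
  assumes "0 \<le> r" "r \<le> r'" "r' \<le> R"
  shows "0 \<le> L2 (fC r') - L2 (fC r)"
    and "L2 (fC r') - L2 (fC r) \<le> 2 * lam * a0 * (measure lborel (C r') - measure lborel (C r))"
proof -
  have "L2 (fC r') - L2 (fC r) = L2 (fk (indicator (C r' - C r)))"
  proof -
    have "fk (indicator (C r' - C r)) x y = fC r' x y - fC r x y" for x y
      unfolding fk_ring[OF assms(1,2), symmetric] by (simp add: fk_def diff_divide_distrib right_diff_distrib)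
    then show ?thesis
      using integrable_L2[OF fk_bm[OF kernel_ok_C[of r]]] integrable_L2[OF fk_bm[OF kernel_ok_C[of r']]] assms
      by (simp add: L2_def sum_subtractf)
  qed
  moreover have "0 \<le> L2 (fk (indicator (C r' - C r)))"
    unfolding L2_def by (intro integral_nonneg_AE AE_I2 sum_nonneg fC_nonneg)
  moreover have "L2 (fk (indicator (C r' - C r))) \<le> 2 * lam * a0 * measure lborel (C r' - C r)"
    by (rule moment_bound_fk[OF mu a0 mu_le _ _ kernel_ok_ring[OF assms]]) (auto simp: C_borel C_bounded)
  moreover have "measure lborel (C r' - C r) = measure lborel (C r') - measure lborel (C r)"
    using emeasure_bounded_finite[OF C_bounded] C_mono[OF assms(1,2)]
    by (intro measure_Diff) (auto simp: C_borel less_top)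
  ultimately show "0 \<le> L2 (fC r') - L2 (fC r)"
    "L2 (fC r') - L2 (fC r) \<le> 2 * lam * a0 * (measure lborel (C r') - measure lborel (C r))" by simp_all
qed

section \<open>Linearisation and edge error, uniformly in the radius\<close>

definition \<Delta> :: "'w \<Rightarrow> real" where "\<Delta> \<omega> = lambda_hat W (N \<omega>) - lam"

definition X :: "real \<Rightarrow> 'w \<Rightarrow> real" where
  "X r \<omega> = S2 (fC r) \<omega> - L2 (fC r) - 2 * lam * measure lborel (C r) * \<Delta> \<omega>"

text \<open>For a fixed displacement \<open>z\<close> this is the error made by replacing the
  edge-corrected weight by the reciprocal volume; its mean is 0. Taking the integral of its absolute
  value over the largest set, \<open>edge\<close> dominates the linearisation error for all radii
  simultaneously.\<close>

definition Y :: "'w \<Rightarrow> 'a \<Rightarrow> real" where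
  "Y \<omega> z = (\<Sum>x\<in>N \<omega> \<inter> W. indicator W (x + z) / setcov W z - 1 / measure lborel W)"

definition edge :: "'w \<Rightarrow> real" where "edge \<omega> = (\<integral>z. indicator (C R) z * \<bar>Y \<omega> z\<bar> \<partial>lborel)"

lemma setcov_meas [measurable]: "setcov W \<in> borel_measurable borel"
  by (rule setcov_measurable[OF W_borel W_bounded])

lemma Y_measurable: "(\<lambda>p. Y (fst p) (snd p)) \<in> borel_measurable (M \<Otimes>\<^sub>M borel)"
  unfolding Y_def
  by (rule measurable_sum_config_compose[OF N_measurable W_borel W_bounded]) measurable

lemma g_bound:
  assumes "z \<in> C R"
  shows "\<bar>indicator W (x + z) / setcov W z - 1 / measure lborel W\<bar> \<le> 3 / measure lborel W"
proof -
  have c: "measure lborel W / 2 \<le> setcov W z" using assms cov by (auto simp: C_def)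
  then have "1 / setcov W z \<le> 1 / (measure lborel W / 2)" using W_pos by (intro divide_left_mono) auto
  moreover have "0 \<le> 1 / setcov W z" using c W_pos by simp
  moreover have "0 < 1 / measure lborel W" using W_pos by simp
  moreover have "1 / (measure lborel W / 2) = 2 * (1 / measure lborel W)" "3 / measure lborel W = 3 * (1 / measure lborel W)" by simp_all
  moreover have "\<bar>i * q - v\<bar> \<le> 3 * v" if "i = 0 \<or> i = 1" "0 \<le> q" "q \<le> 2 * v" "0 < v" for i q v :: real
    using that by auto
  moreover have "indicator W (x + z) = (0::real) \<or> indicator W (x + z) = (1::real)" by (simp add: indicator_def)
  ultimately have "\<bar>indicator W (x + z) * (1 / setcov W z) - 1 / measure lborel W\<bar> \<le> 3 * (1 / measure lborel W)"
    by metis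
  then show ?thesis by simp
qed

lemma Y_integrable:
  assumes "\<omega> \<in> space M"
  shows "integrable lborel (\<lambda>z. indicator (C R) z * \<bar>Y \<omega> z\<bar>)"
proof (rule Bochner_Integration.integrable_bound)
  let ?c = "real (card (N \<omega> \<inter> W)) * (3 / measure lborel W)"
  show "integrable lborel (\<lambda>z. indicator (C R) z * ?c)"
    using emeasure_bounded_finite[OF C_bounded] by (intro integrable_mult_left integrable_real_indicator) (auto simp: C_borel)
  have "(\<lambda>z. Y \<omega> z) \<in> borel_measurable borel"
    using measurable_compose[OF measurable_Pair1'[OF assms] Y_measurable] by simp
  then show "(\<lambda>z. indicator (C R) z * \<bar>Y \<omega> z\<bar>) \<in> borel_measurable lborel"
    using C_borel[of R] by measurable
  have "\<bar>Y \<omega> z\<bar> \<le> ?c" if "z \<in> C R" for z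
  proof -
    have "\<bar>Y \<omega> z\<bar> \<le> (\<Sum>x\<in>N \<omega> \<inter> W. 3 / measure lborel W)"
      unfolding Y_def by (intro order_trans[OF sum_abs] sum_mono g_bound that)
    then show ?thesis by simp
  qed
  then show "AE z in lborel. norm (indicator (C R) z * \<bar>Y \<omega> z\<bar>) \<le> norm (indicator (C R) z * ?c)"
    by (intro AE_I2) (auto simp: indicator_def intro: order_trans[OF _ abs_ge_self])
qed

lemma edge_nonneg: "0 \<le> edge \<omega>"
  unfolding edge_def by (intro integral_nonneg_AE) auto

lemma edge_measurable: "edge \<in> borel_measurable M"
  unfolding edge_def
  by (rule lborel.borel_measurable_lebesgue_integral)
     (use Y_measurable C_borel[of R] in \<open>simp add: split_beta' borel_measurable_times borel_measurable_abs\<close>)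

text \<open>\<open>NP\<close> subtracts the exact projection, \<open>X\<close> the simpler multiple
  of the intensity error. By exchanging sum and integral their difference becomes
  \<open>2 * lam\<close> times the integral of \<open>Y \<omega>\<close> over
  \<open>C r\<close>.\<close>

lemma X_decomposition:
  assumes w: "\<omega> \<in> space M" and r: "0 \<le> r" "r \<le> R"
  shows "\<bar>X r \<omega> - NP (fC r) \<omega>\<bar> \<le> 2 * lam * edge \<omega>"
proof -
  note ok = kernel_ok_C[OF r]
  let ?c = "measure lborel (C r)" and ?w = "measure lborel W"
  have II: "I (\<lambda>x. I (\<lambda>y. fC r x y)) = ?c" using I_I_fk[OF ok] C_borel by simp
  have ki: "integrable lborel (\<lambda>z. indicator W (x + z) * (indicator (C r) z / setcov W z) :: real)" for x
  proof (rule Bochner_Integration.integrable_bound)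
    show "integrable lborel (\<lambda>z. indicator (C r) z * (2 / ?w))"
      using emeasure_bounded_finite[OF C_bounded] by (intro integrable_mult_left integrable_real_indicator) (auto simp: C_borel)
    show "(\<lambda>z. indicator W (x + z) * (indicator (C r) z / setcov W z) :: real) \<in> borel_measurable lborel"
      using C_borel[of r] by measurable
    interpret k: b4_kernel M N \<gamma> W "indicator (C r)" "\<lambda>z. indicator (C r) z / setcov W z" 1 "2 / ?w"
      by (rule kernel_ok_interp[OF ok indicator_le_1])
    have "\<bar>indicator W (x + z) * (indicator (C r) z / setcov W z)\<bar> \<le> indicator (C r) z * (2 / ?w)" for z
    proof -
      have "\<bar>indicator W (x + z) * q\<bar> \<le> q" if "0 \<le> q" for q :: real using that by (simp add: indicator_def)
      from order_trans[OF this[OF k.\<kappa>_nonneg] k.\<kappa>_le] show ?thesis by (simp only: mult.commute)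
    qed
    then show "AE z in lborel. norm (indicator W (x + z) * (indicator (C r) z / setcov W z)) \<le> norm (indicator (C r) z * (2 / ?w))"
      unfolding real_norm_def by (intro AE_I2 order_trans[OF _ abs_ge_self])
  qed
  have ci: "integrable lborel (\<lambda>z. indicator (C r) z * (1 / ?w) :: real)"
    using emeasure_bounded_finite[OF C_bounded] by (intro integrable_mult_left integrable_real_indicator) (auto simp: C_borel)
  have "X r \<omega> - NP (fC r) \<omega> = 2 * lam * (S1 (\<lambda>x. I (\<lambda>y. fC r x y)) \<omega> - ?c * (real (card (N \<omega> \<inter> W)) / ?w))"
    unfolding X_def NP_def II \<Delta>_def lambda_hat_def by (simp add: algebra_simps)
  also have "S1 (\<lambda>x. I (\<lambda>y. fC r x y)) \<omega> - ?c * (real (card (N \<omega> \<inter> W)) / ?w) =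
      (\<Sum>x\<in>N \<omega> \<inter> W. (\<integral>z. indicator W (x + z) * (indicator (C r) z / setcov W z) \<partial>lborel) - (\<integral>z. indicator (C r) z * (1 / ?w) \<partial>lborel))"
    using C_borel[of r] by (simp add: I_fk[OF ok] sum_subtractf)
  also have "\<dots> = (\<Sum>x\<in>N \<omega> \<inter> W. \<integral>z. indicator W (x + z) * (indicator (C r) z / setcov W z) - indicator (C r) z * (1 / ?w) \<partial>lborel)"
    using ki ci by simp
  also have "\<dots> = (\<integral>z. (\<Sum>x\<in>N \<omega> \<inter> W. indicator W (x + z) * (indicator (C r) z / setcov W z) - indicator (C r) z * (1 / ?w)) \<partial>lborel)"
    using ki ci by (intro Bochner_Integration.integral_sum[symmetric] Bochner_Integration.integrable_diff) auto
  also have "\<dots> = (\<integral>z. indicator (C r) z * Y \<omega> z \<partial>lborel)"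
    unfolding Y_def sum_distrib_left by (intro Bochner_Integration.integral_cong sum.cong) (auto simp: algebra_simps)
  finally have eq: "X r \<omega> - NP (fC r) \<omega> = 2 * lam * (\<integral>z. indicator (C r) z * Y \<omega> z \<partial>lborel)" .
  have "\<bar>\<integral>z. indicator (C r) z * Y \<omega> z \<partial>lborel\<bar> \<le> edge \<omega>"
    unfolding edge_def using C_mono[OF r]
    by (intro abs_integral_le[OF Y_integrable[OF w]]) (auto simp: indicator_def)
  then show ?thesis unfolding eq abs_mult using lam_nonneg by (simp add: mult_left_mono)
qed

text \<open>The summand of \<open>Y\<close> integrates to 0 over the window and its square to the
  difference of the two reciprocals in the hypothesis. Hence the variance of \<open>Y\<close> is
  small whenever the set covariance is close to the full volume, and Fubini's theorem yields the
  mean of \<open>edge\<close>.\<close>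

lemma edge_expectation:
  assumes \<eta>: "0 < \<eta>" and \<delta>: "\<And>z. z \<in> C R \<Longrightarrow> lam * (1 + tv) * (1 / setcov W z - 1 / measure lborel W) \<le> \<eta>\<^sup>2"
  shows "integrable M edge" and "(\<integral>\<omega>. edge \<omega> \<partial>M) \<le> measure lborel (C R) * \<eta>"
proof -
  let ?w = "measure lborel W"
  interpret P: pair_sigma_finite M lborel by unfold_locales
  have Ym: "(\<lambda>\<omega>. Y \<omega> z) \<in> borel_measurable M" for z
    using measurable_compose[OF measurable_Pair2' Y_measurable, of z] by simp
  have abs: "(\<integral>\<^sup>+\<omega>. ennreal \<bar>Y \<omega> z\<bar> \<partial>M) \<le> ennreal \<eta>" if z: "z \<in> C R" for z
  proof -
    let ?g = "\<lambda>x. indicator W (x + z) / setcov W z - 1 / ?w"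
    have c: "?w / 2 \<le> setcov W z" using z cov by (auto simp: C_def)
    then have c0: "setcov W z \<noteq> 0" using W_pos by simp
    have g: "?g \<in> bm borel"
      by (rule bmI[OF _ g_bound[OF z]]) measurable
    have Iind: "I (\<lambda>x. indicator W (x + z)) = setcov W z"
      unfolding setcov_altdef[OF W_borel W_bounded] by (rule integral_window_measure[OF W_borel]) measurable
    have ii: "integrable LW (\<lambda>x. indicator W (x + z) :: real)"
      by (rule bm_integrable_LW[OF bm_indicator_compose]) measurable
    have ic: "integrable LW (\<lambda>x. c :: real)" for c by (rule bm_integrable_LW[OF bm_const])
    \<comment> \<open>The set covariance is the volume of the part of the window that stays inside
      after the shift, so the corrected weight has total mass 1 there; no centring term remains in
      the variance bound.\<close>
    have Ig: "I ?g = 0"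
      using ii ic c0 W_pos by (simp add: Iind measure_LW)
    have "I (\<lambda>x. (?g x)\<^sup>2) = I (\<lambda>x. (1 / (setcov W z)\<^sup>2 - 2 / (?w * setcov W z)) * indicator W (x + z) + 1 / ?w\<^sup>2)"
      by (intro Bochner_Integration.integral_cong refl) (auto simp: indicator_def power2_eq_square algebra_simps diff_divide_distrib)
    also have "\<dots> = (1 / (setcov W z)\<^sup>2 - 2 / (?w * setcov W z)) * setcov W z + ?w * (1 / ?w\<^sup>2)"
      using ii ic by (subst Bochner_Integration.integral_add) (auto simp: Iind measure_LW)
    also have "\<dots> = 1 / setcov W z - 1 / ?w"
      using c0 W_pos by (simp add: field_simps power2_eq_square)
    finally have Ig2: "I (\<lambda>x. (?g x)\<^sup>2) = 1 / setcov W z - 1 / ?w" .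
    have V: "(\<integral>\<omega>. (Y \<omega> z)\<^sup>2 \<partial>M) \<le> \<eta>\<^sup>2" and Vi: "integrable M (\<lambda>\<omega>. (Y \<omega> z)\<^sup>2)"
      using variance_linear_le[OF g] variance_linear(1)[OF g] \<delta>[OF z] unfolding Ig Ig2 Y_def by simp_all
    \<comment> \<open>A weighted arithmetic-geometric mean inequality with level \<eta> takes the
      place of the Cauchy-Schwarz inequality for expectations.\<close>
    have le: "\<bar>Y \<omega> z\<bar> \<le> (1 / (2 * \<eta>)) * (Y \<omega> z)\<^sup>2 + \<eta> / 2" for \<omega>
    proof -
      have "0 \<le> (\<bar>Y \<omega> z\<bar> - \<eta>)\<^sup>2" by simp
      then have "2 * \<eta> * \<bar>Y \<omega> z\<bar> \<le> (Y \<omega> z)\<^sup>2 + \<eta>\<^sup>2" by (simp add: power2_diff mult.commute mult.left_commute)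
      then show ?thesis using \<eta> by (simp add: field_simps power2_eq_square)
    qed
    have i: "integrable M (\<lambda>\<omega>. (1 / (2 * \<eta>)) * (Y \<omega> z)\<^sup>2 + \<eta> / 2)"
      by (intro Bochner_Integration.integrable_add integrable_mult_right Vi) simp
    have "(\<integral>\<^sup>+\<omega>. ennreal \<bar>Y \<omega> z\<bar> \<partial>M) \<le> (\<integral>\<^sup>+\<omega>. ennreal ((1 / (2 * \<eta>)) * (Y \<omega> z)\<^sup>2 + \<eta> / 2) \<partial>M)"
      by (intro nn_integral_mono ennreal_leI le)
    also have "\<dots> = ennreal (\<integral>\<omega>. (1 / (2 * \<eta>)) * (Y \<omega> z)\<^sup>2 + \<eta> / 2 \<partial>M)"
      by (rule nn_integral_eq_integral[OF i]) (use \<eta> in auto)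
    also have "\<dots> \<le> ennreal \<eta>"
    proof (rule ennreal_leI)
      have "(\<integral>\<omega>. (1 / (2 * \<eta>)) * (Y \<omega> z)\<^sup>2 + \<eta> / 2 \<partial>M) = (1 / (2 * \<eta>)) * (\<integral>\<omega>. (Y \<omega> z)\<^sup>2 \<partial>M) + \<eta> / 2"
        by (subst Bochner_Integration.integral_add[OF integrable_mult_right[OF Vi]]) (auto simp: prob_space)
      also have "\<dots> \<le> (1 / (2 * \<eta>)) * \<eta>\<^sup>2 + \<eta> / 2" using V \<eta> by (intro add_right_mono mult_left_mono) auto
      also have "\<dots> = \<eta>" using \<eta> by (simp add: power2_eq_square)
      finally show "(\<integral>\<omega>. (1 / (2 * \<eta>)) * (Y \<omega> z)\<^sup>2 + \<eta> / 2 \<partial>M) \<le> \<eta>" .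
    qed
    finally show ?thesis .
  qed
  have fm: "(\<lambda>(\<omega>, z). ennreal (indicator (C R) z * \<bar>Y \<omega> z\<bar>)) \<in> borel_measurable (M \<Otimes>\<^sub>M lborel)"
    using Y_measurable C_borel[of R] by (simp add: split_beta')
  have "(\<integral>\<^sup>+\<omega>. ennreal (edge \<omega>) \<partial>M) = (\<integral>\<^sup>+\<omega>. \<integral>\<^sup>+z. ennreal (indicator (C R) z * \<bar>Y \<omega> z\<bar>) \<partial>lborel \<partial>M)"
    unfolding edge_def by (intro nn_integral_cong nn_integral_eq_integral[symmetric] Y_integrable) auto
  also have "\<dots> = (\<integral>\<^sup>+z. \<integral>\<^sup>+\<omega>. ennreal (indicator (C R) z * \<bar>Y \<omega> z\<bar>) \<partial>M \<partial>lborel)"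
    by (rule P.Fubini'[OF fm, symmetric])
  also have "\<dots> \<le> (\<integral>\<^sup>+z. ennreal \<eta> * indicator (C R) z \<partial>lborel)"
    by (intro nn_integral_mono) (use abs in \<open>auto simp: indicator_def\<close>)
  also have "\<dots> = ennreal \<eta> * emeasure lborel (C R)"
    using C_borel by (simp add: nn_integral_cmult)
  also have "\<dots> = ennreal (measure lborel (C R) * \<eta>)"
    using emeasure_bounded_finite[OF C_bounded, of R] \<eta> by (simp add: emeasure_eq_ennreal_measure ennreal_mult mult.commute less_top)
  finally have le: "(\<integral>\<^sup>+\<omega>. ennreal (edge \<omega>) \<partial>M) \<le> ennreal (measure lborel (C R) * \<eta>)" .
  show i: "integrable M edge"
    using le edge_nonneg edge_measurable by (intro integrableI_nonneg) (auto intro: le_less_trans)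
  have "ennreal (\<integral>\<omega>. edge \<omega> \<partial>M) \<le> ennreal (measure lborel (C R) * \<eta>)"
    using le nn_integral_eq_integral[OF i] edge_nonneg by simp
  then show "(\<integral>\<omega>. edge \<omega> \<partial>M) \<le> measure lborel (C R) * \<eta>"
    using \<eta> by (subst (asm) ennreal_le_iff) auto
qed

text \<open>The grid is equidistant in the volume of \<open>C r\<close>, not in the radius: each of
  the \<open>2 ^ p\<close> cells carries the same volume, which bounds both kinds of increments
  between neighbouring grid points.\<close>

definition grid :: "nat \<Rightarrow> nat \<Rightarrow> real" where "grid p j = R * root DIM('a) (real j / 2 ^ p)"

lemma grid_props:
  shows "grid p 0 = 0" and "0 \<le> grid p j" and "i \<le> j \<Longrightarrow> grid p i \<le> grid p j" and "j \<le> 2 ^ p \<Longrightarrow> grid p j \<le> R"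
    and "measure lborel (C (grid p j)) = measure lborel (C R) * (real j / 2 ^ p)"
proof -
  show "grid p 0 = 0" by (simp add: grid_def)
  show g0: "0 \<le> grid p j" using R by (simp add: grid_def)
  show "i \<le> j \<Longrightarrow> grid p i \<le> grid p j"
    using R by (auto simp: grid_def intro!: mult_left_mono divide_right_mono)
  show "j \<le> 2 ^ p \<Longrightarrow> grid p j \<le> R"
  proof -
    assume "j \<le> 2 ^ p"
    then have "real j \<le> real (2 ^ p)" unfolding of_nat_le_iff .
    then have "root DIM('a) (real j / 2 ^ p) \<le> 1" by simp
    then show "grid p j \<le> R" using R by (simp add: grid_def mult_left_le)
  qed
  show "measure lborel (C (grid p j)) = measure lborel (C R) * (real j / 2 ^ p)"
    using R by (simp add: measure_C[OF g0] measure_C[OF less_imp_le[OF R]]) (simp add: grid_def power_mult_distrib)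
qed

definition chain :: "nat \<Rightarrow> 'w \<Rightarrow> real" where
  "chain p \<omega> = real (p + 1) * (\<Sum>k\<le>p. \<Sum>i<2 ^ k.
     (NP (fC (grid p ((i + 1) * 2 ^ (p - k)))) \<omega> - NP (fC (grid p (i * 2 ^ (p - k)))) \<omega>)\<^sup>2)"

lemma NP_empty: "NP (fk (indicator {})) \<omega> = 0"
proof -
  have "fk (indicator {}) = (\<lambda>x y. 0)" by (auto simp: fk_def fun_eq_iff)
  then show ?thesis by (simp add: NP_def L2_def)
qed

lemma NP_le_chain: "j \<le> 2 ^ p \<Longrightarrow> (NP (fC (grid p j)) \<omega>)\<^sup>2 \<le> chain p \<omega>"
  unfolding chain_def
  by (rule dyadic_chaining_square[where X="\<lambda>j. NP (fC (grid p j)) \<omega>"]) (simp_all add: grid_props(1) C_0 NP_empty)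

text \<open>The rings of one dyadic level are disjoint subsets of \<open>C R\<close>, so by
  \<open>sum_varsum_le\<close> their variances add up to the same bound on every level. Summation
  over the levels contributes one factor \<open>p + 1\<close>, the prefactor of \<open>chain\<close>
  the other.\<close>

lemma chain_expectation:
  shows "integrable M (chain p)"
    and "(\<integral>\<omega>. chain p \<omega> \<partial>M) \<le> (real (p + 1))\<^sup>2 * (vconst / measure lborel W *
      (aint (\<gamma> 4) (\<lambda>_. 1) + aint (\<gamma> 3) (\<lambda>_. 1) + tv + measure lborel (C R)))"
proof -
  let ?T = "aint (\<gamma> 4) (\<lambda>_. 1) + aint (\<gamma> 3) (\<lambda>_. 1) + tv + measure lborel (C R)"
  let ?g = "\<lambda>k i. grid p (i * 2 ^ (p - k))"
  let ?D = "\<lambda>k i. C (?g k (i + 1)) - C (?g k i)"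
  have bnd: "(i + 1) * 2 ^ (p - k) \<le> 2 ^ p" if "k \<le> p" "i < 2 ^ k" for i k :: nat
  proof -
    have "(i + 1) * 2 ^ (p - k) \<le> 2 ^ k * 2 ^ (p - k)" using that by (intro mult_right_mono) auto
    also have "\<dots> = 2 ^ p" using that by (simp add: power_add[symmetric])
    finally show ?thesis .
  qed
  have gle: "?g k i \<le> ?g k (i + 1)" for k i by (rule grid_props(3)) simp
  have g1: "?g k (i + 1) \<le> R" if "k \<le> p" "i < 2 ^ k" for i k
    by (rule grid_props(4)[OF bnd[OF that]])
  have eq: "NP (fC (?g k (i + 1))) \<omega> - NP (fC (?g k i)) \<omega> = NP (fk (indicator (?D k i))) \<omega>" if "k \<le> p" "i < 2 ^ k" for k i \<omega>
    by (rule NP_ring[OF grid_props(2) gle g1[OF that]])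
  have ok: "kernel_ok (indicator (?D k i))" if "k \<le> p" "i < 2 ^ k" for k i
    by (rule kernel_ok_ring[OF grid_props(2) gle g1[OF that]])
  note var = NP_variance[OF ok indicator_le_1]
  have ch: "chain p \<omega> = real (p + 1) * (\<Sum>k\<le>p. \<Sum>i<2 ^ k. (NP (fk (indicator (?D k i))) \<omega>)\<^sup>2)" for \<omega>
    unfolding chain_def by (intro arg_cong2[where f=times] refl sum.cong) (simp_all only: eq atMost_iff lessThan_iff)
  show "integrable M (chain p)"
    unfolding ch[abs_def] by (intro integrable_mult_right Bochner_Integration.integrable_sum var(1)) auto
  have "(\<integral>\<omega>. chain p \<omega> \<partial>M) = real (p + 1) * (\<Sum>k\<le>p. \<Sum>i<2 ^ k. \<integral>\<omega>. (NP (fk (indicator (?D k i))) \<omega>)\<^sup>2 \<partial>M)"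
    unfolding ch by (subst Bochner_Integration.integral_mult_right_zero,
        subst Bochner_Integration.integral_sum, (intro Bochner_Integration.integrable_sum var(1); simp),
        intro arg_cong2[where f=times] refl sum.cong Bochner_Integration.integral_sum var(1)) auto
  also have "\<dots> \<le> real (p + 1) * (\<Sum>k\<le>p. vconst / measure lborel W * ?T)"
  proof (intro mult_left_mono sum_mono)
    fix k assume "k \<in> {..p}"
    then have k: "k \<le> p" by simp
    have "(\<Sum>i<2 ^ k. \<integral>\<omega>. (NP (fk (indicator (?D k i))) \<omega>)\<^sup>2 \<partial>M) \<le> (\<Sum>i<2 ^ k. vconst / measure lborel W * varsum (indicator (?D k i)) 1)"
      by (intro sum_mono var(2)[OF k]) simp
    also have "\<dots> = vconst / measure lborel W * (\<Sum>i<2 ^ k. varsum (indicator (?D k i)) 1)"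
      by (simp only: sum_distrib_left)
    also have "\<dots> \<le> vconst / measure lborel W * ?T"
    proof (rule mult_left_mono)
      show "(\<Sum>i<2 ^ k. varsum (indicator (?D k i)) 1) \<le> ?T"
      proof (rule sum_varsum_le)
        show "disjoint_family_on (?D k) {..<2 ^ k}"
          unfolding disjoint_family_on_def
        proof (intro ballI impI)
          fix i j :: nat assume ij: "i \<noteq> j"
          have "?D k i \<inter> ?D k j = {}" if "i < j" for i j
          proof -
            have "C (?g k (i + 1)) \<subseteq> C (?g k j)"
              by (rule C_mono[OF grid_props(2) grid_props(3)]) (use that in \<open>intro mult_right_mono; simp\<close>)
            then show ?thesis by blast
          qed
          from this[of i j] this[of j i] ij show "?D k i \<inter> ?D k j = {}" by (cases "i < j") auto
        qed
        show "?D k i \<subseteq> C R" if "i \<in> {..<2 ^ k}" for i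
          using C_mono[OF grid_props(2) g1[OF k]] that by blast
      qed (auto simp: C_borel C_bounded)
    qed (use vconst_nonneg in simp)
    finally show "(\<Sum>i<2 ^ k. \<integral>\<omega>. (NP (fk (indicator (?D k i))) \<omega>)\<^sup>2 \<partial>M) \<le> vconst / measure lborel W * ?T" .
  qed simp
  also have "\<dots> = (real (p + 1))\<^sup>2 * (vconst / measure lborel W * ?T)"
    by (simp add: power2_eq_square)
  finally show "(\<integral>\<omega>. chain p \<omega> \<partial>M) \<le> (real (p + 1))\<^sup>2 * (vconst / measure lborel W * ?T)" .
qed

lemma X_grid_le:
  assumes w: "\<omega> \<in> space M" and j: "j \<le> 2 ^ p"
  shows "\<bar>X (grid p j) \<omega>\<bar> \<le> sqrt (chain p \<omega>) + 2 * lam * edge \<omega>"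
proof -
  have "\<bar>NP (fC (grid p j)) \<omega>\<bar> \<le> sqrt (chain p \<omega>)"
    using real_sqrt_le_mono[OF NP_le_chain[OF j, of \<omega>]] by simp
  then show ?thesis using X_decomposition[OF w grid_props(2) grid_props(4)[OF j]] by linarith
qed

text \<open>The estimator and its mean are non-decreasing in the radius. Therefore
  \<open>X r \<omega>\<close> is squeezed between its values at the neighbouring grid radii, up to
  the growth of the mean, bounded by \<open>L2_ring\<close>, and the growth of the linear term,
  bounded through the cell volume.\<close>

theorem X_uniform_le:
  assumes w: "\<omega> \<in> space M" and r: "0 \<le> r" "r \<le> R"
  shows "\<bar>X r \<omega>\<bar> \<le> sqrt (chain p \<omega>) + 2 * lam * edge \<omega> + 2 * lam * (a0 + \<bar>\<Delta> \<omega>\<bar>) * (measure lborel (C R) / 2 ^ p)"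
proof -
  let ?y = "(r / R) ^ DIM('a) * 2 ^ p"
  have rR: "0 \<le> r / R" "r / R \<le> 1" using r R by auto
  have y: "0 \<le> ?y" "?y \<le> 2 ^ p" using rR by (auto simp: power_le_one)
  \<comment> \<open>The cell index is the integer part of \<open>?y\<close>, except at
    \<open>r = R\<close>: there \<open>?y\<close> equals \<open>2 ^ p\<close>, and the last cell is
    taken so that \<open>j + 1\<close> remains a grid index.\<close>
  obtain j :: nat where j: "real j \<le> ?y" "?y \<le> real j + 1" "j + 1 \<le> 2 ^ p"
  proof (cases "?y < 2 ^ p")
    case True
    have "real (nat \<lfloor>?y\<rfloor>) \<le> ?y" "?y \<le> real (nat \<lfloor>?y\<rfloor>) + 1" using y(1) by linarith+
    moreover have "nat \<lfloor>?y\<rfloor> < 2 ^ p"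
    proof -
      have "real (nat \<lfloor>?y\<rfloor>) < 2 ^ p" using True y(1) by linarith
      then show ?thesis by (metis of_nat_less_iff of_nat_numeral of_nat_power)
    qed
    then have "nat \<lfloor>?y\<rfloor> + 1 \<le> 2 ^ p" by (simp only: Suc_eq_plus1[symmetric] Suc_le_eq)
    ultimately show ?thesis by (rule that)
  next
    case False
    then have "?y = 2 ^ p" using y by simp
    moreover have "real (2 ^ p - 1) = 2 ^ p - 1" by (simp add: of_nat_diff)
    ultimately show ?thesis by (intro that[of "2 ^ p - 1"]) auto
  qed
  have rr: "R * root DIM('a) ((r / R) ^ DIM('a)) = r"
    using rR R by (simp add: real_root_power_cancel)
  have lo: "grid p j \<le> r"
  proof -
    have "real j / 2 ^ p \<le> (r / R) ^ DIM('a)" using j(1) by (simp add: divide_le_eq)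
    then have "grid p j \<le> R * root DIM('a) ((r / R) ^ DIM('a))"
      unfolding grid_def using R by (intro mult_left_mono) auto
    then show ?thesis by (simp only: rr)
  qed
  have hi: "r \<le> grid p (j + 1)"
  proof -
    have "(r / R) ^ DIM('a) \<le> real (j + 1) / 2 ^ p" using j(2) by (simp add: le_divide_eq)
    then have "R * root DIM('a) ((r / R) ^ DIM('a)) \<le> grid p (j + 1)"
      unfolding grid_def using R by (intro mult_left_mono) auto
    then show ?thesis by (simp only: rr)
  qed
  let ?c = "\<lambda>r. measure lborel (C r)" and ?K = "\<lambda>r. S2 (fC r) \<omega>" and ?m = "\<lambda>r. L2 (fC r)"
  define g where "g = grid p j"
  define g' where "g' = grid p (j + 1)"
  have gs: "0 \<le> g" "g \<le> r" "r \<le> g'" "g' \<le> R"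
    using lo hi grid_props(2)[of p j] grid_props(4)[OF j(3)] by (auto simp: g_def g'_def)
  have Kmono: "?K a \<le> ?K b" if "0 \<le> a" "a \<le> b" for a b
    using C_mono[OF that] by (intro sum_mono) (auto simp: fk_def indicator_def setcov_nonneg[OF W_borel W_bounded] divide_right_mono)
  have cinc: "?c g' - ?c g = ?c R / 2 ^ p"
    unfolding g_def g'_def grid_props(5) by (simp add: algebra_simps diff_divide_distrib[symmetric] add_divide_distrib)
  have cmono: "?c a \<le> ?c b" if "0 \<le> a" "a \<le> b" for a b
    using C_mono[OF that] emeasure_bounded_finite[OF C_bounded]
    by (intro measure_mono_fmeasurable) (auto simp: C_borel fmeasurable_def)
  have minc: "?m g' - ?m r \<le> 2 * lam * a0 * (?c R / 2 ^ p)" "?m r - ?m g \<le> 2 * lam * a0 * (?c R / 2 ^ p)"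
  proof -
    have "?m g' - ?m g \<le> 2 * lam * a0 * (?c g' - ?c g)" using gs by (intro L2_ring(2)) auto
    moreover have "0 \<le> ?m r - ?m g" "0 \<le> ?m g' - ?m r" using gs L2_ring(1)[of g r] L2_ring(1)[of r g'] by auto
    ultimately show "?m g' - ?m r \<le> 2 * lam * a0 * (?c R / 2 ^ p)" "?m r - ?m g \<le> 2 * lam * a0 * (?c R / 2 ^ p)"
      unfolding cinc by linarith+
  qed
  have dc: "\<bar>2 * lam * (?c a - ?c b) * \<Delta> \<omega>\<bar> \<le> 2 * lam * \<bar>\<Delta> \<omega>\<bar> * (?c R / 2 ^ p)" if "\<bar>?c a - ?c b\<bar> \<le> ?c R / 2 ^ p" for a b
  proof -
    have "\<bar>2 * lam * x * \<Delta> \<omega>\<bar> = (2 * lam * \<bar>\<Delta> \<omega>\<bar>) * \<bar>x\<bar>" for x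
      using lam_nonneg by (simp add: abs_mult mult_ac)
    then have "\<bar>2 * lam * (?c a - ?c b) * \<Delta> \<omega>\<bar> = (2 * lam * \<bar>\<Delta> \<omega>\<bar>) * \<bar>?c a - ?c b\<bar>" .
    also have "\<dots> \<le> (2 * lam * \<bar>\<Delta> \<omega>\<bar>) * (?c R / 2 ^ p)"
      using lam_nonneg by (intro mult_left_mono that) auto
    finally show ?thesis by simp
  qed
  have d1: "\<bar>?c g' - ?c r\<bar> \<le> ?c R / 2 ^ p" "\<bar>?c g - ?c r\<bar> \<le> ?c R / 2 ^ p"
    using cmono[of g r] cmono[of r g'] gs cinc by auto
  have u: "X r \<omega> \<le> X g' \<omega> + (?m g' - ?m r) + 2 * lam * (?c g' - ?c r) * \<Delta> \<omega>"
    using Kmono[of r g'] gs unfolding X_def by (simp add: algebra_simps)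
  have l: "X g \<omega> - (?m r - ?m g) + 2 * lam * (?c g - ?c r) * \<Delta> \<omega> \<le> X r \<omega>"
    using Kmono[of g r] gs unfolding X_def by (simp add: algebra_simps)
  have Xg: "\<bar>X g \<omega>\<bar> \<le> sqrt (chain p \<omega>) + 2 * lam * edge \<omega>" "\<bar>X g' \<omega>\<bar> \<le> sqrt (chain p \<omega>) + 2 * lam * edge \<omega>"
    unfolding g_def g'_def using X_grid_le[OF w, of j p] X_grid_le[OF w j(3)] j(3) by auto
  have e: "2 * lam * (a0 + \<bar>\<Delta> \<omega>\<bar>) * (?c R / 2 ^ p) = 2 * lam * a0 * (?c R / 2 ^ p) + 2 * lam * \<bar>\<Delta> \<omega>\<bar> * (?c R / 2 ^ p)"
    by (simp only: distrib_left distrib_right)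
  show ?thesis
    unfolding e using u l Xg minc dc[OF d1(1)] dc[OF d1(2)] unfolding abs_le_iff by linarith
qed

end

subsection \<open>Convergence in probability\<close>

text \<open>Formulated through events on which the estimate holds, so that it makes sense without
  measurability of the exceptional set. Some error terms below are chosen separately for each n and
  are known to be measurable for large n only.\<close>

definition conv_p :: "'w measure \<Rightarrow> (nat \<Rightarrow> 'w \<Rightarrow> real) \<Rightarrow> real \<Rightarrow> bool" where
  "conv_p M X c \<longleftrightarrow> (\<forall>e>0. \<forall>\<^sub>F n in sequentially.
     \<exists>A\<in>sets M. 1 - e \<le> measure M A \<and> (\<forall>\<omega>\<in>A. \<bar>X n \<omega> - c\<bar> \<le> e))"

definition tight_p :: "'w measure \<Rightarrow> (nat \<Rightarrow> 'w \<Rightarrow> real) \<Rightarrow> bool" where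
  "tight_p M X \<longleftrightarrow> (\<forall>e>0. \<exists>K>0. \<forall>\<^sub>F n in sequentially.
     \<exists>A\<in>sets M. 1 - e \<le> measure M A \<and> (\<forall>\<omega>\<in>A. \<bar>X n \<omega>\<bar> \<le> K))"

context prob_space
begin

lemma prob_Int_ge:
  assumes "A \<in> events" "B \<in> events" "1 - a \<le> prob A" "1 - b \<le> prob B"
  shows "1 - (a + b) \<le> prob (A \<inter> B)"
proof -
  have "prob (A \<union> B) = prob A + prob B - prob (A \<inter> B)"
    using assms by (intro measure_Un3) (auto simp: fmeasurable_eq_sets)
  then show ?thesis using assms prob_le_1[of "A \<union> B"] by linarith
qed

lemma conv_p_mono:
  assumes "conv_p M X 0" "\<forall>\<^sub>F n in sequentially. \<forall>\<omega>\<in>space M. \<bar>Y n \<omega> - c\<bar> \<le> \<bar>X n \<omega>\<bar>"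
  shows "conv_p M Y c"
  unfolding conv_p_def
proof (intro allI impI)
  fix e :: real assume "0 < e"
  with assms(1) have "\<forall>\<^sub>F n in sequentially. \<exists>A\<in>sets M. 1 - e \<le> measure M A \<and> (\<forall>\<omega>\<in>A. \<bar>X n \<omega> - 0\<bar> \<le> e)"
    unfolding conv_p_def by blast
  then show "\<forall>\<^sub>F n in sequentially. \<exists>A\<in>sets M. 1 - e \<le> measure M A \<and> (\<forall>\<omega>\<in>A. \<bar>Y n \<omega> - c\<bar> \<le> e)"
    using assms(2)
  proof eventually_elim
    case (elim n)
    then obtain A where A: "A \<in> sets M" "1 - e \<le> measure M A" "\<And>\<omega>. \<omega> \<in> A \<Longrightarrow> \<bar>X n \<omega> - 0\<bar> \<le> e" by blast
    have "\<bar>Y n \<omega> - c\<bar> \<le> e" if "\<omega> \<in> A" for \<omega>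
    proof -
      have "\<omega> \<in> space M" using sets.sets_into_space[OF A(1)] that by blast
      then have "\<bar>Y n \<omega> - c\<bar> \<le> \<bar>X n \<omega>\<bar>" using elim(2) by blast
      then show ?thesis using A(3)[OF that] by simp
    qed
    then show ?case using A by blast
  qed
qed

lemma conv_p_const:
  assumes "f \<longlonglongrightarrow> c"
  shows "conv_p M (\<lambda>n \<omega>. f n) c"
  unfolding conv_p_def
proof (intro allI impI)
  fix e :: real assume e: "0 < e"
  have "\<forall>\<^sub>F n in sequentially. dist (f n) c < e" using tendstoD[OF assms e] .
  then show "\<forall>\<^sub>F n in sequentially. \<exists>A\<in>sets M. 1 - e \<le> measure M A \<and> (\<forall>\<omega>\<in>A. \<bar>f n - c\<bar> \<le> e)"
    by eventually_elim (use e in \<open>auto simp: dist_real_def prob_space intro!: bexI[of _ "space M"]\<close>)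
qed

lemma conv_p_cont2:
  fixes f :: "real \<Rightarrow> real \<Rightarrow> real"
  assumes X: "conv_p M X a" and Y: "conv_p M Y b" and f: "isCont (\<lambda>p. f (fst p) (snd p)) (a, b)"
  shows "conv_p M (\<lambda>n \<omega>. f (X n \<omega>) (Y n \<omega>)) (f a b)"
  unfolding conv_p_def
proof (intro allI impI)
  fix e :: real assume e: "0 < e"
  obtain d where d: "0 < d" "\<And>p. dist p (a, b) < d \<Longrightarrow> dist (f (fst p) (snd p)) (f a b) < e"
    using iffD1[OF continuous_at_eps_delta f, rule_format, OF e] by auto
  \<comment> \<open>Two deviations of at most a third of \<open>d\<close> stay strictly within
    distance \<open>d\<close>, and the two exceptional probabilities add up to at most
    \<open>e\<close>.\<close>
  define e' where "e' = min (d / 3) (e / 2)"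
  have e': "0 < e'" "e' \<le> d / 3" "e' \<le> e / 2" using d e by (auto simp: e'_def)
  have "\<forall>\<^sub>F n in sequentially. \<exists>A\<in>sets M. 1 - e' \<le> measure M A \<and> (\<forall>\<omega>\<in>A. \<bar>X n \<omega> - a\<bar> \<le> e')"
    "\<forall>\<^sub>F n in sequentially. \<exists>A\<in>sets M. 1 - e' \<le> measure M A \<and> (\<forall>\<omega>\<in>A. \<bar>Y n \<omega> - b\<bar> \<le> e')"
    using X Y e'(1) unfolding conv_p_def by blast+
  then show "\<forall>\<^sub>F n in sequentially. \<exists>A\<in>sets M. 1 - e \<le> measure M A \<and> (\<forall>\<omega>\<in>A. \<bar>f (X n \<omega>) (Y n \<omega>) - f a b\<bar> \<le> e)"
  proof eventually_elim
    case (elim n)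
    then obtain A B where AB: "A \<in> sets M" "1 - e' \<le> measure M A" "\<And>\<omega>. \<omega> \<in> A \<Longrightarrow> \<bar>X n \<omega> - a\<bar> \<le> e'"
      "B \<in> sets M" "1 - e' \<le> measure M B" "\<And>\<omega>. \<omega> \<in> B \<Longrightarrow> \<bar>Y n \<omega> - b\<bar> \<le> e'" by blast
    have "1 - e \<le> measure M (A \<inter> B)"
      using prob_Int_ge[OF AB(1,4,2,5)] e' by linarith
    moreover have "\<bar>f (X n \<omega>) (Y n \<omega>) - f a b\<bar> \<le> e" if "\<omega> \<in> A \<inter> B" for \<omega>
    proof -
      have "dist (X n \<omega>, Y n \<omega>) (a, b) \<le> \<bar>X n \<omega> - a\<bar> + \<bar>Y n \<omega> - b\<bar>"
        unfolding dist_Pair_Pair dist_real_def using sqrt_sum_squares_le_sum_abs[of "\<bar>X n \<omega> - a\<bar>" "\<bar>Y n \<omega> - b\<bar>"] by simp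
      also have "\<dots> < d" using AB(3,6)[of \<omega>] that e' d(1) by simp
      finally show ?thesis using d(2)[of "(X n \<omega>, Y n \<omega>)"] by (simp add: dist_real_def)
    qed
    ultimately show ?case using AB by blast
  qed
qed

lemma conv_p_cont1:
  assumes X: "conv_p M X a" and f: "isCont f (a :: real)"
  shows "conv_p M (\<lambda>n \<omega>. f (X n \<omega>)) (f a)"
proof -
  have "isCont (\<lambda>p. f (fst p)) (a, a)"
    using f by (intro isCont_o2[where g=f and f=fst] continuous_intros) auto
  then show ?thesis using conv_p_cont2[OF X X, of "\<lambda>x y. f x"] by simp
qed

lemma conv_p_add: "conv_p M X a \<Longrightarrow> conv_p M Y b \<Longrightarrow> conv_p M (\<lambda>n \<omega>. X n \<omega> + Y n \<omega>) (a + b)"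
  by (erule conv_p_cont2[where f="(+)"]) (auto intro!: continuous_intros)

lemma conv_p_diff: "conv_p M X a \<Longrightarrow> conv_p M Y b \<Longrightarrow> conv_p M (\<lambda>n \<omega>. X n \<omega> - Y n \<omega>) (a - b)"
  by (erule conv_p_cont2[where f="(-)"]) (auto intro!: continuous_intros)

lemma conv_p_mult: "conv_p M X a \<Longrightarrow> conv_p M Y b \<Longrightarrow> conv_p M (\<lambda>n \<omega>. X n \<omega> * Y n \<omega>) (a * b)"
  by (erule conv_p_cont2[where f=times]) (auto intro!: continuous_intros)

lemma conv_p_expectation:
  assumes int: "\<forall>\<^sub>F n in sequentially. integrable M (U n)" and nn: "\<And>n \<omega>. 0 \<le> U n \<omega>"
    and lim: "(\<lambda>n. \<integral>\<omega>. U n \<omega> \<partial>M) \<longlonglongrightarrow> 0"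
  shows "conv_p M U 0"
  unfolding conv_p_def
proof (intro allI impI)
  fix e :: real assume e: "0 < e"
  \<comment> \<open>With the mean below \<open>e * e\<close>, Markov's inequality at threshold
    \<open>e\<close> leaves an exceptional probability of at most \<open>e\<close>.\<close>
  have "\<forall>\<^sub>F n in sequentially. dist (\<integral>\<omega>. U n \<omega> \<partial>M) 0 < e * e"
    using e by (intro tendstoD[OF lim]) auto
  then show "\<forall>\<^sub>F n in sequentially. \<exists>A\<in>sets M. 1 - e \<le> measure M A \<and> (\<forall>\<omega>\<in>A. \<bar>U n \<omega> - 0\<bar> \<le> e)"
    using int
  proof eventually_elim
    case (elim n)
    have m [measurable]: "U n \<in> borel_measurable M" using elim(2) by simp
    let ?B = "{\<omega> \<in> space M. e \<le> U n \<omega>}"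
    have "measure M ?B \<le> (\<integral>\<omega>. U n \<omega> \<partial>M) / e"
      by (rule integral_Markov_inequality_measure[where A="space M"]) (use elim e nn in auto)
    also have "\<dots> \<le> e" using elim(1) e by (simp add: dist_real_def divide_le_eq)
    finally have "1 - e \<le> prob (space M - ?B)"
      by (subst prob_compl) auto
    moreover have "\<forall>\<omega>\<in>space M - ?B. \<bar>U n \<omega> - 0\<bar> \<le> e" using nn[of n] by auto
    moreover have "space M - ?B \<in> sets M" by measurable
    ultimately show ?case by blast
  qed
qed

lemma conv_p_L2:
  assumes int: "\<forall>\<^sub>F n in sequentially. integrable M (\<lambda>\<omega>. (X n \<omega>)\<^sup>2)"
    and lim: "(\<lambda>n. \<integral>\<omega>. (X n \<omega>)\<^sup>2 \<partial>M) \<longlonglongrightarrow> 0"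
  shows "conv_p M X 0"
proof -
  have "conv_p M (\<lambda>n \<omega>. sqrt ((X n \<omega>)\<^sup>2)) (sqrt 0)"
    by (rule conv_p_cont1[OF conv_p_expectation[OF int _ lim]]) (auto intro: isCont_real_sqrt)
  then have "conv_p M (\<lambda>n \<omega>. \<bar>X n \<omega>\<bar>) 0" by simp
  then show ?thesis by (rule conv_p_mono) simp
qed

lemma tight_p_L2:
  assumes int: "\<forall>\<^sub>F n in sequentially. integrable M (\<lambda>\<omega>. (X n \<omega>)\<^sup>2) \<and> (\<integral>\<omega>. (X n \<omega>)\<^sup>2 \<partial>M) \<le> C"
  shows "tight_p M X"
  unfolding tight_p_def
proof (intro allI impI)
  fix e :: real assume e: "0 < e"
  \<comment> \<open>Chosen so that Chebyshev's bound equals \<open>e\<close>; adding 1 keeps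
    \<open>K\<close> positive when \<open>C\<close> is 0.\<close>
  define K where "K = sqrt ((\<bar>C\<bar> + 1) / e)"
  have K: "0 < K" "K\<^sup>2 = (\<bar>C\<bar> + 1) / e" using e by (auto simp: K_def)
  have K2: "0 < K\<^sup>2" using K(1) by simp
  show "\<exists>K>0. \<forall>\<^sub>F n in sequentially. \<exists>A\<in>sets M. 1 - e \<le> measure M A \<and> (\<forall>\<omega>\<in>A. \<bar>X n \<omega>\<bar> \<le> K)"
  proof (intro exI[of _ K] conjI K(1))
    show "\<forall>\<^sub>F n in sequentially. \<exists>A\<in>sets M. 1 - e \<le> measure M A \<and> (\<forall>\<omega>\<in>A. \<bar>X n \<omega>\<bar> \<le> K)"
      using int
    proof eventually_elim
      case (elim n)
      have m [measurable]: "(\<lambda>\<omega>. (X n \<omega>)\<^sup>2) \<in> borel_measurable M"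
        by (rule borel_measurable_integrable[OF conjunct1[OF elim]])
      let ?B = "{\<omega> \<in> space M. K\<^sup>2 \<le> (X n \<omega>)\<^sup>2}"
      have "measure M ?B \<le> (\<integral>\<omega>. (X n \<omega>)\<^sup>2 \<partial>M) / K\<^sup>2"
        by (rule integral_Markov_inequality_measure[where A="space M"]) (use elim K2 in auto)
      also have "\<dots> \<le> (\<bar>C\<bar> + 1) / K\<^sup>2" using elim by (intro divide_right_mono) auto
      also have "\<dots> = e" using e by (simp add: K(2))
      finally have "1 - e \<le> prob (space M - ?B)"
        by (subst prob_compl) auto
      moreover have "\<bar>X n \<omega>\<bar> \<le> K" if "\<omega> \<in> space M - ?B" for \<omega>
      proof -
        have "\<not> K\<^sup>2 \<le> (X n \<omega>)\<^sup>2" using that by blast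
        then have "(X n \<omega>)\<^sup>2 \<le> K\<^sup>2" by linarith
        then have "\<bar>X n \<omega>\<bar> \<le> \<bar>K\<bar>" by (simp only: abs_le_square_iff)
        then show ?thesis using K(1) by simp
      qed
      moreover have "space M - ?B \<in> sets M" by measurable
      ultimately show ?case by blast
    qed
  qed
qed

lemma conv_p_mult_tight:
  assumes X: "conv_p M X 0" and Y: "tight_p M Y"
  shows "conv_p M (\<lambda>n \<omega>. X n \<omega> * Y n \<omega>) 0"
  unfolding conv_p_def
proof (intro allI impI)
  fix e :: real assume e: "0 < e"
  obtain K where K: "0 < K" "\<forall>\<^sub>F n in sequentially. \<exists>A\<in>sets M. 1 - e / 2 \<le> measure M A \<and> (\<forall>\<omega>\<in>A. \<bar>Y n \<omega>\<bar> \<le> K)"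
    using Y[unfolded tight_p_def, rule_format, of "e / 2"] e by auto
  define e' where "e' = min (e / K) (e / 2)"
  have e': "0 < e'" "e' * K \<le> e" "e' \<le> e / 2" using K e by (auto simp: e'_def min_def field_simps)
  have "\<forall>\<^sub>F n in sequentially. \<exists>A\<in>sets M. 1 - e' \<le> measure M A \<and> (\<forall>\<omega>\<in>A. \<bar>X n \<omega> - 0\<bar> \<le> e')"
    using X e'(1) unfolding conv_p_def by blast
  then show "\<forall>\<^sub>F n in sequentially. \<exists>A\<in>sets M. 1 - e \<le> measure M A \<and> (\<forall>\<omega>\<in>A. \<bar>X n \<omega> * Y n \<omega> - 0\<bar> \<le> e)"
    using K(2)
  proof eventually_elim
    case (elim n)
    then obtain A B where AB: "A \<in> sets M" "1 - e' \<le> measure M A" "\<And>\<omega>. \<omega> \<in> A \<Longrightarrow> \<bar>X n \<omega>\<bar> \<le> e'"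
      "B \<in> sets M" "1 - e / 2 \<le> measure M B" "\<And>\<omega>. \<omega> \<in> B \<Longrightarrow> \<bar>Y n \<omega>\<bar> \<le> K" by auto
    have "1 - e \<le> measure M (A \<inter> B)"
      using prob_Int_ge[OF AB(1,4,2,5)] e' by linarith
    moreover have "\<bar>X n \<omega> * Y n \<omega> - 0\<bar> \<le> e" if "\<omega> \<in> A \<inter> B" for \<omega>
    proof -
      have "\<bar>X n \<omega>\<bar> * \<bar>Y n \<omega>\<bar> \<le> e' * K" using AB(3,6)[of \<omega>] that e' by (intro mult_mono) auto
      then show ?thesis using e' by (simp add: abs_mult)
    qed
    ultimately show ?case using AB by blast
  qed
qed

subsection \<open>Slutsky's theorem and continuous mapping via characteristic functions\<close>

lemma norm_iexp_diff_le: "cmod (iexp a - iexp b) \<le> \<bar>a - b\<bar>"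
proof -
  have "iexp a - iexp b = iexp b * (iexp (a - b) - 1)"
    by (simp add: right_diff_distrib exp_add[symmetric] of_real_diff algebra_simps)
  then have "cmod (iexp a - iexp b) = cmod (iexp (a - b) - 1)" by (simp add: norm_mult)
  also have "\<dots> \<le> \<bar>a - b\<bar>" using iexp_approx1[of "a - b" 0] by simp
  finally show ?thesis .
qed

lemma char_distr:
  assumes [measurable]: "T \<in> borel_measurable M"
  shows "char (distr M borel T) t = (\<integral>\<omega>. iexp (t * T \<omega>) \<partial>M)"
  by (simp add: char_def integral_distr)

lemma real_distribution_distr_rv: "T \<in> borel_measurable M \<Longrightarrow> real_distribution (distr M borel T)"
  by (rule real_distribution_distr)

text \<open>The characteristic functions at \<open>t\<close> differ by at most |t| times the
  deviation on the good event plus twice the probability of its complement; Levy's continuity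
  theorem does the rest.\<close>

lemma slutsky:
  assumes T [measurable]: "\<And>n. T n \<in> borel_measurable M" and U [measurable]: "\<And>n. U n \<in> borel_measurable M"
    and TU: "conv_p M (\<lambda>n \<omega>. T n \<omega> - U n \<omega>) 0"
    and L: "real_distribution L" and lim: "weak_conv_m (\<lambda>n. distr M borel (U n)) L"
  shows "weak_conv_m (\<lambda>n. distr M borel (T n)) L"
proof (rule levy_continuity)
  show "real_distribution (distr M borel (T n))" for n by (rule real_distribution_distr_rv[OF T])
  show "real_distribution L" by fact
  fix t :: real
  have U': "(\<lambda>n. char (distr M borel (U n)) t) \<longlonglongrightarrow> char L t"
    by (rule levy_continuity1[OF real_distribution_distr_rv[OF U] L lim])
  have "(\<lambda>n. char (distr M borel (T n)) t - char (distr M borel (U n)) t) \<longlonglongrightarrow> 0"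
  proof (rule tendstoI)
    fix e :: real assume e: "0 < e"
    \<comment> \<open>The 3 instead of 2 leaves a slack of \<open>d\<close>, which makes the final
      inequality strict.\<close>
    define d where "d = e / (\<bar>t\<bar> + 3)"
    have "0 < \<bar>t\<bar> + 3" by (simp add: add_nonneg_pos)
    then have d0: "0 < d" "d * (\<bar>t\<bar> + 3) = e" using e by (simp_all add: d_def)
    from d0(2) have "\<bar>t\<bar> * d + 2 * d + d = e" by (simp add: algebra_simps)
    with d0(1) have d: "0 < d" "\<bar>t\<bar> * d + 2 * d < e" by auto
    have "\<forall>\<^sub>F n in sequentially. \<exists>A\<in>sets M. 1 - d \<le> measure M A \<and> (\<forall>\<omega>\<in>A. \<bar>T n \<omega> - U n \<omega> - 0\<bar> \<le> d)"
      using TU d(1) unfolding conv_p_def by blast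
    then show "\<forall>\<^sub>F n in sequentially. dist (char (distr M borel (T n)) t - char (distr M borel (U n)) t) 0 < e"
    proof eventually_elim
      case (elim n)
      then obtain A where A [measurable]: "A \<in> sets M" and A': "1 - d \<le> measure M A" "\<And>\<omega>. \<omega> \<in> A \<Longrightarrow> \<bar>T n \<omega> - U n \<omega>\<bar> \<le> d" by auto
      have iT: "integrable M (\<lambda>\<omega>. iexp (t * T n \<omega>))" "integrable M (\<lambda>\<omega>. iexp (t * U n \<omega>))"
        by (auto intro!: integrable_const_bound[where B=1])
      have "cmod (char (distr M borel (T n)) t - char (distr M borel (U n)) t) = cmod (\<integral>\<omega>. iexp (t * T n \<omega>) - iexp (t * U n \<omega>) \<partial>M)"
        using iT by (simp add: char_distr)
      also have "\<dots> \<le> (\<integral>\<omega>. cmod (iexp (t * T n \<omega>) - iexp (t * U n \<omega>)) \<partial>M)"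
        by (rule integral_norm_bound)
      also have "\<dots> \<le> (\<integral>\<omega>. \<bar>t\<bar> * d + 2 * indicator (space M - A) \<omega> \<partial>M)"
      proof (rule integral_mono)
        show "integrable M (\<lambda>\<omega>. cmod (iexp (t * T n \<omega>) - iexp (t * U n \<omega>)))" using iT by simp
        show "integrable M (\<lambda>\<omega>. \<bar>t\<bar> * d + 2 * indicator (space M - A) \<omega> :: real)"
          by (intro Bochner_Integration.integrable_add integrable_mult_right integrable_real_indicator) (auto simp: less_top[symmetric])
        fix \<omega> assume w: "\<omega> \<in> space M"
        show "cmod (iexp (t * T n \<omega>) - iexp (t * U n \<omega>)) \<le> \<bar>t\<bar> * d + 2 * indicator (space M - A) \<omega>"
        proof (cases "\<omega> \<in> A")
          case True
          have "cmod (iexp (t * T n \<omega>) - iexp (t * U n \<omega>)) \<le> \<bar>t * T n \<omega> - t * U n \<omega>\<bar>" by (rule norm_iexp_diff_le)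
          also have "\<dots> = \<bar>t\<bar> * \<bar>T n \<omega> - U n \<omega>\<bar>" by (simp add: abs_mult[symmetric] right_diff_distrib)
          also have "\<dots> \<le> \<bar>t\<bar> * d" using A'(2)[OF True] by (intro mult_left_mono) auto
          finally show ?thesis using True by simp
        next
          case False
          have "cmod (iexp (t * T n \<omega>) - iexp (t * U n \<omega>)) \<le> 1 + 1"
            by (rule order_trans[OF norm_triangle_ineq4]) (simp add: norm_exp_i_times)
          moreover have "0 \<le> \<bar>t\<bar> * d" using d by simp
          ultimately show ?thesis using False w by simp
        qed
      qed
      also have "\<dots> = \<bar>t\<bar> * d + 2 * prob (space M - A)"
        by (subst Bochner_Integration.integral_add) (auto simp: prob_space less_top[symmetric] intro!: integrable_mult_right integrable_real_indicator)
      also have "\<dots> \<le> \<bar>t\<bar> * d + 2 * d" using A'(1) by (simp add: prob_compl)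
      also have "\<dots> < e" by (rule d(2))
      finally show ?case by (simp add: dist_norm)
    qed
  qed
  from tendsto_add[OF this U'] show "(\<lambda>n. char (distr M borel (T n)) t) \<longlonglongrightarrow> char L t" by simp
qed

text \<open>The function \<open>iexp (t * g x)\<close> is bounded and continuous, so its integrals
  converge; these are the characteristic functions of the image laws.\<close>

lemma continuous_mapping:
  fixes g :: "real \<Rightarrow> real"
  assumes Z [measurable]: "\<And>n. Z n \<in> borel_measurable M" and L: "real_distribution L"
    and lim: "weak_conv_m (\<lambda>n. distr M borel (Z n)) L" and g: "\<And>x. isCont g x"
  shows "weak_conv_m (\<lambda>n. distr M borel (\<lambda>\<omega>. g (Z n \<omega>))) (distr L borel g)"
proof (rule levy_continuity)
  have gm [measurable]: "g \<in> borel_measurable borel"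
    by (intro borel_measurable_continuous_onI continuous_at_imp_continuous_on) (use g in auto)
  interpret L: real_distribution L by fact
  have gL: "g \<in> borel_measurable L" using gm by (simp cong: measurable_cong_sets)
  show "real_distribution (distr M borel (\<lambda>\<omega>. g (Z n \<omega>)))" for n by (rule real_distribution_distr_rv) measurable
  show "real_distribution (distr L borel g)" using L.real_distribution_distr[OF gL] .
  fix t :: real
  have "(\<lambda>n. \<integral>x. iexp (t * g x) \<partial>distr M borel (Z n)) \<longlonglongrightarrow> (\<integral>x. iexp (t * g x) \<partial>L)"
  proof (rule weak_conv_imp_integral_bdd_continuous_conv[where B=1])
    show "isCont (\<lambda>x. iexp (t * g x)) x" for x using g by (intro continuous_intros) auto
  qed (use L lim real_distribution_distr_rv[OF Z] in \<open>auto simp: norm_exp_i_times\<close>)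
  moreover have "char (distr M borel (\<lambda>\<omega>. g (Z n \<omega>))) t = (\<integral>x. iexp (t * g x) \<partial>distr M borel (Z n))" for n
    by (subst char_distr) (auto simp: integral_distr)
  moreover have "char (distr L borel g) t = (\<integral>x. iexp (t * g x) \<partial>L)"
    using gL by (simp add: char_def integral_distr)
  ultimately show "(\<lambda>n. char (distr M borel (\<lambda>\<omega>. g (Z n \<omega>))) t) \<longlonglongrightarrow> char (distr L borel g) t" by simp
qed

end

section \<open>Normal laws and differences of independent samples\<close>

lemma real_distribution_std_normal: "real_distribution std_normal_distribution"
  by (rule real_dist_normal_dist)

lemma normal_density_distr:
  assumes s: "0 < s"
  shows "density lborel (normal_density 0 s) = distr std_normal_distribution borel (\<lambda>x. s * x)"
proof -
  interpret prob_space std_normal_distribution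
    using real_distribution_std_normal by (simp add: real_distribution_def)
  have "distributed std_normal_distribution lborel (\<lambda>x. x) (normal_density 0 1)"
    unfolding distributed_def by (auto simp: distr_id2 sets_density)
  from normal_density_affine[OF this, of s 0] s
  have "distributed std_normal_distribution lborel (\<lambda>x. s * x) (normal_density 0 s)" by simp
  then have "distr std_normal_distribution lborel (\<lambda>x. s * x) = density lborel (normal_density 0 s)"
    by (simp add: distributed_def)
  moreover have "distr std_normal_distribution lborel (\<lambda>x. s * x) = distr std_normal_distribution borel (\<lambda>x. s * x)"
    by (rule distr_cong) auto
  ultimately show ?thesis by simp
qed

lemma char_normal:
  "char (distr std_normal_distribution borel (\<lambda>x. s * x)) t = complex_of_real (exp (- ((s * t)\<^sup>2) / 2))"
proof -
  have "char (distr std_normal_distribution borel (\<lambda>x. s * x)) t = char std_normal_distribution (t * s)"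
    by (simp add: char_def integral_distr mult.assoc)
  then show ?thesis by (simp add: char_std_normal_distribution mult.commute)
qed

text \<open>For each n independence factorises the characteristic function of the difference, so
  convergence of the two marginals is enough. The product of the Gaussian limits is again Gaussian,
  with the variances added.\<close>

lemma (in prob_space) weak_conv_indep_diff:
  assumes ind: "\<And>n. indep_var borel (X n) borel (Y n)"
    and a: "0 < a" and b: "0 < b"
    and X: "weak_conv_m (\<lambda>n. distr M borel (X n)) (density lborel (normal_density 0 a))"
    and Y: "weak_conv_m (\<lambda>n. distr M borel (Y n)) (density lborel (normal_density 0 b))"
  shows "weak_conv_m (\<lambda>n. distr M borel (\<lambda>\<omega>. X n \<omega> - Y n \<omega>))
    (distr std_normal_distribution borel (\<lambda>x. sqrt (a\<^sup>2 + b\<^sup>2) * x))"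
proof (rule levy_continuity)
  note m [measurable] = indep_var_rv1[OF ind] indep_var_rv2[OF ind]
  have rd: "real_distribution (distr std_normal_distribution borel (\<lambda>x. c * x))" for c
    using prob_space.real_distribution_distr[OF _ , of std_normal_distribution "\<lambda>x. c * x"] real_distribution_std_normal
    by (simp add: real_distribution_def)
  show "real_distribution (distr M borel (\<lambda>\<omega>. X n \<omega> - Y n \<omega>))" for n by (rule real_distribution_distr_rv) measurable
  show "real_distribution (distr std_normal_distribution borel (\<lambda>x. sqrt (a\<^sup>2 + b\<^sup>2) * x))" by (rule rd)
  fix t :: real
  have i: "indep_var borel (X n) borel (\<lambda>\<omega>. - Y n \<omega>)" for n
    using indep_var_compose[OF ind, of "\<lambda>x. x" borel "\<lambda>y. - y" borel n] by (simp add: comp_def)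
  have ceq: "char (distr M borel (\<lambda>\<omega>. X n \<omega> - Y n \<omega>)) t = char (distr M borel (X n)) t * char (distr M borel (Y n)) (- t)" for n
  proof -
    have "char (distr M borel (\<lambda>\<omega>. X n \<omega> + - Y n \<omega>)) t = char (distr M borel (X n)) t * char (distr M borel (\<lambda>\<omega>. - Y n \<omega>)) t"
      by (rule char_distr_add[OF i])
    moreover have "char (distr M borel (\<lambda>\<omega>. - Y n \<omega>)) t = char (distr M borel (Y n)) (- t)"
      by (simp add: char_distr)
    ultimately show ?thesis by simp
  qed
  have "(\<lambda>n. char (distr M borel (X n)) t) \<longlonglongrightarrow> char (density lborel (normal_density 0 a)) t"
    by (rule levy_continuity1[OF real_distribution_distr_rv[OF m(1)] _ X]) (simp only: normal_density_distr[OF a] rd)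
  moreover have "(\<lambda>n. char (distr M borel (Y n)) (- t)) \<longlonglongrightarrow> char (density lborel (normal_density 0 b)) (- t)"
    by (rule levy_continuity1[OF real_distribution_distr_rv[OF m(2)] _ Y]) (simp only: normal_density_distr[OF b] rd)
  ultimately have "(\<lambda>n. char (distr M borel (\<lambda>\<omega>. X n \<omega> - Y n \<omega>)) t) \<longlonglongrightarrow>
      complex_of_real (exp (- ((a * t)\<^sup>2) / 2)) * complex_of_real (exp (- ((b * (- t))\<^sup>2) / 2))"
    unfolding ceq normal_density_distr[OF a] normal_density_distr[OF b] char_normal by (rule tendsto_mult)
  also have "complex_of_real (exp (- ((a * t)\<^sup>2) / 2)) * complex_of_real (exp (- ((b * (- t))\<^sup>2) / 2)) =
      complex_of_real (exp (- ((sqrt (a\<^sup>2 + b\<^sup>2) * t)\<^sup>2) / 2))"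
    unfolding of_real_mult[symmetric] exp_add[symmetric]
    by (intro arg_cong[where f="\<lambda>x. complex_of_real (exp x)"])
       (simp add: power_mult_distrib algebra_simps add_divide_distrib diff_divide_distrib)
  finally show "(\<lambda>n. char (distr M borel (\<lambda>\<omega>. X n \<omega> - Y n \<omega>)) t) \<longlonglongrightarrow>
      char (distr std_normal_distribution borel (\<lambda>x. sqrt (a\<^sup>2 + b\<^sup>2) * x)) t"
    unfolding char_normal .
qed

subsection \<open>Geometry of convex averaging sequences\<close>

lemma convex_averaging_props:
  assumes "convex_averaging W"
  shows "convex (W n)" "compact (W n)" "W n \<in> sets borel" "bounded (W n)"
  using assms by (auto simp: convex_averaging_def intro: borel_compact compact_imp_bounded)

text \<open>Half of a positive inradius lies strictly below the supremum that defines it, hence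
  below an admissible radius.\<close>

lemma convex_averaging_ball:
  fixes W :: "nat \<Rightarrow> 'a::euclidean_space set"
  assumes "convex_averaging W"
  shows "\<forall>\<^sub>F n in sequentially. 0 < inradius (W n) \<and> (\<exists>x\<in>W n. cball x (inradius (W n) / 2) \<subseteq> W n)"
proof -
  let ?S = "\<lambda>n. {r. 0 < r \<and> (\<exists>x\<in>W n. cball x r \<subseteq> W n)}"
  have "filterlim (\<lambda>n. inradius (W n)) at_top sequentially" using assms by (simp add: convex_averaging_def)
  \<comment> \<open>The supremum of the empty set is some unspecified real number. An inradius
    exceeding it cannot come from an empty set of radii; the other bound makes the inradius
    positive.\<close>
  then have "\<forall>\<^sub>F n in sequentially. max 1 (Sup {} + 1) \<le> inradius (W n)"
    unfolding filterlim_at_top by blast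
  then show ?thesis
  proof eventually_elim
    case (elim n)
    have pos: "0 < inradius (W n)" using elim by simp
    have ne: "?S n \<noteq> {}"
    proof
      assume e: "?S n = {}"
      have "inradius (W n) = Sup {}" unfolding inradius_def e ..
      then show False using elim by simp
    qed
    have "inradius (W n) / 2 < Sup (?S n)" using pos unfolding inradius_def[symmetric] by simp
    from less_cSupD[OF ne this] obtain r x where "inradius (W n) / 2 < r" "x \<in> W n" "cball x r \<subseteq> W n" by blast
    moreover from this(1) have "cball x (inradius (W n) / 2) \<subseteq> cball x r" by auto
    ultimately show ?case using pos by blast
  qed
qed

lemma convex_averaging_volume:
  fixes W :: "nat \<Rightarrow> 'a::euclidean_space set"
  assumes W: "convex_averaging W"
  shows "filterlim (\<lambda>n. measure lborel (W n)) at_top sequentially"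
proof (rule filterlim_at_top_mono)
  let ?\<rho> = "\<lambda>n. inradius (W n)"
  have "filterlim ?\<rho> at_top sequentially" using W by (simp add: convex_averaging_def)
  then have "filterlim (\<lambda>n. ?\<rho> n / 2) at_top sequentially"
    using filterlim_tendsto_pos_mult_at_top[OF tendsto_const, of "1/2" ?\<rho> sequentially] by simp
  then have "filterlim (\<lambda>n. (?\<rho> n / 2) ^ DIM('a)) at_top sequentially"
    by (intro filterlim_pow_at_top) auto
  then show "filterlim (\<lambda>n. unit_ball_vol (real DIM('a)) * (?\<rho> n / 2) ^ DIM('a)) at_top sequentially"
    by (intro filterlim_tendsto_pos_mult_at_top[OF tendsto_const]) auto
  show "\<forall>\<^sub>F n in sequentially. unit_ball_vol (real DIM('a)) * (?\<rho> n / 2) ^ DIM('a) \<le> measure lborel (W n)"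
    using convex_averaging_ball[OF W]
  proof eventually_elim
    case (elim n)
    then obtain x where x: "cball x (?\<rho> n / 2) \<subseteq> W n" by blast
    have "unit_ball_vol (real DIM('a)) * (?\<rho> n / 2) ^ DIM('a) = measure lborel (cball x (?\<rho> n / 2))"
      using elim by (subst content_cball) auto
    also have "\<dots> \<le> measure lborel (W n)"
      using x emeasure_bounded_finite[OF convex_averaging_props(4)[OF W]] convex_averaging_props(3)[OF W]
      by (intro measure_mono_fmeasurable) (auto simp: fmeasurable_def)
    finally show ?case .
  qed
qed

text \<open>The factor 2 stems from applying \<open>setcov_ge\<close> to a ball of half the
  inradius.\<close>

lemma convex_averaging_setcov:
  fixes W :: "nat \<Rightarrow> 'a::euclidean_space set"
  assumes W: "convex_averaging W" and \<zeta>: "(\<lambda>n. \<zeta> n / inradius (W n)) \<longlonglongrightarrow> 0"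
  shows "\<forall>\<^sub>F n in sequentially. \<forall>z. norm z \<le> \<zeta> n \<longrightarrow>
    (1 - 2 * real DIM('a) * (\<zeta> n / inradius (W n))) * measure lborel (W n) \<le> setcov (W n) z"
proof -
  have "\<forall>\<^sub>F n in sequentially. \<zeta> n / inradius (W n) < 1 / 2" using \<zeta> by (rule order_tendstoD) simp
  then show ?thesis using convex_averaging_ball[OF W]
  proof eventually_elim
    case (elim n)
    let ?\<rho> = "inradius (W n)"
    obtain x where x: "x \<in> W n" "cball x (?\<rho> / 2) \<subseteq> W n" using elim by blast
    show ?case
    proof (intro allI impI)
      fix z :: 'a assume z: "norm z \<le> \<zeta> n"
      have "\<zeta> n \<le> ?\<rho> / 2" using elim by (simp add: divide_less_eq)
      then have "(1 - real DIM('a) * (norm z / (?\<rho> / 2))) * measure lborel (W n) \<le> setcov (W n) z"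
        using z elim by (intro setcov_ge[OF convex_averaging_props(3,4,1,2)[OF W] x]) auto
      moreover have "norm z / (?\<rho> / 2) \<le> 2 * (\<zeta> n / ?\<rho>)" using z elim by (simp add: divide_right_mono)
      then have "real DIM('a) * (norm z / (?\<rho> / 2)) \<le> real DIM('a) * (2 * (\<zeta> n / ?\<rho>))" by (intro mult_left_mono) auto
      then have "(1 - real DIM('a) * (2 * (\<zeta> n / ?\<rho>))) * measure lborel (W n) \<le> (1 - real DIM('a) * (norm z / (?\<rho> / 2))) * measure lborel (W n)"
        by (intro mult_right_mono) auto
      ultimately show "(1 - 2 * real DIM('a) * (\<zeta> n / ?\<rho>)) * measure lborel (W n) \<le> setcov (W n) z"
        by (simp add: mult_ac)
    qed
  qed
qed

lemma wscale_power:
  fixes W :: "'a::euclidean_space set"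
  assumes "0 < measure lborel W"
  shows "wscale W ^ DIM('a) = measure lborel W" "(wscale W powr a) ^ DIM('a) = measure lborel W powr a" "0 < wscale W"
  using assms by (simp_all add: wscale_def powr_powr powr_realpow[symmetric] mult.commute)

lemma integral_scale:
  fixes w :: "'a::euclidean_space \<Rightarrow> real"
  assumes [measurable]: "w \<in> borel_measurable borel" and k: "0 < k"
  shows "(\<integral>x. w (x /\<^sub>R k) \<partial>lborel) = k ^ DIM('a) * (\<integral>x. w x \<partial>lborel)"
proof -
  have "(lborel :: 'a measure) = density (distr lborel borel (\<lambda>x. 0 + k *\<^sub>R x)) (\<lambda>_. ennreal (k ^ DIM('a)) :: ennreal) "
    using lborel_affine[of k "0::'a"] k by simp
  then have "(\<integral>x. w (x /\<^sub>R k) \<partial>lborel) = (\<integral>x. w (x /\<^sub>R k) \<partial>density (distr lborel borel (\<lambda>x. 0 + k *\<^sub>R x)) (\<lambda>_. ennreal (k ^ DIM('a)) :: ennreal))"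
    by simp
  also have "\<dots> = (\<integral>x. k ^ DIM('a) * w (x /\<^sub>R k) \<partial>distr lborel borel (\<lambda>x. 0 + k *\<^sub>R x))"
    by (subst integral_density) (use k in auto)
  also have "\<dots> = (\<integral>x. k ^ DIM('a) * w x \<partial>lborel)"
    by (subst integral_distr) (use k in auto)
  finally show ?thesis by simp
qed

subsection \<open>The supremum over the radius\<close>

text \<open>Bisection: near each point \<open>v\<close> is bounded on the right by right-continuity,
  on the left by the existing left limit, and at the point by its value. Boundedness of adjacent
  intervals carries over to their union.\<close>

lemma cadlag_bounded:
  assumes v: "cadlag_on R v" and R: "0 < R"
  obtains b where "0 \<le> b" "\<And>r. r \<in> {0..R} \<Longrightarrow> \<bar>v r\<bar> \<le> b"
proof -
  let ?P = "\<lambda>x y. \<exists>b. \<forall>r\<in>{x..y} \<inter> {0..R}. \<bar>v r\<bar> \<le> b"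
  have "?P 0 R"
  proof (rule Bolzano[where P="?P"])
    show "0 \<le> R" using R by simp
    fix x y z :: real assume "?P x y" "?P y z" "x \<le> y" "y \<le> z"
    then obtain b c where b: "\<forall>r\<in>{x..y} \<inter> {0..R}. \<bar>v r\<bar> \<le> b" and c: "\<forall>r\<in>{y..z} \<inter> {0..R}. \<bar>v r\<bar> \<le> c" by blast
    have "\<bar>v r\<bar> \<le> max b c" if "r \<in> {x..z} \<inter> {0..R}" for r
    proof (cases "r \<le> y")
      case True then show ?thesis using b that by (auto simp: le_max_iff_disj)
    next
      case False then show ?thesis using c that by (auto simp: le_max_iff_disj)
    qed
    then show "?P x z" by blast
  next
    fix t assume t: "0 \<le> t" "t \<le> R"
    have "\<exists>d>0. \<exists>b. \<forall>r\<in>{t<..R}. dist r t < d \<longrightarrow> \<bar>v r\<bar> \<le> b"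
    proof (cases "t < R")
      case True
      then have "(v \<longlongrightarrow> v t) (at t within {t<..R})" using v t by (auto simp: cadlag_on_def)
      then have "\<forall>\<^sub>F r in at t within {t<..R}. dist (v r) (v t) < 1" by (rule tendstoD) simp
      then obtain d where "0 < d" "\<forall>r\<in>{t<..R}. r \<noteq> t \<and> dist r t < d \<longrightarrow> dist (v r) (v t) < 1"
        unfolding eventually_at by blast
      then show ?thesis by (intro exI[of _ d] conjI exI[of _ "\<bar>v t\<bar> + 1"]) (auto simp: dist_real_def)
    qed (auto intro!: exI[of _ 1])
    then obtain d1 b1 where b1: "0 < d1" "\<forall>r\<in>{t<..R}. dist r t < d1 \<longrightarrow> \<bar>v r\<bar> \<le> b1" by blast
    have "\<exists>d>0. \<exists>b. \<forall>r\<in>{0..<t}. dist r t < d \<longrightarrow> \<bar>v r\<bar> \<le> b"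
    proof (cases "0 < t")
      case True
      then have "\<exists>l. (v \<longlongrightarrow> l) (at t within {0..<t})" using v t by (simp add: cadlag_on_def)
      then obtain l where "(v \<longlongrightarrow> l) (at t within {0..<t})" by blast
      then have "\<forall>\<^sub>F r in at t within {0..<t}. dist (v r) l < 1" by (rule tendstoD) simp
      then obtain d where "0 < d" "\<forall>r\<in>{0..<t}. r \<noteq> t \<and> dist r t < d \<longrightarrow> dist (v r) l < 1"
        unfolding eventually_at by blast
      then show ?thesis by (intro exI[of _ d] conjI exI[of _ "\<bar>l\<bar> + 1"]) (auto simp: dist_real_def)
    qed (auto intro!: exI[of _ 1])
    then obtain d2 b2 where b2: "0 < d2" "\<forall>r\<in>{0..<t}. dist r t < d2 \<longrightarrow> \<bar>v r\<bar> \<le> b2" by blast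
    show "\<exists>d>0. \<forall>x y. x \<le> t \<and> t \<le> y \<and> y - x < d \<longrightarrow> ?P x y"
    proof (rule exI[of _ "min d1 d2"], rule conjI, goal_cases)
      case 2
      show ?case
      proof (intro allI impI)
      fix x y assume xy: "x \<le> t \<and> t \<le> y \<and> y - x < min d1 d2"
      show "?P x y"
      proof (intro exI[of _ "max \<bar>v t\<bar> (max b1 b2)"] ballI)
        fix r assume r: "r \<in> {x..y} \<inter> {0..R}"
        consider "r = t" | "r < t" | "t < r" by linarith
        then show "\<bar>v r\<bar> \<le> max \<bar>v t\<bar> (max b1 b2)"
        proof cases
          case 2
          then have "\<bar>v r\<bar> \<le> b2" using b2(2) r xy by (auto simp: dist_real_def)
          then show ?thesis by simp
        next
          case 3
          then have "\<bar>v r\<bar> \<le> b1" using b1(2) r xy by (auto simp: dist_real_def)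
          then show ?thesis by simp
        qed simp
      qed
      qed
    qed (use b1 b2 in simp)
  qed
  then obtain b where "\<forall>r\<in>{0..R}. \<bar>v r\<bar> \<le> b" by auto
  then show ?thesis using that[of "max 0 b"] by (auto simp: le_max_iff_disj)
qed

text \<open>Reduces the supremum to countably many radii and thereby makes it measurable.
  Right-continuity lets a rational point slightly to the right come close to any value; the endpoint
  \<open>R\<close> has no points to its right and is added by hand.\<close>

lemma cSUP_rational_dense:
  fixes f :: "real \<Rightarrow> real"
  assumes R: "0 < R" and bdd: "bdd_above (f ` {0..R})"
    and rc: "\<And>r. 0 \<le> r \<Longrightarrow> r < R \<Longrightarrow> (f \<longlongrightarrow> f r) (at r within {r<..R})"
  shows "(SUP r\<in>{0..R}. f r) = (SUP r\<in>(\<rat> \<inter> {0..R}) \<union> {R}. f r)"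
proof (rule antisym)
  let ?D = "(\<rat> \<inter> {0..R}) \<union> {R}"
  have D: "?D \<subseteq> {0..R}" using R by auto
  have bD: "bdd_above (f ` ?D)" using bdd D by (meson bdd_above_mono image_mono)
  show "(SUP r\<in>?D. f r) \<le> (SUP r\<in>{0..R}. f r)"
    by (rule cSUP_subset_mono[OF _ bdd D]) auto
  show "(SUP r\<in>{0..R}. f r) \<le> (SUP r\<in>?D. f r)"
  proof (rule cSUP_least)
    show "{0..R} \<noteq> {}" using R by simp
    fix r assume r: "r \<in> {0..R}"
    show "f r \<le> (SUP r\<in>?D. f r)"
    proof (cases "r = R")
      case True then show ?thesis by (intro cSUP_upper[OF _ bD]) auto
    next
      case False
      then have rR: "0 \<le> r" "r < R" using r by auto
      show ?thesis
      proof (rule ccontr)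
        assume "\<not> ?thesis"
        then have "(SUP r\<in>?D. f r) < f r" by simp
        then have "\<forall>\<^sub>F q in at r within {r<..R}. (SUP r\<in>?D. f r) < f q"
          using rc[OF rR] by (intro order_tendstoD)
        then obtain d where d: "0 < d" "\<forall>q\<in>{r<..R}. q \<noteq> r \<and> dist q r < d \<longrightarrow> (SUP r\<in>?D. f r) < f q"
          unfolding eventually_at by blast
        obtain q where q: "q \<in> \<rat>" "r < q" "q < min R (r + d)"
          using Rats_dense_in_real[of r "min R (r + d)"] rR d by auto
        have "(SUP r\<in>?D. f r) < f q" using d(2) q by (auto simp: dist_real_def)
        moreover have "f q \<le> (SUP r\<in>?D. f r)" using q rR by (intro cSUP_upper[OF _ bD]) auto
        ultimately show False by simp
      qed
    qed
  qed
qed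

text \<open>A point of the scaled set stays in it as the radius grows, by convexity and
  \<open>0 \<in> B\<close>. A point outside stays outside for slightly larger radii because
  \<open>B\<close> is closed; at radius 0 this argument breaks down and is replaced by boundedness
  of \<open>B\<close>.\<close>

lemma scaled_mem_right_constant:
  fixes B :: "'a::euclidean_space set"
  assumes B: "compact B" "convex B" "0 \<in> B" and k: "0 \<le> k" and r: "0 \<le> r" and z: "z \<noteq> 0"
  shows "\<forall>\<^sub>F q in at r within {r<..R}. z \<in> (\<lambda>x. (k * q) *\<^sub>R x) ` B \<longleftrightarrow> z \<in> (\<lambda>x. (k * r) *\<^sub>R x) ` B"
proof (cases "k = 0")
  case False
  then have k0: "0 < k" using k by simp
  have gt: "\<forall>\<^sub>F q in at r within {r<..R}. r < q"
    by (auto simp: eventually_at intro!: exI[of _ 1])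
  have mem: "z \<in> (\<lambda>x. c *\<^sub>R x) ` B \<longleftrightarrow> (1 / c) *\<^sub>R z \<in> B" if "0 < c" for c
    using that by (auto simp: image_iff intro!: bexI[of _ "(1 / c) *\<^sub>R z"])
  show ?thesis
  proof (cases "z \<in> (\<lambda>x. (k * r) *\<^sub>R x) ` B")
    case True
    then obtain x where x: "x \<in> B" "z = (k * r) *\<^sub>R x" by blast
    have "z \<in> (\<lambda>x. (k * q) *\<^sub>R x) ` B" if "r < q" for q
    proof (rule image_eqI[of _ _ "(r / q) *\<^sub>R x"])
      have "(r / q) *\<^sub>R x = (1 - r / q) *\<^sub>R 0 + (r / q) *\<^sub>R x" by simp
      also have "\<dots> \<in> B" using that r by (intro convexD_alt[OF B(2,3) x(1)]) auto
      finally show "(r / q) *\<^sub>R x \<in> B" .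
    qed (use that r x in auto)
    then show ?thesis using gt True by (auto elim: eventually_mono)
  next
    case False
    have "\<forall>\<^sub>F q in at r within {r<..R}. z \<notin> (\<lambda>x. (k * q) *\<^sub>R x) ` B"
    proof (cases "r = 0")
      case True
      obtain \<beta> where \<beta>: "0 < \<beta>" "\<And>x. x \<in> B \<Longrightarrow> norm x \<le> \<beta>"
        using compact_imp_bounded[OF B(1)] by (auto simp: bounded_pos)
      have "((\<lambda>q. k * q * \<beta>) \<longlongrightarrow> k * r * \<beta>) (at r within {r<..R})" by (intro tendsto_intros)
      then have "\<forall>\<^sub>F q in at r within {r<..R}. k * q * \<beta> < norm z"
        using z True by (intro order_tendstoD) auto
      then show ?thesis using gt
      proof eventually_elim
        case (elim q)
        show ?case
        proof
          assume "z \<in> (\<lambda>x. (k * q) *\<^sub>R x) ` B"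
          then obtain x where x: "x \<in> B" "z = (k * q) *\<^sub>R x" by blast
          have "norm z = k * q * norm x" using x k0 elim True by simp
          also have "\<dots> \<le> k * q * \<beta>" using \<beta>(2)[OF x(1)] k0 elim True by (intro mult_left_mono) auto
          finally show False using elim by simp
        qed
      qed
    next
      case r0: False
      then have r0: "0 < r" using r by simp
      have "((\<lambda>q. (1 / (k * q)) *\<^sub>R z) \<longlongrightarrow> (1 / (k * r)) *\<^sub>R z) (at r within {r<..R})"
        using k0 r0 by (intro tendsto_intros) auto
      moreover have "open (- B)" using compact_imp_closed[OF B(1)] by (simp add: open_Compl)
      moreover have "(1 / (k * r)) *\<^sub>R z \<in> - B" using False mem[of "k * r"] k0 r0 by simp
      ultimately have "\<forall>\<^sub>F q in at r within {r<..R}. (1 / (k * q)) *\<^sub>R z \<in> - B"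
        by (rule topological_tendstoD)
      then show ?thesis using gt
        by eventually_elim (use mem k0 r0 in auto)
    qed
    then show ?thesis using False by (auto elim: eventually_mono)
  qed
qed simp

lemma K_hat_right_constant:
  fixes B :: "'a::euclidean_space set"
  assumes B: "compact B" "convex B" "0 \<in> B" and k: "0 \<le> k" and r: "0 \<le> r" and fin: "finite (\<phi> \<inter> W)"
  shows "\<forall>\<^sub>F q in at r within {r<..R}. K_hat B W \<phi> (k * q) = K_hat B W \<phi> (k * r)"
proof -
  have fp: "finite (point_pairs W \<phi>)"
    using fin by (rule_tac finite_subset[of _ "(\<phi> \<inter> W) \<times> (\<phi> \<inter> W)"]) (auto simp: point_pairs_def)
  have "\<forall>\<^sub>F q in at r within {r<..R}. \<forall>t\<in>point_pairs W \<phi>.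
      snd t - fst t \<in> (\<lambda>x. (k * q) *\<^sub>R x) ` B \<longleftrightarrow> snd t - fst t \<in> (\<lambda>x. (k * r) *\<^sub>R x) ` B"
    by (rule eventually_ball_finite[OF fp], rule ballI, rule scaled_mem_right_constant[OF B k r])
       (auto simp: point_pairs_def)
  then show ?thesis
  proof eventually_elim
    case (elim q)
    show ?case
      unfolding K_hat_def
    proof (rule sum.cong[OF refl])
      fix t assume t: "t \<in> point_pairs W \<phi>"
      show "(case t of (x, y) \<Rightarrow> indicator ((\<lambda>z. (k * q) *\<^sub>R z) ` B) (y - x) / overlap W x y) =
          (case t of (x, y) \<Rightarrow> indicator ((\<lambda>z. (k * r) *\<^sub>R z) ` B) (y - x) / overlap W x y)"
        using bspec[OF elim t] by (simp add: split_beta indicator_def)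
    qed
  qed
qed

lemma K_hat_abs_le:
  fixes B :: "'a::euclidean_space set"
  shows "\<bar>K_hat B W \<phi> r\<bar> \<le> (\<Sum>t\<in>point_pairs W \<phi>. \<bar>1 / overlap W (fst t) (snd t)\<bar>)"
  unfolding K_hat_def by (rule order_trans[OF sum_abs sum_mono]) (auto simp: indicator_def)

lemma measurable_pair_statistic:
  fixes g :: "'a::euclidean_space \<Rightarrow> real"
  assumes W: "W \<in> sets borel" "bounded W" and [measurable]: "g \<in> borel_measurable borel"
  shows "(\<lambda>\<phi>. \<Sum>(x, y)\<in>point_pairs W \<phi>. g (y - x) / overlap W x y) \<in> borel_measurable config_space"
proof -
  have [measurable]: "setcov W \<in> borel_measurable borel" by (rule setcov_measurable[OF W])
  have "(\<lambda>\<phi>. \<Sum>t\<in>point_pairs W \<phi>. g (snd t - fst t) / setcov W (snd t - fst t)) \<in> borel_measurable config_space"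
    by (rule measurable_sum_point_pairs[OF _ W]) measurable
  then show ?thesis by (simp add: split_beta' overlap_eq_setcov[OF W])
qed

lemma K_hat_measurable:
  fixes B W :: "'a::euclidean_space set"
  assumes "W \<in> sets borel" "bounded W" "compact B"
  shows "(\<lambda>\<phi>. K_hat B W \<phi> r) \<in> borel_measurable config_space"
proof -
  have "(\<lambda>z. r *\<^sub>R z) ` B \<in> sets borel"
    by (rule borel_compact[OF compact_scaling[OF assms(3)]])
  then show ?thesis
    unfolding K_hat_def by (intro measurable_pair_statistic[OF assms(1,2), of "indicator ((\<lambda>z. r *\<^sub>R z) ` B)"]) simp
qed

lemma lambda_hat_measurable:
  fixes W :: "'a::euclidean_space set"
  assumes "W \<in> sets borel" "bounded W"
  shows "lambda_hat W \<in> borel_measurable config_space" "lambda2_hat W \<in> borel_measurable config_space"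
  using measurable_card_config[OF assms] unfolding lambda_hat_def[abs_def] lambda2_hat_def[abs_def] by measurable

lemma sigma2_hat_measurable:
  fixes W :: "'a::euclidean_space set"
  assumes "W \<in> sets borel" "bounded W" and [measurable]: "w \<in> borel_measurable borel"
  shows "sigma2_hat w b W \<in> borel_measurable config_space"
  using lambda_hat_measurable[OF assms(1,2)] measurable_pair_statistic[OF assms(1,2), of "\<lambda>z. w (z /\<^sub>R (b * wscale W))"]
  unfolding sigma2_hat_def[abs_def] by simp

text \<open>For each sample point the difference of the two estimators is locally constant to the
  right and \<open>v\<close> is right-continuous, so countably many radii suffice. The boundedness
  claim ensures that the real supremum is a genuine least upper bound.\<close>

lemma measurable_sup_statistic:
  fixes Na Nb :: "'w \<Rightarrow> 'a::euclidean_space set"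
  assumes Na: "Na \<in> M \<rightarrow>\<^sub>M config_space" and Nb: "Nb \<in> M \<rightarrow>\<^sub>M config_space"
    and W: "W \<in> sets borel" "bounded W" and B: "compact B" "convex B" "0 \<in> B"
    and v: "cadlag_on R v" and R: "0 < R" and k: "0 \<le> k"
  shows "(\<lambda>\<omega>. SUP r\<in>{0..R}. \<bar>(K_hat B W (Na \<omega>) (k * r) - K_hat B W (Nb \<omega>) (k * r)) * v r\<bar>) \<in> borel_measurable M"
    and "\<And>\<omega>. bdd_above ((\<lambda>r. \<bar>(K_hat B W (Na \<omega>) (k * r) - K_hat B W (Nb \<omega>) (k * r)) * v r\<bar>) ` {0..R})"
proof -
  let ?f = "\<lambda>\<omega> r. \<bar>(K_hat B W (Na \<omega>) (k * r) - K_hat B W (Nb \<omega>) (k * r)) * v r\<bar>"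
  obtain vb where vb: "0 \<le> vb" "\<And>r. r \<in> {0..R} \<Longrightarrow> \<bar>v r\<bar> \<le> vb" using cadlag_bounded[OF v R] by metis
  let ?s = "\<lambda>\<phi>. \<Sum>t\<in>point_pairs W \<phi>. \<bar>1 / overlap W (fst t) (snd t)\<bar>"
  show bdd: "bdd_above (?f \<omega> ` {0..R})" for \<omega>
  proof (rule bdd_aboveI2)
    fix r assume r: "r \<in> {0..R}"
    have "\<bar>K_hat B W (Na \<omega>) (k * r) - K_hat B W (Nb \<omega>) (k * r)\<bar> \<le> ?s (Na \<omega>) + ?s (Nb \<omega>)"
      using K_hat_abs_le[of B W "Na \<omega>" "k * r"] K_hat_abs_le[of B W "Nb \<omega>" "k * r"] by linarith
    then show "?f \<omega> r \<le> (?s (Na \<omega>) + ?s (Nb \<omega>)) * vb"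
      unfolding abs_mult using vb(2)[OF r] by (intro mult_mono) (auto intro!: add_nonneg_nonneg sum_nonneg)
  qed
  let ?D = "(\<rat> \<inter> {0..R}) \<union> {R}"
  have D: "countable ?D" using countable_rat by auto
  have "(\<lambda>\<omega>. SUP r\<in>?D. ?f \<omega> r) \<in> borel_measurable M"
  proof (rule borel_measurable_cSUP[OF D])
    show "(\<lambda>\<omega>. ?f \<omega> r) \<in> borel_measurable M" for r
      using measurable_compose[OF Na K_hat_measurable[OF W B(1), of "k * r"]]
        measurable_compose[OF Nb K_hat_measurable[OF W B(1), of "k * r"]] by measurable
    show "bdd_above (?f \<omega> ` ?D)" for \<omega>
      by (rule bdd_above_mono[OF bdd image_mono]) (use R in auto)
  qed
  also have "?this \<longleftrightarrow> (\<lambda>\<omega>. SUP r\<in>{0..R}. ?f \<omega> r) \<in> borel_measurable M"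
  proof (rule measurable_cong)
    fix \<omega> assume w: "\<omega> \<in> space M"
    show "(SUP r\<in>?D. ?f \<omega> r) = (SUP r\<in>{0..R}. ?f \<omega> r)"
    proof (rule cSUP_rational_dense[OF R bdd, symmetric])
      fix r assume r: "0 \<le> r" "r < R"
      have "\<forall>\<^sub>F q in at r within {r<..R}. ?f \<omega> q = \<bar>(K_hat B W (Na \<omega>) (k * r) - K_hat B W (Nb \<omega>) (k * r)) * v q\<bar>"
        using K_hat_right_constant[OF B k r(1) config_finite[OF Na w W(2)], of R]
          K_hat_right_constant[OF B k r(1) config_finite[OF Nb w W(2)], of R]
        by eventually_elim simp
      moreover have "((\<lambda>q. \<bar>(K_hat B W (Na \<omega>) (k * r) - K_hat B W (Nb \<omega>) (k * r)) * v q\<bar>) \<longlongrightarrow> ?f \<omega> r) (at r within {r<..R})"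
        using v r by (intro tendsto_intros) (auto simp: cadlag_on_def)
      ultimately show "(?f \<omega> \<longlongrightarrow> ?f \<omega> r) (at r within {r<..R})"
        by (simp add: filterlim_cong[OF refl refl])
    qed
  qed
  finally show "(\<lambda>\<omega>. SUP r\<in>{0..R}. ?f \<omega> r) \<in> borel_measurable M" .
qed

subsection \<open>Mean square bounds for the estimators\<close>

context b4_window
begin

lemma lambda_hat_L2:
  assumes V: "0 < measure lborel W"
  shows "integrable M (\<lambda>\<omega>. (lambda_hat W (N \<omega>) - lam)\<^sup>2)"
    and "(\<integral>\<omega>. (lambda_hat W (N \<omega>) - lam)\<^sup>2 \<partial>M) \<le> lam * (1 + tv) / measure lborel W"
proof -
  let ?c = "1 / measure lborel W"
  have I: "I (\<lambda>_. c) = c * measure lborel W" for c :: real by (simp add: measure_LW)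
  have S: "S1 (\<lambda>_. ?c) \<omega> - lam * I (\<lambda>_. ?c) = lambda_hat W (N \<omega>) - lam" for \<omega>
    unfolding I using V by (simp add: lambda_hat_def)
  show "integrable M (\<lambda>\<omega>. (lambda_hat W (N \<omega>) - lam)\<^sup>2)"
    using variance_linear(1)[OF bm_const, of ?c] unfolding S .
  have "(\<integral>\<omega>. (lambda_hat W (N \<omega>) - lam)\<^sup>2 \<partial>M) \<le> lam * (1 + tv) * I (\<lambda>_. ?c\<^sup>2)"
    using variance_linear_le[OF bm_const, of ?c] unfolding S .
  also have "\<dots> = lam * (1 + tv) / measure lborel W"
    unfolding I using V by (simp add: power2_eq_square)
  finally show "(\<integral>\<omega>. (lambda_hat W (N \<omega>) - lam)\<^sup>2 \<partial>M) \<le> lam * (1 + tv) / measure lborel W" .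
qed

lemma varsum_le:
  assumes h: "kernel_ok h" and H: "\<And>z. h z \<le> H"
  shows "varsum h H \<le> H\<^sup>2 * (aint (\<gamma> 4) (\<lambda>_. 1) + aint (\<gamma> 3) (\<lambda>_. 1) + tv) + H * (\<integral>z. h z \<partial>lborel)"
proof -
  have hm [measurable]: "h \<in> borel_measurable borel" and nn: "\<And>z. 0 \<le> h z" using h by (auto simp: kernel_ok_def)
  have H0: "0 \<le> H" using nn[of 0] H[of 0] by linarith
  have p: "0 \<le> h x * h y" "h x * h y \<le> H * H" for x y using nn H H0 by (auto intro: mult_mono)
  have c: "(\<lambda>t. t l) \<in> borel_measurable (\<Pi>\<^sub>M l\<in>{1..<k}. (borel :: 'a measure))" if "l \<in> {1..<k}" for l k :: nat
    by (rule measurable_component_singleton[OF that])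
  have m4: "(\<lambda>t. h (t 2 - t 1) * h (t 3)) \<in> borel_measurable (\<Pi>\<^sub>M l\<in>{1..<4::nat}. (borel :: 'a measure))"
    by (intro borel_measurable_times measurable_compose[OF _ hm] borel_measurable_diff c) auto
  have m3: "(\<lambda>t. h (t 2 - t 1) * h (t 2)) \<in> borel_measurable (\<Pi>\<^sub>M l\<in>{1..<3::nat}. (borel :: 'a measure))"
    by (intro borel_measurable_times measurable_compose[OF _ hm] borel_measurable_diff c) auto
  have m2: "(\<lambda>t. h (t 1)) \<in> borel_measurable (\<Pi>\<^sub>M l\<in>{1..<2::nat}. (borel :: 'a measure))"
    by (intro measurable_compose[OF _ hm] c) auto
  have "aint (\<gamma> 4) (\<lambda>t. h (t 2 - t 1) * h (t 3)) \<le> aint (\<gamma> 4) (\<lambda>_. H * H * 1)"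
    by (rule aint_mono[OF _ bmI[OF m4, of "H * H"] bm_const]) (use p in auto)
  moreover have "aint (\<gamma> 3) (\<lambda>t. h (t 2 - t 1) * h (t 2)) \<le> aint (\<gamma> 3) (\<lambda>_. H * H * 1)"
    by (rule aint_mono[OF _ bmI[OF m3, of "H * H"] bm_const]) (use p in auto)
  moreover have "aint (\<gamma> 2) (\<lambda>t. h (t 1)) \<le> aint (\<gamma> 2) (\<lambda>_. H * 1)"
    by (rule aint_mono[OF _ bmI[OF m2, of H] bm_const]) (use nn H in auto)
  then have "H * (aint (\<gamma> 2) (\<lambda>t. h (t 1)) + (\<integral>z. h z \<partial>lborel)) \<le> H * (H * tv + (\<integral>z. h z \<partial>lborel))"
    unfolding aint_cmult tv_def using H0 by (intro mult_left_mono add_right_mono) auto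
  ultimately show ?thesis
    unfolding aint_cmult varsum_def by (simp add: power2_eq_square algebra_simps)
qed

text \<open>The centring is the exact mean of the edge-corrected sum by \<open>L2_fk\<close>. The
  deviation consists of the non-linear part and the projection; each is bounded in mean square, and
  the square of the sum is at most twice the sum of the squares.\<close>

lemma pair_statistic_L2:
  assumes h: "kernel_ok h" and H: "\<And>z. h z \<le> H"
  defines "D \<equiv> \<lambda>\<omega>. (\<Sum>(x, y)\<in>point_pairs W (N \<omega>). h (y - x) / overlap W x y) - lam * sint (\<gamma> 2) (\<lambda>t. h (t 1)) - lam\<^sup>2 * (\<integral>z. h z \<partial>lborel)"
  shows "integrable M (\<lambda>\<omega>. (D \<omega>)\<^sup>2)"
    and "(\<integral>\<omega>. (D \<omega>)\<^sup>2 \<partial>M) \<le> (2 * vconst * (H\<^sup>2 * (aint (\<gamma> 4) (\<lambda>_. 1) + aint (\<gamma> 3) (\<lambda>_. 1) + tv) + H * (\<integral>z. h z \<partial>lborel))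
       + 32 * lam ^ 3 * (1 + tv) * (\<integral>z. h z \<partial>lborel)\<^sup>2) / measure lborel W"
proof -
  let ?F = "\<lambda>x. I (\<lambda>y. fk h x y)" and ?V = "measure lborel W" and ?J = "\<integral>z. h z \<partial>lborel"
  let ?Y = "\<lambda>\<omega>. S1 ?F \<omega> - lam * I ?F"
  have hm [measurable]: "h \<in> borel_measurable borel" and V: "0 < ?V" using h by (auto simp: kernel_ok_def)
  have S: "(\<Sum>(x, y)\<in>point_pairs W (N \<omega>). h (y - x) / overlap W x y) = S2 (fk h) \<omega>" for \<omega>
    by (rule sum.cong) (auto simp: point_pairs_def fk_def overlap_eq_setcov[OF W_borel W_bounded])
  have D: "D \<omega> = NP (fk h) \<omega> + 2 * lam * ?Y \<omega>" for \<omega>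
    unfolding D_def S NP_def L2_fk[OF h] by simp
  have Dm: "D \<in> borel_measurable M"
    unfolding D_def using measurable_compose[OF N_measurable measurable_pair_statistic[OF W_borel W_bounded hm]] by simp
  have le: "(D \<omega>)\<^sup>2 \<le> 2 * (NP (fk h) \<omega>)\<^sup>2 + 8 * lam\<^sup>2 * (?Y \<omega>)\<^sup>2" for \<omega>
  proof -
    have "(a + 2 * l * y)\<^sup>2 \<le> 2 * a\<^sup>2 + 8 * l\<^sup>2 * y\<^sup>2" for a l y :: real
      using zero_le_power2[of "a - 2 * l * y"] by (simp add: power2_eq_square algebra_simps)
    then show ?thesis unfolding D .
  qed
  note F = integral_I_fk_sq_le[OF h]
  note NPv = NP_variance[OF h H] and Yv = variance_linear(1)[OF F(1)]
  have int: "integrable M (\<lambda>\<omega>. 2 * (NP (fk h) \<omega>)\<^sup>2 + 8 * lam\<^sup>2 * (?Y \<omega>)\<^sup>2)"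
    by (intro Bochner_Integration.integrable_add integrable_mult_right NPv(1) Yv)
  show iD: "integrable M (\<lambda>\<omega>. (D \<omega>)\<^sup>2)"
    by (rule Bochner_Integration.integrable_bound[OF int]) (use Dm le in \<open>auto intro!: AE_I2 abs_ge_self order_trans[OF le]\<close>)
  have "(\<integral>\<omega>. (D \<omega>)\<^sup>2 \<partial>M) \<le> (\<integral>\<omega>. 2 * (NP (fk h) \<omega>)\<^sup>2 + 8 * lam\<^sup>2 * (?Y \<omega>)\<^sup>2 \<partial>M)"
    by (rule integral_mono[OF iD int le])
  also have "\<dots> = 2 * (\<integral>\<omega>. (NP (fk h) \<omega>)\<^sup>2 \<partial>M) + 8 * lam\<^sup>2 * (\<integral>\<omega>. (?Y \<omega>)\<^sup>2 \<partial>M)"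
    by (subst Bochner_Integration.integral_add) (intro integrable_mult_right NPv(1) Yv, intro integrable_mult_right NPv(1) Yv, simp)
  also have "\<dots> \<le> 2 * (vconst / ?V * (H\<^sup>2 * (aint (\<gamma> 4) (\<lambda>_. 1) + aint (\<gamma> 3) (\<lambda>_. 1) + tv) + H * ?J))
       + 8 * lam\<^sup>2 * (lam * (1 + tv) * (4 / ?V * ?J\<^sup>2))"
  proof (intro add_mono mult_left_mono)
    show "(\<integral>\<omega>. (NP (fk h) \<omega>)\<^sup>2 \<partial>M) \<le> vconst / ?V * (H\<^sup>2 * (aint (\<gamma> 4) (\<lambda>_. 1) + aint (\<gamma> 3) (\<lambda>_. 1) + tv) + H * ?J)"
      by (rule order_trans[OF NPv(2) mult_left_mono[OF varsum_le[OF h H]]]) (use V vconst_nonneg in auto)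
    have tv: "0 \<le> tv" unfolding tv_def aint_def by simp
    show "(\<integral>\<omega>. (?Y \<omega>)\<^sup>2 \<partial>M) \<le> lam * (1 + tv) * (4 / ?V * ?J\<^sup>2)"
      by (rule order_trans[OF variance_linear_le[OF F(1)] mult_left_mono[OF F(2)]]) (use lam_nonneg tv in auto)
  qed auto
  also have "\<dots> = (2 * vconst * (H\<^sup>2 * (aint (\<gamma> 4) (\<lambda>_. 1) + aint (\<gamma> 3) (\<lambda>_. 1) + tv) + H * ?J)
       + 32 * lam ^ 3 * (1 + tv) * ?J\<^sup>2) / ?V"
    by (simp add: add_divide_distrib power2_eq_square power3_eq_cube)
  finally show "(\<integral>\<omega>. (D \<omega>)\<^sup>2 \<partial>M) \<le> (2 * vconst * (H\<^sup>2 * (aint (\<gamma> 4) (\<lambda>_. 1) + aint (\<gamma> 3) (\<lambda>_. 1) + tv) + H * ?J)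
       + 32 * lam ^ 3 * (1 + tv) * ?J\<^sup>2) / ?V" .
qed

end

context k_window
begin

text \<open>The random variables \<open>chain p\<close> and \<open>edge\<close> belong to a locale
  whose window and scale change along the sequence. Hiding them behind existential quantifiers
  leaves exactly what the limit argument uses: signs, means and the pointwise bound.\<close>

lemma uniform_bound:
  fixes p :: nat
  assumes \<eta>: "0 < \<eta>" and \<delta>: "\<And>z. z \<in> (\<lambda>z. (s * R) *\<^sub>R z) ` B \<Longrightarrow> lam * (1 + tv) * (1 / setcov W z - 1 / measure lborel W) \<le> \<eta>\<^sup>2"
  shows "\<exists>Z Y. (\<forall>\<omega>. 0 \<le> Z \<omega> \<and> 0 \<le> Y \<omega>) \<and> integrable M Z \<and> integrable M Y \<and>
     (\<integral>\<omega>. Z \<omega> \<partial>M) \<le> (real (p + 1))\<^sup>2 * (vconst / measure lborel W *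
        (aint (\<gamma> 4) (\<lambda>_. 1) + aint (\<gamma> 3) (\<lambda>_. 1) + tv + (s * R) ^ DIM('a) * measure lborel B)) \<and>
     (\<integral>\<omega>. Y \<omega> \<partial>M) \<le> (s * R) ^ DIM('a) * measure lborel B * \<eta> \<and>
     (\<forall>\<omega>\<in>space M. \<forall>r\<in>{0..R}. \<bar>K_hat B W (N \<omega>) (s * r) - (\<integral>\<omega>. K_hat B W (N \<omega>) (s * r) \<partial>M)
          - 2 * lam * ((s * r) ^ DIM('a) * measure lborel B) * (lambda_hat W (N \<omega>) - lam)\<bar>
        \<le> sqrt (Z \<omega>) + 2 * lam * Y \<omega> + 2 * lam * (a0 + \<bar>lambda_hat W (N \<omega>) - lam\<bar>) * ((s * R) ^ DIM('a) * measure lborel B / 2 ^ p))"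
proof (rule exI[of _ "chain p"], rule exI[of _ edge], intro conjI allI ballI)
  have R0: "0 \<le> R" using R by simp
  show "0 \<le> chain p \<omega>" for \<omega> unfolding chain_def by (intro mult_nonneg_nonneg sum_nonneg) auto
  show "0 \<le> edge \<omega>" for \<omega> by (rule edge_nonneg)
  show "integrable M (chain p)" by (rule chain_expectation)
  have \<delta>': "lam * (1 + tv) * (1 / setcov W z - 1 / measure lborel W) \<le> \<eta>\<^sup>2" if "z \<in> C R" for z
    using that by (intro \<delta>) (auto simp: C_def)
  show "integrable M edge" by (rule edge_expectation(1)[OF \<eta> \<delta>'])
  show "(\<integral>\<omega>. edge \<omega> \<partial>M) \<le> (s * R) ^ DIM('a) * measure lborel B * \<eta>"
    using edge_expectation(2)[OF \<eta> \<delta>'] unfolding measure_C[OF R0] .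
  show "(\<integral>\<omega>. chain p \<omega> \<partial>M) \<le> (real (p + 1))\<^sup>2 * (vconst / measure lborel W *
        (aint (\<gamma> 4) (\<lambda>_. 1) + aint (\<gamma> 3) (\<lambda>_. 1) + tv + (s * R) ^ DIM('a) * measure lborel B))"
    using chain_expectation(2)[of p] unfolding measure_C[OF R0] .
  fix \<omega> r assume w: "\<omega> \<in> space M" and r: "r \<in> {0..R}"
  show "\<bar>K_hat B W (N \<omega>) (s * r) - (\<integral>\<omega>. K_hat B W (N \<omega>) (s * r) \<partial>M)
          - 2 * lam * ((s * r) ^ DIM('a) * measure lborel B) * (lambda_hat W (N \<omega>) - lam)\<bar>
        \<le> sqrt (chain p \<omega>) + 2 * lam * edge \<omega> + 2 * lam * (a0 + \<bar>lambda_hat W (N \<omega>) - lam\<bar>) * ((s * R) ^ DIM('a) * measure lborel B / 2 ^ p)"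
    using X_uniform_le[OF w, of r p] r measure_C[of r] measure_C[OF R0] unfolding X_def \<Delta>_def K_hat_eq L2_def by simp
qed

end

subsection \<open>Consistency along a convex averaging sequence\<close>

locale b4_sequence = b4_process M N \<gamma>
  for M :: "'w measure" and N :: "'w \<Rightarrow> 'a::euclidean_space set" and \<gamma> :: "nat \<Rightarrow> (nat \<Rightarrow> 'a) signed" +
  fixes W :: "nat \<Rightarrow> 'a set"
  assumes convW: "convex_averaging W"
begin

abbreviation V :: "nat \<Rightarrow> real" where "V n \<equiv> measure lborel (W n)"

lemma V_at_top: "filterlim V at_top sequentially"
  by (rule convex_averaging_volume[OF convW])

lemma V_ge: "\<forall>\<^sub>F n in sequentially. c \<le> V n"
  using V_at_top by (simp add: filterlim_at_top)

lemma inverse_V: "(\<lambda>n. 1 / V n) \<longlonglongrightarrow> 0"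
  using tendsto_inverse_0_at_top[OF V_at_top] by (simp add: inverse_eq_divide)

lemma window: "b4_window M N \<gamma> (W n)"
  by unfold_locales (rule convex_averaging_props(3,4)[OF convW])+

text \<open>Used with \<open>q n = 1\<close> for consistency and with the volume factor of the
  smoothing kernel; in the latter case the bandwidth condition on
  \<open>wscale (W n) * (b n)\<^sup>2\<close> is what makes the hypothesis true.\<close>

lemma lambda_hat_scaled:
  assumes q: "(\<lambda>n. (q n)\<^sup>2 / V n) \<longlonglongrightarrow> 0"
  shows "conv_p M (\<lambda>n \<omega>. q n * (lambda_hat (W n) (N \<omega>) - lam)) 0"
proof (rule conv_p_L2)
  interpret w: b4_window M N \<gamma> "W n" for n by (rule window)
  let ?c = "lam * (1 + aint (\<gamma> 2) (\<lambda>_. 1))"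
  have ev: "\<forall>\<^sub>F n in sequentially. integrable M (\<lambda>\<omega>. (q n * (lambda_hat (W n) (N \<omega>) - lam))\<^sup>2) \<and>
     (\<integral>\<omega>. (q n * (lambda_hat (W n) (N \<omega>) - lam))\<^sup>2 \<partial>M) \<le> ?c * ((q n)\<^sup>2 / V n)"
    using V_ge[of 1]
  proof eventually_elim
    case (elim n)
    then have V: "0 < V n" by simp
    have "(q n)\<^sup>2 * (\<integral>\<omega>. (lambda_hat (W n) (N \<omega>) - lam)\<^sup>2 \<partial>M) \<le> (q n)\<^sup>2 * (?c / V n)"
      using w.lambda_hat_L2(2)[OF V] unfolding w.tv_def by (intro mult_left_mono) auto
    then show ?case using w.lambda_hat_L2(1)[OF V] by (simp add: power_mult_distrib mult_ac)
  qed
  then show "\<forall>\<^sub>F n in sequentially. integrable M (\<lambda>\<omega>. (q n * (lambda_hat (W n) (N \<omega>) - lam))\<^sup>2)"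
    by (rule eventually_mono) simp
  show "(\<lambda>n. \<integral>\<omega>. (q n * (lambda_hat (W n) (N \<omega>) - lam))\<^sup>2 \<partial>M) \<longlonglongrightarrow> 0"
  proof (rule tendsto_sandwich[OF _ _ tendsto_const])
    show "\<forall>\<^sub>F n in sequentially. (\<integral>\<omega>. (q n * (lambda_hat (W n) (N \<omega>) - lam))\<^sup>2 \<partial>M) \<le> ?c * ((q n)\<^sup>2 / V n)"
      using ev by (rule eventually_mono) simp
    show "(\<lambda>n. ?c * ((q n)\<^sup>2 / V n)) \<longlonglongrightarrow> 0" using tendsto_mult_left[OF q, of ?c] by simp
  qed (auto intro!: always_eventually integral_nonneg_AE)
qed

lemma lambda_hat_consistent: "conv_p M (\<lambda>n \<omega>. lambda_hat (W n) (N \<omega>)) lam"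
proof -
  have "conv_p M (\<lambda>n \<omega>. 1 * (lambda_hat (W n) (N \<omega>) - lam)) 0"
    by (rule lambda_hat_scaled) (use inverse_V in simp)
  then show ?thesis by (rule conv_p_mono) simp
qed

lemma lambda2_hat_eq: "V n \<noteq> 0 \<Longrightarrow> lambda2_hat (W n) \<phi> = (lambda_hat (W n) \<phi>)\<^sup>2 - lambda_hat (W n) \<phi> * (1 / V n)"
  by (simp add: lambda2_hat_def lambda_hat_def power2_eq_square field_simps)

lemma lambda2_hat_consistent: "conv_p M (\<lambda>n \<omega>. lambda2_hat (W n) (N \<omega>)) (lam\<^sup>2)"
proof -
  have "conv_p M (\<lambda>n \<omega>. lambda_hat (W n) (N \<omega>) * lambda_hat (W n) (N \<omega>) - lambda_hat (W n) (N \<omega>) * (1 / V n)) (lam * lam - lam * 0)"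
    by (rule conv_p_diff[OF conv_p_mult[OF lambda_hat_consistent lambda_hat_consistent]
          conv_p_mult[OF lambda_hat_consistent conv_p_const[OF inverse_V]]])
  then have "conv_p M (\<lambda>n \<omega>. lambda_hat (W n) (N \<omega>) * lambda_hat (W n) (N \<omega>) - lambda_hat (W n) (N \<omega>) * (1 / V n) - lam\<^sup>2) (lam * lam - lam * 0 - lam\<^sup>2)"
    by (rule conv_p_diff[OF _ conv_p_const[OF tendsto_const]])
  then have "conv_p M (\<lambda>n \<omega>. lambda_hat (W n) (N \<omega>) * lambda_hat (W n) (N \<omega>) - lambda_hat (W n) (N \<omega>) * (1 / V n) - lam\<^sup>2) 0"
    by (simp add: power2_eq_square)
  then show ?thesis
  proof (rule conv_p_mono)
    show "\<forall>\<^sub>F n in sequentially. \<forall>\<omega>\<in>space M. \<bar>lambda2_hat (W n) (N \<omega>) - lam\<^sup>2\<bar> \<le>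
        \<bar>lambda_hat (W n) (N \<omega>) * lambda_hat (W n) (N \<omega>) - lambda_hat (W n) (N \<omega>) * (1 / V n) - lam\<^sup>2\<bar>"
      using V_ge[of 1] by eventually_elim (subst lambda2_hat_eq; simp add: power2_eq_square)
  qed
qed

text \<open>Dominated convergence under each Jordan part, as \<open>w (t 1 /\<^sub>R k n)\<close>
  tends to \<open>w 0 = 1\<close>. The summand \<open>lam\<close> is the diagonal contribution that
  \<open>sigma2_hat\<close> supplies through the intensity estimator.\<close>

lemma sint_smoothing:
  assumes w: "smoothing_kernel w" and k: "filterlim k at_top sequentially"
  shows "(\<lambda>n. lam * sint (\<gamma> 2) (\<lambda>t. w (t 1 /\<^sub>R k n)) + lam) \<longlonglongrightarrow> asymp_variance M N \<gamma>"
proof -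
  \<comment> \<open>Any window would do; it only gives access to the facts about the cumulant
    measures.\<close>
  interpret w: b4_window M N \<gamma> "W 0" by (rule window)
  have wm [measurable]: "w \<in> borel_measurable borel" and w0: "w 0 = 1" and wl: "(w \<longlongrightarrow> 1) (at 0)"
    using w by (auto simp: smoothing_kernel_def)
  have wc: "isCont w 0" using w0 wl by (simp add: isCont_def)
  obtain H where H: "\<And>x. \<bar>w x\<bar> \<le> H" using w unfolding smoothing_kernel_def bounded_iff by fastforce
  have k0: "(\<lambda>n. inverse (k n)) \<longlonglongrightarrow> 0" by (rule tendsto_inverse_0_at_top[OF k])
  have lim: "(\<lambda>n. \<integral>t. w (t 1 /\<^sub>R k n) \<partial>\<nu>) \<longlonglongrightarrow> measure \<nu> (space \<nu>)"
    if "finite_measure \<nu>" and m: "(\<lambda>t. t 1) \<in> borel_measurable \<nu>" for \<nu> :: "(nat \<Rightarrow> 'a) measure"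
  proof -
    interpret finite_measure \<nu> by fact
    note [measurable] = m
    have mw: "(\<lambda>t. w (t 1 /\<^sub>R k n)) \<in> borel_measurable \<nu>" for n
      by (rule measurable_compose[OF borel_measurable_scaleR[OF borel_measurable_const m] wm])
    have "(\<lambda>n. \<integral>t. w (t 1 /\<^sub>R k n) \<partial>\<nu>) \<longlonglongrightarrow> (\<integral>t. 1 \<partial>\<nu>)"
    proof (rule integral_dominated_convergence[where w="\<lambda>_. H"])
      show "AE t in \<nu>. (\<lambda>n. w (t 1 /\<^sub>R k n)) \<longlonglongrightarrow> 1"
      proof (rule AE_I2)
        fix t :: "nat \<Rightarrow> 'a"
        have "(\<lambda>n. t 1 /\<^sub>R k n) \<longlonglongrightarrow> 0" using tendsto_scaleR[OF k0 tendsto_const, of "t 1"] by simp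
        from isCont_tendsto_compose[OF wc this] show "(\<lambda>n. w (t 1 /\<^sub>R k n)) \<longlonglongrightarrow> 1" by (simp add: w0)
      qed
    qed (use H mw in auto)
    then show ?thesis by simp
  qed
  have "(\<lambda>n. lam * sint (\<gamma> 2) (\<lambda>t. w (t 1 /\<^sub>R k n)) + lam) \<longlonglongrightarrow>
      lam * (measure (fst (\<gamma> 2)) (space (fst (\<gamma> 2))) - measure (snd (\<gamma> 2)) (space (snd (\<gamma> 2)))) + lam"
    unfolding sint_def
    by (intro tendsto_intros lim w.gam_finite w.gam_component) auto
  also have "lam * (measure (fst (\<gamma> 2)) (space (fst (\<gamma> 2))) - measure (snd (\<gamma> 2)) (space (snd (\<gamma> 2)))) + lam = asymp_variance M N \<gamma>"
    using w.gam_space[of 2] by (simp add: asymp_variance_def signed_value_def algebra_simps)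
  finally show ?thesis .
qed

lemma pair_statistic_consistent:
  assumes ok: "\<forall>\<^sub>F n in sequentially. b4_window.kernel_ok (W n) (h n)" and H: "\<And>n z. h n z \<le> H"
    and J1: "(\<lambda>n. (\<integral>z. h n z \<partial>lborel) / V n) \<longlonglongrightarrow> 0" and J2: "(\<lambda>n. (\<integral>z. h n z \<partial>lborel)\<^sup>2 / V n) \<longlonglongrightarrow> 0"
  shows "conv_p M (\<lambda>n \<omega>. (\<Sum>(x, y)\<in>point_pairs (W n) (N \<omega>). h n (y - x) / overlap (W n) x y)
    - lam * sint (\<gamma> 2) (\<lambda>t. h n (t 1)) - lam\<^sup>2 * (\<integral>z. h n z \<partial>lborel)) 0"
proof (rule conv_p_L2)
  interpret w: b4_window M N \<gamma> "W n" for n by (rule window)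
  let ?D = "\<lambda>n \<omega>. (\<Sum>(x, y)\<in>point_pairs (W n) (N \<omega>). h n (y - x) / overlap (W n) x y)
    - lam * sint (\<gamma> 2) (\<lambda>t. h n (t 1)) - lam\<^sup>2 * (\<integral>z. h n z \<partial>lborel)"
  define vc where "vc = 4 * (4 * lam + 2 * lam\<^sup>2 * (aint (\<gamma> 2) (\<lambda>_. 1) + 1)\<^sup>2)"
  define A where "A = aint (\<gamma> 4) (\<lambda>_. 1) + aint (\<gamma> 3) (\<lambda>_. 1) + aint (\<gamma> 2) (\<lambda>_. 1)"
  define e where "e = 32 * lam ^ 3 * (1 + aint (\<gamma> 2) (\<lambda>_. 1))"
  let ?J = "\<lambda>n. \<integral>z. h n z \<partial>lborel"
  let ?b = "\<lambda>n. 2 * vc * (H\<^sup>2 * A) * (1 / V n) + 2 * vc * H * (?J n / V n) + e * ((?J n)\<^sup>2 / V n)"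
  show "\<forall>\<^sub>F n in sequentially. integrable M (\<lambda>\<omega>. (?D n \<omega>)\<^sup>2)"
    using ok by eventually_elim (rule w.pair_statistic_L2(1)[OF _ H])
  show "(\<lambda>n. \<integral>\<omega>. (?D n \<omega>)\<^sup>2 \<partial>M) \<longlonglongrightarrow> 0"
  proof (rule tendsto_sandwich[OF _ _ tendsto_const])
    show "\<forall>\<^sub>F n in sequentially. (\<integral>\<omega>. (?D n \<omega>)\<^sup>2 \<partial>M) \<le> ?b n"
      using ok
    proof eventually_elim
      case (elim n)
      have "(\<integral>\<omega>. (?D n \<omega>)\<^sup>2 \<partial>M) \<le> (2 * vc * (H\<^sup>2 * A + H * ?J n) + e * (?J n)\<^sup>2) / V n"
        using w.pair_statistic_L2(2)[OF elim H] unfolding w.tv_def w.vconst_def vc_def A_def e_def .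
      also have "\<dots> = ?b n" by (simp add: add_divide_distrib distrib_left mult.assoc)
      finally show ?case .
    qed
    have "?b \<longlonglongrightarrow> 2 * vc * (H\<^sup>2 * A) * 0 + 2 * vc * H * 0 + e * 0"
      by (intro tendsto_intros inverse_V J1 J2)
    then show "?b \<longlonglongrightarrow> 0" by simp
  qed (auto intro!: always_eventually integral_nonneg_AE)
qed

end

context b4_sequence
begin

text \<open>The mean of the pair sum contains \<open>lam\<^sup>2 * q n * J\<close>, which grows with
  n and is removed with an estimate of \<open>lam\<^sup>2\<close>. The error of this removal is
  \<open>q n\<close> times the error of the squared intensity estimator, so the rate of that
  estimator is needed and not only its consistency.\<close>

lemma sigma2_hat_consistent:
  assumes w: "smoothing_kernel w" and b: "\<And>n. 0 < b n" and b0: "b \<longlonglongrightarrow> 0"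
    and cb: "filterlim (\<lambda>n. wscale (W n) * b n) at_top sequentially"
    and cb2: "(\<lambda>n. wscale (W n) * (b n)\<^sup>2) \<longlonglongrightarrow> 0"
    and cbr: "(\<lambda>n. wscale (W n) * b n / inradius (W n)) \<longlonglongrightarrow> 0"
  shows "conv_p M (\<lambda>n \<omega>. sigma2_hat w (b n) (W n) (N \<omega>)) (asymp_variance M N \<gamma>)"
proof -
  interpret w: b4_window M N \<gamma> "W n" for n by (rule window)
  define k where "k n = b n * wscale (W n)" for n
  define q where "q n = k n ^ DIM('a)" for n
  define J where "J = (\<integral>x. w x \<partial>lborel)"
  let ?h = "\<lambda>n z. w (z /\<^sub>R k n)"
  have wm [measurable]: "w \<in> borel_measurable borel" and wnn: "\<And>x. 0 \<le> w x" and wsym: "\<And>x. w (- x) = w x"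
    using w by (auto simp: smoothing_kernel_def)
  obtain H where H: "\<And>x. w x \<le> H" using w wnn unfolding smoothing_kernel_def bounded_iff by fastforce
  obtain \<rho> where \<rho>: "\<And>x. w x \<noteq> 0 \<Longrightarrow> norm x \<le> \<rho>" using w unfolding smoothing_kernel_def bounded_iff by fastforce
  have ktop: "filterlim k at_top sequentially" using cb by (simp add: k_def[abs_def] mult.commute)
  have kr: "(\<lambda>n. \<rho> * k n / inradius (W n)) \<longlonglongrightarrow> 0"
    using tendsto_mult_left[OF cbr, of \<rho>] by (simp add: k_def mult_ac)
  have d: "0 < DIM('a)" by simp
  have ev: "\<forall>\<^sub>F n in sequentially. 1 \<le> V n \<and> 0 < k n \<and> q n / V n = b n ^ DIM('a) \<and>
      (q n)\<^sup>2 / V n = (wscale (W n) * (b n)\<^sup>2) ^ DIM('a) \<and> (\<integral>z. ?h n z \<partial>lborel) = q n * J"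
    using V_ge[of 1]
  proof eventually_elim
    case (elim n)
    then have V: "0 < V n" by simp
    have k: "0 < k n" using b wscale_power(3)[OF V] by (simp add: k_def)
    \<comment> \<open>The d-th power of the window scale is the volume; thus
      \<open>q n / V n\<close> and \<open>(q n)\<^sup>2 / V n\<close> are d-th powers of
      \<open>b n\<close> and \<open>wscale (W n) * (b n)\<^sup>2\<close>.\<close>
    have q: "q n = b n ^ DIM('a) * V n" by (simp add: q_def k_def power_mult_distrib wscale_power(1)[OF V])
    have "(q n)\<^sup>2 / V n = b n ^ DIM('a) * b n ^ DIM('a) * V n"
      unfolding q using V by (simp add: power2_eq_square)
    also have "\<dots> = (wscale (W n) * (b n)\<^sup>2) ^ DIM('a)"
      unfolding wscale_power(1)[OF V, symmetric] by (simp add: power_mult_distrib power2_eq_square mult_ac)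
    finally show ?case using elim k V integral_scale[OF wm k] q by (simp add: q_def J_def)
  qed
  have qV: "(\<lambda>n. q n / V n) \<longlonglongrightarrow> 0"
  proof (rule Lim_transform_eventually)
    show "(\<lambda>n. b n ^ DIM('a)) \<longlonglongrightarrow> 0" using tendsto_power[OF b0, of "DIM('a)"] d by (simp add: power_0_left)
    show "\<forall>\<^sub>F n in sequentially. b n ^ DIM('a) = q n / V n" using ev by (rule eventually_mono) simp
  qed
  have q2V: "(\<lambda>n. (q n)\<^sup>2 / V n) \<longlonglongrightarrow> 0"
  proof (rule Lim_transform_eventually)
    show "(\<lambda>n. (wscale (W n) * (b n)\<^sup>2) ^ DIM('a)) \<longlonglongrightarrow> 0" using tendsto_power[OF cb2, of "DIM('a)"] d by (simp add: power_0_left)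
    show "\<forall>\<^sub>F n in sequentially. (wscale (W n) * (b n)\<^sup>2) ^ DIM('a) = (q n)\<^sup>2 / V n" using ev by (rule eventually_mono) simp
  qed
  let ?S = "\<lambda>n \<omega>. \<Sum>(x, y)\<in>point_pairs (W n) (N \<omega>). ?h n (y - x) / overlap (W n) x y"
  let ?D = "\<lambda>n \<omega>. ?S n \<omega> - lam * sint (\<gamma> 2) (\<lambda>t. ?h n (t 1)) - lam\<^sup>2 * (\<integral>z. ?h n z \<partial>lborel)"
  have D: "conv_p M ?D 0"
  proof (rule pair_statistic_consistent)
    show "(\<lambda>n. (\<integral>z. ?h n z \<partial>lborel) / V n) \<longlonglongrightarrow> 0"
    proof (rule Lim_transform_eventually)
      show "(\<lambda>n. J * (q n / V n)) \<longlonglongrightarrow> 0" using tendsto_mult_left[OF qV, of J] by simp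
      show "\<forall>\<^sub>F n in sequentially. J * (q n / V n) = (\<integral>z. ?h n z \<partial>lborel) / V n"
        using ev
      proof eventually_elim
        case (elim n)
        then have I: "(\<integral>z. ?h n z \<partial>lborel) = q n * J" by blast
        show ?case unfolding I by simp
      qed
    qed
    show "(\<lambda>n. (\<integral>z. ?h n z \<partial>lborel)\<^sup>2 / V n) \<longlonglongrightarrow> 0"
    proof (rule Lim_transform_eventually)
      show "(\<lambda>n. J\<^sup>2 * ((q n)\<^sup>2 / V n)) \<longlonglongrightarrow> 0" using tendsto_mult_left[OF q2V, of "J\<^sup>2"] by simp
      show "\<forall>\<^sub>F n in sequentially. J\<^sup>2 * ((q n)\<^sup>2 / V n) = (\<integral>z. ?h n z \<partial>lborel)\<^sup>2 / V n"
        using ev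
      proof eventually_elim
        case (elim n)
        then have I: "(\<integral>z. ?h n z \<partial>lborel) = q n * J" by blast
        show ?case unfolding I by (simp add: power_mult_distrib)
      qed
    qed
    show "?h n z \<le> H" for n z by (rule H)
    have kr': "\<forall>\<^sub>F n in sequentially. 2 * real DIM('a) * (\<rho> * k n / inradius (W n)) < 1 / 2"
      using tendsto_mult_left[OF kr, of "2 * real DIM('a)"] by (intro order_tendstoD(2)) auto
    show "\<forall>\<^sub>F n in sequentially. b4_window.kernel_ok (W n) (?h n)"
      using kr' ev convex_averaging_setcov[OF convW kr]
    proof eventually_elim
      case (elim n)
      have k: "0 < k n" and V: "0 < V n" using elim by auto
      have supp: "norm z \<le> \<rho> * k n" if "w (z /\<^sub>R k n) \<noteq> 0" for z
      proof -
        have "norm z / k n \<le> \<rho>" using \<rho>[OF that] k by (simp add: divide_inverse mult.commute)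
        then show ?thesis using k by (simp add: divide_le_eq)
      qed
      show ?case
        unfolding w.kernel_ok_def
      proof (intro conjI allI impI)
        have ci: "integrable lborel (\<lambda>z. H * indicator (cball 0 (\<rho> * k n)) z :: real)"
          by (intro integrable_mult_right integrable_real_indicator emeasure_bounded_finite) auto
        have le: "norm (w (z /\<^sub>R k n)) \<le> norm (H * indicator (cball 0 (\<rho> * k n)) z)" for z
          using supp[of z] H[of "z /\<^sub>R k n"] wnn[of "z /\<^sub>R k n"] by (cases "w (z /\<^sub>R k n) = 0") auto
        show "integrable lborel (?h n)"
          by (rule Bochner_Integration.integrable_bound[OF ci]) (use le in auto)
        show "\<exists>H. \<forall>z. ?h n z \<le> H" using H by blast
        show "V n / 2 \<le> setcov (W n) z" if "?h n z \<noteq> 0" for z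
        proof -
          have "1 / 2 * V n \<le> (1 - 2 * real DIM('a) * (\<rho> * k n / inradius (W n))) * V n"
            using elim(1) V by (intro mult_right_mono) auto
          also have "\<dots> \<le> setcov (W n) z" using elim(3) supp[OF that] by blast
          finally show ?thesis by simp
        qed
        show "?h n (- z) = ?h n z" for z using wsym[of "z /\<^sub>R k n"] by simp
      qed (use V wnn in auto)
    qed
  qed
  let ?L = "\<lambda>n \<omega>. lambda_hat (W n) (N \<omega>)"
  let ?e = "\<lambda>n. lam * sint (\<gamma> 2) (\<lambda>t. ?h n (t 1)) + lam - asymp_variance M N \<gamma>"
  \<comment> \<open>An exact regrouping of the error: intensity error, centred pair sum, smoothing
    bias, and the error of the estimated squared intensity. In the last one the bias correction in
    \<open>lambda2_hat\<close> leaves a multiple of \<open>q n / V n\<close>, and the difference of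
    squares is factored.\<close>
  let ?U = "\<lambda>n \<omega>. (?L n \<omega> - lam) + ?D n \<omega> + ?e n + J * (?L n \<omega> * (q n / V n) - (q n * (?L n \<omega> - lam)) * (?L n \<omega> + lam))"
  have e0: "?e \<longlonglongrightarrow> asymp_variance M N \<gamma> - asymp_variance M N \<gamma>"
    by (intro tendsto_diff sint_smoothing[OF w ktop] tendsto_const)
  note c = conv_p_const[OF tendsto_const]
  have "conv_p M ?U ((lam - lam) + 0 + (asymp_variance M N \<gamma> - asymp_variance M N \<gamma>) + J * (lam * 0 - 0 * (lam + lam)))"
    by (intro conv_p_add[OF conv_p_add[OF conv_p_add[OF conv_p_diff[OF lambda_hat_consistent c] D] conv_p_const[OF e0]]]
      conv_p_mult[OF c conv_p_diff[OF conv_p_mult[OF lambda_hat_consistent conv_p_const[OF qV]]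
        conv_p_mult[OF lambda_hat_scaled[OF q2V] conv_p_add[OF lambda_hat_consistent c]]]])
  then have U: "conv_p M ?U 0" by simp
  show ?thesis
  proof (rule conv_p_mono[OF U])
    show "\<forall>\<^sub>F n in sequentially. \<forall>\<omega>\<in>space M. \<bar>sigma2_hat w (b n) (W n) (N \<omega>) - asymp_variance M N \<gamma>\<bar> \<le> \<bar>?U n \<omega>\<bar>"
      using ev
    proof eventually_elim
      case (elim n)
      then have V: "V n \<noteq> 0" and I: "(\<integral>z. ?h n z \<partial>lborel) = q n * J" by auto
      have eq: "sigma2_hat w (b n) (W n) (N \<omega>) - asymp_variance M N \<gamma> = ?U n \<omega>" for \<omega>
        unfolding sigma2_hat_def lambda2_hat_eq[OF V] k_def[symmetric] q_def[symmetric] J_def[symmetric] I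
        by (simp add: algebra_simps power2_eq_square)
      show ?case unfolding eq by simp
    qed
  qed
qed

text \<open>Three errors have to vanish after scaling by \<open>V n powr (1 / 2 - \<alpha>)\<close>.
  In mean square the chain is of order \<open>(p n + 1)\<^sup>2 * V n powr (\<alpha> - 1)\<close>,
  which leaves a squared logarithm times \<open>V n powr (- \<alpha>)\<close>. The edge term is of
  order \<open>sqrt (V n) * \<eta> n\<close> in mean, small because the displacements are small
  relative to the inradius. The discretisation contributes at most the order
  \<open>sqrt (V n) / 2 ^ p n\<close>.\<close>

lemma K_hat_uniform:
  assumes mu: "reduced_moment M N 2 \<mu>" and mb: "moment_bound \<mu>"
    and B: "compact B" "convex B" "\<forall>x\<in>B. - x \<in> B" "0 \<in> B"
    and R: "0 < R" and \<alpha>: "0 < \<alpha>"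
    and rad: "(\<lambda>n. wscale (W n) powr \<alpha> / inradius (W n)) \<longlonglongrightarrow> 0"
  shows "\<exists>E. conv_p M E 0 \<and> (\<forall>\<^sub>F n in sequentially. \<forall>\<omega>\<in>space M. \<forall>r\<in>{0..R}.
    \<bar>V n powr (1 / 2 - \<alpha>) * (K_hat B (W n) (N \<omega>) (wscale (W n) powr \<alpha> * r) - (\<integral>\<omega>. K_hat B (W n) (N \<omega>) (wscale (W n) powr \<alpha> * r) \<partial>M))
      - 2 * lam * (measure lborel B * r ^ DIM('a)) * (sqrt (V n) * (lambda_hat (W n) (N \<omega>) - lam))\<bar> \<le> E n \<omega>)"
proof -
  obtain a0 where a0: "0 < a0" "\<And>A. A \<in> sets borel \<Longrightarrow> bounded A \<Longrightarrow> emeasure \<mu> (\<Pi>\<^sub>E l\<in>{1..<2::nat}. A) \<le> ennreal a0 * emeasure lborel A"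
    using mb unfolding moment_bound_def by blast
  obtain \<beta> where \<beta>: "0 < \<beta>" "\<And>x. x \<in> B \<Longrightarrow> norm x \<le> \<beta>"
    using compact_imp_bounded[OF B(1)] by (auto simp: bounded_pos)
  define tv0 where "tv0 = aint (\<gamma> 2) (\<lambda>_. 1)"
  define vc where "vc = 4 * (4 * lam + 2 * lam\<^sup>2 * (tv0 + 1)\<^sup>2)"
  define A where "A = aint (\<gamma> 4) (\<lambda>_. 1) + aint (\<gamma> 3) (\<lambda>_. 1) + tv0"
  \<comment> \<open>As 1 / (1 - e) is at most 1 + 2 e for 0 \<le> e \<le> 1/2, the variance bound of
    the edge process is at most \<open>c1 * \<epsilon> n / V n\<close>; the 2 comes from
    there.\<close>
  define c1 where "c1 = 2 * (lam * (1 + tv0))"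
  define m where "m = R ^ DIM('a) * measure lborel B"
  have nn0: "0 \<le> tv0" "0 \<le> A" "0 \<le> m" using R by (simp_all add: tv0_def A_def m_def aint_def)
  have nn: "0 \<le> tv0" "0 \<le> vc" "0 \<le> A" "0 \<le> c1" "0 \<le> m"
    using nn0 lam_nonneg by (auto simp: vc_def c1_def)
  define s where "s n = wscale (W n) powr \<alpha>" for n
  define \<zeta> where "\<zeta> n = s n * R * \<beta>" for n
  define \<epsilon> where "\<epsilon> n = \<bar>2 * real DIM('a) * (\<zeta> n / inradius (W n))\<bar>" for n
  \<comment> \<open>The second summand keeps \<open>\<eta> n\<close> positive, as
    \<open>uniform_bound\<close> demands; multiplied by \<open>sqrt (V n)\<close> its contribution
    still tends to 0.\<close>
  define \<eta> where "\<eta> n = sqrt (c1 * \<epsilon> n / V n + 1 / (V n)\<^sup>2)" for n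
  \<comment> \<open>The depth is the least with at least \<open>V n\<close> cells: enough for the
    discretisation error and only logarithmic in the chaining bound.\<close>
  define p where "p n = nat \<lceil>log 2 (V n)\<rceil>" for n
  \<comment> \<open>All relevant powers of the volume become integer powers of \<open>x n\<close>,
    and the logarithm in \<open>p n\<close> is absorbed by one factor \<open>x n\<close>. The
    balance is 2 + 4 - 8 = -2, that is, the bound decays like
    \<open>V n powr (- \<alpha> / 2)\<close>.\<close>
  define x where "x n = V n powr (\<alpha> / 4)" for n
  have \<zeta>0: "(\<lambda>n. \<zeta> n / inradius (W n)) \<longlonglongrightarrow> 0"
    using tendsto_mult_left[OF rad, of "R * \<beta>"] by (simp add: \<zeta>_def s_def mult_ac)
  have \<epsilon>0: "\<epsilon> \<longlonglongrightarrow> 0"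
    unfolding \<epsilon>_def[abs_def] using tendsto_mult_left[OF \<zeta>0, of "2 * real DIM('a)"] by (intro tendsto_rabs_zero) simp
  have \<epsilon>nn: "0 \<le> \<epsilon> n" for n by (simp add: \<epsilon>_def)
  have \<epsilon>small: "\<forall>\<^sub>F n in sequentially. \<epsilon> n < 1 / 2" by (rule order_tendstoD(2)[OF \<epsilon>0]) simp
  let ?L = "\<lambda>n \<omega>. lambda_hat (W n) (N \<omega>)"
  let ?K = "\<lambda>n r \<omega>. K_hat B (W n) (N \<omega>) (s n * r)"
  let ?P = "\<lambda>n ZY. (\<forall>\<omega>. 0 \<le> fst ZY \<omega> \<and> 0 \<le> snd ZY \<omega>) \<and> integrable M (fst ZY) \<and> integrable M (snd ZY) \<and>
     (\<integral>\<omega>. fst ZY \<omega> \<partial>M) \<le> (real (p n + 1))\<^sup>2 * (vc / V n * (A + (s n * R) ^ DIM('a) * measure lborel B)) \<and>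
     (\<integral>\<omega>. snd ZY \<omega> \<partial>M) \<le> (s n * R) ^ DIM('a) * measure lborel B * \<eta> n \<and>
     (\<forall>\<omega>\<in>space M. \<forall>r\<in>{0..R}. \<bar>?K n r \<omega> - (\<integral>\<omega>. ?K n r \<omega> \<partial>M)
          - 2 * lam * ((s n * r) ^ DIM('a) * measure lborel B) * (?L n \<omega> - lam)\<bar>
        \<le> sqrt (fst ZY \<omega>) + 2 * lam * snd ZY \<omega> + 2 * lam * (a0 + \<bar>?L n \<omega> - lam\<bar>) * ((s n * R) ^ DIM('a) * measure lborel B / 2 ^ p n))"
  have "\<forall>\<^sub>F n in sequentially. \<exists>ZY. ?P n ZY"
    using V_ge[of 1] \<epsilon>small convex_averaging_setcov[OF convW \<zeta>0]
  proof eventually_elim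
    case (elim n)
    then have V: "0 < V n" by simp
    have s: "0 < s n" using wscale_power(3)[OF V] by (simp add: s_def)
    have cov: "(1 - \<epsilon> n) * V n \<le> setcov (W n) z" if zB: "z \<in> (\<lambda>z. (s n * R) *\<^sub>R z) ` B" for z
    proof -
      obtain y where y: "y \<in> B" "z = (s n * R) *\<^sub>R y" using zB by blast
      have "norm z = s n * R * norm y" using y(2) s R by simp
      also have "\<dots> \<le> \<zeta> n" unfolding \<zeta>_def using \<beta>(2)[OF y(1)] s R by (intro mult_left_mono) auto
      finally have "norm z \<le> \<zeta> n" .
      then have "(1 - 2 * real DIM('a) * (\<zeta> n / inradius (W n))) * V n \<le> setcov (W n) z" using elim(3) by blast
      moreover have "(1 - \<epsilon> n) * V n \<le> (1 - 2 * real DIM('a) * (\<zeta> n / inradius (W n))) * V n"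
        using abs_ge_self[of "2 * real DIM('a) * (\<zeta> n / inradius (W n))"] V
        by (intro mult_right_mono) (simp_all only: \<epsilon>_def diff_left_mono less_imp_le)
      ultimately show ?thesis by linarith
    qed
    have cov2: "V n / 2 \<le> setcov (W n) z" if "z \<in> (\<lambda>z. (s n * R) *\<^sub>R z) ` B" for z
    proof -
      have "1 / 2 * V n \<le> (1 - \<epsilon> n) * V n" using elim(2) V by (intro mult_right_mono) auto
      then show ?thesis using cov[OF that] by linarith
    qed
    interpret k: k_window M N \<gamma> "W n" \<mu> a0 "s n" R B
      by (intro k_window.intro window k_window_axioms.intro) (use mu a0 B s R V cov2 in auto)
    have \<eta>: "0 < \<eta> n" "(\<eta> n)\<^sup>2 = c1 * \<epsilon> n / V n + 1 / (V n)\<^sup>2"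
    proof -
      have "0 \<le> c1 * \<epsilon> n / V n" "0 < 1 / (V n)\<^sup>2" using nn \<epsilon>nn[of n] V by auto
      then have "0 < c1 * \<epsilon> n / V n + 1 / (V n)\<^sup>2" by (rule add_nonneg_pos)
      then show "0 < \<eta> n" "(\<eta> n)\<^sup>2 = c1 * \<epsilon> n / V n + 1 / (V n)\<^sup>2"
        unfolding \<eta>_def by (simp_all only: real_sqrt_gt_zero real_sqrt_pow2 less_imp_le)
    qed
    have "lam * (1 + k.tv) * (1 / setcov (W n) z - 1 / V n) \<le> (\<eta> n)\<^sup>2" if "z \<in> (\<lambda>z. (s n * R) *\<^sub>R z) ` B" for z
    proof -
      have e: "0 < 1 - \<epsilon> n" using elim(2) by simp
      have "0 \<le> \<epsilon> n * (1 - 2 * \<epsilon> n)" using \<epsilon>nn[of n] elim(2) by (intro mult_nonneg_nonneg) auto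
      then have "1 \<le> (1 + 2 * \<epsilon> n) * (1 - \<epsilon> n)" by (simp add: algebra_simps)
      then have e2: "1 / (1 - \<epsilon> n) \<le> 1 + 2 * \<epsilon> n" using e by (simp add: divide_le_eq)
      have "1 / setcov (W n) z \<le> 1 / ((1 - \<epsilon> n) * V n)"
      proof (rule divide_left_mono)
        have "0 < (1 - \<epsilon> n) * V n" using e V by simp
        moreover from this have "0 < setcov (W n) z" using cov[OF that] by linarith
        ultimately show "0 < setcov (W n) z * ((1 - \<epsilon> n) * V n)" by (rule mult_pos_pos[rotated])
      qed (use cov[OF that] in auto)
      also have "\<dots> = 1 / (1 - \<epsilon> n) * (1 / V n)" by simp
      also have "\<dots> \<le> (1 + 2 * \<epsilon> n) * (1 / V n)" using e2 V by (intro mult_right_mono) auto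
      finally have "1 / setcov (W n) z - 1 / V n \<le> 2 * \<epsilon> n / V n" by (simp add: add_divide_distrib)
      then have "lam * (1 + tv0) * (1 / setcov (W n) z - 1 / V n) \<le> lam * (1 + tv0) * (2 * \<epsilon> n / V n)"
        using nn lam_nonneg by (intro mult_left_mono) auto
      also have "\<dots> = c1 * \<epsilon> n / V n" by (simp add: c1_def)
      also have "\<dots> \<le> (\<eta> n)\<^sup>2" unfolding \<eta>(2) by simp
      finally show ?thesis by (simp add: k.tv_def tv0_def)
    qed
    from k.uniform_bound[OF \<eta>(1) this, of "p n"]
    show ?case unfolding k.vconst_def k.tv_def tv0_def[symmetric] vc_def[symmetric] A_def[symmetric] split_paired_Ex fst_conv snd_conv .
  qed
  then obtain ZY where P: "\<forall>\<^sub>F n in sequentially. ?P n (ZY n)" unfolding eventually_ex by blast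
  \<comment> \<open>The chosen functions are known to be non-negative for large n only, while
    \<open>conv_p_expectation\<close> asks for it at every n; hence the absolute values.\<close>
  let ?Z = "\<lambda>n \<omega>. V n powr (1 - 2 * \<alpha>) * \<bar>fst (ZY n) \<omega>\<bar>"
  let ?Y = "\<lambda>n \<omega>. V n powr (1 / 2 - \<alpha>) * \<bar>snd (ZY n) \<omega>\<bar>"
  have scale: "(s n * r) ^ DIM('a) = V n powr \<alpha> * r ^ DIM('a)" if "1 \<le> V n" for n r
    using that wscale_power(2)[of "W n" \<alpha>] by (simp add: s_def power_mult_distrib)
  have x4: "0 < x n" "1 \<le> x n" "V n powr \<alpha> = x n ^ 4" "V n powr (1 - 2 * \<alpha>) = V n / x n ^ 8" "V n powr (- \<alpha> / 2) = 1 / x n ^ 2"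
    if "1 \<le> V n" for n
  proof -
    have xk: "x n ^ k = V n powr (\<alpha> / 4 * real k)" for k using that by (simp add: x_def powr_powr powr_realpow[symmetric])
    show "0 < x n" "1 \<le> x n" using that \<alpha> by (auto simp: x_def ge_one_powr_ge_zero)
    show "V n powr \<alpha> = x n ^ 4" "V n powr (1 - 2 * \<alpha>) = V n / x n ^ 8" "V n powr (- \<alpha> / 2) = 1 / x n ^ 2"
      unfolding xk using that by (simp_all add: powr_diff powr_minus_divide)
  qed
  \<comment> \<open>The first summand comes from bounding the logarithm by a power with exponent
    \<open>\<alpha> / 4\<close>; the 2 pays for the ceiling and for the extra level in
    \<open>p n + 1\<close>.\<close>
  define k0 where "k0 = 4 / (\<alpha> * ln 2) + 2"
  have k0: "0 \<le> k0" using \<alpha> by (simp add: k0_def)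
  have px: "real (p n + 1) \<le> k0 * x n" and p2: "V n \<le> 2 ^ p n" if "1 \<le> V n" for n
  proof -
    have l: "0 \<le> log 2 (V n)" using that by simp
    have "ln (V n) \<le> x n / (\<alpha> / 4)" unfolding x_def using that \<alpha> by (intro ln_powr_bound) auto
    then have "ln (V n) / ln 2 \<le> x n / (\<alpha> / 4) / ln 2" by (intro divide_right_mono) auto
    then have "log 2 (V n) \<le> 4 / (\<alpha> * ln 2) * x n" by (simp add: log_def field_simps)
    moreover have "real (p n) \<le> log 2 (V n) + 1" using l unfolding p_def by (simp add: of_nat_nat)
    moreover have "2 \<le> 2 * x n" using x4(2)[OF that] by simp
    ultimately show "real (p n + 1) \<le> k0 * x n" by (simp add: k0_def algebra_simps)
    have "V n = 2 powr (log 2 (V n))" using that by simp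
    also have "\<dots> \<le> 2 powr (real (p n))" using l unfolding p_def by (intro powr_mono) (auto simp: of_nat_nat le_of_int_ceiling)
    also have "\<dots> = 2 ^ p n" by (simp add: powr_realpow)
    finally show "V n \<le> 2 ^ p n" .
  qed
  have Z0: "conv_p M ?Z 0"
  proof (rule conv_p_expectation)
    show "\<forall>\<^sub>F n in sequentially. integrable M (?Z n)"
      using P by (rule eventually_mono) (auto intro!: integrable_mult_right)
    show "(\<lambda>n. \<integral>\<omega>. ?Z n \<omega> \<partial>M) \<longlonglongrightarrow> 0"
    proof (rule tendsto_sandwich[OF _ _ tendsto_const])
      have "(\<lambda>n. V n powr (- \<alpha> / 2)) \<longlonglongrightarrow> 0" by (rule tendsto_neg_powr[OF _ V_at_top]) (use \<alpha> in simp)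
      from tendsto_mult_left[OF this, of "k0\<^sup>2 * vc * (A + m)"]
      show "(\<lambda>n. k0\<^sup>2 * vc * (A + m) * V n powr (- \<alpha> / 2)) \<longlonglongrightarrow> 0" by simp
      show "\<forall>\<^sub>F n in sequentially. (\<integral>\<omega>. ?Z n \<omega> \<partial>M) \<le> k0\<^sup>2 * vc * (A + m) * V n powr (- \<alpha> / 2)"
        using P V_ge[of 1]
      proof eventually_elim
        case (elim n)
        note x = x4[OF elim(2)]
        have V: "0 < V n" using elim(2) by simp
        have "(\<integral>\<omega>. ?Z n \<omega> \<partial>M) = V n / x n ^ 8 * (\<integral>\<omega>. fst (ZY n) \<omega> \<partial>M)"
          using elim(1) x(4) by (simp add: abs_of_nonneg)
        also have "\<dots> \<le> V n / x n ^ 8 * ((k0 * x n)\<^sup>2 * (vc / V n * ((A + m) * x n ^ 4)))"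
        proof (rule mult_left_mono)
          have "(\<integral>\<omega>. fst (ZY n) \<omega> \<partial>M) \<le> (real (p n + 1))\<^sup>2 * (vc / V n * (A + (s n * R) ^ DIM('a) * measure lborel B))"
            using elim(1) by blast
          also have "\<dots> = (real (p n + 1))\<^sup>2 * (vc / V n * (A + m * x n ^ 4))"
            unfolding scale[OF elim(2)] x(3) m_def by (simp add: mult_ac)
          also have "\<dots> \<le> (k0 * x n)\<^sup>2 * (vc / V n * ((A + m) * x n ^ 4))"
          proof (intro mult_mono power_mono px[OF elim(2)])
            have Ax: "0 \<le> A + m * x n ^ 4" using nn x(1) by (intro add_nonneg_nonneg mult_nonneg_nonneg) auto
            then show "0 \<le> A + m * x n ^ 4" "0 \<le> vc / V n * (A + m * x n ^ 4)"
              using nn V by (auto intro: mult_nonneg_nonneg)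
            have "A * 1 \<le> A * x n ^ 4" using nn x(2) by (intro mult_left_mono) auto
            then show "A + m * x n ^ 4 \<le> (A + m) * x n ^ 4" by (simp add: distrib_right)
          qed (use nn V x in auto)
          finally show "(\<integral>\<omega>. fst (ZY n) \<omega> \<partial>M) \<le> (k0 * x n)\<^sup>2 * (vc / V n * ((A + m) * x n ^ 4))" .
        qed (use V x in auto)
        also have "\<dots> = k0\<^sup>2 * vc * (A + m) * (1 / x n ^ 2)"
          using V x(1) by (simp add: field_simps power_mult_distrib power2_eq_square) (simp add: power_add[symmetric] eval_nat_numeral)
        finally show ?case unfolding x(5) .
      qed
    qed (auto intro!: always_eventually integral_nonneg_AE)
  qed auto
  have Y0: "conv_p M ?Y 0"
  proof (rule conv_p_expectation)
    show "\<forall>\<^sub>F n in sequentially. integrable M (?Y n)"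
      using P by (rule eventually_mono) (auto intro!: integrable_mult_right)
    show "(\<lambda>n. \<integral>\<omega>. ?Y n \<omega> \<partial>M) \<longlonglongrightarrow> 0"
    proof (rule tendsto_sandwich[OF _ _ tendsto_const])
      have "(\<lambda>n. m * sqrt (c1 * \<epsilon> n + 1 / V n)) \<longlonglongrightarrow> m * sqrt (c1 * 0 + 0)"
        by (intro tendsto_intros \<epsilon>0 inverse_V)
      then show "(\<lambda>n. m * sqrt (c1 * \<epsilon> n + 1 / V n)) \<longlonglongrightarrow> 0" by simp
      show "\<forall>\<^sub>F n in sequentially. (\<integral>\<omega>. ?Y n \<omega> \<partial>M) \<le> m * sqrt (c1 * \<epsilon> n + 1 / V n)"
        using P V_ge[of 1]
      proof eventually_elim
        case (elim n)
        have V: "0 < V n" using elim(2) by simp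
        have "(\<integral>\<omega>. ?Y n \<omega> \<partial>M) = V n powr (1 / 2 - \<alpha>) * (\<integral>\<omega>. snd (ZY n) \<omega> \<partial>M)"
          using elim(1) by (simp add: abs_of_nonneg)
        also have "\<dots> \<le> V n powr (1 / 2 - \<alpha>) * ((s n * R) ^ DIM('a) * measure lborel B * \<eta> n)"
          using elim(1) by (intro mult_left_mono) auto
        also have "\<dots> = m * (V n powr (1 / 2 - \<alpha>) * V n powr \<alpha> * \<eta> n)"
          unfolding scale[OF elim(2)] m_def by (simp add: mult_ac)
        also have "V n powr (1 / 2 - \<alpha>) * V n powr \<alpha> = sqrt (V n)"
          using V by (simp add: powr_add[symmetric] powr_half_sqrt)
        also have "sqrt (V n) * \<eta> n = sqrt (V n * (c1 * \<epsilon> n / V n + 1 / (V n)\<^sup>2))"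
          unfolding \<eta>_def by (rule real_sqrt_mult[symmetric])
        also have "V n * (c1 * \<epsilon> n / V n + 1 / (V n)\<^sup>2) = c1 * \<epsilon> n + 1 / V n"
          using V by (simp add: distrib_left power2_eq_square)
        finally show ?case .
      qed
    qed (auto intro!: always_eventually integral_nonneg_AE)
  qed auto
  let ?E = "\<lambda>n \<omega>. sqrt (?Z n \<omega>) + 2 * lam * ?Y n \<omega> + 2 * lam * ((a0 + \<bar>?L n \<omega> - lam\<bar>) * (m * V n powr (- 1 / 2)))"
  have sq: "conv_p M (\<lambda>n \<omega>. sqrt (?Z n \<omega>)) (sqrt 0)"
    by (rule conv_p_cont1[OF Z0]) (auto intro: isCont_real_sqrt)
  note c = conv_p_const[OF tendsto_const]
  have Vh: "(\<lambda>n. m * V n powr (- 1 / 2)) \<longlonglongrightarrow> m * 0"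
    by (intro tendsto_mult_left tendsto_neg_powr[OF _ V_at_top]) simp
  have abs: "conv_p M (\<lambda>n \<omega>. \<bar>?L n \<omega> - lam\<bar>) \<bar>lam - lam\<bar>"
    by (rule conv_p_cont1[OF conv_p_diff[OF lambda_hat_consistent c], where f=abs]) (intro continuous_intros)
  have "conv_p M ?E (sqrt 0 + 2 * lam * 0 + 2 * lam * ((a0 + \<bar>lam - lam\<bar>) * (m * 0)))"
    by (rule conv_p_add[OF conv_p_add[OF sq conv_p_mult[OF c Y0]] conv_p_mult[OF c conv_p_mult[OF conv_p_add[OF c abs] conv_p_const[OF Vh]]]])
  then have "conv_p M ?E 0" by simp
  moreover have "\<forall>\<^sub>F n in sequentially. \<forall>\<omega>\<in>space M. \<forall>r\<in>{0..R}.
    \<bar>V n powr (1 / 2 - \<alpha>) * (?K n r \<omega> - (\<integral>\<omega>. ?K n r \<omega> \<partial>M))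
      - 2 * lam * (measure lborel B * r ^ DIM('a)) * (sqrt (V n) * (?L n \<omega> - lam))\<bar> \<le> ?E n \<omega>"
    using P V_ge[of 1]
  proof eventually_elim
    case (elim n)
    have V: "0 < V n" using elim(2) by simp
    let ?v = "V n powr (1 / 2 - \<alpha>)"
    have va: "?v * V n powr \<alpha> = sqrt (V n)" using V by (simp add: powr_add[symmetric] powr_half_sqrt)
    have vs: "?v = sqrt (V n powr (1 - 2 * \<alpha>))"
      using V by (simp add: powr_half_sqrt[symmetric] powr_powr diff_divide_distrib)
    show ?case
    proof (intro ballI)
      fix \<omega> r assume w: "\<omega> \<in> space M" and r: "r \<in> {0..R}"
      let ?D = "?L n \<omega> - lam" and ?dK = "?K n r \<omega> - (\<integral>\<omega>. ?K n r \<omega> \<partial>M)"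
      have zy: "0 \<le> fst (ZY n) \<omega>" "0 \<le> snd (ZY n) \<omega>" using elim(1) by blast+
      have "\<bar>?dK - 2 * lam * ((s n * r) ^ DIM('a) * measure lborel B) * ?D\<bar>
        \<le> sqrt (fst (ZY n) \<omega>) + 2 * lam * snd (ZY n) \<omega> + 2 * lam * (a0 + \<bar>?D\<bar>) * ((s n * R) ^ DIM('a) * measure lborel B / 2 ^ p n)"
        using elim(1) w r by blast
      then have "?v * \<bar>?dK - 2 * lam * ((s n * r) ^ DIM('a) * measure lborel B) * ?D\<bar>
        \<le> ?v * (sqrt (fst (ZY n) \<omega>) + 2 * lam * snd (ZY n) \<omega> + 2 * lam * (a0 + \<bar>?D\<bar>) * ((s n * R) ^ DIM('a) * measure lborel B / 2 ^ p n))"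
        by (rule mult_left_mono) simp
      also have "?v * \<bar>?dK - 2 * lam * ((s n * r) ^ DIM('a) * measure lborel B) * ?D\<bar> =
          \<bar>?v * (?dK - 2 * lam * ((s n * r) ^ DIM('a) * measure lborel B) * ?D)\<bar>" by (simp add: abs_mult)
      also have "?v * (?dK - 2 * lam * ((s n * r) ^ DIM('a) * measure lborel B) * ?D) =
          ?v * ?dK - 2 * lam * (measure lborel B * r ^ DIM('a)) * ((?v * V n powr \<alpha>) * ?D)"
        unfolding scale[OF elim(2)] by (simp add: algebra_simps)
      also have "?v * (sqrt (fst (ZY n) \<omega>) + 2 * lam * snd (ZY n) \<omega> + 2 * lam * (a0 + \<bar>?D\<bar>) * ((s n * R) ^ DIM('a) * measure lborel B / 2 ^ p n)) =
          ?v * sqrt (fst (ZY n) \<omega>) + 2 * lam * (?v * snd (ZY n) \<omega>) + 2 * lam * ((a0 + \<bar>?D\<bar>) * (m * ((?v * V n powr \<alpha>) / 2 ^ p n)))"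
        unfolding scale[OF elim(2)] m_def by (simp add: algebra_simps add_divide_distrib)
      also have "\<dots> \<le> ?E n \<omega>"
      proof (intro add_mono mult_left_mono)
        show "?v * sqrt (fst (ZY n) \<omega>) \<le> sqrt (?Z n \<omega>)" unfolding vs using zy by (simp add: real_sqrt_mult)
        show "snd (ZY n) \<omega> \<le> \<bar>snd (ZY n) \<omega>\<bar>" by simp
        \<comment> \<open>The choice of the depth enters here: with at least \<open>V n\<close>
          cells the growth within a cell is of order \<open>V n powr (- 1 / 2)\<close>.\<close>
        have "sqrt (V n) / 2 ^ p n \<le> sqrt (V n) / V n"
          using p2[OF elim(2)] V by (intro divide_left_mono) auto
        also have "\<dots> = V n powr (- 1 / 2)" using V powr_diff[of "V n" "1 / 2" 1] by (simp add: powr_half_sqrt)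
        finally show "?v * V n powr \<alpha> / 2 ^ p n \<le> V n powr (- 1 / 2)" unfolding va .
      qed (use lam_nonneg a0 nn in auto)
      finally show "\<bar>?v * ?dK - 2 * lam * (measure lborel B * r ^ DIM('a)) * (sqrt (V n) * ?D)\<bar> \<le> ?E n \<omega>" unfolding va .
    qed
  qed
  ultimately show ?thesis unfolding s_def by blast
qed

end

subsection \<open>The two-sample statistic\<close>

lemma cSUP_cmult:
  fixes f :: "'i \<Rightarrow> real"
  assumes "A \<noteq> {}" "bdd_above (f ` A)" "0 \<le> c"
  shows "(SUP x\<in>A. c * f x) = c * (SUP x\<in>A. f x)"
proof (cases "c = 0")
  case False
  then have c: "0 < c" using assms by simp
  show ?thesis
  proof (rule antisym)
    have le: "c * f x \<le> c * (SUP x\<in>A. f x)" if "x \<in> A" for x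
      using c by (intro mult_left_mono cSUP_upper[OF that assms(2)]) auto
    show "(SUP x\<in>A. c * f x) \<le> c * (SUP x\<in>A. f x)" by (rule cSUP_least[OF assms(1) le])
    have bdd: "bdd_above ((\<lambda>x. c * f x) ` A)" by (rule bdd_aboveI2[OF le])
    have "(SUP x\<in>A. f x) \<le> (SUP x\<in>A. c * f x) / c"
    proof (rule cSUP_least[OF assms(1)])
      fix x assume "x \<in> A"
      then have "c * f x \<le> (SUP x\<in>A. c * f x)" by (rule cSUP_upper[OF _ bdd])
      then show "f x \<le> (SUP x\<in>A. c * f x) / c" using c by (simp add: le_divide_eq mult.commute)
    qed
    then show "c * (SUP x\<in>A. f x) \<le> (SUP x\<in>A. c * f x)" using c by (simp add: le_divide_eq mult.commute)
  qed
qed (use assms in simp)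

lemma cSUP_diff_le:
  fixes f g :: "'i \<Rightarrow> real"
  assumes A: "A \<noteq> {}" and f: "bdd_above (f ` A)" and g: "bdd_above (g ` A)" and fg: "\<And>x. x \<in> A \<Longrightarrow> \<bar>f x - g x\<bar> \<le> e"
  shows "\<bar>(SUP x\<in>A. f x) - (SUP x\<in>A. g x)\<bar> \<le> e"
proof -
  have "f x \<le> (SUP x\<in>A. g x) + e" if "x \<in> A" for x
    using fg[OF that] cSUP_upper[OF that g] by linarith
  then have "(SUP x\<in>A. f x) \<le> (SUP x\<in>A. g x) + e" by (rule cSUP_least[OF A])
  moreover have "g x \<le> (SUP x\<in>A. f x) + e" if "x \<in> A" for x
    using fg[OF that] cSUP_upper[OF that f] by linarith
  then have "(SUP x\<in>A. g x) \<le> (SUP x\<in>A. f x) + e" by (rule cSUP_least[OF A])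
  ultimately show ?thesis by linarith
qed

lemma (in b4_sequence) lambda_hat_tight: "tight_p M (\<lambda>n \<omega>. sqrt (V n) * (lambda_hat (W n) (N \<omega>) - lam))"
proof (rule tight_p_L2)
  interpret w: b4_window M N \<gamma> "W n" for n by (rule window)
  let ?c = "lam * (1 + aint (\<gamma> 2) (\<lambda>_. 1))"
  show "\<forall>\<^sub>F n in sequentially. integrable M (\<lambda>\<omega>. (sqrt (V n) * (lambda_hat (W n) (N \<omega>) - lam))\<^sup>2) \<and>
      (\<integral>\<omega>. (sqrt (V n) * (lambda_hat (W n) (N \<omega>) - lam))\<^sup>2 \<partial>M) \<le> ?c"
    using V_ge[of 1]
  proof eventually_elim
    case (elim n)
    then have V: "0 < V n" by simp
    have "V n * (\<integral>\<omega>. (lambda_hat (W n) (N \<omega>) - lam)\<^sup>2 \<partial>M) \<le> V n * (?c / V n)"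
      using w.lambda_hat_L2(2)[OF V] V unfolding w.tv_def by (intro mult_left_mono) auto
    then show ?case using w.lambda_hat_L2(1)[OF V] V by (simp add: power_mult_distrib)
  qed
qed

theorem theorem5:
  fixes M :: "'w measure"
    and Na Nb :: "'w \<Rightarrow> 'a::euclidean_space set"
    and \<mu>a \<mu>b :: "(nat \<Rightarrow> 'a) measure"
    and \<gamma>a \<gamma>b :: "nat \<Rightarrow> (nat \<Rightarrow> 'a) signed"
    and W :: "nat \<Rightarrow> 'a set" and B :: "'a set"
    and w :: "'a \<Rightarrow> real" and v :: "real \<Rightarrow> real"
    and b :: "nat \<Rightarrow> real" and R \<alpha> :: real
  assumes "prob_space M"
    and "point_process M Na" and "point_process M Nb"
    and "intensity M Na > 0" and "intensity M Nb > 0"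
    and "prob_space.indep_var M config_space Na config_space Nb"
    and "B4_mixing M Na \<gamma>a" and "B4_mixing M Nb \<gamma>b"
    and "reduced_moment M Na 2 \<mu>a" and "reduced_moment M Nb 2 \<mu>b"
    and "convex_averaging W"
    and "compact B" and "convex B" and "\<forall>x\<in>B. - x \<in> B" and "0 \<in> interior B"
    and "smoothing_kernel w"
    and "R > 0" and "0 < \<alpha>" and "\<alpha> \<le> 1/2"
    and "(\<lambda>n. wscale (W n) powr \<alpha> / inradius (W n)) \<longlonglongrightarrow> 0"
    and "process_conditions M W \<alpha> Na \<mu>a \<gamma>a" and "process_conditions M W \<alpha> Nb \<mu>b \<gamma>b"
    and "\<forall>n. b n > 0" and "b \<longlonglongrightarrow> 0"
    and "filterlim (\<lambda>n. wscale (W n) * b n) at_top sequentially"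
    and "(\<lambda>n. wscale (W n) * (b n)\<^sup>2) \<longlonglongrightarrow> 0"
    and "(\<lambda>n. wscale (W n) * b n / inradius (W n)) \<longlonglongrightarrow> 0"
    and "cadlag_on R v"
    and "distr M config_space Na = distr M config_space Nb"
  shows "weak_conv_m
    (\<lambda>n. distr M borel (\<lambda>\<omega>.
       sqrt (measure lborel (W n)) *
         (SUP r\<in>{0..R}. \<bar>(K_hat B (W n) (Na \<omega>) (wscale (W n) powr \<alpha> * r)
                        - K_hat B (W n) (Nb \<omega>) (wscale (W n) powr \<alpha> * r)) * v r\<bar>)
       / (measure lborel (W n) powr \<alpha> *
          sqrt (lambda2_hat (W n) (Na \<omega>) * sigma2_hat w (b n) (W n) (Na \<omega>)
              + lambda2_hat (W n) (Nb \<omega>) * sigma2_hat w (b n) (W n) (Nb \<omega>)))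
       + sqrt (measure lborel (W n)) * \<bar>lambda_hat (W n) (Na \<omega>) - lambda_hat (W n) (Nb \<omega>)\<bar>
         / sqrt (sigma2_hat w (b n) (W n) (Na \<omega>) + sigma2_hat w (b n) (W n) (Nb \<omega>))))
    (distr (density lborel std_normal_density) borel
       (\<lambda>z. (2 * measure lborel B * (SUP r\<in>{0..R}. \<bar>r ^ DIM('a) * v r\<bar>) + 1) * \<bar>z\<bar>))"
proof -
  interpret prob_space M by fact
  interpret a: b4_sequence M Na \<gamma>a W
    by (intro b4_sequence.intro b4_process.intro b4_process_axioms.intro b4_sequence_axioms.intro assms)
  interpret b: b4_sequence M Nb \<gamma>b W
    by (intro b4_sequence.intro b4_process.intro b4_process_axioms.intro b4_sequence_axioms.intro assms)
  note Na [measurable] = a.N_measurable and Nb [measurable] = b.N_measurable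
  note Wb = convex_averaging_props(3,4)[OF assms(11)]
  have B0: "0 \<in> B" using assms(15) interior_subset by blast
  have wm: "w \<in> borel_measurable borel" using assms(16) by (simp add: smoothing_kernel_def)
  \<comment> \<open>Equality in law enters through expectations of functionals of a single sample:
    the intensities agree, and so do the means of the pair statistics at every radius.\<close>
  have same_law: "(\<integral>\<omega>. F (Na \<omega>) \<partial>M) = (\<integral>\<omega>. F (Nb \<omega>) \<partial>M)" if F: "F \<in> borel_measurable config_space" for F :: "'a set \<Rightarrow> real"
    using integral_distr[OF Na F] integral_distr[OF Nb F] assms(29) by simp
  define l where "l = intensity M Na"
  have la: "intensity M Na = l" by (simp add: l_def)
  have lb: "intensity M Nb = l"
    using same_law[OF measurable_card_config[OF sets_unit_cube bounded_unit_cube]] by (simp add: l_def intensity_def)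
  have l: "0 < l" using assms(4) by (simp add: l_def)
  \<comment> \<open>The cumulant measures of the two samples are given separately, so their
    asymptotic variances are kept apart; the limit involves only the sum, the square of
    \<open>s\<close>.\<close>
  define sa where "sa = asymp_variance M Na \<gamma>a"
  define sb where "sb = asymp_variance M Nb \<gamma>b"
  have sab: "0 < sa" "0 < sb" using assms(21,22) by (simp_all add: process_conditions_def sa_def sb_def)
  define s where "s = sqrt (sa + sb)"
  have s: "0 < s" "s\<^sup>2 = sa + sb" using sab by (simp_all add: s_def)
  obtain vb where vb: "0 \<le> vb" "\<And>r. r \<in> {0..R} \<Longrightarrow> \<bar>v r\<bar> \<le> vb" using cadlag_bounded[OF assms(28,17)] by metis
  let ?V = "\<lambda>n. measure lborel (W n)" and ?k = "\<lambda>n. wscale (W n) powr \<alpha>"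
  let ?La = "\<lambda>n \<omega>. lambda_hat (W n) (Na \<omega>)" and ?Lb = "\<lambda>n \<omega>. lambda_hat (W n) (Nb \<omega>)"
  let ?Ka = "\<lambda>n r \<omega>. K_hat B (W n) (Na \<omega>) (?k n * r)" and ?Kb = "\<lambda>n r \<omega>. K_hat B (W n) (Nb \<omega>) (?k n * r)"
  let ?Sa = "\<lambda>n \<omega>. sigma2_hat w (b n) (W n) (Na \<omega>)" and ?Sb = "\<lambda>n \<omega>. sigma2_hat w (b n) (W n) (Nb \<omega>)"
  let ?Qa = "\<lambda>n \<omega>. lambda2_hat (W n) (Na \<omega>)" and ?Qb = "\<lambda>n \<omega>. lambda2_hat (W n) (Nb \<omega>)"
  let ?G = "\<lambda>n \<omega>. SUP r\<in>{0..R}. \<bar>(?Ka n r \<omega> - ?Kb n r \<omega>) * v r\<bar>"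
  let ?Z = "\<lambda>n \<omega>. sqrt (?V n) * (?La n \<omega> - ?Lb n \<omega>)"
  let ?P = "\<lambda>n \<omega>. 1 / sqrt (?Qa n \<omega> * ?Sa n \<omega> + ?Qb n \<omega> * ?Sb n \<omega>)"
  let ?Q = "\<lambda>n \<omega>. 1 / sqrt (?Sa n \<omega> + ?Sb n \<omega>)"
  let ?T = "\<lambda>n \<omega>. sqrt (?V n) * ?G n \<omega> / (?V n powr \<alpha> * sqrt (?Qa n \<omega> * ?Sa n \<omega> + ?Qb n \<omega> * ?Sb n \<omega>))
       + sqrt (?V n) * \<bar>?La n \<omega> - ?Lb n \<omega>\<bar> / sqrt (?Sa n \<omega> + ?Sb n \<omega>)"
  define S where "S = (SUP r\<in>{0..R}. \<bar>r ^ DIM('a) * v r\<bar>)"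
  define \<kappa> where "\<kappa> = 2 * l * measure lborel B * S"
  \<comment> \<open>Both terms of the statistic are asymptotically multiples of the same variable
    |Z|, which is why a single normal variable appears in the limit. The first has the factor
    \<open>\<kappa> / (l * s)\<close>, in which the intensity cancels, the second
    \<open>1 / s\<close>; \<open>K\<close> is their sum.\<close>
  define K where "K = (2 * measure lborel B * S + 1) / s"
  have bS: "bdd_above ((\<lambda>r. \<bar>r ^ DIM('a) * v r\<bar>) ` {0..R})"
  proof (rule bdd_aboveI2)
    fix r assume r: "r \<in> {0..R}"
    show "\<bar>r ^ DIM('a) * v r\<bar> \<le> R ^ DIM('a) * vb"
      unfolding abs_mult using vb(2)[OF r] vb(1) r by (intro mult_mono) (auto intro: power_mono)
  qed
  note sup = measurable_sup_statistic[OF Na Nb Wb assms(12,13) B0 assms(28,17)]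
  have Gm [measurable]: "?G n \<in> borel_measurable M" for n by (rule sup(1)) simp
  have lm [measurable]: "?La n \<in> borel_measurable M" "?Lb n \<in> borel_measurable M" "?Qa n \<in> borel_measurable M" "?Qb n \<in> borel_measurable M"
    "?Sa n \<in> borel_measurable M" "?Sb n \<in> borel_measurable M" for n
    by (rule measurable_compose[OF Na lambda_hat_measurable(1)[OF Wb]] measurable_compose[OF Nb lambda_hat_measurable(1)[OF Wb]]
      measurable_compose[OF Na lambda_hat_measurable(2)[OF Wb]] measurable_compose[OF Nb lambda_hat_measurable(2)[OF Wb]]
      measurable_compose[OF Na sigma2_hat_measurable[OF Wb wm]] measurable_compose[OF Nb sigma2_hat_measurable[OF Wb wm]])+
  note c = conv_p_const[OF tendsto_const]
  note bw = assms(23)[rule_format] assms(24-27)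
  have Sa: "conv_p M ?Sa sa" unfolding sa_def by (rule a.sigma2_hat_consistent[OF assms(16) bw])
  have Sb: "conv_p M ?Sb sb" unfolding sb_def by (rule b.sigma2_hat_consistent[OF assms(16) bw])
  have Qa: "conv_p M ?Qa (l\<^sup>2)" using a.lambda2_hat_consistent unfolding la .
  have Qb: "conv_p M ?Qb (l\<^sup>2)" using b.lambda2_hat_consistent unfolding lb .
  have inv_sqrt: "isCont (\<lambda>x. 1 / sqrt x) y" if "0 < y" for y :: real
    using that by (intro continuous_intros) auto
  have P: "conv_p M ?P (1 / (l * s))"
  proof -
    have "conv_p M ?P (1 / sqrt (l\<^sup>2 * sa + l\<^sup>2 * sb))"
      by (rule conv_p_cont1[OF conv_p_add[OF conv_p_mult[OF Qa Sa] conv_p_mult[OF Qb Sb]], where f="\<lambda>x. 1 / sqrt x"])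
        (use l sab in \<open>intro inv_sqrt add_pos_pos mult_pos_pos; simp\<close>)
    moreover have "l\<^sup>2 * sa + l\<^sup>2 * sb = (l * s)\<^sup>2" by (simp add: power_mult_distrib s(2) distrib_left)
    ultimately show ?thesis using l s by simp
  qed
  have Q: "conv_p M ?Q (1 / s)"
    unfolding s_def
    by (rule conv_p_cont1[OF conv_p_add[OF Sa Sb], where f="\<lambda>x. 1 / sqrt x"]) (use sab in \<open>intro inv_sqrt; simp\<close>)
  obtain Ea where Ea: "conv_p M Ea 0" "\<forall>\<^sub>F n in sequentially. \<forall>\<omega>\<in>space M. \<forall>r\<in>{0..R}.
    \<bar>?V n powr (1 / 2 - \<alpha>) * (?Ka n r \<omega> - (\<integral>\<omega>. ?Ka n r \<omega> \<partial>M))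
      - 2 * l * (measure lborel B * r ^ DIM('a)) * (sqrt (?V n) * (?La n \<omega> - l))\<bar> \<le> Ea n \<omega>"
    using a.K_hat_uniform[OF assms(9) _ assms(12,13,14) B0 assms(17,18,20)] assms(21) unfolding process_conditions_def la by blast
  obtain Eb where Eb: "conv_p M Eb 0" "\<forall>\<^sub>F n in sequentially. \<forall>\<omega>\<in>space M. \<forall>r\<in>{0..R}.
    \<bar>?V n powr (1 / 2 - \<alpha>) * (?Kb n r \<omega> - (\<integral>\<omega>. ?Kb n r \<omega> \<partial>M))
      - 2 * l * (measure lborel B * r ^ DIM('a)) * (sqrt (?V n) * (?Lb n \<omega> - l))\<bar> \<le> Eb n \<omega>"
    using b.K_hat_uniform[OF assms(10) _ assms(12,13,14) B0 assms(17,18,20)] assms(22) unfolding process_conditions_def lb by blast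
  have KE: "(\<integral>\<omega>. ?Ka n r \<omega> \<partial>M) = (\<integral>\<omega>. ?Kb n r \<omega> \<partial>M)" for n r
    by (rule same_law[OF K_hat_measurable[OF Wb assms(12)]])
  \<comment> \<open>The two linearisations are subtracted, and with \<open>KE\<close> the common
    mean disappears. The resulting error does not depend on the radius, and a supremum changes by at
    most the uniform distance of the functions.\<close>
  have G: "\<forall>\<^sub>F n in sequentially. \<forall>\<omega>\<in>space M. \<bar>?V n powr (1 / 2 - \<alpha>) * ?G n \<omega> - \<kappa> * \<bar>?Z n \<omega>\<bar>\<bar> \<le> vb * (Ea n \<omega> + Eb n \<omega>)"
    using Ea(2) Eb(2)
  proof eventually_elim
    case (elim n)
    show ?case
    proof
      fix \<omega> assume w: "\<omega> \<in> space M"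
      let ?u = "?V n powr (1 / 2 - \<alpha>)" and ?y = "2 * l * measure lborel B * \<bar>?Z n \<omega>\<bar>"
      have ne: "{0..R} \<noteq> {}" using assms(17) by simp
      have y0: "0 \<le> ?y" using l by simp
      have 1: "?u * ?G n \<omega> = (SUP r\<in>{0..R}. ?u * \<bar>(?Ka n r \<omega> - ?Kb n r \<omega>) * v r\<bar>)"
        by (rule cSUP_cmult[OF ne sup(2), symmetric]) auto
      have 2: "\<kappa> * \<bar>?Z n \<omega>\<bar> = (SUP r\<in>{0..R}. ?y * \<bar>r ^ DIM('a) * v r\<bar>)"
        unfolding cSUP_cmult[OF ne bS y0] by (simp add: \<kappa>_def S_def mult_ac)
      have b1: "bdd_above ((\<lambda>r. ?u * \<bar>(?Ka n r \<omega> - ?Kb n r \<omega>) * v r\<bar>) ` {0..R})"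
        by (rule bdd_aboveI2, rule mult_left_mono[OF cSUP_upper[OF _ sup(2)]]) auto
      have b2: "bdd_above ((\<lambda>r. ?y * \<bar>r ^ DIM('a) * v r\<bar>) ` {0..R})"
        by (rule bdd_aboveI2, rule mult_left_mono[OF cSUP_upper[OF _ bS]]) (use y0 in auto)
      show "\<bar>?u * ?G n \<omega> - \<kappa> * \<bar>?Z n \<omega>\<bar>\<bar> \<le> vb * (Ea n \<omega> + Eb n \<omega>)"
        unfolding 1 2
      proof (rule cSUP_diff_le[OF ne b1 b2])
        fix r assume r: "r \<in> {0..R}"
        let ?d = "2 * l * (measure lborel B * r ^ DIM('a)) * ?Z n \<omega>" and ?D = "?u * (?Ka n r \<omega> - ?Kb n r \<omega>)"
        have e: "\<bar>?u * (?Ka n r \<omega> - (\<integral>\<omega>. ?Kb n r \<omega> \<partial>M)) - 2 * l * (measure lborel B * r ^ DIM('a)) * (sqrt (?V n) * (?La n \<omega> - l))\<bar> \<le> Ea n \<omega>"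
          "\<bar>?u * (?Kb n r \<omega> - (\<integral>\<omega>. ?Kb n r \<omega> \<partial>M)) - 2 * l * (measure lborel B * r ^ DIM('a)) * (sqrt (?V n) * (?Lb n \<omega> - l))\<bar> \<le> Eb n \<omega>"
          using elim w r unfolding KE by blast+
        have eq: "?D - ?d = (?u * (?Ka n r \<omega> - (\<integral>\<omega>. ?Kb n r \<omega> \<partial>M)) - 2 * l * (measure lborel B * r ^ DIM('a)) * (sqrt (?V n) * (?La n \<omega> - l)))
            - (?u * (?Kb n r \<omega> - (\<integral>\<omega>. ?Kb n r \<omega> \<partial>M)) - 2 * l * (measure lborel B * r ^ DIM('a)) * (sqrt (?V n) * (?Lb n \<omega> - l)))"
          by (simp add: algebra_simps)
        have D: "\<bar>?D - ?d\<bar> \<le> Ea n \<omega> + Eb n \<omega>" unfolding eq using e by linarith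
        have "?u * \<bar>(?Ka n r \<omega> - ?Kb n r \<omega>) * v r\<bar> = \<bar>?D\<bar> * \<bar>v r\<bar>" by (simp add: abs_mult)
        moreover have "?y * \<bar>r ^ DIM('a) * v r\<bar> = \<bar>?d\<bar> * \<bar>v r\<bar>" using l by (simp add: abs_mult)
        ultimately have "\<bar>?u * \<bar>(?Ka n r \<omega> - ?Kb n r \<omega>) * v r\<bar> - ?y * \<bar>r ^ DIM('a) * v r\<bar>\<bar> = \<bar>\<bar>?D\<bar> - \<bar>?d\<bar>\<bar> * \<bar>v r\<bar>"
          by (simp only: left_diff_distrib[symmetric] abs_mult abs_idempotent)
        also have "\<dots> \<le> (Ea n \<omega> + Eb n \<omega>) * vb"
          using D vb(2)[OF r] by (intro mult_mono) auto
        finally show "\<bar>?u * \<bar>(?Ka n r \<omega> - ?Kb n r \<omega>) * v r\<bar> - ?y * \<bar>r ^ DIM('a) * v r\<bar>\<bar> \<le> vb * (Ea n \<omega> + Eb n \<omega>)"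
          by (simp only: mult.commute)
      qed
    qed
  qed
  \<comment> \<open>\<open>?Y\<close> is the error of the random normalisers. It multiplies
    \<open>?Z\<close>, which is split in \<open>?Y1\<close> into the two centred intensity errors,
    each tight by its own variance bound. \<open>?Y2\<close> is the linearisation error times a
    convergent normaliser.\<close>
  let ?Y = "\<lambda>n \<omega>. \<kappa> * (?P n \<omega> - 1 / (l * s)) + (?Q n \<omega> - 1 / s)"
  let ?Y1 = "\<lambda>n \<omega>. ?Y n \<omega> * (sqrt (?V n) * (?La n \<omega> - l)) - ?Y n \<omega> * (sqrt (?V n) * (?Lb n \<omega> - l))"
  let ?Y2 = "\<lambda>n \<omega>. vb * (Ea n \<omega> + Eb n \<omega>) * ?P n \<omega>"
  have "conv_p M ?Y (\<kappa> * (1 / (l * s) - 1 / (l * s)) + (1 / s - 1 / s))"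
    by (rule conv_p_add[OF conv_p_mult[OF c conv_p_diff[OF P c]] conv_p_diff[OF Q c]])
  then have Y: "conv_p M ?Y 0" by simp
  have Y1: "conv_p M ?Y1 (0 - 0)"
    by (rule conv_p_diff[OF conv_p_mult_tight[OF Y a.lambda_hat_tight[unfolded la]] conv_p_mult_tight[OF Y b.lambda_hat_tight[unfolded lb]]])
  have Y2: "conv_p M ?Y2 (vb * (0 + 0) * (1 / (l * s)))"
    by (rule conv_p_mult[OF conv_p_mult[OF c conv_p_add[OF Ea(1) Eb(1)]] P])
  have Y3: "conv_p M (\<lambda>n \<omega>. \<bar>?Y1 n \<omega>\<bar> + \<bar>?Y2 n \<omega>\<bar>) (\<bar>0 - 0\<bar> + \<bar>vb * (0 + 0) * (1 / (l * s))\<bar>)"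
    by (rule conv_p_add[OF conv_p_cont1[OF Y1, where f=abs] conv_p_cont1[OF Y2, where f=abs]]; intro continuous_intros)
  have TZ: "conv_p M (\<lambda>n \<omega>. ?T n \<omega> - K * \<bar>?Z n \<omega>\<bar>) 0"
  proof (rule conv_p_mono)
    show "conv_p M (\<lambda>n \<omega>. \<bar>?Y1 n \<omega>\<bar> + \<bar>?Y2 n \<omega>\<bar>) 0" using Y3 by simp
    show "\<forall>\<^sub>F n in sequentially. \<forall>\<omega>\<in>space M. \<bar>?T n \<omega> - K * \<bar>?Z n \<omega>\<bar> - 0\<bar> \<le> \<bar>\<bar>?Y1 n \<omega>\<bar> + \<bar>?Y2 n \<omega>\<bar>\<bar>"
      using G a.V_ge[of 1]
    proof eventually_elim
      case (elim n)
      then have V: "0 < ?V n" by simp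
      let ?u = "?V n powr (1 / 2 - \<alpha>)"
      have u: "?u = sqrt (?V n) / ?V n powr \<alpha>" using V by (simp add: powr_diff powr_half_sqrt)
      have K: "K = \<kappa> * (1 / (l * s)) + 1 / s" using l s by (simp add: K_def \<kappa>_def field_simps)
      show ?case
      proof
        fix \<omega> assume w: "\<omega> \<in> space M"
        let ?e = "?u * ?G n \<omega> - \<kappa> * \<bar>?Z n \<omega>\<bar>"
        have aZ: "sqrt (?V n) * \<bar>?La n \<omega> - ?Lb n \<omega>\<bar> = \<bar>?Z n \<omega>\<bar>" by (simp add: abs_mult)
        \<comment> \<open>Separates the error of the normalisers, which multiplies \<open>z\<close>,
          from the error of the numerator, which multiplies the random normaliser
          \<open>p\<close>.\<close>
        have split: "g * p + z * q - (\<kappa> * x + y) * z = (\<kappa> * (p - x) + (q - y)) * z + (g - \<kappa> * z) * p" for g p q x y z :: real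
          by (simp add: algebra_simps)
        have "?T n \<omega> = (?u * ?G n \<omega>) * ?P n \<omega> + \<bar>?Z n \<omega>\<bar> * ?Q n \<omega>"
          unfolding u aZ by simp
        then have T: "?T n \<omega> - K * \<bar>?Z n \<omega>\<bar> = ?Y n \<omega> * \<bar>?Z n \<omega>\<bar> + ?e * ?P n \<omega>"
          unfolding K by (simp only: split)
        have Y1: "?Y n \<omega> * ?Z n \<omega> = ?Y1 n \<omega>"
          unfolding right_diff_distrib[symmetric] by (simp add: algebra_simps)
        have "\<bar>?e * ?P n \<omega>\<bar> \<le> \<bar>?Y2 n \<omega>\<bar>"
          unfolding abs_mult[of _ "?P n \<omega>"]
          by (rule mult_right_mono[OF order_trans[OF _ abs_ge_self]]) (use elim(1) w in auto)
        moreover have "\<bar>?Y n \<omega> * \<bar>?Z n \<omega>\<bar>\<bar> = \<bar>?Y1 n \<omega>\<bar>"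
          unfolding Y1[symmetric] by (simp only: abs_mult abs_idempotent)
        moreover have "\<bar>?Y n \<omega> * \<bar>?Z n \<omega>\<bar> + ?e * ?P n \<omega>\<bar> \<le> \<bar>?Y n \<omega> * \<bar>?Z n \<omega>\<bar>\<bar> + \<bar>?e * ?P n \<omega>\<bar>"
          by (rule abs_triangle_ineq)
        ultimately have "\<bar>?Y n \<omega> * \<bar>?Z n \<omega>\<bar> + ?e * ?P n \<omega>\<bar> \<le> \<bar>?Y1 n \<omega>\<bar> + \<bar>?Y2 n \<omega>\<bar>" by linarith
        then show "\<bar>?T n \<omega> - K * \<bar>?Z n \<omega>\<bar> - 0\<bar> \<le> \<bar>\<bar>?Y1 n \<omega>\<bar> + \<bar>?Y2 n \<omega>\<bar>\<bar>"
          unfolding T diff_0_right by (rule order_trans[OF _ abs_ge_self])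
      qed
    qed
  qed
  let ?X = "\<lambda>n \<phi>. (real (card (\<phi> \<inter> W n)) - l * ?V n) / sqrt (?V n)"
  have Xm: "?X n \<in> borel_measurable config_space" for n
    using measurable_card_config[OF Wb] by measurable
  have ind: "indep_var borel (\<lambda>\<omega>. ?X n (Na \<omega>)) borel (\<lambda>\<omega>. ?X n (Nb \<omega>))" for n
    using indep_var_compose[OF assms(6) Xm[of n] Xm[of n]] by (simp add: comp_def)
  have Xa: "weak_conv_m (\<lambda>n. distr M borel (\<lambda>\<omega>. ?X n (Na \<omega>))) (density lborel (normal_density 0 (sqrt sa)))"
    using assms(21) unfolding process_conditions_def clt_condition_def la sa_def by simp
  have Xb: "weak_conv_m (\<lambda>n. distr M borel (\<lambda>\<omega>. ?X n (Nb \<omega>))) (density lborel (normal_density 0 (sqrt sb)))"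
    using assms(22) unfolding process_conditions_def clt_condition_def lb sb_def by simp
  let ?N = "distr std_normal_distribution borel (\<lambda>x. s * x)"
  \<comment> \<open>The centrings cancel because both intensities equal \<open>l\<close>. For a
    window of volume 0 both sides are 0 by the convention on division.\<close>
  have Zeq: "?X n (Na \<omega>) - ?X n (Nb \<omega>) = ?Z n \<omega>" for n \<omega>
  proof (cases "?V n = 0")
    case False
    then have "0 < ?V n" by (simp add: less_le)
    then have "x / sqrt (?V n) = sqrt (?V n) * (x / ?V n)" for x
      by (simp add: field_simps)
    then show ?thesis unfolding diff_divide_distrib[symmetric] lambda_hat_def by simp
  qed simp
  have Zlim: "weak_conv_m (\<lambda>n. distr M borel (?Z n)) ?N"
    using weak_conv_indep_diff[OF ind _ _ Xa Xb] sab unfolding Zeq s_def by simp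
  have Zm: "?Z n \<in> borel_measurable M" for n by measurable
  have rd: "real_distribution (distr std_normal_distribution borel g)" if "g \<in> borel_measurable borel" for g :: "real \<Rightarrow> real"
    using prob_space.real_distribution_distr[of std_normal_distribution g] real_distribution_std_normal that
    by (simp add: real_distribution_def)
  have "weak_conv_m (\<lambda>n. distr M borel (\<lambda>\<omega>. K * \<bar>?Z n \<omega>\<bar>)) (distr ?N borel (\<lambda>x. K * \<bar>x\<bar>))"
    by (rule continuous_mapping[OF Zm rd Zlim, of "\<lambda>x. K * \<bar>x\<bar>"]) (auto intro!: continuous_intros)
  \<comment> \<open>The modulus of \<open>s * x\<close> is \<open>s\<close> times the modulus of
    \<open>x\<close>, and this \<open>s\<close> cancels the denominator of \<open>K\<close>.\<close>
  also have "distr ?N borel (\<lambda>x. K * \<bar>x\<bar>) = distr std_normal_distribution borel (\<lambda>z. (2 * measure lborel B * S + 1) * \<bar>z\<bar>)"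
    using s by (subst distr_distr) (auto simp: comp_def K_def abs_mult intro!: distr_cong)
  finally have lim: "weak_conv_m (\<lambda>n. distr M borel (\<lambda>\<omega>. K * \<bar>?Z n \<omega>\<bar>))
      (distr std_normal_distribution borel (\<lambda>z. (2 * measure lborel B * S + 1) * \<bar>z\<bar>))" .
  have "weak_conv_m (\<lambda>n. distr M borel (?T n)) (distr std_normal_distribution borel (\<lambda>z. (2 * measure lborel B * S + 1) * \<bar>z\<bar>))"
    by (rule slutsky[OF _ _ TZ rd lim]) measurable
  then show ?thesis unfolding S_def .
qed

end
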